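(* Let $f\colon A\to B$ be an isocohomological embedding between unital algebras in $\mathsf C$. If $A$ has a projective $A$-bimodule resolution of length $k$, then $B$ has a projective $B$-bimodule resolution of length $k$.
   Context: $(\mathsf C,\otimes)$ is an additive closed symmetric monoidal category with kernels and cokernels. For a unital algebra $A$ in $\mathsf C$, $\mathsf{Mod}_A$ is the category of unital left $A$-modules in $\mathsf C$ with the exact structure given by kernel-cokernel pairs that split in $\mathsf C$ (semi-split extensions). A complex in $\mathsf{Mod}_A$ is exact iff it is contractible as a complex in $\mathsf C$. $P$ is projective if $\mathsf{Hom}_A(P,-)$ is exact on semi-split extensions. A projective $A$-bimodule resolution of $A$ is a complex $P_\bullet$ of projective $A\otimes A^{\mathrm{op}}$-modules with augmentation $P_0\to A$ such that $P_\bullet\to A\to0$ is contractible in $\mathsf C$. $\mathsf D(A)$ is the localisation of the homotopy category of complexes in $\mathsf{Mod}_A$ at chain maps with exact mapping cone. A unital algebra homomorphism $f\colon A\to B$ is an isocohomological embedding if the restriction functor $f^*\colon\mathsf D(B)\to\mathsf D(A)$ is fully faithful. *)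

theory Defs
  imports "HOL-Algebra.Group"
begin

section \<open>Categories and additive categories\<close>

record ('o, 'm) cat =
  obj :: "'o set"
  arr :: "'m set"
  src :: "'m \<Rightarrow> 'o"
  tgt :: "'m \<Rightarrow> 'o"
  ident :: "'o \<Rightarrow> 'm"
  cmp :: "'m \<Rightarrow> 'm \<Rightarrow> 'm" (infixr "\<cdot>\<index>" 70)  \<comment> \<open>\<open>g \<cdot> f\<close> is \<open>f\<close> followed by \<open>g\<close>\<close>

definition Hom :: "('o, 'm, 'x) cat_scheme \<Rightarrow> 'o \<Rightarrow> 'o \<Rightarrow> 'm set" where
  "Hom C X Y = {f \<in> arr C. src C f = X \<and> tgt C f = Y}"

locale category =
  fixes C :: "('o, 'm, 'x) cat_scheme" (structure)
  assumes src_in_obj: "f \<in> arr C \<Longrightarrow> src C f \<in> obj C"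
    and tgt_in_obj: "f \<in> arr C \<Longrightarrow> tgt C f \<in> obj C"
    and ident_in_Hom: "X \<in> obj C \<Longrightarrow> ident C X \<in> Hom C X X"
    and cmp_in_Hom: "f \<in> Hom C X Y \<Longrightarrow> g \<in> Hom C Y Z \<Longrightarrow> g \<cdot> f \<in> Hom C X Z"
    and cmp_ident_right: "f \<in> Hom C X Y \<Longrightarrow> f \<cdot> ident C X = f"
    and cmp_ident_left: "f \<in> Hom C X Y \<Longrightarrow> ident C Y \<cdot> f = f"
    and cmp_assoc: "f \<in> Hom C W X \<Longrightarrow> g \<in> Hom C X Y \<Longrightarrow> h \<in> Hom C Y Z
      \<Longrightarrow> (h \<cdot> g) \<cdot> f = h \<cdot> (g \<cdot> f)"

definition inverse_arrows :: "('o, 'm, 'x) cat_scheme \<Rightarrow> 'm \<Rightarrow> 'm \<Rightarrow> bool" where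
  "inverse_arrows C f g \<longleftrightarrow> f \<in> arr C \<and> g \<in> Hom C (tgt C f) (src C f) \<and>
     g \<cdot>\<^bsub>C\<^esub> f = ident C (src C f) \<and> f \<cdot>\<^bsub>C\<^esub> g = ident C (tgt C f)"

definition iso_arrow :: "('o, 'm, 'x) cat_scheme \<Rightarrow> 'm \<Rightarrow> bool" where
  "iso_arrow C f \<longleftrightarrow> (\<exists>g. inverse_arrows C f g)"

definition inv_arrow :: "('o, 'm, 'x) cat_scheme \<Rightarrow> 'm \<Rightarrow> 'm" where
  "inv_arrow C f = (THE g. inverse_arrows C f g)"

definition zero_object :: "('o, 'm, 'x) cat_scheme \<Rightarrow> 'o \<Rightarrow> bool" where
  "zero_object C Z \<longleftrightarrow> Z \<in> obj C \<and>
     (\<forall>X\<in>obj C. (\<exists>!f. f \<in> Hom C X Z) \<and> (\<exists>!f. f \<in> Hom C Z X))"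

record ('o, 'm) addcat = "('o, 'm) cat" +
  add_arr :: "'m \<Rightarrow> 'm \<Rightarrow> 'm" (infixl "\<boxplus>\<index>" 65)
  zero_arr :: "'o \<Rightarrow> 'o \<Rightarrow> 'm"

definition hom_group :: "('o, 'm, 'x) addcat_scheme \<Rightarrow> 'o \<Rightarrow> 'o \<Rightarrow> 'm monoid" where
  "hom_group C X Y = \<lparr>carrier = Hom C X Y, mult = add_arr C, one = zero_arr C X Y\<rparr>"

definition neg_arr :: "('o, 'm, 'x) addcat_scheme \<Rightarrow> 'm \<Rightarrow> 'm" where
  "neg_arr C f = inv\<^bsub>hom_group C (src C f) (tgt C f)\<^esub> f"

definition biproduct :: "('o, 'm, 'x) addcat_scheme \<Rightarrow> 'o \<Rightarrow> 'o \<Rightarrow> 'o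
    \<Rightarrow> 'm \<Rightarrow> 'm \<Rightarrow> 'm \<Rightarrow> 'm \<Rightarrow> bool" where
  "biproduct C X Y S i j p q \<longleftrightarrow>
     i \<in> Hom C X S \<and> j \<in> Hom C Y S \<and> p \<in> Hom C S X \<and> q \<in> Hom C S Y \<and>
     p \<cdot>\<^bsub>C\<^esub> i = ident C X \<and> q \<cdot>\<^bsub>C\<^esub> j = ident C Y \<and>
     p \<cdot>\<^bsub>C\<^esub> j = zero_arr C Y X \<and> q \<cdot>\<^bsub>C\<^esub> i = zero_arr C X Y \<and>
     (i \<cdot>\<^bsub>C\<^esub> p) \<boxplus>\<^bsub>C\<^esub> (j \<cdot>\<^bsub>C\<^esub> q) = ident C S"

locale additive_category = category C for C :: "('o, 'm, 'x) addcat_scheme" (structure) +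
  assumes hom_comm_group: "X \<in> obj C \<Longrightarrow> Y \<in> obj C \<Longrightarrow> comm_group (hom_group C X Y)"
    and cmp_add_right: "f \<in> Hom C X Y \<Longrightarrow> f' \<in> Hom C X Y \<Longrightarrow> g \<in> Hom C Y Z
      \<Longrightarrow> g \<cdot> (f \<boxplus> f') = (g \<cdot> f) \<boxplus> (g \<cdot> f')"
    and cmp_add_left: "f \<in> Hom C X Y \<Longrightarrow> g \<in> Hom C Y Z \<Longrightarrow> g' \<in> Hom C Y Z
      \<Longrightarrow> (g \<boxplus> g') \<cdot> f = (g \<cdot> f) \<boxplus> (g' \<cdot> f)"
    and ex_zero_object: "\<exists>Z. zero_object C Z"
    and ex_biproduct: "X \<in> obj C \<Longrightarrow> Y \<in> obj C \<Longrightarrow> \<exists>S i j p q. biproduct C X Y S i j p q"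

definition is_kernel :: "('o, 'm, 'x) addcat_scheme \<Rightarrow> 'm \<Rightarrow> 'm \<Rightarrow> bool" where
  "is_kernel C f i \<longleftrightarrow> f \<in> arr C \<and> i \<in> arr C \<and> tgt C i = src C f \<and>
     f \<cdot>\<^bsub>C\<^esub> i = zero_arr C (src C i) (tgt C f) \<and>
     (\<forall>g\<in>arr C. tgt C g = src C f \<and> f \<cdot>\<^bsub>C\<^esub> g = zero_arr C (src C g) (tgt C f) \<longrightarrow>
        (\<exists>!h. h \<in> Hom C (src C g) (src C i) \<and> i \<cdot>\<^bsub>C\<^esub> h = g))"

definition is_cokernel :: "('o, 'm, 'x) addcat_scheme \<Rightarrow> 'm \<Rightarrow> 'm \<Rightarrow> bool" where
  "is_cokernel C f p \<longleftrightarrow> f \<in> arr C \<and> p \<in> arr C \<and> src C p = tgt C f \<and>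
     p \<cdot>\<^bsub>C\<^esub> f = zero_arr C (src C f) (tgt C p) \<and>
     (\<forall>g\<in>arr C. src C g = tgt C f \<and> g \<cdot>\<^bsub>C\<^esub> f = zero_arr C (src C f) (tgt C g) \<longrightarrow>
        (\<exists>!h. h \<in> Hom C (tgt C p) (tgt C g) \<and> h \<cdot>\<^bsub>C\<^esub> p = g))"

definition has_kernels :: "('o, 'm, 'x) addcat_scheme \<Rightarrow> bool" where
  "has_kernels C \<longleftrightarrow> (\<forall>f\<in>arr C. \<exists>i. is_kernel C f i)"

definition has_cokernels :: "('o, 'm, 'x) addcat_scheme \<Rightarrow> bool" where
  "has_cokernels C \<longleftrightarrow> (\<forall>f\<in>arr C. \<exists>p. is_cokernel C f p)"


section \<open>Closed symmetric monoidal categories\<close>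

record ('o, 'm) moncat = "('o, 'm) addcat" +
  tens :: "'o \<Rightarrow> 'o \<Rightarrow> 'o" (infixr "\<boxtimes>\<index>" 75)
  tens_arr :: "'m \<Rightarrow> 'm \<Rightarrow> 'm" (infixr "\<boxdot>\<index>" 75)
  tunit :: 'o
  assoc :: "'o \<Rightarrow> 'o \<Rightarrow> 'o \<Rightarrow> 'm"  \<comment> \<open>\<open>(X \<boxtimes> Y) \<boxtimes> Z \<rightarrow> X \<boxtimes> (Y \<boxtimes> Z)\<close>\<close>
  lunit :: "'o \<Rightarrow> 'm"  \<comment> \<open>\<open>tunit \<boxtimes> X \<rightarrow> X\<close>\<close>
  runit :: "'o \<Rightarrow> 'm"  \<comment> \<open>\<open>X \<boxtimes> tunit \<rightarrow> X\<close>\<close>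
  swap :: "'o \<Rightarrow> 'o \<Rightarrow> 'm"  \<comment> \<open>\<open>X \<boxtimes> Y \<rightarrow> Y \<boxtimes> X\<close>\<close>

locale symmetric_monoidal_category = category C
  for C :: "('o, 'm, 'x) moncat_scheme" (structure) +
  assumes tens_obj: "X \<in> obj C \<Longrightarrow> Y \<in> obj C \<Longrightarrow> X \<boxtimes> Y \<in> obj C"
    and tunit_obj: "tunit C \<in> obj C"
    and tens_arr_in_Hom: "f \<in> Hom C X X' \<Longrightarrow> g \<in> Hom C Y Y'
      \<Longrightarrow> f \<boxdot> g \<in> Hom C (X \<boxtimes> Y) (X' \<boxtimes> Y')"
    and tens_ident: "X \<in> obj C \<Longrightarrow> Y \<in> obj C
      \<Longrightarrow> ident C X \<boxdot> ident C Y = ident C (X \<boxtimes> Y)"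
    and tens_cmp: "f \<in> Hom C X X' \<Longrightarrow> f' \<in> Hom C X' X'' \<Longrightarrow> g \<in> Hom C Y Y' \<Longrightarrow> g' \<in> Hom C Y' Y''
      \<Longrightarrow> (f' \<cdot> f) \<boxdot> (g' \<cdot> g) = (f' \<boxdot> g') \<cdot> (f \<boxdot> g)"
    and assoc_in_Hom: "X \<in> obj C \<Longrightarrow> Y \<in> obj C \<Longrightarrow> Z \<in> obj C
      \<Longrightarrow> assoc C X Y Z \<in> Hom C ((X \<boxtimes> Y) \<boxtimes> Z) (X \<boxtimes> (Y \<boxtimes> Z))"
    and assoc_iso: "X \<in> obj C \<Longrightarrow> Y \<in> obj C \<Longrightarrow> Z \<in> obj C \<Longrightarrow> iso_arrow C (assoc C X Y Z)"
    and assoc_natural: "f \<in> Hom C X X' \<Longrightarrow> g \<in> Hom C Y Y' \<Longrightarrow> h \<in> Hom C Z Z'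
      \<Longrightarrow> assoc C X' Y' Z' \<cdot> ((f \<boxdot> g) \<boxdot> h) = (f \<boxdot> (g \<boxdot> h)) \<cdot> assoc C X Y Z"
    and lunit_in_Hom: "X \<in> obj C \<Longrightarrow> lunit C X \<in> Hom C (tunit C \<boxtimes> X) X"
    and lunit_iso: "X \<in> obj C \<Longrightarrow> iso_arrow C (lunit C X)"
    and lunit_natural: "f \<in> Hom C X X' \<Longrightarrow> lunit C X' \<cdot> (ident C (tunit C) \<boxdot> f) = f \<cdot> lunit C X"
    and runit_in_Hom: "X \<in> obj C \<Longrightarrow> runit C X \<in> Hom C (X \<boxtimes> tunit C) X"
    and runit_iso: "X \<in> obj C \<Longrightarrow> iso_arrow C (runit C X)"
    and runit_natural: "f \<in> Hom C X X' \<Longrightarrow> runit C X' \<cdot> (f \<boxdot> ident C (tunit C)) = f \<cdot> runit C X"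
    and swap_in_Hom: "X \<in> obj C \<Longrightarrow> Y \<in> obj C \<Longrightarrow> swap C X Y \<in> Hom C (X \<boxtimes> Y) (Y \<boxtimes> X)"
    and swap_natural: "f \<in> Hom C X X' \<Longrightarrow> g \<in> Hom C Y Y'
      \<Longrightarrow> swap C X' Y' \<cdot> (f \<boxdot> g) = (g \<boxdot> f) \<cdot> swap C X Y"
    and swap_swap: "X \<in> obj C \<Longrightarrow> Y \<in> obj C \<Longrightarrow> swap C Y X \<cdot> swap C X Y = ident C (X \<boxtimes> Y)"
    and pentagon: "W \<in> obj C \<Longrightarrow> X \<in> obj C \<Longrightarrow> Y \<in> obj C \<Longrightarrow> Z \<in> obj C \<Longrightarrow>
      assoc C W X (Y \<boxtimes> Z) \<cdot> assoc C (W \<boxtimes> X) Y Z =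
      (ident C W \<boxdot> assoc C X Y Z) \<cdot> assoc C W (X \<boxtimes> Y) Z \<cdot> (assoc C W X Y \<boxdot> ident C Z)"
    and triangle: "X \<in> obj C \<Longrightarrow> Y \<in> obj C \<Longrightarrow>
      (ident C X \<boxdot> lunit C Y) \<cdot> assoc C X (tunit C) Y = runit C X \<boxdot> ident C Y"
    and hexagon: "X \<in> obj C \<Longrightarrow> Y \<in> obj C \<Longrightarrow> Z \<in> obj C \<Longrightarrow>
      assoc C Y Z X \<cdot> swap C X (Y \<boxtimes> Z) \<cdot> assoc C X Y Z =
      (ident C Y \<boxdot> swap C X Z) \<cdot> assoc C Y X Z \<cdot> (swap C X Y \<boxdot> ident C Z)"

text \<open>Closedness is stated as the existence, for all \<open>Y\<close> and \<open>Z\<close>, of an internal hom \<open>H\<close> with a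
  universal evaluation \<open>H \<boxtimes> Y \<rightarrow> Z\<close>, that is, a right adjoint of \<open>\<hyphen> \<boxtimes> Y\<close>.\<close>

locale closed_symmetric_monoidal_category = symmetric_monoidal_category C
  for C :: "('o, 'm, 'x) moncat_scheme" (structure) +
  assumes closed: "Y \<in> obj C \<Longrightarrow> Z \<in> obj C \<Longrightarrow>
    \<exists>H\<in>obj C. \<exists>ev\<in>Hom C (H \<boxtimes> Y) Z. \<forall>X\<in>obj C. \<forall>g\<in>Hom C (X \<boxtimes> Y) Z.
      \<exists>!h. h \<in> Hom C X H \<and> ev \<cdot> (h \<boxdot> ident C Y) = g"


section \<open>Algebras and modules\<close>

record ('o, 'm) alg =
  alg_obj :: 'o
  alg_mult :: 'm
  alg_unit :: 'm

definition unital_algebra :: "('o, 'm) moncat \<Rightarrow> ('o, 'm) alg \<Rightarrow> bool" where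
  "unital_algebra C A \<longleftrightarrow> (let a = alg_obj A; m = alg_mult A; u = alg_unit A in
     a \<in> obj C \<and> m \<in> Hom C (a \<boxtimes>\<^bsub>C\<^esub> a) a \<and> u \<in> Hom C (tunit C) a \<and>
     m \<cdot>\<^bsub>C\<^esub> (m \<boxdot>\<^bsub>C\<^esub> ident C a) = m \<cdot>\<^bsub>C\<^esub> (ident C a \<boxdot>\<^bsub>C\<^esub> m) \<cdot>\<^bsub>C\<^esub> assoc C a a a \<and>
     m \<cdot>\<^bsub>C\<^esub> (u \<boxdot>\<^bsub>C\<^esub> ident C a) = lunit C a \<and>
     m \<cdot>\<^bsub>C\<^esub> (ident C a \<boxdot>\<^bsub>C\<^esub> u) = runit C a)"

definition algebra_hom :: "('o, 'm) moncat \<Rightarrow> ('o, 'm) alg \<Rightarrow> ('o, 'm) alg \<Rightarrow> 'm \<Rightarrow> bool" where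
  "algebra_hom C A B f \<longleftrightarrow> f \<in> Hom C (alg_obj A) (alg_obj B) \<and>
     f \<cdot>\<^bsub>C\<^esub> alg_mult A = alg_mult B \<cdot>\<^bsub>C\<^esub> (f \<boxdot>\<^bsub>C\<^esub> f) \<and>
     f \<cdot>\<^bsub>C\<^esub> alg_unit A = alg_unit B"

definition op_alg :: "('o, 'm) moncat \<Rightarrow> ('o, 'm) alg \<Rightarrow> ('o, 'm) alg" where
  "op_alg C A = A\<lparr>alg_mult := alg_mult A \<cdot>\<^bsub>C\<^esub> swap C (alg_obj A) (alg_obj A)\<rparr>"

text \<open>The middle-four interchange
  \<open>(W \<boxtimes> X) \<boxtimes> (Y \<boxtimes> Z) \<rightarrow> (W \<boxtimes> Y) \<boxtimes> (X \<boxtimes> Z)\<close>.\<close>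

definition interchange :: "('o, 'm) moncat \<Rightarrow> 'o \<Rightarrow> 'o \<Rightarrow> 'o \<Rightarrow> 'o \<Rightarrow> 'm" where
  "interchange C W X Y Z =
     inv_arrow C (assoc C W Y (X \<boxtimes>\<^bsub>C\<^esub> Z)) \<cdot>\<^bsub>C\<^esub>
     (ident C W \<boxdot>\<^bsub>C\<^esub> (assoc C Y X Z \<cdot>\<^bsub>C\<^esub> (swap C X Y \<boxdot>\<^bsub>C\<^esub> ident C Z) \<cdot>\<^bsub>C\<^esub>
        inv_arrow C (assoc C X Y Z))) \<cdot>\<^bsub>C\<^esub>
     assoc C W X (Y \<boxtimes>\<^bsub>C\<^esub> Z)"

definition tensor_alg :: "('o, 'm) moncat \<Rightarrow> ('o, 'm) alg \<Rightarrow> ('o, 'm) alg \<Rightarrow> ('o, 'm) alg" where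
  "tensor_alg C A B =
     \<lparr>alg_obj = alg_obj A \<boxtimes>\<^bsub>C\<^esub> alg_obj B,
      alg_mult = (alg_mult A \<boxdot>\<^bsub>C\<^esub> alg_mult B) \<cdot>\<^bsub>C\<^esub>
        interchange C (alg_obj A) (alg_obj B) (alg_obj A) (alg_obj B),
      alg_unit = (alg_unit A \<boxdot>\<^bsub>C\<^esub> alg_unit B) \<cdot>\<^bsub>C\<^esub> inv_arrow C (lunit C (tunit C))\<rparr>"

definition env_alg :: "('o, 'm) moncat \<Rightarrow> ('o, 'm) alg \<Rightarrow> ('o, 'm) alg" where
  "env_alg C A = tensor_alg C A (op_alg C A)"

text \<open>A left module is a pair of an object \<open>M\<close> and an action \<open>A \<boxtimes> M \<rightarrow> M\<close>; a module map is
  a triple of source, underlying arrow and target.\<close>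

type_synonym ('o, 'm) module_obj = "'o \<times> 'm"
type_synonym ('o, 'm) module_arr = "('o, 'm) module_obj \<times> 'm \<times> ('o, 'm) module_obj"

definition left_module :: "('o, 'm) moncat \<Rightarrow> ('o, 'm) alg \<Rightarrow> ('o, 'm) module_obj \<Rightarrow> bool" where
  "left_module C A = (\<lambda>(M, act). let a = alg_obj A in
     M \<in> obj C \<and> act \<in> Hom C (a \<boxtimes>\<^bsub>C\<^esub> M) M \<and>
     act \<cdot>\<^bsub>C\<^esub> (alg_mult A \<boxdot>\<^bsub>C\<^esub> ident C M) =
       act \<cdot>\<^bsub>C\<^esub> (ident C a \<boxdot>\<^bsub>C\<^esub> act) \<cdot>\<^bsub>C\<^esub> assoc C a a M \<and>
     act \<cdot>\<^bsub>C\<^esub> (alg_unit A \<boxdot>\<^bsub>C\<^esub> ident C M) = lunit C M)"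

definition module_map :: "('o, 'm) moncat \<Rightarrow> ('o, 'm) alg \<Rightarrow> ('o, 'm) module_obj
    \<Rightarrow> 'm \<Rightarrow> ('o, 'm) module_obj \<Rightarrow> bool" where
  "module_map C A X h Y \<longleftrightarrow> left_module C A X \<and> left_module C A Y \<and>
     h \<in> Hom C (fst X) (fst Y) \<and>
     h \<cdot>\<^bsub>C\<^esub> snd X = snd Y \<cdot>\<^bsub>C\<^esub> (ident C (alg_obj A) \<boxdot>\<^bsub>C\<^esub> h)"

definition LMod :: "('o, 'm) moncat \<Rightarrow> ('o, 'm) alg
    \<Rightarrow> (('o, 'm) module_obj, ('o, 'm) module_arr) addcat" where
  "LMod C A =
     \<lparr>obj = {X. left_module C A X},
      arr = {(X, h, Y). module_map C A X h Y},
      src = (\<lambda>(X, h, Y). X),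
      tgt = (\<lambda>(X, h, Y). Y),
      ident = (\<lambda>X. (X, ident C (fst X), X)),
      cmp = (\<lambda>(Y', g, Z) (X, f, Y). (X, g \<cdot>\<^bsub>C\<^esub> f, Z)),
      add_arr = (\<lambda>(X, f, Y) (X', g, Y'). (X, f \<boxplus>\<^bsub>C\<^esub> g, Y)),
      zero_arr = (\<lambda>X Y. (X, zero_arr C (fst X) (fst Y), Y))\<rparr>"

definition forget_obj :: "('o, 'm) module_obj \<Rightarrow> 'o" where
  "forget_obj X = fst X"

definition forget_arr :: "('o, 'm) module_arr \<Rightarrow> 'm" where
  "forget_arr h = fst (snd h)"

text \<open>Restriction of scalars along \<open>f : A \<rightarrow> B\<close>.\<close>

definition restrict_obj :: "('o, 'm) moncat \<Rightarrow> 'm \<Rightarrow> ('o, 'm) module_obj \<Rightarrow> ('o, 'm) module_obj" where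
  "restrict_obj C f = (\<lambda>(M, act). (M, act \<cdot>\<^bsub>C\<^esub> (f \<boxdot>\<^bsub>C\<^esub> ident C M)))"

definition restrict_arr :: "('o, 'm) moncat \<Rightarrow> 'm \<Rightarrow> ('o, 'm) module_arr \<Rightarrow> ('o, 'm) module_arr" where
  "restrict_arr C f = (\<lambda>(X, h, Y). (restrict_obj C f X, h, restrict_obj C f Y))"

definition splits :: "('o, 'm, 'x) addcat_scheme \<Rightarrow> 'm \<Rightarrow> 'm \<Rightarrow> bool" where
  "splits C i p \<longleftrightarrow> (\<exists>r s. biproduct C (src C i) (tgt C p) (tgt C i) i s r p)"

definition semisplit_extension :: "('o, 'm) moncat \<Rightarrow> ('o, 'm) alg
    \<Rightarrow> ('o, 'm) module_arr \<Rightarrow> ('o, 'm) module_arr \<Rightarrow> bool" where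
  "semisplit_extension C A i p \<longleftrightarrow>
     is_kernel (LMod C A) p i \<and> is_cokernel (LMod C A) i p \<and>
     splits C (forget_arr i) (forget_arr p)"

text \<open>Projectivity: \<open>0 \<rightarrow> Hom P K \<rightarrow> Hom P E \<rightarrow> Hom P Q \<rightarrow> 0\<close> is exact for every semi-split
  extension \<open>K \<rightarrow> E \<rightarrow> Q\<close>.\<close>

definition projective_module :: "('o, 'm) moncat \<Rightarrow> ('o, 'm) alg \<Rightarrow> ('o, 'm) module_obj \<Rightarrow> bool" where
  "projective_module C A P \<longleftrightarrow> (let M = LMod C A in
     P \<in> obj M \<and>
     (\<forall>i p. semisplit_extension C A i p \<longrightarrow>
        inj_on (\<lambda>g. i \<cdot>\<^bsub>M\<^esub> g) (Hom M P (src M i)) \<and>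
        (\<lambda>g. i \<cdot>\<^bsub>M\<^esub> g) ` Hom M P (src M i) =
          {g \<in> Hom M P (tgt M i). p \<cdot>\<^bsub>M\<^esub> g = zero_arr M P (tgt M p)} \<and>
        (\<lambda>g. p \<cdot>\<^bsub>M\<^esub> g) ` Hom M P (src M p) = Hom M P (tgt M p)))"


section \<open>Complexes and the homotopy category\<close>

text \<open>Complexes are unbounded and graded homologically: \<open>snd X n : fst X n \<rightarrow> fst X (n - 1)\<close>.\<close>

type_synonym ('o, 'm) cplx = "(int \<Rightarrow> 'o) \<times> (int \<Rightarrow> 'm)"

definition chain_complex :: "('o, 'm, 'x) addcat_scheme \<Rightarrow> ('o, 'm) cplx \<Rightarrow> bool" where
  "chain_complex C X \<longleftrightarrow> (\<forall>n. fst X n \<in> obj C \<and> snd X n \<in> Hom C (fst X n) (fst X (n - 1)) \<and>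
     snd X (n - 1) \<cdot>\<^bsub>C\<^esub> snd X n = zero_arr C (fst X n) (fst X (n - 2)))"

definition chain_map :: "('o, 'm, 'x) addcat_scheme \<Rightarrow> ('o, 'm) cplx \<Rightarrow> ('o, 'm) cplx
    \<Rightarrow> (int \<Rightarrow> 'm) \<Rightarrow> bool" where
  "chain_map C X Y f \<longleftrightarrow> chain_complex C X \<and> chain_complex C Y \<and>
     (\<forall>n. f n \<in> Hom C (fst X n) (fst Y n) \<and>
        snd Y n \<cdot>\<^bsub>C\<^esub> f n = f (n - 1) \<cdot>\<^bsub>C\<^esub> snd X n)"

definition chain_homotopic :: "('o, 'm, 'x) addcat_scheme \<Rightarrow> ('o, 'm) cplx \<Rightarrow> ('o, 'm) cplx
    \<Rightarrow> (int \<Rightarrow> 'm) \<Rightarrow> (int \<Rightarrow> 'm) \<Rightarrow> bool" where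
  "chain_homotopic C X Y f g \<longleftrightarrow> chain_map C X Y f \<and> chain_map C X Y g \<and>
     (\<exists>h. \<forall>n. h n \<in> Hom C (fst X n) (fst Y (n + 1)) \<and>
        f n = g n \<boxplus>\<^bsub>C\<^esub> ((snd Y (n + 1) \<cdot>\<^bsub>C\<^esub> h n) \<boxplus>\<^bsub>C\<^esub> (h (n - 1) \<cdot>\<^bsub>C\<^esub> snd X n)))"

definition contractible :: "('o, 'm, 'x) addcat_scheme \<Rightarrow> ('o, 'm) cplx \<Rightarrow> bool" where
  "contractible C X \<longleftrightarrow> chain_complex C X \<and>
     chain_homotopic C X X (\<lambda>n. ident C (fst X n)) (\<lambda>n. zero_arr C (fst X n) (fst X n))"

text \<open>The mapping cone of \<open>f : X \<rightarrow> Y\<close> is \<open>X (n - 1) \<oplus> Y n\<close> in degree \<open>n\<close>, with the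
  differential \<open>(x, y) \<mapsto> (- d x, f x + d y)\<close>. It is determined up to isomorphism only, because
  of the choice of biproducts.\<close>

definition mapping_cone :: "('o, 'm, 'x) addcat_scheme \<Rightarrow> ('o, 'm) cplx \<Rightarrow> ('o, 'm) cplx
    \<Rightarrow> (int \<Rightarrow> 'm) \<Rightarrow> ('o, 'm) cplx \<Rightarrow> bool" where
  "mapping_cone C X Y f Z \<longleftrightarrow> chain_complex C Z \<and> (\<exists>i j p q. \<forall>n.
     biproduct C (fst X (n - 1)) (fst Y n) (fst Z n) (i n) (j n) (p n) (q n) \<and>
     snd Z n =
       (i (n - 1) \<cdot>\<^bsub>C\<^esub> neg_arr C (snd X (n - 1)) \<cdot>\<^bsub>C\<^esub> p n) \<boxplus>\<^bsub>C\<^esub>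
       (j (n - 1) \<cdot>\<^bsub>C\<^esub> f (n - 1) \<cdot>\<^bsub>C\<^esub> p n) \<boxplus>\<^bsub>C\<^esub>
       (j (n - 1) \<cdot>\<^bsub>C\<^esub> snd Y n \<cdot>\<^bsub>C\<^esub> q n))"

definition homotopy_class :: "('o, 'm, 'x) addcat_scheme \<Rightarrow> ('o, 'm) cplx \<Rightarrow> ('o, 'm) cplx
    \<Rightarrow> (int \<Rightarrow> 'm) \<Rightarrow> (int \<Rightarrow> 'm) set" where
  "homotopy_class C X Y f = {g. chain_homotopic C X Y f g}"

type_synonym ('o, 'm) ho_arr = "('o, 'm) cplx \<times> (int \<Rightarrow> 'm) set \<times> ('o, 'm) cplx"

definition homotopy_category :: "('o, 'm, 'x) addcat_scheme
    \<Rightarrow> (('o, 'm) cplx, ('o, 'm) ho_arr) cat" where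
  "homotopy_category C =
     \<lparr>obj = {X. chain_complex C X},
      arr = {(X, \<phi>, Y). \<exists>f. chain_map C X Y f \<and> \<phi> = homotopy_class C X Y f},
      src = (\<lambda>(X, \<phi>, Y). X),
      tgt = (\<lambda>(X, \<phi>, Y). Y),
      ident = (\<lambda>X. (X, homotopy_class C X X (\<lambda>n. ident C (fst X n)), X)),
      cmp = (\<lambda>(Y', \<psi>, Z) (X, \<phi>, Y).
        (X, \<Union>g\<in>\<psi>. \<Union>f\<in>\<phi>. homotopy_class C X Z (\<lambda>n. g n \<cdot>\<^bsub>C\<^esub> f n), Z))\<rparr>"

definition map_cplx :: "('o \<Rightarrow> 'p) \<Rightarrow> ('m \<Rightarrow> 'n) \<Rightarrow> ('o, 'm) cplx \<Rightarrow> ('p, 'n) cplx" where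
  "map_cplx Fo Fa X = (Fo \<circ> fst X, Fa \<circ> snd X)"

text \<open>The map on arrows of homotopy categories induced by an additive functor \<open>(Fo, Fa)\<close>
  with values in \<open>D\<close>.\<close>

definition map_ho_arr :: "('p, 'n, 'x) addcat_scheme \<Rightarrow> ('o \<Rightarrow> 'p) \<Rightarrow> ('m \<Rightarrow> 'n)
    \<Rightarrow> ('o, 'm) ho_arr \<Rightarrow> ('p, 'n) ho_arr" where
  "map_ho_arr D Fo Fa = (\<lambda>(X, \<phi>, Y).
     (map_cplx Fo Fa X, \<Union>f\<in>\<phi>. homotopy_class D (map_cplx Fo Fa X) (map_cplx Fo Fa Y) (Fa \<circ> f),
      map_cplx Fo Fa Y))"


section \<open>Localisation of a category\<close>

text \<open>The localisation of \<open>C\<close> at a class \<open>W\<close> of arrows (Gabriel and Zisman): an arrow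
  \<open>X \<rightarrow> Y\<close> is a zigzag of arrows of \<open>C\<close> and formal inverses of arrows in \<open>W\<close>, read from left to
  right, modulo the congruence generated by the relations of \<open>C\<close> and by \<open>Bwd w\<close> being inverse
  to \<open>Fwd w\<close>.\<close>

datatype 'm step = Fwd 'm | Bwd 'm

fun zigzag :: "('o, 'm, 'x) cat_scheme \<Rightarrow> 'm set \<Rightarrow> 'o \<Rightarrow> 'm step list \<Rightarrow> 'o \<Rightarrow> bool" where
  "zigzag C W X [] Y \<longleftrightarrow> X \<in> obj C \<and> Y = X"
| "zigzag C W X (Fwd f # z) Y \<longleftrightarrow> f \<in> arr C \<and> src C f = X \<and> zigzag C W (tgt C f) z Y"
| "zigzag C W X (Bwd w # z) Y \<longleftrightarrow> w \<in> arr C \<and> w \<in> W \<and> tgt C w = X \<and> zigzag C W (src C w) z Y"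

inductive zigzag_equiv :: "('o, 'm, 'x) cat_scheme \<Rightarrow> 'm set
    \<Rightarrow> 'o \<Rightarrow> 'o \<Rightarrow> 'm step list \<Rightarrow> 'm step list \<Rightarrow> bool" for C W where
  refl: "zigzag C W X z Y \<Longrightarrow> zigzag_equiv C W X Y z z"
| sym: "zigzag_equiv C W X Y z z' \<Longrightarrow> zigzag_equiv C W X Y z' z"
| trans: "zigzag_equiv C W X Y z z' \<Longrightarrow> zigzag_equiv C W X Y z' z'' \<Longrightarrow> zigzag_equiv C W X Y z z''"
| cong: "zigzag C W X' u X \<Longrightarrow> zigzag_equiv C W X Y z z' \<Longrightarrow> zigzag C W Y v Y'
    \<Longrightarrow> zigzag_equiv C W X' Y' (u @ z @ v) (u @ z' @ v)"
| ident: "X \<in> obj C \<Longrightarrow> zigzag_equiv C W X X [Fwd (ident C X)] []"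
| cmp: "f \<in> Hom C X Y \<Longrightarrow> g \<in> Hom C Y Z \<Longrightarrow> zigzag_equiv C W X Z [Fwd f, Fwd g] [Fwd (g \<cdot>\<^bsub>C\<^esub> f)]"
| fwd_bwd: "w \<in> W \<Longrightarrow> w \<in> Hom C X Y \<Longrightarrow> zigzag_equiv C W X X [Fwd w, Bwd w] []"
| bwd_fwd: "w \<in> W \<Longrightarrow> w \<in> Hom C X Y \<Longrightarrow> zigzag_equiv C W Y Y [Bwd w, Fwd w] []"

definition zigzag_class :: "('o, 'm, 'x) cat_scheme \<Rightarrow> 'm set \<Rightarrow> 'o \<Rightarrow> 'o
    \<Rightarrow> 'm step list \<Rightarrow> 'm step list set" where
  "zigzag_class C W X Y z = {z'. zigzag_equiv C W X Y z z'}"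

type_synonym ('o, 'm) loc_arr = "'o \<times> 'm step list set \<times> 'o"

definition localisation :: "('o, 'm, 'x) cat_scheme \<Rightarrow> 'm set \<Rightarrow> ('o, ('o, 'm) loc_arr) cat" where
  "localisation C W =
     \<lparr>obj = obj C,
      arr = {(X, \<zeta>, Y). \<exists>z. zigzag C W X z Y \<and> \<zeta> = zigzag_class C W X Y z},
      src = (\<lambda>(X, \<zeta>, Y). X),
      tgt = (\<lambda>(X, \<zeta>, Y). Y),
      ident = (\<lambda>X. (X, zigzag_class C W X X [], X)),
      cmp = (\<lambda>(Y', \<eta>, Z) (X, \<zeta>, Y).
        (X, \<Union>y\<in>\<eta>. \<Union>z\<in>\<zeta>. zigzag_class C W X Z (z @ y), Z))\<rparr>"

text \<open>The map on arrows of localisations induced by a functor \<open>(Fo, Fa)\<close> to \<open>D\<close> that sends the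
  localised arrows of its source into \<open>V\<close>.\<close>

definition map_loc_arr :: "('p, 'n, 'x) cat_scheme \<Rightarrow> 'n set \<Rightarrow> ('o \<Rightarrow> 'p) \<Rightarrow> ('m \<Rightarrow> 'n)
    \<Rightarrow> ('o, 'm) loc_arr \<Rightarrow> ('p, 'n) loc_arr" where
  "map_loc_arr D V Fo Fa = (\<lambda>(X, \<zeta>, Y).
     (Fo X, \<Union>z\<in>\<zeta>. zigzag_class D V (Fo X) (Fo Y) (map (map_step Fa) z), Fo Y))"

definition fully_faithful :: "('o, 'm, 'x) cat_scheme \<Rightarrow> ('p, 'n, 'y) cat_scheme
    \<Rightarrow> ('o \<Rightarrow> 'p) \<Rightarrow> ('m \<Rightarrow> 'n) \<Rightarrow> bool" where
  "fully_faithful C D Fo Fa \<longleftrightarrow>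
     (\<forall>X\<in>obj C. \<forall>Y\<in>obj C. bij_betw Fa (Hom C X Y) (Hom D (Fo X) (Fo Y)))"


section \<open>Derived categories and isocohomological embeddings\<close>

definition exact_complex :: "('o, 'm) moncat \<Rightarrow> ('o, 'm) alg
    \<Rightarrow> (('o, 'm) module_obj, ('o, 'm) module_arr) cplx \<Rightarrow> bool" where
  "exact_complex C A X \<longleftrightarrow> chain_complex (LMod C A) X \<and> contractible C (map_cplx forget_obj forget_arr X)"

definition quasi_isos :: "('o, 'm) moncat \<Rightarrow> ('o, 'm) alg
    \<Rightarrow> (('o, 'm) module_obj, ('o, 'm) module_arr) ho_arr set" where
  "quasi_isos C A = {(X, homotopy_class (LMod C A) X Y f, Y) | X Y f.
     chain_map (LMod C A) X Y f \<and> (\<exists>Z. mapping_cone (LMod C A) X Y f Z \<and> exact_complex C A Z)}"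

definition derived_category where
  "derived_category C A = localisation (homotopy_category (LMod C A)) (quasi_isos C A)"

definition derived_restrict_obj where
  "derived_restrict_obj C f = map_cplx (restrict_obj C f) (restrict_arr C f)"

definition derived_restrict_arr where
  "derived_restrict_arr C A f =
     map_loc_arr (homotopy_category (LMod C A)) (quasi_isos C A)
       (derived_restrict_obj C f)
       (map_ho_arr (LMod C A) (restrict_obj C f) (restrict_arr C f))"

definition isocohomological_embedding :: "('o, 'm) moncat \<Rightarrow> ('o, 'm) alg \<Rightarrow> ('o, 'm) alg
    \<Rightarrow> 'm \<Rightarrow> bool" where
  "isocohomological_embedding C A B f \<longleftrightarrow> algebra_hom C A B f \<and>
     fully_faithful (derived_category C B) (derived_category C A)
       (derived_restrict_obj C f) (derived_restrict_arr C A f)"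


section \<open>Projective bimodule resolutions\<close>

text \<open>\<open>A\<close> as a left module over \<open>A \<otimes> A\<^sup>o\<^sup>p\<close>: \<open>(a \<otimes> b) x = a (x b)\<close>.\<close>

definition regular_bimodule :: "('o, 'm) moncat \<Rightarrow> ('o, 'm) alg \<Rightarrow> ('o, 'm) module_obj" where
  "regular_bimodule C A = (let a = alg_obj A in
     (a, alg_mult A \<cdot>\<^bsub>C\<^esub> (ident C a \<boxdot>\<^bsub>C\<^esub> alg_mult (op_alg C A)) \<cdot>\<^bsub>C\<^esub> assoc C a a a))"

text \<open>The complex \<open>\<dots> \<rightarrow> P 1 \<rightarrow> P 0 \<rightarrow> M \<rightarrow> 0\<close> with \<open>M\<close> in degree \<open>-1\<close>, for a complex \<open>P\<close>
  that vanishes in negative degrees.\<close>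

definition augmented :: "('o, 'm, 'x) addcat_scheme \<Rightarrow> ('o, 'm) cplx \<Rightarrow> 'm \<Rightarrow> 'o \<Rightarrow> ('o, 'm) cplx" where
  "augmented C P \<epsilon> M =
     (\<lambda>n. if n = -1 then M else fst P n,
      \<lambda>n. if n = 0 then \<epsilon> else if n = -1 then zero_arr C M (fst P (-2)) else snd P n)"

definition projective_bimodule_resolution :: "('o, 'm) moncat \<Rightarrow> ('o, 'm) alg
    \<Rightarrow> (('o, 'm) module_obj, ('o, 'm) module_arr) cplx \<Rightarrow> ('o, 'm) module_arr \<Rightarrow> bool" where
  "projective_bimodule_resolution C A P \<epsilon> \<longleftrightarrow>
     (let E = env_alg C A; M = LMod C E; R = regular_bimodule C A; Q = augmented M P \<epsilon> R in
        chain_complex M P \<and> (\<forall>n<0. zero_object M (fst P n)) \<and>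
        (\<forall>n. projective_module C E (fst P n)) \<and>
        \<epsilon> \<in> Hom M (fst P 0) R \<and>
        chain_complex M Q \<and> contractible C (map_cplx forget_obj forget_arr Q))"

text \<open>As usual, length \<open>k\<close> means that the resolution has the form
  \<open>0 \<rightarrow> P k \<rightarrow> \<dots> \<rightarrow> P 0 \<rightarrow> A \<rightarrow> 0\<close>; \<open>P k\<close> may vanish.\<close>

definition has_projective_bimodule_resolution_of_length ::
    "('o, 'm) moncat \<Rightarrow> ('o, 'm) alg \<Rightarrow> nat \<Rightarrow> bool" where
  "has_projective_bimodule_resolution_of_length C A k \<longleftrightarrow>
     (\<exists>P \<epsilon>. projective_bimodule_resolution C A P \<epsilon> \<and>
        (\<forall>n > int k. zero_object (LMod C (env_alg C A)) (fst P n)))"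

end

theory Submission
  imports Defs
begin

text \<open>
  Write \<open>S = A \<otimes> \<hyphen>\<close> and \<open>T = A\<^sup>o\<^sup>p \<otimes> \<hyphen>\<close>; an \<open>A\<close>-bimodule is an object with commuting actions of the
  monads \<open>S\<close> and \<open>T\<close>. A projective bimodule is a retract of a free one, so inducing it along \<open>f\<close> on
  either side only requires splitting an idempotent on a free bimodule. Let \<open>P \<rightarrow> A\<close> be the given
  resolution, \<open>R = P \<otimes>\<^sub>A B\<close> and \<open>Q = B \<otimes>\<^sub>A R\<close>. The augmented complex \<open>P \<rightarrow> A\<close> is contractible over
  \<open>A\<^sup>o\<^sup>p\<close>, being bounded below, exact and termwise projective; hence \<open>R \<rightarrow> B\<close> is exact, and
  \<open>R\<close> is a projective resolution of \<open>f\<^sup>*B\<close> by left \<open>A\<close>-modules. Full faithfulness lifts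
  \<open>f\<^sup>*B \<leftarrow> R \<rightarrow> f\<^sup>*Q\<close> to a morphism \<open>s : B \<rightarrow> Q\<close>, a section of the augmentation \<open>\<epsilon> : Q \<rightarrow> B\<close>. As maps
  from \<open>R\<close> in the derived category are homotopy classes, the \<open>A\<close>-linear maps \<open>R \<rightarrow> f\<^sup>*Q\<close> underlying
  \<open>s \<epsilon>\<close> and \<open>id\<close> are homotopic, and by adjunction so are \<open>s \<epsilon>\<close> and \<open>id\<close>. Thus \<open>Q \<rightarrow> B\<close> is
  contractible.
\<close>

section \<open>Preadditive categories\<close>

text \<open>Relative tensor products are never formed. A module induced along \<open>g\<close> is
  specified by a universal arrow (\<open>universal\<close>); for a retract of a free module it
  exists because the defining idempotent extends to the induced free module and splits there.
  Kernels of \<open>C\<close> serve to split idempotents. Two-sided induction is cut into a right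
  and a left half because the halves preserve different things. The right half is at the same time
  induction of the underlying right modules, where the augmentation term \<open>A\<close> becomes
  \<open>B\<close>; so it carries an \<open>A\<^sup>o\<^sup>p\<close>-linear contraction to a
  \<open>B\<^sup>o\<^sup>p\<close>-linear one. The left half leaves the augmentation term
  \<open>B\<close> as it is, and a contraction after it can only come from the derived hypothesis:
  fullness produces the section, faithfulness shows that it is one. Morphisms of the derived
  category are zigzags. They are reduced to homotopy classes by letting zigzags act on maps out of
  bounded below complexes whose terms are summands of free modules.\<close>

lemma Hom_iff [simp]: "f \<in> Hom C X Y \<longleftrightarrow> f \<in> arr C \<and> src C f = X \<and> tgt C f = Y"
  by (simp add: Hom_def)

context category
begin

lemmas [simp] = src_in_obj tgt_in_obj

lemma ident_simps [simp]:
  assumes "X \<in> obj C"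
  shows "ident C X \<in> arr C" "src C (ident C X) = X" "tgt C (ident C X) = X"
  using ident_in_Hom[OF assms] by simp_all

lemma cmp_simps [simp]:
  assumes "f \<in> arr C" "g \<in> arr C" "src C g = tgt C f"
  shows "g \<cdot> f \<in> arr C" "src C (g \<cdot> f) = src C f" "tgt C (g \<cdot> f) = tgt C g"
  using cmp_in_Hom[of f "src C f" "tgt C f" g "tgt C g"] assms by simp_all

lemma cmp_ident [simp]:
  "f \<in> arr C \<Longrightarrow> src C f = X \<Longrightarrow> f \<cdot> ident C X = f"
  "f \<in> arr C \<Longrightarrow> tgt C f = X \<Longrightarrow> ident C X \<cdot> f = f"
  using cmp_ident_right[of f X "tgt C f"] cmp_ident_left[of f "src C f" X] by simp_all

lemma cmp_assoc' [simp]: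
  assumes "f \<in> arr C" "g \<in> arr C" "h \<in> arr C" "src C g = tgt C f" "src C h = tgt C g"
  shows "(h \<cdot> g) \<cdot> f = h \<cdot> g \<cdot> f"
  using cmp_assoc[of f "src C f" "tgt C f" g "tgt C g" h "tgt C h"] assms by simp

text \<open>Composites are kept nested to the right, where a known value of
  \<open>g \<cdot> f\<close> is hidden as soon as something precedes \<open>f\<close>. This form
  with a tail \<open>x\<close> lets such an equation rewrite inside longer composites.\<close>

lemma cmp_eq_ext:
  assumes "g \<cdot> f = k" "f \<in> arr C" "g \<in> arr C" "src C g = tgt C f" "x \<in> arr C" "tgt C x = src C f"
  shows "g \<cdot> f \<cdot> x = k \<cdot> x"
  using assms cmp_assoc'[of x f g] by simp

lemma inverse_arrows_unique:
  assumes "inverse_arrows C f g" "inverse_arrows C f g'"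
  shows "g' = g"
proof -
  have "g' = g' \<cdot> f \<cdot> g" using assms by (simp add: inverse_arrows_def)
  also have "\<dots> = (g' \<cdot> f) \<cdot> g" using assms cmp_assoc'[of g f g'] by (simp add: inverse_arrows_def)
  also have "\<dots> = g" using assms by (simp add: inverse_arrows_def)
  finally show ?thesis .
qed

lemma inverse_arrows_inv_arrow:
  assumes "iso_arrow C f" shows "inverse_arrows C f (inv_arrow C f)"
  unfolding inv_arrow_def
  by (rule theI') (use assms inverse_arrows_unique in \<open>auto simp: iso_arrow_def\<close>)

end

text \<open>The part of additivity that is established for the module categories
  \<open>LMod C E\<close>; the biproducts needed for cones in them are written down where they
  occur.\<close>

locale preadditive_category = category C for C :: "('o, 'm, 'x) addcat_scheme" (structure) +
  assumes hom_comm_group: "X \<in> obj C \<Longrightarrow> Y \<in> obj C \<Longrightarrow> comm_group (hom_group C X Y)"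
    and cmp_add_right: "f \<in> Hom C X Y \<Longrightarrow> f' \<in> Hom C X Y \<Longrightarrow> g \<in> Hom C Y Z
      \<Longrightarrow> g \<cdot> (f \<boxplus> f') = (g \<cdot> f) \<boxplus> (g \<cdot> f')"
    and cmp_add_left: "f \<in> Hom C X Y \<Longrightarrow> g \<in> Hom C Y Z \<Longrightarrow> g' \<in> Hom C Y Z
      \<Longrightarrow> (g \<boxplus> g') \<cdot> f = (g \<cdot> f) \<boxplus> (g' \<cdot> f)"
begin

lemma hom_group_sel [simp]:
  "carrier (hom_group C X Y) = Hom C X Y" "mult (hom_group C X Y) = add_arr C"
  "one (hom_group C X Y) = zero_arr C X Y"
  by (simp_all add: hom_group_def)

lemma zero_arr_simps [simp]:
  assumes "X \<in> obj C" "Y \<in> obj C"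
  shows "zero_arr C X Y \<in> arr C" "src C (zero_arr C X Y) = X" "tgt C (zero_arr C X Y) = Y"
proof -
  interpret G: comm_group "hom_group C X Y" using hom_comm_group assms .
  show "zero_arr C X Y \<in> arr C" "src C (zero_arr C X Y) = X" "tgt C (zero_arr C X Y) = Y"
    using G.one_closed by simp_all
qed

lemma add_arr_simps [simp]:
  assumes "f \<in> arr C" "g \<in> arr C" "src C g = src C f" "tgt C g = tgt C f"
  shows "f \<boxplus> g \<in> arr C" "src C (f \<boxplus> g) = src C f" "tgt C (f \<boxplus> g) = tgt C f"
proof -
  interpret G: comm_group "hom_group C (src C f) (tgt C f)" using hom_comm_group assms by simp
  show "f \<boxplus> g \<in> arr C" "src C (f \<boxplus> g) = src C f" "tgt C (f \<boxplus> g) = tgt C f"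
    using G.m_closed[of f g] assms by simp_all
qed

lemma neg_arr_simps [simp]:
  assumes "f \<in> arr C"
  shows "neg_arr C f \<in> arr C" "src C (neg_arr C f) = src C f" "tgt C (neg_arr C f) = tgt C f"
    "f \<boxplus> neg_arr C f = zero_arr C (src C f) (tgt C f)"
    "neg_arr C f \<boxplus> f = zero_arr C (src C f) (tgt C f)"
proof -
  interpret G: comm_group "hom_group C (src C f) (tgt C f)" using hom_comm_group assms by simp
  show "neg_arr C f \<in> arr C" "src C (neg_arr C f) = src C f" "tgt C (neg_arr C f) = tgt C f"
    "f \<boxplus> neg_arr C f = zero_arr C (src C f) (tgt C f)"
    "neg_arr C f \<boxplus> f = zero_arr C (src C f) (tgt C f)"
    unfolding neg_arr_def using G.inv_closed[of f] G.r_inv[of f] G.l_inv[of f] assms by simp_all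
qed

lemma add_arr_assoc:
  assumes "f \<in> arr C" "g \<in> arr C" "h \<in> arr C" "src C g = src C f" "tgt C g = tgt C f"
    "src C h = src C f" "tgt C h = tgt C f"
  shows "(f \<boxplus> g) \<boxplus> h = f \<boxplus> (g \<boxplus> h)"
proof -
  interpret G: comm_group "hom_group C (src C f) (tgt C f)" using hom_comm_group assms by simp
  show ?thesis using G.m_assoc[of f g h] assms by simp
qed

lemma add_arr_comm:
  assumes "f \<in> arr C" "g \<in> arr C" "src C g = src C f" "tgt C g = tgt C f"
  shows "f \<boxplus> g = g \<boxplus> f"
proof -
  interpret G: comm_group "hom_group C (src C f) (tgt C f)" using hom_comm_group assms by simp
  show ?thesis using G.m_comm[of f g] assms by simp
qed

lemma add_arr_left_comm:
  assumes "f \<in> arr C" "g \<in> arr C" "h \<in> arr C" "src C g = src C f" "tgt C g = tgt C f"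
    "src C h = src C f" "tgt C h = tgt C f"
  shows "f \<boxplus> (g \<boxplus> h) = g \<boxplus> (f \<boxplus> h)"
  using assms add_arr_assoc[of f g h] add_arr_assoc[of g f h] add_arr_comm[of f g] by simp

lemmas add_arr_ac = add_arr_assoc add_arr_comm add_arr_left_comm

lemma add_zero_arr [simp]:
  assumes "f \<in> arr C" "src C f = X" "tgt C f = Y"
  shows "f \<boxplus> zero_arr C X Y = f" "zero_arr C X Y \<boxplus> f = f"
proof -
  interpret G: comm_group "hom_group C X Y" using hom_comm_group assms by auto
  show "f \<boxplus> zero_arr C X Y = f" "zero_arr C X Y \<boxplus> f = f"
    using G.r_one[of f] G.l_one[of f] assms by simp_all
qed

lemma add_arr_left_cancel:
  assumes "f \<boxplus> g = f \<boxplus> h" "f \<in> arr C" "g \<in> arr C" "h \<in> arr C"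
    "src C g = src C f" "tgt C g = tgt C f" "src C h = src C f" "tgt C h = tgt C f"
  shows "g = h"
proof -
  interpret G: comm_group "hom_group C (src C f) (tgt C f)" using hom_comm_group assms by simp
  have "f \<in> Units (hom_group C (src C f) (tgt C f))" using G.Units assms by auto
  then show ?thesis using G.Units_l_cancel[of f g h] assms by simp
qed

lemma add_neg_cancel [simp]:
  assumes "f \<in> arr C" "g \<in> arr C" "src C g = src C f" "tgt C g = tgt C f"
  shows "f \<boxplus> (neg_arr C f \<boxplus> g) = g" "neg_arr C f \<boxplus> (f \<boxplus> g) = g"
  using assms add_arr_assoc[of f "neg_arr C f" g] add_arr_assoc[of "neg_arr C f" f g] by simp_all

lemma neg_arr_unique:
  assumes "f \<boxplus> g = zero_arr C (src C f) (tgt C f)"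
    "f \<in> arr C" "g \<in> arr C" "src C g = src C f" "tgt C g = tgt C f"
  shows "neg_arr C f = g"
  using add_arr_left_cancel[of f "neg_arr C f" g] assms by simp

lemma neg_neg_arr [simp]: "f \<in> arr C \<Longrightarrow> neg_arr C (neg_arr C f) = f"
  by (rule neg_arr_unique) simp_all

lemma cmp_add_right' [simp]:
  assumes "f \<in> arr C" "f' \<in> arr C" "g \<in> arr C" "src C f' = src C f" "tgt C f' = tgt C f" "src C g = tgt C f"
  shows "g \<cdot> (f \<boxplus> f') = (g \<cdot> f) \<boxplus> (g \<cdot> f')"
  using assms by (intro cmp_add_right) auto

lemma cmp_add_left' [simp]:
  assumes "g \<in> arr C" "g' \<in> arr C" "f \<in> arr C" "src C g' = src C g" "tgt C g' = tgt C g" "src C g = tgt C f"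
  shows "(g \<boxplus> g') \<cdot> f = (g \<cdot> f) \<boxplus> (g' \<cdot> f)"
  using assms by (intro cmp_add_left) auto

lemma cmp_zero_right [simp]:
  assumes "g \<in> arr C" "X \<in> obj C" "src C g = Y"
  shows "g \<cdot> zero_arr C X Y = zero_arr C X (tgt C g)"
proof (rule add_arr_left_cancel[of "g \<cdot> zero_arr C X Y"])
  have "Y \<in> obj C" using assms by auto
  then show "g \<cdot> zero_arr C X Y \<boxplus> g \<cdot> zero_arr C X Y = g \<cdot> zero_arr C X Y \<boxplus> zero_arr C X (tgt C g)"
    using cmp_add_right'[of "zero_arr C X Y" "zero_arr C X Y" g] assms by simp
qed (use assms in auto)

lemma cmp_zero_left [simp]:
  assumes "g \<in> arr C" "Z \<in> obj C" "tgt C g = Y"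
  shows "zero_arr C Y Z \<cdot> g = zero_arr C (src C g) Z"
proof (rule add_arr_left_cancel[of "zero_arr C Y Z \<cdot> g"])
  have "Y \<in> obj C" using assms by auto
  then show "zero_arr C Y Z \<cdot> g \<boxplus> zero_arr C Y Z \<cdot> g = zero_arr C Y Z \<cdot> g \<boxplus> zero_arr C (src C g) Z"
    using cmp_add_left'[of "zero_arr C Y Z" "zero_arr C Y Z" g] assms by simp
qed (use assms in auto)

lemma neg_zero_arr [simp]: "X \<in> obj C \<Longrightarrow> Y \<in> obj C \<Longrightarrow> neg_arr C (zero_arr C X Y) = zero_arr C X Y"
  by (rule neg_arr_unique) simp_all

lemma cmp_neg_right [simp]:
  assumes "f \<in> arr C" "g \<in> arr C" "src C g = tgt C f"
  shows "g \<cdot> neg_arr C f = neg_arr C (g \<cdot> f)"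
  by (rule neg_arr_unique[symmetric])
    (use assms cmp_add_right'[of f "neg_arr C f" g, symmetric] in simp_all)

lemma cmp_neg_left [simp]:
  assumes "f \<in> arr C" "g \<in> arr C" "src C g = tgt C f"
  shows "neg_arr C g \<cdot> f = neg_arr C (g \<cdot> f)"
  by (rule neg_arr_unique[symmetric])
    (use assms cmp_add_left'[of g "neg_arr C g" f, symmetric] in simp_all)

lemma neg_add_arr:
  assumes "f \<in> arr C" "g \<in> arr C" "src C g = src C f" "tgt C g = tgt C f"
  shows "neg_arr C (f \<boxplus> g) = neg_arr C f \<boxplus> neg_arr C g"
proof (rule neg_arr_unique)
  have "(f \<boxplus> g) \<boxplus> (neg_arr C f \<boxplus> neg_arr C g) = (f \<boxplus> neg_arr C f) \<boxplus> (g \<boxplus> neg_arr C g)"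
    using assms by (simp only: add_arr_ac add_arr_simps neg_arr_simps(1-3))
  also have "\<dots> = zero_arr C (src C (f \<boxplus> g)) (tgt C (f \<boxplus> g))"
    using assms by simp
  finally show "(f \<boxplus> g) \<boxplus> (neg_arr C f \<boxplus> neg_arr C g) = zero_arr C (src C (f \<boxplus> g)) (tgt C (f \<boxplus> g))" .
qed (use assms in simp_all)

text \<open>An arrow into or out of \<open>X\<close> equals its composite with the identity of
  \<open>X\<close>, so it vanishes with that identity.\<close>

lemma zero_object_iff_ident_zero:
  assumes "X \<in> obj C"
  shows "zero_object C X \<longleftrightarrow> ident C X = zero_arr C X X"
proof
  assume "zero_object C X"
  then have "\<exists>!f. f \<in> Hom C X X" using assms by (auto simp: zero_object_def)
  then show "ident C X = zero_arr C X X" using assms by (metis Hom_iff ident_simps zero_arr_simps)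
next
  assume eq: "ident C X = zero_arr C X X"
  have "\<exists>!f. f \<in> Hom C Y X" if "Y \<in> obj C" for Y
    using that assms eq cmp_ident(2)[of _ X] by (intro ex1I[of _ "zero_arr C Y X"]) auto
  moreover have "\<exists>!f. f \<in> Hom C X Y" if "Y \<in> obj C" for Y
    using that assms eq cmp_ident(1)[of _ X] by (intro ex1I[of _ "zero_arr C X Y"]) auto
  ultimately show "zero_object C X" using assms by (simp add: zero_object_def)
qed

lemma zero_object_arr:
  assumes "zero_object C X" "f \<in> arr C"
  shows "src C f = X \<Longrightarrow> f = zero_arr C X (tgt C f)" "tgt C f = X \<Longrightarrow> f = zero_arr C (src C f) X"
proof -
  have "X \<in> obj C" "ident C X = zero_arr C X X"
    using assms zero_object_iff_ident_zero by (auto simp: zero_object_def)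
  then show "src C f = X \<Longrightarrow> f = zero_arr C X (tgt C f)" "tgt C f = X \<Longrightarrow> f = zero_arr C (src C f) X"
    using assms(2) cmp_ident[of f X] by auto
qed

end

sublocale additive_category \<subseteq> preadditive_category
  by (intro preadditive_category.intro preadditive_category_axioms.intro category_axioms
    hom_comm_group cmp_add_right cmp_add_left)

section \<open>Morphisms in a localisation\<close>

text \<open>The objects \<open>X\<close> out of which localisation neither adds nor identifies maps,
  as shown by \<open>zigzag_equiv_Fwd\<close> and \<open>zigzag_equiv_FwdD\<close>. Among complexes
  they play the role of the K-projective ones.\<close>

definition inverts :: "('o, 'm, 'x) cat_scheme \<Rightarrow> 'm set \<Rightarrow> 'o \<Rightarrow> bool" where
  "inverts C W X \<longleftrightarrow>
     (\<forall>w\<in>W. w \<in> arr C \<longrightarrow> bij_betw (\<lambda>\<phi>. w \<cdot>\<^bsub>C\<^esub> \<phi>) (Hom C X (src C w)) (Hom C X (tgt C w)))"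

text \<open>Continues a map out of \<open>X\<close> along a zigzag. A formal inverse of
  \<open>w\<close> is interpreted by lifting through \<open>w\<close>; under \<open>inverts\<close>
  the lift is unique, so the choice made by \<open>inv_into\<close> has no effect.\<close>

fun zigzag_act :: "('o, 'm, 'x) cat_scheme \<Rightarrow> 'o \<Rightarrow> 'm \<Rightarrow> 'm step list \<Rightarrow> 'm" where
  "zigzag_act C X \<phi> [] = \<phi>"
| "zigzag_act C X \<phi> (Fwd f # z) = zigzag_act C X (f \<cdot>\<^bsub>C\<^esub> \<phi>) z"
| "zigzag_act C X \<phi> (Bwd w # z) =
     zigzag_act C X (inv_into (Hom C X (src C w)) (\<lambda>\<psi>. w \<cdot>\<^bsub>C\<^esub> \<psi>) \<phi>) z"

lemma zigzag_act_append:
  "zigzag_act C X \<phi> (u @ v) = zigzag_act C X (zigzag_act C X \<phi> u) v"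
  by (induction C X \<phi> u rule: zigzag_act.induct) simp_all

declare zigzag_equiv.trans [trans]

context category
begin

lemma zigzag_in_obj: "zigzag C W X z Y \<Longrightarrow> X \<in> obj C \<and> Y \<in> obj C"
proof (induction z arbitrary: X)
  case (Cons s z)
  then show ?case by (cases s) auto
qed simp

lemma zigzag_append: "zigzag C W X (u @ v) Z \<longleftrightarrow> (\<exists>Y. zigzag C W X u Y \<and> zigzag C W Y v Z)"
proof (induction u arbitrary: X)
  case (Cons s u)
  then show ?case by (cases s) auto
qed (auto dest: zigzag_in_obj)

lemma zigzag_equiv_zigzag:
  assumes "zigzag_equiv C W X Y z z'"
  shows "zigzag C W X z Y \<and> zigzag C W X z' Y"
  using assms
  by induction (auto simp: zigzag_append)

lemma zigzag_equiv_append_right: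
  assumes "zigzag_equiv C W X Y z z'" "zigzag C W Y v Y'"
  shows "zigzag_equiv C W X Y' (z @ v) (z' @ v)"
  using zigzag_equiv.cong[of C W X "[]" X Y z z' v Y'] assms
    zigzag_in_obj[of W X z Y] zigzag_equiv_zigzag[OF assms(1)] by auto

lemma zigzag_equiv_append_left:
  assumes "zigzag C W X' u X" "zigzag_equiv C W X Y z z'"
  shows "zigzag_equiv C W X' Y (u @ z) (u @ z')"
  using zigzag_equiv.cong[of C W X' u X Y z z' "[]" Y] assms
    zigzag_in_obj[of W X z Y] zigzag_equiv_zigzag[OF assms(2)] by auto

lemma inv_into_inverts:
  assumes "inverts C W X" "w \<in> W" "w \<in> arr C" "\<phi> \<in> Hom C X (tgt C w)"
    "\<psi> = inv_into (Hom C X (src C w)) (\<lambda>\<psi>. w \<cdot> \<psi>) \<phi>"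
  shows "\<psi> \<in> Hom C X (src C w)" "w \<cdot> \<psi> = \<phi>"
proof -
  have "bij_betw (\<lambda>\<phi>. w \<cdot> \<phi>) (Hom C X (src C w)) (Hom C X (tgt C w))"
    using assms by (simp add: inverts_def del: Hom_iff)
  then have im: "\<phi> \<in> (\<lambda>\<phi>. w \<cdot> \<phi>) ` Hom C X (src C w)"
    using assms(4) by (simp add: bij_betw_def del: Hom_iff)
  show "\<psi> \<in> Hom C X (src C w)" "w \<cdot> \<psi> = \<phi>"
    unfolding assms(5) by (fact inv_into_into[OF im], fact f_inv_into_f[OF im])
qed

lemma inverts_unique:
  assumes "inverts C W X" "w \<in> W" "w \<in> arr C" "\<phi> \<in> Hom C X (src C w)"
  shows "inv_into (Hom C X (src C w)) (\<lambda>\<psi>. w \<cdot> \<psi>) (w \<cdot> \<phi>) = \<phi>"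
proof -
  have "inj_on (\<lambda>\<phi>. w \<cdot> \<phi>) (Hom C X (src C w))"
    using assms by (simp add: inverts_def bij_betw_def del: Hom_iff)
  from inv_into_f_f[OF this assms(4)] show ?thesis .
qed

lemma zigzag_act_Hom:
  assumes "inverts C W X"
  shows "zigzag C W Y z Y' \<Longrightarrow> \<phi> \<in> Hom C X Y \<Longrightarrow> zigzag_act C X \<phi> z \<in> Hom C X Y'"
proof (induction z arbitrary: Y \<phi>)
  case (Cons s z)
  show ?case
  proof (cases s)
    case (Fwd f)
    with Cons.prems Cons.IH[of "tgt C f" "f \<cdot> \<phi>"] show ?thesis by simp
  next
    case (Bwd w)
    then have w: "w \<in> W" "w \<in> arr C" "\<phi> \<in> Hom C X (tgt C w)" "zigzag C W (src C w) z Y'"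
      using Cons.prems by auto
    show ?thesis
      unfolding Bwd zigzag_act.simps
      by (rule Cons.IH[OF w(4) inv_into_inverts(1)[OF assms w(1-3) HOL.refl]])
  qed
qed simp

text \<open>The relations of \<open>C\<close> are respected by associativity. Cancelling
  \<open>Fwd w, Bwd w\<close> uses injectivity of composition with \<open>w\<close>, cancelling
  \<open>Bwd w, Fwd w\<close> its surjectivity.\<close>

lemma zigzag_act_equiv:
  assumes "inverts C W X"
  shows "zigzag_equiv C W Y Y' z z' \<Longrightarrow> \<phi> \<in> Hom C X Y \<Longrightarrow> zigzag_act C X \<phi> z = zigzag_act C X \<phi> z'"
proof (induction arbitrary: \<phi> rule: zigzag_equiv.induct)
  case (cong X' u Xa Y z z' v Y')
  then show ?case
    using zigzag_act_Hom[OF assms cong.hyps(1)] by (simp add: zigzag_act_append del: Hom_iff)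
next
  case (fwd_bwd w Xa Y)
  then have "inv_into (Hom C X (src C w)) (\<lambda>\<psi>. w \<cdot> \<psi>) (w \<cdot> \<phi>) = \<phi>"
    using inverts_unique[OF assms, of w \<phi>] by simp
  then show ?case by simp
next
  case (bwd_fwd w Xa Y)
  then have "w \<cdot> inv_into (Hom C X (src C w)) (\<lambda>\<psi>. w \<cdot> \<psi>) \<phi> = \<phi>"
    using inv_into_inverts(2)[OF assms, of w \<phi>] by simp
  then show ?case by simp
qed simp_all

text \<open>A backward step is absorbed by writing the current map as
  \<open>w \<cdot> \<psi>\<close>: the forward step \<open>w\<close> so produced cancels against the
  formal inverse.\<close>

lemma zigzag_equiv_Fwd_act:
  assumes "inverts C W X"
  shows "zigzag C W Y z Y' \<Longrightarrow> \<phi> \<in> Hom C X Y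
    \<Longrightarrow> zigzag_equiv C W X Y' (Fwd \<phi> # z) [Fwd (zigzag_act C X \<phi> z)]"
proof (induction z arbitrary: Y \<phi>)
  case Nil
  then show ?case by (auto intro: zigzag_equiv.refl)
next
  case (Cons s z)
  show ?case
  proof (cases s)
    case (Fwd f)
    have "zigzag_equiv C W X (tgt C f) [Fwd \<phi>, Fwd f] [Fwd (f \<cdot> \<phi>)]"
      using Cons.prems Fwd by (intro zigzag_equiv.cmp[where Y = Y]) auto
    from zigzag_equiv_append_right[OF this] Cons.prems Fwd
    have "zigzag_equiv C W X Y' (Fwd \<phi> # Fwd f # z) (Fwd (f \<cdot> \<phi>) # z)" by simp
    also have "zigzag_equiv C W X Y' \<dots> [Fwd (zigzag_act C X (f \<cdot> \<phi>) z)]"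
      using Cons.prems Fwd by (intro Cons.IH[of "tgt C f"]) auto
    finally show ?thesis using Fwd by simp
  next
    case (Bwd w)
    define \<psi> where "\<psi> = inv_into (Hom C X (src C w)) (\<lambda>\<psi>. w \<cdot> \<psi>) \<phi>"
    have w: "w \<in> W" "w \<in> arr C" "tgt C w = Y" "zigzag C W (src C w) z Y'"
      using Cons.prems Bwd by auto
    have \<psi>: "\<psi> \<in> Hom C X (src C w)" "w \<cdot> \<psi> = \<phi>"
      by (rule inv_into_inverts[OF assms w(1,2) _ \<psi>_def]; use w Cons.prems(2) in simp)+
    have "zigzag_equiv C W X (tgt C w) [Fwd \<psi>, Fwd w] [Fwd \<phi>]"
      using w \<psi> zigzag_equiv.cmp[of \<psi> C X "src C w" w "tgt C w" W] by auto
    from zigzag_equiv_append_right[OF zigzag_equiv.sym[OF this], of "Bwd w # z" Y'] w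
    have "zigzag_equiv C W X Y' (Fwd \<phi> # Bwd w # z) (Fwd \<psi> # Fwd w # Bwd w # z)" by simp
    also have "zigzag_equiv C W X Y' \<dots> (Fwd \<psi> # z)"
    proof -
      have "zigzag_equiv C W (src C w) (src C w) [Fwd w, Bwd w] []"
        using w by (intro zigzag_equiv.fwd_bwd[where Y = Y]) auto
      then have "zigzag_equiv C W X Y' ([Fwd \<psi>] @ [Fwd w, Bwd w] @ z) ([Fwd \<psi>] @ [] @ z)"
        by (rule zigzag_equiv.cong[rotated]) (use \<psi> w in \<open>auto dest: zigzag_in_obj\<close>)
      then show ?thesis by simp
    qed
    also have "zigzag_equiv C W X Y' \<dots> [Fwd (zigzag_act C X \<psi> z)]"
      using w \<psi> by (intro Cons.IH[of "src C w"]) auto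
    finally show ?thesis using Bwd \<psi>_def by simp
  qed
qed

text \<open>Letting the zigzag act on the identity of \<open>X\<close> produces the single arrow:
  the localisation functor is full on maps out of \<open>X\<close>.\<close>

lemma zigzag_equiv_Fwd:
  assumes "inverts C W X" "zigzag C W X z Y"
  obtains \<phi> where "\<phi> \<in> Hom C X Y" "zigzag_equiv C W X Y z [Fwd \<phi>]"
proof
  have X: "X \<in> obj C" using zigzag_in_obj[OF assms(2)] by simp
  let ?\<phi> = "zigzag_act C X (ident C X) z"
  show "?\<phi> \<in> Hom C X Y"
    using X by (intro zigzag_act_Hom[OF assms]) simp
  have "zigzag_equiv C W X Y z (Fwd (ident C X) # z)"
    using zigzag_equiv_append_right[OF zigzag_equiv.sym[OF zigzag_equiv.ident[OF X]] assms(2)] by simp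
  also have "zigzag_equiv C W X Y \<dots> [Fwd ?\<phi>]"
    using X by (intro zigzag_equiv_Fwd_act[OF assms]) simp
  finally show "zigzag_equiv C W X Y z [Fwd ?\<phi>]" .
qed

text \<open>Faithfulness on maps out of \<open>X\<close>: the action on the identity recovers the
  arrow from its class.\<close>

lemma zigzag_equiv_FwdD:
  assumes "inverts C W X" "zigzag_equiv C W X Y [Fwd \<phi>] [Fwd \<psi>]"
  shows "\<phi> = \<psi>"
proof -
  have "X \<in> obj C" "\<phi> \<in> Hom C X Y" "\<psi> \<in> Hom C X Y"
    using zigzag_equiv_zigzag[OF assms(2)] by auto
  then show ?thesis using zigzag_act_equiv[OF assms, of "ident C X"] by simp
qed

lemma zigzag_class_eq_iff:
  assumes "zigzag C W X z Y"
  shows "zigzag_class C W X Y z = zigzag_class C W X Y z' \<longleftrightarrow> zigzag_equiv C W X Y z z'"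
proof
  assume "zigzag_class C W X Y z = zigzag_class C W X Y z'"
  then have "z \<in> zigzag_class C W X Y z'"
    using zigzag_equiv.refl[OF assms] by (auto simp: zigzag_class_def)
  then show "zigzag_equiv C W X Y z z'" by (simp add: zigzag_class_def zigzag_equiv.sym)
next
  assume "zigzag_equiv C W X Y z z'"
  then show "zigzag_class C W X Y z = zigzag_class C W X Y z'"
    by (auto simp: zigzag_class_def intro: zigzag_equiv.trans zigzag_equiv.sym)
qed

end

section \<open>Functors between localisations\<close>

locale localising_functor = C: category C + D: category D
  for C :: "('o, 'm, 'x) cat_scheme" and D :: "('p, 'n, 'y) cat_scheme"
    and W :: "'m set" and V :: "'n set" and Fo :: "'o \<Rightarrow> 'p" and Fa :: "'m \<Rightarrow> 'n" +
  assumes F_Hom: "f \<in> Hom C X Y \<Longrightarrow> Fa f \<in> Hom D (Fo X) (Fo Y)"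
    and F_ident: "X \<in> obj C \<Longrightarrow> Fa (ident C X) = ident D (Fo X)"
    and F_cmp: "f \<in> Hom C X Y \<Longrightarrow> g \<in> Hom C Y Z \<Longrightarrow> Fa (g \<cdot>\<^bsub>C\<^esub> f) = Fa g \<cdot>\<^bsub>D\<^esub> Fa f"
    and F_loc: "w \<in> W \<Longrightarrow> w \<in> arr C \<Longrightarrow> Fa w \<in> V"
begin

lemma F_obj: "X \<in> obj C \<Longrightarrow> Fo X \<in> obj D"
  using F_Hom[of "ident C X" X X] D.src_in_obj[of "Fa (ident C X)"] by simp

lemma F_arr [simp]:
  "f \<in> arr C \<Longrightarrow> Fa f \<in> arr D \<and> src D (Fa f) = Fo (src C f) \<and> tgt D (Fa f) = Fo (tgt C f)"
  using F_Hom[of f "src C f" "tgt C f"] by simp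

lemma zigzag_map: "zigzag C W X z Y \<Longrightarrow> zigzag D V (Fo X) (map (map_step Fa) z) (Fo Y)"
proof (induction z arbitrary: X)
  case (Cons s z)
  then show ?case by (cases s) (auto simp: F_loc)
qed (simp add: F_obj)

lemma zigzag_equiv_map:
  assumes "zigzag_equiv C W X Y z z'"
  shows "zigzag_equiv D V (Fo X) (Fo Y) (map (map_step Fa) z) (map (map_step Fa) z')"
  using assms
proof induction
  case (refl X z Y)
  then show ?case by (intro zigzag_equiv.refl zigzag_map)
next
  case (sym X Y z z')
  show ?case by (rule zigzag_equiv.sym[OF sym.IH])
next
  case (trans X Y z z' z'')
  then show ?case by (blast intro: zigzag_equiv.trans)
next
  case (cong X' u X Y z z' v Y')
  then show ?case by (auto intro!: zigzag_equiv.cong zigzag_map)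
next
  case (ident X)
  then show ?case by (simp add: F_ident F_obj zigzag_equiv.ident)
next
  case (cmp f X Y g Z)
  then show ?case
    using zigzag_equiv.cmp[OF F_Hom[OF cmp(1)] F_Hom[OF cmp(2)]] F_cmp[OF cmp] by simp
next
  case (fwd_bwd w X Y)
  then show ?case using zigzag_equiv.fwd_bwd[OF F_loc[of w] F_Hom[of w X Y]] by auto
next
  case (bwd_fwd w X Y)
  then show ?case using zigzag_equiv.bwd_fwd[OF F_loc[of w] F_Hom[of w X Y]] by auto
qed

text \<open>The image class does not depend on the representative, so the union in
  \<open>map_loc_arr\<close> is a union of equal sets.\<close>

lemma map_loc_arr_class:
  assumes "zigzag C W X z Y"
  shows "map_loc_arr D V Fo Fa (X, zigzag_class C W X Y z, Y) =
    (Fo X, zigzag_class D V (Fo X) (Fo Y) (map (map_step Fa) z), Fo Y)"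
proof -
  have eq: "zigzag_class D V (Fo X) (Fo Y) (map (map_step Fa) z') =
      zigzag_class D V (Fo X) (Fo Y) (map (map_step Fa) z)" if "z' \<in> zigzag_class C W X Y z" for z'
  proof -
    have "zigzag_equiv C W X Y z' z" using that by (simp add: zigzag_class_def zigzag_equiv.sym)
    then have "zigzag_equiv D V (Fo X) (Fo Y) (map (map_step Fa) z') (map (map_step Fa) z)"
      by (rule zigzag_equiv_map)
    then show ?thesis using D.zigzag_class_eq_iff D.zigzag_equiv_zigzag by meson
  qed
  have mem: "z \<in> zigzag_class C W X Y z"
    using assms by (simp add: zigzag_class_def zigzag_equiv.refl)
  have "(\<Union>z'\<in>zigzag_class C W X Y z. zigzag_class D V (Fo X) (Fo Y) (map (map_step Fa) z')) =
      zigzag_class D V (Fo X) (Fo Y) (map (map_step Fa) z)"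
    by (rule UN_constant_eq[OF mem]) (rule ballI, erule eq)
  then show ?thesis by (simp add: map_loc_arr_def)
qed

context
  assumes ff: "fully_faithful (localisation C W) (localisation D V) Fo (map_loc_arr D V Fo Fa)"
begin

lemma bij_betw_map_loc_arr:
  assumes "X \<in> obj C" "Y \<in> obj C"
  shows "bij_betw (map_loc_arr D V Fo Fa)
    {(X, zigzag_class C W X Y z, Y) | z. zigzag C W X z Y}
    {(Fo X, zigzag_class D V (Fo X) (Fo Y) z, Fo Y) | z. zigzag D V (Fo X) z (Fo Y)}"
proof -
  have H: "Hom (localisation K U) A B = {(A, zigzag_class K U A B z, B) | z. zigzag K U A z B}"
    for K :: "('a, 'b, 'c) cat_scheme" and U A B
    by (auto simp: Hom_def localisation_def)
  show ?thesis using ff assms unfolding H[symmetric] by (simp add: fully_faithful_def localisation_def del: Hom_iff)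
qed

text \<open>Full faithfulness concerns triples with a class of zigzags in the middle. This and the
  next lemma turn it into statements about individual zigzags, which can be composed and
  rewritten.\<close>

lemma localisation_full:
  assumes "X \<in> obj C" "Y \<in> obj C" "zigzag D V (Fo X) y (Fo Y)"
  obtains z where "zigzag C W X z Y" "zigzag_equiv D V (Fo X) (Fo Y) (map (map_step Fa) z) y"
proof -
  have "(Fo X, zigzag_class D V (Fo X) (Fo Y) y, Fo Y) \<in>
      map_loc_arr D V Fo Fa ` {(X, zigzag_class C W X Y z, Y) | z. zigzag C W X z Y}"
    using bij_betw_imp_surj_on[OF bij_betw_map_loc_arr[OF assms(1,2)]] assms(3) by auto
  then obtain z where z: "zigzag C W X z Y"
    "zigzag_class D V (Fo X) (Fo Y) y = zigzag_class D V (Fo X) (Fo Y) (map (map_step Fa) z)"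
    by (auto simp: map_loc_arr_class)
  show ?thesis
    using that[OF z(1)] z(2) D.zigzag_class_eq_iff[OF zigzag_map[OF z(1)], of y] by simp
qed

lemma localisation_faithful:
  assumes "zigzag C W X z Y" "zigzag C W X z' Y"
    and "zigzag_equiv D V (Fo X) (Fo Y) (map (map_step Fa) z) (map (map_step Fa) z')"
  shows "zigzag_equiv C W X Y z z'"
proof -
  have "(X, zigzag_class C W X Y z, Y) = (X, zigzag_class C W X Y z', Y)"
  proof (rule inj_onD[OF bij_betw_imp_inj_on[OF bij_betw_map_loc_arr[of X Y]]])
    show "map_loc_arr D V Fo Fa (X, zigzag_class C W X Y z, Y) =
        map_loc_arr D V Fo Fa (X, zigzag_class C W X Y z', Y)"
      using assms D.zigzag_class_eq_iff[OF zigzag_map[OF assms(1)]] by (simp add: map_loc_arr_class)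
  qed (use assms C.zigzag_in_obj[OF assms(1)] in auto)
  then show ?thesis using C.zigzag_class_eq_iff[OF assms(1)] by simp
qed

end

end

section \<open>Homotopy categories\<close>

definition ho_arrow :: "('o, 'm, 'x) addcat_scheme \<Rightarrow> ('o, 'm) cplx \<Rightarrow> ('o, 'm) cplx
    \<Rightarrow> (int \<Rightarrow> 'm) \<Rightarrow> ('o, 'm) ho_arr" where
  "ho_arrow C X Y f = (X, homotopy_class C X Y f, Y)"

text \<open>Acyclicity of the complex of groups \<open>Hom P Z\<close>, written elementwise: every
  cycle is a boundary. It is the form in which projectivity enters the homotopy arguments.\<close>

definition lifts_against :: "('o, 'm, 'x) addcat_scheme \<Rightarrow> ('o, 'm) cplx \<Rightarrow> 'o \<Rightarrow> bool" where
  "lifts_against C Z P \<longleftrightarrow> (\<forall>n a. a \<in> Hom C P (fst Z n) \<longrightarrow>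
     snd Z n \<cdot>\<^bsub>C\<^esub> a = zero_arr C P (fst Z (n - 1)) \<longrightarrow>
     (\<exists>b\<in>Hom C P (fst Z (n + 1)). snd Z (n + 1) \<cdot>\<^bsub>C\<^esub> b = a))"

context preadditive_category
begin

lemma add_neg_cancel_middle:
  assumes "x \<in> arr C" "a \<in> arr C" "b \<in> arr C" "src C a = src C x" "tgt C a = tgt C x"
    "src C b = src C x" "tgt C b = tgt C x"
  shows "x \<boxplus> (a \<boxplus> b) \<boxplus> neg_arr C a = x \<boxplus> b"
proof -
  have "x \<boxplus> (a \<boxplus> b) \<boxplus> neg_arr C a = x \<boxplus> ((b \<boxplus> a) \<boxplus> neg_arr C a)"
    using assms by (simp add: add_arr_assoc add_arr_comm[of a b])
  also have "(b \<boxplus> a) \<boxplus> neg_arr C a = b"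
    using assms by (subst add_arr_assoc) simp_all
  finally show ?thesis .
qed

lemma chain_complex_simps [simp]:
  assumes "chain_complex C X"
  shows "fst X n \<in> obj C" "snd X n \<in> arr C" "src C (snd X n) = fst X n"
    "tgt C (snd X n) = fst X (n - 1)" "snd X (n - 1) \<cdot> snd X n = zero_arr C (fst X n) (fst X (n - 2))"
  using assms unfolding chain_complex_def Hom_iff by simp_all

lemma chain_complex_cmp [simp]:
  assumes "chain_complex C X"
  shows "snd X n \<cdot> snd X (n + 1) = zero_arr C (fst X (n + 1)) (fst X (n - 1))"
  using chain_complex_simps(5)[OF assms, of "n + 1"] by simp

lemma chain_map_simps:
  assumes "chain_map C X Y f"
  shows "chain_complex C X" "chain_complex C Y" "f n \<in> arr C" "src C (f n) = fst X n"
    "tgt C (f n) = fst Y n"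
  using assms unfolding chain_map_def Hom_iff by simp_all

lemma chain_map_comm:
  assumes "chain_map C X Y f"
  shows "snd Y n \<cdot> f n = f (n - 1) \<cdot> snd X n"
  using assms unfolding chain_map_def by blast

lemma chain_map_ident: "chain_complex C X \<Longrightarrow> chain_map C X X (\<lambda>n. ident C (fst X n))"
  by (simp add: chain_map_def)

lemma chain_map_zero:
  assumes "chain_complex C X" "chain_complex C Y"
  shows "chain_map C X Y (\<lambda>n. zero_arr C (fst X n) (fst Y n))"
  using assms by (simp add: chain_map_def)

lemma chain_map_cmp:
  assumes "chain_map C X Y f" "chain_map C Y Z g"
  shows "chain_map C X Z (\<lambda>n. g n \<cdot> f n)"
proof -
  note [simp] = chain_map_simps[OF assms(1)] chain_map_simps[OF assms(2)]
  show ?thesis unfolding chain_map_def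
proof (intro conjI allI)
  fix n
  have "snd Z n \<cdot> g n \<cdot> f n = g (n - 1) \<cdot> snd Y n \<cdot> f n"
    using cmp_eq_ext[OF chain_map_comm[OF assms(2)], of n "f n"] assms by simp
  then show "snd Z n \<cdot> g n \<cdot> f n = (g (n - 1) \<cdot> f (n - 1)) \<cdot> snd X n"
    using assms by (simp add: chain_map_comm)
qed simp_all
qed

lemma chain_homotopic_maps:
  assumes "chain_homotopic C X Y f g"
  shows "chain_map C X Y f" "chain_map C X Y g"
  using assms by (simp_all add: chain_homotopic_def)

lemma chain_homotopicE:
  assumes "chain_homotopic C X Y f g"
  obtains h where
    "\<And>n. h n \<in> arr C" "\<And>n. src C (h n) = fst X n" "\<And>n. tgt C (h n) = fst Y (n + 1)"
    "\<And>n. f n = g n \<boxplus> ((snd Y (n + 1) \<cdot> h n) \<boxplus> (h (n - 1) \<cdot> snd X n))"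
  using assms by (auto simp: chain_homotopic_def)

lemma chain_homotopic_refl:
  assumes "chain_map C X Y f" shows "chain_homotopic C X Y f f"
  unfolding chain_homotopic_def
  by (intro conjI exI[of _ "\<lambda>n. zero_arr C (fst X n) (fst Y (n + 1))"])
    (use assms chain_map_simps[OF assms] in simp_all)

lemma chain_homotopic_sym:
  assumes "chain_homotopic C X Y f g" shows "chain_homotopic C X Y g f"
proof -
  note [simp] = chain_homotopic_maps[OF assms, THEN chain_map_simps(1)]
    chain_homotopic_maps[OF assms, THEN chain_map_simps(2)]
    chain_map_simps(3-5)[OF chain_homotopic_maps(1)[OF assms]]
    chain_map_simps(3-5)[OF chain_homotopic_maps(2)[OF assms]]
  obtain h where h [simp]: "\<And>n. h n \<in> arr C" "\<And>n. src C (h n) = fst X n"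
      "\<And>n. tgt C (h n) = fst Y (n + 1)"
    and eq: "\<And>n. f n = g n \<boxplus> ((snd Y (n + 1) \<cdot> h n) \<boxplus> (h (n - 1) \<cdot> snd X n))"
    using chain_homotopicE[OF assms] by blast
  show ?thesis
    unfolding chain_homotopic_def
  proof (intro conjI exI[of _ "\<lambda>n. neg_arr C (h n)"] allI)
    fix n
    let ?k = "(snd Y (n + 1) \<cdot> h n) \<boxplus> (h (n - 1) \<cdot> snd X n)"
    have "f n \<boxplus> neg_arr C ?k = g n"
      unfolding eq by (subst add_arr_assoc) simp_all
    then show "g n = f n \<boxplus> (snd Y (n + 1) \<cdot> neg_arr C (h n) \<boxplus> neg_arr C (h (n - 1)) \<cdot> snd X n)"
      by (simp add: neg_add_arr)
  qed (use assms in \<open>simp_all add: chain_homotopic_maps\<close>)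
qed

lemma chain_homotopic_trans [trans]:
  assumes "chain_homotopic C X Y f g" "chain_homotopic C X Y g k" shows "chain_homotopic C X Y f k"
proof -
  note [simp] = chain_homotopic_maps[OF assms(1), THEN chain_map_simps(1)]
    chain_homotopic_maps[OF assms(1), THEN chain_map_simps(2)]
    chain_map_simps(3-5)[OF chain_homotopic_maps(1)[OF assms(1)]]
    chain_map_simps(3-5)[OF chain_homotopic_maps(2)[OF assms(1)]]
    chain_map_simps(3-5)[OF chain_homotopic_maps(2)[OF assms(2)]]
  obtain h where h [simp]: "\<And>n. h n \<in> arr C" "\<And>n. src C (h n) = fst X n"
      "\<And>n. tgt C (h n) = fst Y (n + 1)"
    and eq: "\<And>n. f n = g n \<boxplus> ((snd Y (n + 1) \<cdot> h n) \<boxplus> (h (n - 1) \<cdot> snd X n))"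
    using chain_homotopicE[OF assms(1)] by blast
  obtain h' where h' [simp]: "\<And>n. h' n \<in> arr C" "\<And>n. src C (h' n) = fst X n"
      "\<And>n. tgt C (h' n) = fst Y (n + 1)"
    and eq': "\<And>n. g n = k n \<boxplus> ((snd Y (n + 1) \<cdot> h' n) \<boxplus> (h' (n - 1) \<cdot> snd X n))"
    using chain_homotopicE[OF assms(2)] by blast
  show ?thesis
    unfolding chain_homotopic_def
  proof (intro conjI exI[of _ "\<lambda>n. h n \<boxplus> h' n"] allI)
    fix n
    show "f n = k n \<boxplus> (snd Y (n + 1) \<cdot> (h n \<boxplus> h' n) \<boxplus> (h (n - 1) \<boxplus> h' (n - 1)) \<cdot> snd X n)"
      unfolding eq eq' by (simp add: add_arr_ac)
  qed (use assms in \<open>simp_all add: chain_homotopic_maps\<close>)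
qed

lemma chain_homotopic_cmp_left:
  assumes "chain_homotopic C X Y f f'" "chain_map C Y Z g"
  shows "chain_homotopic C X Z (\<lambda>n. g n \<cdot> f n) (\<lambda>n. g n \<cdot> f' n)"
proof -
  note [simp] = chain_map_simps[OF assms(2)] chain_homotopic_maps[OF assms(1), THEN chain_map_simps(1)]
    chain_map_simps(3-5)[OF chain_homotopic_maps(1)[OF assms(1)]]
    chain_map_simps(3-5)[OF chain_homotopic_maps(2)[OF assms(1)]]
  obtain h where h [simp]: "\<And>n. h n \<in> arr C" "\<And>n. src C (h n) = fst X n"
      "\<And>n. tgt C (h n) = fst Y (n + 1)"
    and eq: "\<And>n. f n = f' n \<boxplus> ((snd Y (n + 1) \<cdot> h n) \<boxplus> (h (n - 1) \<cdot> snd X n))"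
    using chain_homotopicE[OF assms(1)] by blast
  show ?thesis
    unfolding chain_homotopic_def
  proof (intro conjI exI[of _ "\<lambda>n. g (n + 1) \<cdot> h n"] allI)
    fix n
    show "g n \<cdot> f n = g n \<cdot> f' n \<boxplus> (snd Z (n + 1) \<cdot> g (n + 1) \<cdot> h n \<boxplus> (g (n - 1 + 1) \<cdot> h (n - 1)) \<cdot> snd X n)"
      using cmp_eq_ext[OF chain_map_comm[OF assms(2)], of "n + 1" "h n"] by (simp add: eq)
  qed (use assms in \<open>simp_all add: chain_map_cmp[OF chain_homotopic_maps(1)] chain_map_cmp[OF chain_homotopic_maps(2)]\<close>)
qed

lemma chain_homotopic_cmp_right:
  assumes "chain_homotopic C Y Z g g'" "chain_map C X Y f"
  shows "chain_homotopic C X Z (\<lambda>n. g n \<cdot> f n) (\<lambda>n. g' n \<cdot> f n)"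
proof -
  note [simp] = chain_map_simps[OF assms(2)] chain_homotopic_maps[OF assms(1), THEN chain_map_simps(2)]
    chain_map_simps(3-5)[OF chain_homotopic_maps(1)[OF assms(1)]]
    chain_map_simps(3-5)[OF chain_homotopic_maps(2)[OF assms(1)]]
  obtain h where h [simp]: "\<And>n. h n \<in> arr C" "\<And>n. src C (h n) = fst Y n"
      "\<And>n. tgt C (h n) = fst Z (n + 1)"
    and eq: "\<And>n. g n = g' n \<boxplus> ((snd Z (n + 1) \<cdot> h n) \<boxplus> (h (n - 1) \<cdot> snd Y n))"
    using chain_homotopicE[OF assms(1)] by blast
  show ?thesis
    unfolding chain_homotopic_def
  proof (intro conjI exI[of _ "\<lambda>n. h n \<cdot> f n"] allI)
    fix n
    show "g n \<cdot> f n = g' n \<cdot> f n \<boxplus> (snd Z (n + 1) \<cdot> h n \<cdot> f n \<boxplus> (h (n - 1) \<cdot> f (n - 1)) \<cdot> snd X n)"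
      by (simp add: eq chain_map_comm[OF assms(2)])
  qed (use assms in \<open>simp_all add: chain_map_cmp[OF _ chain_homotopic_maps(1)] chain_map_cmp[OF _ chain_homotopic_maps(2)]\<close>)
qed

lemma chain_homotopic_cmp:
  assumes "chain_homotopic C X Y f f'" "chain_homotopic C Y Z g g'"
  shows "chain_homotopic C X Z (\<lambda>n. g n \<cdot> f n) (\<lambda>n. g' n \<cdot> f' n)"
  using chain_homotopic_trans chain_homotopic_cmp_left[OF assms(1) chain_homotopic_maps(1)[OF assms(2)]]
    chain_homotopic_cmp_right[OF assms(2) chain_homotopic_maps(2)[OF assms(1)]] by blast

section \<open>Homotopy classes and the homotopy category\<close>

lemma homotopy_class_eq:
  assumes "chain_homotopic C X Y f g"
  shows "homotopy_class C X Y f = homotopy_class C X Y g"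
  unfolding homotopy_class_def
  using chain_homotopic_trans[OF assms] chain_homotopic_trans[OF chain_homotopic_sym[OF assms]] by blast

lemma homotopy_class_self: "chain_map C X Y f \<Longrightarrow> f \<in> homotopy_class C X Y f"
  by (simp add: homotopy_class_def chain_homotopic_refl)

lemma homotopy_class_eq_iff:
  assumes "chain_map C X Y f"
  shows "homotopy_class C X Y f = homotopy_class C X Y g \<longleftrightarrow> chain_homotopic C X Y f g"
proof
  assume "homotopy_class C X Y f = homotopy_class C X Y g"
  then have "f \<in> homotopy_class C X Y g" using homotopy_class_self[OF assms] by simp
  then show "chain_homotopic C X Y f g" by (simp add: homotopy_class_def chain_homotopic_sym)
qed (rule homotopy_class_eq)

lemma ho_arrow_eq_iff:
  "chain_map C X Y f \<Longrightarrow> ho_arrow C X Y f = ho_arrow C X Y g \<longleftrightarrow> chain_homotopic C X Y f g"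
  by (simp add: ho_arrow_def homotopy_class_eq_iff)

lemma homotopy_category_simps [simp]:
  "X \<in> obj (homotopy_category C) \<longleftrightarrow> chain_complex C X"
  "src (homotopy_category C) (ho_arrow C X Y f) = X"
  "tgt (homotopy_category C) (ho_arrow C X Y f) = Y"
  "ident (homotopy_category C) X = ho_arrow C X X (\<lambda>n. ident C (fst X n))"
  by (simp_all add: homotopy_category_def ho_arrow_def)

lemma ho_arrow_in_arr [simp]: "chain_map C X Y f \<Longrightarrow> ho_arrow C X Y f \<in> arr (homotopy_category C)"
  by (auto simp: homotopy_category_def ho_arrow_def)

lemma homotopy_category_arrE:
  assumes "\<phi> \<in> arr (homotopy_category C)"
  obtains f where "\<phi> = ho_arrow C (src (homotopy_category C) \<phi>) (tgt (homotopy_category C) \<phi>) f"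
    "chain_map C (src (homotopy_category C) \<phi>) (tgt (homotopy_category C) \<phi>) f"
  using assms by (auto simp: homotopy_category_def ho_arrow_def)

lemma ho_arrow_cmp [simp]:
  assumes "chain_map C X Y f" "chain_map C Y Z g"
  shows "ho_arrow C Y Z g \<cdot>\<^bsub>homotopy_category C\<^esub> ho_arrow C X Y f = ho_arrow C X Z (\<lambda>n. g n \<cdot> f n)"
proof -
  have eq: "homotopy_class C X Z (\<lambda>n. g' n \<cdot> f' n) = homotopy_class C X Z (\<lambda>n. g n \<cdot> f n)"
    if "f' \<in> homotopy_class C X Y f" "g' \<in> homotopy_class C Y Z g" for f' g'
    using that by (intro homotopy_class_eq chain_homotopic_sym[OF chain_homotopic_cmp])
      (simp_all add: homotopy_class_def)
  have "(\<Union>f'\<in>homotopy_class C X Y f. homotopy_class C X Z (\<lambda>n. g' n \<cdot> f' n)) =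
      homotopy_class C X Z (\<lambda>n. g n \<cdot> f n)" if "g' \<in> homotopy_class C Y Z g" for g'
    by (rule UN_constant_eq[OF homotopy_class_self[OF assms(1)]]) (use eq that in blast)
  then have "(\<Union>g'\<in>homotopy_class C Y Z g. \<Union>f'\<in>homotopy_class C X Y f. homotopy_class C X Z (\<lambda>n. g' n \<cdot> f' n)) =
      homotopy_class C X Z (\<lambda>n. g n \<cdot> f n)"
    by (intro UN_constant_eq[OF homotopy_class_self[OF assms(2)]]) blast
  then show ?thesis by (simp add: homotopy_category_def ho_arrow_def)
qed

lemma homotopy_category_HomE:
  assumes "\<phi> \<in> Hom (homotopy_category C) X Y"
  obtains f where "\<phi> = ho_arrow C X Y f" "chain_map C X Y f"
  using assms homotopy_category_arrE by (metis Hom_iff)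

lemma category_homotopy_category: "category (homotopy_category C)"
proof
  fix f assume f: "f \<in> arr (homotopy_category C)"
  obtain g where "f = ho_arrow C (src (homotopy_category C) f) (tgt (homotopy_category C) f) g"
    "chain_map C (src (homotopy_category C) f) (tgt (homotopy_category C) f) g"
    using homotopy_category_arrE[OF f] .
  then show "src (homotopy_category C) f \<in> obj (homotopy_category C)"
    "tgt (homotopy_category C) f \<in> obj (homotopy_category C)"
    using chain_map_simps(1,2) by simp_all
next
  fix X assume "X \<in> obj (homotopy_category C)"
  then show "ident (homotopy_category C) X \<in> Hom (homotopy_category C) X X"
    by (simp add: chain_map_ident)
next
  fix f X Y g Z assume "f \<in> Hom (homotopy_category C) X Y" "g \<in> Hom (homotopy_category C) Y Z"
  then show "g \<cdot>\<^bsub>homotopy_category C\<^esub> f \<in> Hom (homotopy_category C) X Z"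
    by (elim homotopy_category_HomE) (simp add: chain_map_cmp)
next
  fix \<phi> X Y assume "\<phi> \<in> Hom (homotopy_category C) X Y"
  then obtain f where f: "\<phi> = ho_arrow C X Y f" "chain_map C X Y f" by (rule homotopy_category_HomE)
  show "\<phi> \<cdot>\<^bsub>homotopy_category C\<^esub> ident (homotopy_category C) X = \<phi>"
    using f chain_map_simps[OF f(2)] chain_map_ident[of X] by simp
  show "ident (homotopy_category C) Y \<cdot>\<^bsub>homotopy_category C\<^esub> \<phi> = \<phi>"
    using f chain_map_simps[OF f(2)] chain_map_ident[of Y] by simp
next
  fix f W X g Y h Z
  assume "f \<in> Hom (homotopy_category C) W X" "g \<in> Hom (homotopy_category C) X Y"
    "h \<in> Hom (homotopy_category C) Y Z"
  then show "(h \<cdot>\<^bsub>homotopy_category C\<^esub> g) \<cdot>\<^bsub>homotopy_category C\<^esub> f =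
      h \<cdot>\<^bsub>homotopy_category C\<^esub> g \<cdot>\<^bsub>homotopy_category C\<^esub> f"
    by (elim homotopy_category_HomE) (simp add: chain_map_cmp chain_map_simps)
qed

section \<open>Bounded below complexes of projectives\<close>

text \<open>The homotopy is built upwards from the degree below which \<open>X\<close> vanishes.
  Once it is known up to degree \<open>n - 1\<close>, the part of \<open>a n\<close> not yet
  accounted for is a cycle, and lifting provides the next component.\<close>

lemma lifting_null_homotopic:
  assumes a: "chain_map C X Z a" and bdd: "\<And>n. n < N \<Longrightarrow> zero_object C (fst X n)"
    and lift: "\<And>n. lifts_against C Z (fst X n)"
  shows "chain_homotopic C X Z a (\<lambda>n. zero_arr C (fst X n) (fst Z n))"
proof -
  note [simp] = chain_map_simps[OF a]
  \<comment> \<open>\<open>P m x\<close> is the homotopy identity in degree \<open>N + m - 1\<close>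
    after composition with the differential of \<open>X\<close>, which is what makes the next defect
    a cycle; \<open>Q m x y\<close> is the identity itself in degree \<open>N + m\<close>.\<close>
  define P where "P = (\<lambda>m x. x \<in> Hom C (fst X (N + int m - 1)) (fst Z (N + int m)) \<and>
    snd Z (N + int m) \<cdot> x \<cdot> snd X (N + int m) = a (N + int m - 1) \<cdot> snd X (N + int m))"
  define Q where "Q = (\<lambda>m x y. snd Z (N + int m + 1) \<cdot> y = a (N + int m) \<boxplus> neg_arr C (x \<cdot> snd X (N + int m)))"
  have "\<exists>H. \<forall>m. P m (H m) \<and> Q m (H m) (H (Suc m))"
  proof (rule dependent_nat_choice)
    have "a (N - 1) = zero_arr C (fst X (N - 1)) (fst Z (N - 1))"
      using zero_object_arr(1)[OF bdd[of "N - 1"], of "a (N - 1)"] by simp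
    then show "\<exists>x. P 0 x"
      unfolding P_def by (intro exI[of _ "zero_arr C (fst X (N - 1)) (fst Z N)"]) simp
  next
    fix x m assume P: "P m x"
    let ?n = "N + int m"
    have x [simp]: "x \<in> arr C" "src C x = fst X (?n - 1)" "tgt C x = fst Z ?n"
      and eq: "snd Z ?n \<cdot> x \<cdot> snd X ?n = a (?n - 1) \<cdot> snd X ?n"
      using P by (auto simp: P_def)
    let ?c = "a ?n \<boxplus> neg_arr C (x \<cdot> snd X ?n)"
    have "snd Z ?n \<cdot> ?c = zero_arr C (fst X ?n) (fst Z (?n - 1))"
      using eq by (simp add: chain_map_comm[OF a])
    moreover have "?c \<in> Hom C (fst X ?n) (fst Z ?n)" by simp
    ultimately obtain y where y: "y \<in> Hom C (fst X ?n) (fst Z (?n + 1))" "snd Z (?n + 1) \<cdot> y = ?c"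
      using lift[of ?n] unfolding lifts_against_def by blast
    have "x \<cdot> snd X ?n \<cdot> snd X (?n + 1) = zero_arr C (fst X (?n + 1)) (fst Z ?n)" by simp
    then have "snd Z (?n + 1) \<cdot> y \<cdot> snd X (?n + 1) = a ?n \<cdot> snd X (?n + 1)"
      using cmp_eq_ext[OF y(2), of "snd X (?n + 1)"] y(1) by simp
    then have "P (Suc m) y" using y(1) by (simp add: P_def add.commute add.left_commute)
    moreover have "Q m x y" using y(2) by (simp add: Q_def)
    ultimately show "\<exists>y. P (Suc m) y \<and> Q m x y" by blast
  qed
  then obtain H where H: "\<And>m. P m (H m)" "\<And>m. Q m (H m) (H (Suc m))" by blast
  \<comment> \<open>\<open>H m\<close> is the component in degree \<open>N + m - 1\<close>, hence
    the index \<open>n - N + 1\<close>. The recursion starts on the zero object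
    \<open>fst X (N - 1)\<close>, where \<open>H 0\<close> agrees with the default zero.\<close>
  define h where "h n = (if n < N then zero_arr C (fst X n) (fst Z (n + 1)) else H (nat (n - N + 1)))" for n
  have H0: "H 0 = zero_arr C (fst X (N - 1)) (fst Z N)"
    using H(1)[of 0] zero_object_arr(1)[OF bdd[of "N - 1"], of "H 0"] by (simp add: P_def)
  have hH: "h (N + int m - 1) = H m" for m
    using H0 by (cases m) (simp_all add: h_def nat_add_distrib)
  have h [simp]: "h n \<in> arr C" "src C (h n) = fst X n" "tgt C (h n) = fst Z (n + 1)" for n
  proof -
    have "h n \<in> arr C \<and> src C (h n) = fst X n \<and> tgt C (h n) = fst Z (n + 1)"
      using H(1)[of "nat (n - N + 1)"] by (cases "n < N") (simp_all add: h_def P_def)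
    then show "h n \<in> arr C" "src C (h n) = fst X n" "tgt C (h n) = fst Z (n + 1)" by auto
  qed
  have "a n = zero_arr C (fst X n) (fst Z n) \<boxplus> (snd Z (n + 1) \<cdot> h n \<boxplus> h (n - 1) \<cdot> snd X n)" for n
  proof (cases "n < N")
    case True
    have "f = g" if "f \<in> Hom C (fst X n) (fst Z n)" "g \<in> Hom C (fst X n) (fst Z n)" for f g
      using that zero_object_arr(1)[OF bdd[OF True], of f] zero_object_arr(1)[OF bdd[OF True], of g] by simp
    then show ?thesis by simp
  next
    case False
    then obtain m where n: "n = N + int m" using zle_iff_zadd[of N n] by auto
    have "snd Z (n + 1) \<cdot> h n = a n \<boxplus> neg_arr C (h (n - 1) \<cdot> snd X n)"
      using H(2)[of m] hH[of m] hH[of "Suc m"] unfolding Q_def n by (simp add: algebra_simps)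
    then show ?thesis by (simp add: add_arr_ac)
  qed
  then show ?thesis
    using a unfolding chain_homotopic_def by (intro conjI exI[of _ h] chain_map_zero allI) auto
qed

text \<open>The columns and rows of the cone differential as a two-by-two matrix, so that the
  three-term sum need not be expanded again.\<close>

lemma cone_diff:
  assumes "biproduct C X Y S i j p q" "biproduct C X' Y' S' i' j' p' q'"
    and "dX \<in> Hom C X X'" "dY \<in> Hom C Y Y'" "w \<in> Hom C X Y'"
    and "d = (i' \<cdot> neg_arr C dX \<cdot> p) \<boxplus> (j' \<cdot> w \<cdot> p) \<boxplus> (j' \<cdot> dY \<cdot> q)"
  shows "d \<cdot> i = (i' \<cdot> neg_arr C dX) \<boxplus> (j' \<cdot> w)" "d \<cdot> j = j' \<cdot> dY"
    "p' \<cdot> d = neg_arr C dX \<cdot> p" "q' \<cdot> d = (w \<cdot> p) \<boxplus> (dY \<cdot> q)"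
proof -
  have t [simp]: "X \<in> obj C" "Y \<in> obj C" "X' \<in> obj C" "Y' \<in> obj C" "S \<in> obj C" "S' \<in> obj C"
    using assms tgt_in_obj[of i] tgt_in_obj[of i'] src_in_obj[of dX] src_in_obj[of dY] tgt_in_obj[of dX] tgt_in_obj[of dY]
    by (auto simp: biproduct_def)
  have b [simp]: "p \<cdot> i = ident C X" "q \<cdot> j = ident C Y" "p \<cdot> j = zero_arr C Y X" "q \<cdot> i = zero_arr C X Y"
    "p' \<cdot> i' = ident C X'" "q' \<cdot> j' = ident C Y'" "p' \<cdot> j' = zero_arr C Y' X'" "q' \<cdot> i' = zero_arr C X' Y'"
    "i \<in> arr C" "j \<in> arr C" "p \<in> arr C" "q \<in> arr C" "i' \<in> arr C" "j' \<in> arr C" "p' \<in> arr C" "q' \<in> arr C"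
    "src C i = X" "src C j = Y" "src C p = S" "src C q = S" "tgt C i = S" "tgt C j = S" "tgt C p = X" "tgt C q = Y"
    "src C i' = X'" "src C j' = Y'" "src C p' = S'" "src C q' = S'" "tgt C i' = S'" "tgt C j' = S'"
    "tgt C p' = X'" "tgt C q' = Y'"
    using assms by (auto simp: biproduct_def)
  have d [simp]: "dX \<in> arr C" "src C dX = X" "tgt C dX = X'" "dY \<in> arr C" "src C dY = Y" "tgt C dY = Y'"
    "w \<in> arr C" "src C w = X" "tgt C w = Y'"
    using assms by auto
  note [simp] = cmp_eq_ext[OF b(5)] cmp_eq_ext[OF b(6)] cmp_eq_ext[OF b(7)] cmp_eq_ext[OF b(8)]
  show "d \<cdot> i = (i' \<cdot> neg_arr C dX) \<boxplus> (j' \<cdot> w)" "d \<cdot> j = j' \<cdot> dY"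
    "p' \<cdot> d = neg_arr C dX \<cdot> p" "q' \<cdot> d = (w \<cdot> p) \<boxplus> (dY \<cdot> q)"
    unfolding assms(6) by simp_all
qed

lemma chain_homotopic_ident_comp:
  assumes "chain_map C X Y f" "chain_map C X Y g" and "\<And>n. h n \<in> Hom C (fst X n) (fst Y (n + 1))"
    and "\<And>n. f n = g n \<boxplus> ((snd Y (n + 1) \<cdot> h n) \<boxplus> (h (n - 1) \<cdot> snd X n))"
  shows "chain_homotopic C X Y f g"
  using assms unfolding chain_homotopic_def by blast

text \<open>Maps into the cone are null-homotopic by \<open>lifting_null_homotopic\<close>, and a
  null-homotopy is a pair. For \<open>j \<cdot> g\<close> the pair is a lift of \<open>g\<close> and
  a homotopy correcting it; for the map built from the difference of \<open>g\<close> and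
  \<open>g'\<close> its first component is the homotopy sought.\<close>

lemma cone_lifting:
  assumes w: "chain_map C Y Y' w" and Z: "mapping_cone C Y Y' w Z"
    and X: "chain_complex C X" and bdd: "\<And>n. n < N \<Longrightarrow> zero_object C (fst X n)"
    and lift: "\<And>n. lifts_against C Z (fst X n)"
  shows "chain_map C X Y' g \<Longrightarrow> \<exists>g'. chain_map C X Y g' \<and> chain_homotopic C X Y' (\<lambda>n. w n \<cdot> g' n) g"
    and "chain_map C X Y g \<Longrightarrow> chain_map C X Y g' \<Longrightarrow>
      chain_homotopic C X Y' (\<lambda>n. w n \<cdot> g n) (\<lambda>n. w n \<cdot> g' n) \<Longrightarrow> chain_homotopic C X Y g g'"
proof -
  note w' [simp] = chain_map_simps[OF w] and X' [simp] = chain_complex_simps(1-4)[OF X]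
  have cZ: "chain_complex C Z" using Z by (simp add: mapping_cone_def)
  note [simp] = chain_complex_simps(1-4)[OF cZ]
  obtain i j p q where b: "\<And>n. biproduct C (fst Y (n - 1)) (fst Y' n) (fst Z n) (i n) (j n) (p n) (q n)"
    and D: "\<And>n. snd Z n = (i (n - 1) \<cdot> neg_arr C (snd Y (n - 1)) \<cdot> p n) \<boxplus> (j (n - 1) \<cdot> w (n - 1) \<cdot> p n) \<boxplus>
       (j (n - 1) \<cdot> snd Y' n \<cdot> q n)"
    using Z unfolding mapping_cone_def by metis
  have b' [simp]: "i n \<in> arr C" "src C (i n) = fst Y (n - 1)" "tgt C (i n) = fst Z n"
    "j n \<in> arr C" "src C (j n) = fst Y' n" "tgt C (j n) = fst Z n"
    "p n \<in> arr C" "src C (p n) = fst Z n" "tgt C (p n) = fst Y (n - 1)"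
    "q n \<in> arr C" "src C (q n) = fst Z n" "tgt C (q n) = fst Y' n" for n
    using b[of n] by (auto simp: biproduct_def)
  have pi: "p n \<cdot> i n = ident C (fst Y (n - 1))" "q n \<cdot> j n = ident C (fst Y' n)"
    "p n \<cdot> j n = zero_arr C (fst Y' n) (fst Y (n - 1))" "q n \<cdot> i n = zero_arr C (fst Y (n - 1)) (fst Y' n)" for n
    using b[of n] by (auto simp: biproduct_def)
  note [simp] = pi cmp_eq_ext[OF pi(1)] cmp_eq_ext[OF pi(2)] cmp_eq_ext[OF pi(3)] cmp_eq_ext[OF pi(4)]
  have D': "snd Z n \<cdot> i n = (i (n - 1) \<cdot> neg_arr C (snd Y (n - 1))) \<boxplus> (j (n - 1) \<cdot> w (n - 1))"
    "snd Z n \<cdot> j n = j (n - 1) \<cdot> snd Y' n"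
    "p (n - 1) \<cdot> snd Z n = neg_arr C (snd Y (n - 1)) \<cdot> p n"
    "q (n - 1) \<cdot> snd Z n = (w (n - 1) \<cdot> p n) \<boxplus> (snd Y' n \<cdot> q n)" for n
    by (rule cone_diff[OF b[of n] b[of "n - 1"] _ _ _ D[of n]]; simp add: chain_complex_simps(1-4)[OF w'(1)])+
  show "\<exists>g'. chain_map C X Y g' \<and> chain_homotopic C X Y' (\<lambda>n. w n \<cdot> g' n) g" if g: "chain_map C X Y' g"
  proof -
    note [simp] = chain_map_simps(3-5)[OF g]
    have "chain_map C X Z (\<lambda>n. j n \<cdot> g n)"
      unfolding chain_map_def
    proof (intro conjI allI)
      fix n
      show "snd Z n \<cdot> j n \<cdot> g n = (j (n - 1) \<cdot> g (n - 1)) \<cdot> snd X n"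
        using cmp_eq_ext[OF D'(2)[of n], of "g n"] by (simp add: chain_map_comm[OF g])
    qed (use cZ X in simp_all)
    then have "chain_homotopic C X Z (\<lambda>n. j n \<cdot> g n) (\<lambda>n. zero_arr C (fst X n) (fst Z n))"
      by (rule lifting_null_homotopic[OF _ bdd lift])
    then obtain h where
      h [simp]: "\<And>n. h n \<in> arr C" "\<And>n. src C (h n) = fst X n" "\<And>n. tgt C (h n) = fst Z (n + 1)" and
      hj: "\<And>n. j n \<cdot> g n = zero_arr C (fst X n) (fst Z n) \<boxplus> (snd Z (n + 1) \<cdot> h n \<boxplus> h (n - 1) \<cdot> snd X n)"
      by (elim chain_homotopicE) auto
    have hj': "j n \<cdot> g n = snd Z (n + 1) \<cdot> h n \<boxplus> h (n - 1) \<cdot> snd X n" for n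
      using hj[of n] by simp
    \<comment> \<open>\<open>u\<close> is the lift of \<open>g\<close> along \<open>w\<close>, and
      \<open>v\<close> compares \<open>w \<cdot> u\<close> with \<open>g\<close>: applying
      \<open>p\<close> to the null-homotopy shows that \<open>u\<close> commutes with the
      differentials, applying \<open>q\<close> gives the comparison.\<close>
    define u v where "u n = p (n + 1) \<cdot> h n" and "v n = q (n + 1) \<cdot> h n" for n
    have uv [simp]: "u n \<in> arr C" "src C (u n) = fst X n" "tgt C (u n) = fst Y n"
      "v n \<in> arr C" "src C (v n) = fst X n" "tgt C (v n) = fst Y' (n + 1)" for n
      by (simp_all add: u_def v_def)
    have "p n \<cdot> j n \<cdot> g n = neg_arr C (snd Y n \<cdot> u n) \<boxplus> u (n - 1) \<cdot> snd X n" for n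
      unfolding hj' u_def using cmp_eq_ext[OF D'(3)[of "n + 1"], of "h n"] by simp
    then have "neg_arr C (snd Y n \<cdot> u n) \<boxplus> u (n - 1) \<cdot> snd X n = zero_arr C (fst X n) (fst Y (n - 1))" for n
      by simp
    then have uc: "snd Y n \<cdot> u n = u (n - 1) \<cdot> snd X n" for n
      using neg_arr_unique[of "neg_arr C (snd Y n \<cdot> u n)" "u (n - 1) \<cdot> snd X n"] by simp
    then have u: "chain_map C X Y u" using X by (simp add: chain_map_def)
    have eq: "g n = w n \<cdot> u n \<boxplus> (snd Y' (n + 1) \<cdot> v n \<boxplus> v (n - 1) \<cdot> snd X n)" for n
    proof -
      have "g n = q n \<cdot> j n \<cdot> g n" by simp
      also have "\<dots> = (w n \<cdot> u n \<boxplus> snd Y' (n + 1) \<cdot> v n) \<boxplus> v (n - 1) \<cdot> snd X n"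
        unfolding hj' u_def v_def using cmp_eq_ext[OF D'(4)[of "n + 1"], of "h n"] by simp
      finally show ?thesis by (simp add: add_arr_assoc)
    qed
    have "chain_homotopic C X Y' g (\<lambda>n. w n \<cdot> u n)"
      by (rule chain_homotopic_ident_comp[where h = v]) (use g u w eq in \<open>auto intro: chain_map_cmp\<close>)
    then show ?thesis using u chain_homotopic_sym by blast
  qed
  show "chain_homotopic C X Y g g'" if g: "chain_map C X Y g" "chain_map C X Y g'"
    and hom: "chain_homotopic C X Y' (\<lambda>n. w n \<cdot> g n) (\<lambda>n. w n \<cdot> g' n)"
  proof -
    note [simp] = chain_map_simps(3-5)[OF g(1)] chain_map_simps(3-5)[OF g(2)]
    obtain k where k [simp]: "\<And>n. k n \<in> arr C" "\<And>n. src C (k n) = fst X n" "\<And>n. tgt C (k n) = fst Y' (n + 1)"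
      and wk: "\<And>n. w n \<cdot> g n = w n \<cdot> g' n \<boxplus> (snd Y' (n + 1) \<cdot> k n \<boxplus> k (n - 1) \<cdot> snd X n)"
      using chain_homotopicE[OF hom] by blast
    define e where "e n = g n \<boxplus> neg_arr C (g' n)" for n
    have e [simp]: "e n \<in> arr C" "src C (e n) = fst X n" "tgt C (e n) = fst Y n" for n
      by (simp_all add: e_def)
    have ec: "snd Y n \<cdot> e n = e (n - 1) \<cdot> snd X n" for n
      by (simp add: e_def chain_map_comm[OF g(1)] chain_map_comm[OF g(2)])
    have we: "w n \<cdot> e n = snd Y' (n + 1) \<cdot> k n \<boxplus> k (n - 1) \<cdot> snd X n" for n
      by (simp add: e_def wk add_arr_ac)
    \<comment> \<open>The cone shifted by one, with the customary sign on the differential, so that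
      a degree-preserving map into it has components in \<open>fst Z (n + 1)\<close>.\<close>
    define Z' where "Z' = ((\<lambda>n. fst Z (n + 1)), (\<lambda>n. neg_arr C (snd Z (n + 1))))"
    have Z' [simp]: "fst Z' n = fst Z (n + 1)" "snd Z' n = neg_arr C (snd Z (n + 1))" for n
      by (simp_all add: Z'_def)
    have cZ': "chain_complex C Z'"
      unfolding chain_complex_def
    proof (intro allI conjI)
      fix n
      show "snd Z' (n - 1) \<cdot> snd Z' n = zero_arr C (fst Z' n) (fst Z' (n - 2))"
        using chain_complex_simps(5)[OF cZ, of "n + 1"] by (simp add: algebra_simps)
    qed simp_all
    \<comment> \<open>The difference \<open>e\<close> and the homotopy \<open>k\<close> form one
      chain map into the shifted cone; the minus sign on \<open>k\<close> cancels the part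
      \<open>snd Y' (n + 1) \<cdot> k n\<close> of \<open>w n \<cdot> e n\<close>.\<close>
    define a where "a n = i (n + 1) \<cdot> e n \<boxplus> neg_arr C (j (n + 1) \<cdot> k n)" for n
    have a [simp]: "a n \<in> arr C" "src C (a n) = fst X n" "tgt C (a n) = fst Z (n + 1)" for n
      by (simp_all add: a_def)
    have "snd Z (n + 1) \<cdot> a n = neg_arr C (a (n - 1) \<cdot> snd X n)" for n
    proof -
      have "snd Z (n + 1) \<cdot> a n =
          (i n \<cdot> neg_arr C (snd Y n)) \<cdot> e n \<boxplus> (j n \<cdot> w n) \<cdot> e n \<boxplus> neg_arr C (j n \<cdot> snd Y' (n + 1) \<cdot> k n)"
        using cmp_eq_ext[OF D'(1)[of "n + 1"], of "e n"] cmp_eq_ext[OF D'(2)[of "n + 1"], of "k n"]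
        by (simp add: a_def)
      also have "\<dots> = neg_arr C (i n \<cdot> e (n - 1) \<cdot> snd X n) \<boxplus> j n \<cdot> k (n - 1) \<cdot> snd X n"
        by (simp add: ec we add_neg_cancel_middle)
      finally show ?thesis by (simp add: a_def neg_add_arr)
    qed
    then have ca: "chain_map C X Z' a" using X cZ' by (simp add: chain_map_def)
    have lift': "lifts_against C Z' (fst X n)" for n
      unfolding lifts_against_def
    proof (intro allI impI)
      fix m c assume c: "c \<in> Hom C (fst X n) (fst Z' m)" "snd Z' m \<cdot> c = zero_arr C (fst X n) (fst Z' (m - 1))"
      have "neg_arr C (neg_arr C (snd Z (m + 1) \<cdot> c)) = neg_arr C (zero_arr C (fst X n) (fst Z m))"
        using c by simp
      then have "snd Z (m + 1) \<cdot> c = zero_arr C (fst X n) (fst Z (m + 1 - 1))"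
        using c(1) by simp
      then obtain b where "b \<in> Hom C (fst X n) (fst Z (m + 1 + 1))" "snd Z (m + 1 + 1) \<cdot> b = c"
        using lift[of n] c(1) unfolding lifts_against_def by (metis Z'(1))
      then show "\<exists>b\<in>Hom C (fst X n) (fst Z' (m + 1)). snd Z' (m + 1) \<cdot> b = c"
        by (intro bexI[of _ "neg_arr C b"]) auto
    qed
    have "chain_homotopic C X Z' a (\<lambda>n. zero_arr C (fst X n) (fst Z' n))"
      by (rule lifting_null_homotopic[OF ca bdd lift'])
    then obtain h where
      h: "\<And>n. h n \<in> arr C" "\<And>n. src C (h n) = fst X n" "\<And>n. tgt C (h n) = fst Z (n + 1 + 1)" and
      ha: "\<And>n. a n = zero_arr C (fst X n) (fst Z (n + 1)) \<boxplus>
        (neg_arr C (snd Z (n + 1 + 1)) \<cdot> h n \<boxplus> h (n - 1) \<cdot> snd X n)"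
      by (elim chain_homotopicE) auto
    have e2: "n + 1 + 1 = n + 2" "n + 2 - 1 = n + 1" for n :: int by simp_all
    note h' [simp] = h[unfolded e2]
    \<comment> \<open>The \<open>Y\<close>-component of the null-homotopy is a homotopy between
      \<open>g\<close> and \<open>g'\<close>.\<close>
    define u where "u n = p (n + 2) \<cdot> h n" for n
    have u [simp]: "u n \<in> arr C" "src C (u n) = fst X n" "tgt C (u n) = fst Y (n + 1)" for n
      by (simp_all add: u_def add.commute)
    have u': "u (n - 1) = p (n + 1) \<cdot> h (n - 1)" for n
      by (simp add: u_def add.commute)
    have "e n = snd Y (n + 1) \<cdot> u n \<boxplus> u (n - 1) \<cdot> snd X n" for n
    proof -
      have 1: "h (n - 1) \<in> arr C" "tgt C (h (n - 1)) = fst Z (n + 1)"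
          "tgt C (snd Z (n + 2)) = fst Z (n + 1)" "tgt C (p (n + 2)) = fst Y (n + 1)"
        using h'[of "n - 1"] by (simp_all add: add.commute)
      have "e n = p (n + 1) \<cdot> a n" by (simp add: a_def)
      also have "a n = neg_arr C (snd Z (n + 2) \<cdot> h n) \<boxplus> h (n - 1) \<cdot> snd X n"
        unfolding ha e2 using 1 by simp
      also have "p (n + 1) \<cdot> \<dots> = neg_arr C (p (n + 1) \<cdot> snd Z (n + 2) \<cdot> h n) \<boxplus> u (n - 1) \<cdot> snd X n"
        using 1 by (simp add: u')
      also have "p (n + 1) \<cdot> snd Z (n + 2) \<cdot> h n = neg_arr C (snd Y (n + 1) \<cdot> u n)"
        using cmp_eq_ext[OF D'(3)[of "n + 2", unfolded e2], of "h n"] 1 by (simp add: u_def)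
      finally show ?thesis by simp
    qed
    then have "g n = g' n \<boxplus> (snd Y (n + 1) \<cdot> u n \<boxplus> u (n - 1) \<cdot> snd X n)" for n
      unfolding e_def using add_arr_left_comm[of "g' n" "g n" "neg_arr C (g' n)"] by (metis (no_types) add_zero_arr(1) chain_map_simps(3-5)[OF g(1)] chain_map_simps(3-5)[OF g(2)] neg_arr_simps)
    then show ?thesis using g by (intro chain_homotopic_ident_comp[where h = u]) auto
  qed
qed

end

section \<open>Symmetric monoidal coherence\<close>

locale additive_closed_monoidal = additive_category C + closed_symmetric_monoidal_category C
  for C :: "('o, 'm) moncat" (structure)
begin

abbreviation whisker_left :: "'o \<Rightarrow> 'm \<Rightarrow> 'm" (infixr "\<lhd>" 80) where
  "X \<lhd> g \<equiv> ident C X \<boxdot> g"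

abbreviation whisker_right :: "'m \<Rightarrow> 'o \<Rightarrow> 'm" (infixl "\<rhd>" 80) where
  "g \<rhd> X \<equiv> g \<boxdot> ident C X"

abbreviation \<alpha> where "\<alpha> \<equiv> assoc C"
abbreviation \<beta> where "\<beta> X Y Z \<equiv> inv_arrow C (\<alpha> X Y Z)"
abbreviation lu where "lu \<equiv> lunit C"
abbreviation lu' where "lu' X \<equiv> inv_arrow C (lu X)"
abbreviation ru where "ru \<equiv> runit C"
abbreviation ru' where "ru' X \<equiv> inv_arrow C (ru X)"
abbreviation sw where "sw \<equiv> swap C"
abbreviation U where "U \<equiv> tunit C"

lemmas [simp] = tens_obj tunit_obj tens_ident

lemma tens_arr_simps [simp]:
  assumes "f \<in> arr C" "g \<in> arr C"
  shows "f \<boxdot> g \<in> arr C" "src C (f \<boxdot> g) = src C f \<boxtimes> src C g" "tgt C (f \<boxdot> g) = tgt C f \<boxtimes> tgt C g"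
  using tens_arr_in_Hom[of f "src C f" "tgt C f" g "src C g" "tgt C g"] assms by simp_all

lemma tens_cmp':
  assumes "f \<in> arr C" "f' \<in> arr C" "g \<in> arr C" "g' \<in> arr C" "src C f' = tgt C f" "src C g' = tgt C g"
  shows "(f' \<boxdot> g') \<cdot> (f \<boxdot> g) = (f' \<cdot> f) \<boxdot> (g' \<cdot> g)"
  using tens_cmp[of f "src C f" "tgt C f" f' "tgt C f'" g "src C g" "tgt C g" g' "tgt C g'"] assms by simp

lemma whisker_left_cmp [simp]:
  "f \<in> arr C \<Longrightarrow> g \<in> arr C \<Longrightarrow> src C g = tgt C f \<Longrightarrow> X \<in> obj C \<Longrightarrow> X \<lhd> (g \<cdot> f) = X \<lhd> g \<cdot> X \<lhd> f"
  by (simp add: tens_cmp')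

lemma whisker_right_cmp [simp]:
  "f \<in> arr C \<Longrightarrow> g \<in> arr C \<Longrightarrow> src C g = tgt C f \<Longrightarrow> X \<in> obj C \<Longrightarrow> (g \<cdot> f) \<rhd> X = g \<rhd> X \<cdot> f \<rhd> X"
  by (simp add: tens_cmp')

lemma tens_left_right:
  assumes "f \<in> arr C" "g \<in> arr C" "src C f = X" "tgt C g = Y'"
  shows "f \<rhd> Y' \<cdot> X \<lhd> g = f \<boxdot> g"
  using assms by (auto simp: tens_cmp')

lemma tens_right_left:
  assumes "f \<in> arr C" "g \<in> arr C" "tgt C f = X'" "src C g = Y"
  shows "X' \<lhd> g \<cdot> f \<rhd> Y = f \<boxdot> g"
  using assms by (auto simp: tens_cmp')

lemma whisker_exchange:
  assumes "f \<in> arr C" "g \<in> arr C" "src C f = X" "tgt C g = Y'"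
  shows "f \<rhd> Y' \<cdot> X \<lhd> g = tgt C f \<lhd> g \<cdot> f \<rhd> src C g"
  using assms tens_left_right[of f g X Y'] tens_right_left[of f g] by simp

lemma struct_simps [simp]:
  assumes "X \<in> obj C"
  shows "lu X \<in> arr C" "src C (lu X) = U \<boxtimes> X" "tgt C (lu X) = X"
    "ru X \<in> arr C" "src C (ru X) = X \<boxtimes> U" "tgt C (ru X) = X"
    "Y \<in> obj C \<Longrightarrow> sw X Y \<in> arr C" "Y \<in> obj C \<Longrightarrow> src C (sw X Y) = X \<boxtimes> Y"
    "Y \<in> obj C \<Longrightarrow> tgt C (sw X Y) = Y \<boxtimes> X"
    "Y \<in> obj C \<Longrightarrow> Z \<in> obj C \<Longrightarrow> \<alpha> X Y Z \<in> arr C"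
    "Y \<in> obj C \<Longrightarrow> Z \<in> obj C \<Longrightarrow> src C (\<alpha> X Y Z) = (X \<boxtimes> Y) \<boxtimes> Z"
    "Y \<in> obj C \<Longrightarrow> Z \<in> obj C \<Longrightarrow> tgt C (\<alpha> X Y Z) = X \<boxtimes> (Y \<boxtimes> Z)"
  using assoc_in_Hom[OF assms] lunit_in_Hom[OF assms] runit_in_Hom[OF assms]
    swap_in_Hom[OF assms] by simp_all

lemma inv_arrow_simps:
  assumes "iso_arrow C f"
  shows "inv_arrow C f \<in> arr C" "src C (inv_arrow C f) = tgt C f" "tgt C (inv_arrow C f) = src C f"
    "inv_arrow C f \<cdot> f = ident C (src C f)" "f \<cdot> inv_arrow C f = ident C (tgt C f)"
  using inverse_arrows_inv_arrow[OF assms] by (simp_all add: inverse_arrows_def)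

lemma assoc_inv_simps [simp]:
  assumes "X \<in> obj C" "Y \<in> obj C" "Z \<in> obj C"
  shows "\<beta> X Y Z \<in> arr C" "src C (\<beta> X Y Z) = X \<boxtimes> (Y \<boxtimes> Z)" "tgt C (\<beta> X Y Z) = (X \<boxtimes> Y) \<boxtimes> Z"
    "\<alpha> X Y Z \<cdot> \<beta> X Y Z = ident C (X \<boxtimes> Y \<boxtimes> Z)" "\<beta> X Y Z \<cdot> \<alpha> X Y Z = ident C ((X \<boxtimes> Y) \<boxtimes> Z)"
  using assms inv_arrow_simps[OF assoc_iso[OF assms]] by simp_all

lemma unit_inv_simps [simp]:
  assumes "X \<in> obj C"
  shows "lu' X \<in> arr C" "src C (lu' X) = X" "tgt C (lu' X) = U \<boxtimes> X"
    "ru' X \<in> arr C" "src C (ru' X) = X" "tgt C (ru' X) = X \<boxtimes> U"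
    "lu X \<cdot> lu' X = ident C X" "lu' X \<cdot> lu X = ident C (U \<boxtimes> X)"
    "ru X \<cdot> ru' X = ident C X" "ru' X \<cdot> ru X = ident C (X \<boxtimes> U)"
  using assms inv_arrow_simps[OF lunit_iso[OF assms]] inv_arrow_simps[OF runit_iso[OF assms]] by simp_all

declare swap_swap [simp]

lemmas struct_cancel = assoc_inv_simps(4,5) unit_inv_simps(7-10) swap_swap

lemmas struct_inv_cancel [simp] =
  cmp_eq_ext[OF struct_cancel(1)] cmp_eq_ext[OF struct_cancel(2)] cmp_eq_ext[OF struct_cancel(3)]
  cmp_eq_ext[OF struct_cancel(4)] cmp_eq_ext[OF struct_cancel(5)] cmp_eq_ext[OF struct_cancel(6)]
  cmp_eq_ext[OF struct_cancel(7)]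

text \<open>Closedness makes \<open>N \<boxtimes> Y\<close> a zero object when \<open>N\<close> is
  one: its identity and its zero endomorphism have adjuncts out of \<open>N\<close>, which coincide.
  Zero arrows factor through \<open>N\<close>.\<close>

lemma whisker_right_zero [simp]:
  assumes "X \<in> obj C" "X' \<in> obj C" "Y \<in> obj C"
  shows "zero_arr C X X' \<rhd> Y = zero_arr C (X \<boxtimes> Y) (X' \<boxtimes> Y)"
proof -
  obtain N where N: "zero_object C N" using ex_zero_object by blast
  then have N' [simp]: "N \<in> obj C" by (simp add: zero_object_def)
  let ?Z = "N \<boxtimes> Y"
  obtain H ev where H [simp]: "H \<in> obj C" and ev: "\<forall>X\<in>obj C. \<forall>g\<in>Hom C (X \<boxtimes> Y) ?Z.
      \<exists>!h. h \<in> Hom C X H \<and> ev \<cdot> h \<rhd> Y = g"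
    using closed[of Y ?Z] assms by auto
  obtain h1 where h1: "h1 \<in> Hom C N H" "ev \<cdot> h1 \<rhd> Y = ident C ?Z"
    using bspec[OF bspec[OF ev, of N], of "ident C ?Z"] assms by auto
  obtain h2 where h2: "h2 \<in> Hom C N H" "ev \<cdot> h2 \<rhd> Y = zero_arr C ?Z ?Z"
    using bspec[OF bspec[OF ev, of N], of "zero_arr C ?Z ?Z"] assms by auto
  have "h1 = h2" using zero_object_arr(1)[OF N, of h1] zero_object_arr(1)[OF N, of h2] h1 h2 by simp
  then have "zero_object C ?Z" using h1 h2 zero_object_iff_ident_zero[of ?Z] assms by simp
  moreover have "zero_arr C X X' = zero_arr C N X' \<cdot> zero_arr C X N" using assms by simp
  then have "zero_arr C X X' \<rhd> Y = zero_arr C N X' \<rhd> Y \<cdot> zero_arr C X N \<rhd> Y"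
    using assms whisker_right_cmp[of "zero_arr C X N" "zero_arr C N X'" Y] by simp
  ultimately show ?thesis
    using zero_object_arr(1)[of ?Z "zero_arr C N X' \<rhd> Y"] assms by simp
qed

text \<open>Additivity comes from closedness: two arrows out of \<open>S \<boxtimes> Y\<close>, with \<open>S = X \<oplus> X\<close>, agree as
  soon as their restrictions to both copies of \<open>X \<boxtimes> Y\<close> do, since this holds for their adjuncts.\<close>

lemma whisker_right_biproduct:
  assumes "biproduct C X X' S i j p q" "X \<in> obj C" "X' \<in> obj C" "Y \<in> obj C"
  shows "(i \<rhd> Y \<cdot> p \<rhd> Y) \<boxplus> (j \<rhd> Y \<cdot> q \<rhd> Y) = ident C (S \<boxtimes> Y)"
proof -
  have b [simp]: "i \<in> arr C" "j \<in> arr C" "p \<in> arr C" "q \<in> arr C" "src C i = X" "src C j = X'"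
    "src C p = S" "src C q = S" "tgt C i = S" "tgt C j = S" "tgt C p = X" "tgt C q = X'"
    "p \<cdot> i = ident C X" "q \<cdot> j = ident C X'" "p \<cdot> j = zero_arr C X' X" "q \<cdot> i = zero_arr C X X'"
    and sum: "(i \<cdot> p) \<boxplus> (j \<cdot> q) = ident C S"
    using assms by (auto simp: biproduct_def)
  have S [simp]: "S \<in> obj C" using tgt_in_obj[OF b(1)] by simp
  note [simp] = assms(2-4)
  let ?Z = "S \<boxtimes> Y" and ?k = "(i \<rhd> Y \<cdot> p \<rhd> Y) \<boxplus> (j \<rhd> Y \<cdot> q \<rhd> Y)"
  obtain H ev where H [simp]: "H \<in> obj C" and ev_in [simp]: "ev \<in> arr C" "src C ev = H \<boxtimes> Y" "tgt C ev = ?Z"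
    and ev: "\<And>X g. X \<in> obj C \<Longrightarrow> g \<in> Hom C (X \<boxtimes> Y) ?Z \<Longrightarrow> \<exists>!h. h \<in> Hom C X H \<and> ev \<cdot> h \<rhd> Y = g"
    using closed[of Y ?Z] by auto
  have kk: "?k \<in> Hom C (S \<boxtimes> Y) ?Z" "ident C ?Z \<in> Hom C (S \<boxtimes> Y) ?Z" by simp_all
  obtain h1 where h1: "h1 \<in> arr C" "src C h1 = S" "tgt C h1 = H" "ev \<cdot> h1 \<rhd> Y = ?k"
    using ev[OF S kk(1)] by auto
  obtain h2 where h2: "h2 \<in> arr C" "src C h2 = S" "tgt C h2 = H" "ev \<cdot> h2 \<rhd> Y = ident C ?Z"
    using ev[OF S kk(2)] by auto
  \<comment> \<open>When \<open>?k\<close> fixes \<open>x \<rhd> Y\<close>, both composites are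
    adjuncts of \<open>x \<rhd> Y\<close>, so uniqueness of adjuncts identifies them.\<close>
  have eq: "h1 \<cdot> x = h2 \<cdot> x" if x [simp]: "x \<in> arr C" "tgt C x = S" and kx: "?k \<cdot> x \<rhd> Y = x \<rhd> Y" for x
  proof -
    have 1: "ev \<cdot> (h1 \<cdot> x) \<rhd> Y = x \<rhd> Y"
      using cmp_eq_ext[OF h1(4), of "x \<rhd> Y"] kx h1(1-3) by simp
    have 2: "ev \<cdot> (h2 \<cdot> x) \<rhd> Y = x \<rhd> Y"
      using cmp_eq_ext[OF h2(4), of "x \<rhd> Y"] kx h2(1-3) by simp
    have ex: "\<exists>!h. h \<in> Hom C (src C x) H \<and> ev \<cdot> h \<rhd> Y = x \<rhd> Y"
      using ev[of "src C x" "x \<rhd> Y"] by simp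
    from ex obtain h where h: "\<And>h'. h' \<in> Hom C (src C x) H \<and> ev \<cdot> h' \<rhd> Y = x \<rhd> Y \<Longrightarrow> h' = h"
      by blast
    have "h1 \<cdot> x = h" by (rule h) (use 1 h1(1-3) in \<open>simp del: whisker_right_cmp\<close>)
    moreover have "h2 \<cdot> x = h" by (rule h) (use 2 h2(1-3) in \<open>simp del: whisker_right_cmp\<close>)
    ultimately show ?thesis by simp
  qed
  have cmpw: "g \<rhd> Y \<cdot> f \<rhd> Y = (g \<cdot> f) \<rhd> Y" if "f \<in> arr C" "g \<in> arr C" "src C g = tgt C f" for f g
    using that by simp
  have "?k \<cdot> i \<rhd> Y = i \<rhd> Y" "?k \<cdot> j \<rhd> Y = j \<rhd> Y"
    by (simp_all add: cmpw del: whisker_right_cmp)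
  then have ij: "h1 \<cdot> i = h2 \<cdot> i" "h1 \<cdot> j = h2 \<cdot> j" by (simp_all add: eq)
  have "h = (h \<cdot> i) \<cdot> p \<boxplus> (h \<cdot> j) \<cdot> q" if "h \<in> arr C" "src C h = S" for h
    using cmp_add_right'[of "i \<cdot> p" "j \<cdot> q" h] that sum by simp
  from this[OF h1(1,2)] this[OF h2(1,2)] have "h1 = h2" unfolding ij by simp
  then show ?thesis using h1(4) h2(4) by simp
qed

text \<open>A sum factors as \<open>(f \<cdot> p \<boxplus> g \<cdot> q) \<cdot> (i \<boxplus>
  j)\<close> through a biproduct \<open>S\<close> of \<open>X\<close> with itself. Inserting the
  decomposition of the identity of \<open>S \<boxtimes> Y\<close> between the two whiskered factors
  splits the sum.\<close>

lemma whisker_right_add [simp]: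
  assumes "f \<in> arr C" "g \<in> arr C" "src C g = src C f" "tgt C g = tgt C f" "Y \<in> obj C"
  shows "(f \<boxplus> g) \<rhd> Y = f \<rhd> Y \<boxplus> g \<rhd> Y"
proof -
  define X where "X = src C f"
  have X [simp]: "X \<in> obj C" "src C f = X" "src C g = X" using assms by (simp_all add: X_def)
  obtain S i j p q where bp: "biproduct C X X S i j p q" using ex_biproduct[OF X(1) X(1)] by blast
  have b [simp]: "i \<in> arr C" "j \<in> arr C" "p \<in> arr C" "q \<in> arr C" "src C i = X" "src C j = X"
    "src C p = S" "src C q = S" "tgt C i = S" "tgt C j = S" "tgt C p = X" "tgt C q = X"
    "p \<cdot> i = ident C X" "q \<cdot> j = ident C X" "p \<cdot> j = zero_arr C X X" "q \<cdot> i = zero_arr C X X"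
    using bp by (auto simp: biproduct_def)
  note [simp] = assms cmp_eq_ext[OF b(13)] cmp_eq_ext[OF b(14)] cmp_eq_ext[OF b(15)] cmp_eq_ext[OF b(16)]
  have S [simp]: "S \<in> obj C" using tgt_in_obj[OF b(1)] by simp
  let ?u = "f \<cdot> p \<boxplus> g \<cdot> q" and ?d = "i \<boxplus> j"
  have ud: "?u \<cdot> ?d = f \<boxplus> g" "?u \<cdot> i = f" "?u \<cdot> j = g" "p \<cdot> ?d = ident C X" "q \<cdot> ?d = ident C X"
    by (simp_all)
  have cmpw: "k \<rhd> Y \<cdot> h \<rhd> Y = (k \<cdot> h) \<rhd> Y" if "h \<in> arr C" "k \<in> arr C" "src C k = tgt C h" for h k
    using that by simp
  have "(f \<boxplus> g) \<rhd> Y = (?u \<cdot> ?d) \<rhd> Y" by (simp only: ud)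
  also have "\<dots> = ?u \<rhd> Y \<cdot> ?d \<rhd> Y" by (rule whisker_right_cmp) simp_all
  also have "\<dots> = ?u \<rhd> Y \<cdot> ident C (S \<boxtimes> Y) \<cdot> ?d \<rhd> Y" by simp
  also have "\<dots> = (?u \<rhd> Y \<cdot> i \<rhd> Y) \<cdot> (p \<rhd> Y \<cdot> ?d \<rhd> Y) \<boxplus> (?u \<rhd> Y \<cdot> j \<rhd> Y) \<cdot> (q \<rhd> Y \<cdot> ?d \<rhd> Y)"
    unfolding whisker_right_biproduct[OF bp X(1) X(1) assms(5), symmetric] by simp
  also have "\<dots> = f \<rhd> Y \<boxplus> g \<rhd> Y"
    by (simp add: cmpw ud del: whisker_right_cmp cmp_add_left' cmp_add_right')
  finally show ?thesis .
qed

text \<open>The symmetry conjugates left whiskering into right whiskering and so transports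
  additivity to the other side.\<close>

lemma whisker_left_conv:
  assumes "f \<in> arr C" "X \<in> obj C" "src C f = Y" "tgt C f = Y'"
  shows "X \<lhd> f = sw Y' X \<cdot> f \<rhd> X \<cdot> sw X Y"
  using swap_natural[of "ident C X" X X f "src C f" "tgt C f"] assms by (auto simp flip: swap_natural)

lemma whisker_left_zero [simp]:
  assumes "X \<in> obj C" "Y \<in> obj C" "Y' \<in> obj C"
  shows "X \<lhd> zero_arr C Y Y' = zero_arr C (X \<boxtimes> Y) (X \<boxtimes> Y')"
  using assms by (simp add: whisker_left_conv[of _ _ Y Y'])

lemma whisker_left_add [simp]:
  assumes "f \<in> arr C" "g \<in> arr C" "src C g = src C f" "tgt C g = tgt C f" "X \<in> obj C"
  shows "X \<lhd> (f \<boxplus> g) = X \<lhd> f \<boxplus> X \<lhd> g"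
  using assms by (simp add: whisker_left_conv[of _ _ "src C f" "tgt C f"])

lemma whisker_left_neg [simp]:
  assumes "f \<in> arr C" "X \<in> obj C"
  shows "X \<lhd> neg_arr C f = neg_arr C (X \<lhd> f)"
  by (rule neg_arr_unique[symmetric]) (use assms whisker_left_add[of f "neg_arr C f" X, symmetric] in simp_all)

end

context category
begin

lemma split_epi_cancel:
  assumes "f \<cdot> e = g \<cdot> e" "e \<cdot> e' = ident C Y" "f \<in> arr C" "g \<in> arr C" "e \<in> arr C" "e' \<in> arr C"
    "src C f = Y" "src C g = Y" "tgt C e = Y" "tgt C e' = src C e"
  shows "f = g"
proof -
  have "f = (f \<cdot> e) \<cdot> e'" using assms(2-) by simp
  also have "\<dots> = g" unfolding assms(1) using assms(2-) by simp
  finally show ?thesis .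
qed

lemma split_mono_cancel:
  assumes "m \<cdot> f = m \<cdot> g" "m' \<cdot> m = ident C X" "f \<in> arr C" "g \<in> arr C" "m \<in> arr C" "m' \<in> arr C"
    "tgt C f = X" "tgt C g = X" "src C m = X" "src C m' = tgt C m"
  shows "f = g"
proof -
  have "f = m' \<cdot> (m \<cdot> f)" using cmp_assoc'[of f m m'] assms(2-) by simp
  also have "\<dots> = g" unfolding assms(1) using cmp_assoc'[of g m m'] assms(2-) by simp
  finally show ?thesis .
qed

end

context additive_closed_monoidal
begin

lemma whisker_inv:
  assumes "g \<cdot> f = ident C Z" "f \<in> arr C" "g \<in> arr C" "src C g = tgt C f" "X \<in> obj C" "Z \<in> obj C"
  shows "X \<lhd> g \<cdot> X \<lhd> f = ident C (X \<boxtimes> Z)" "g \<rhd> X \<cdot> f \<rhd> X = ident C (Z \<boxtimes> X)"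
  using whisker_left_cmp[OF assms(2-5)] whisker_right_cmp[OF assms(2-5)] assms(5,6) unfolding assms(1)
  by simp_all

lemmas whisker_struct_inv [simp] =
  whisker_inv[OF struct_cancel(1)] whisker_inv[OF struct_cancel(2)] whisker_inv[OF struct_cancel(3)]
  whisker_inv[OF struct_cancel(4)] whisker_inv[OF struct_cancel(5)] whisker_inv[OF struct_cancel(6)]
  whisker_inv[OF struct_cancel(7)]

lemmas whisker_struct_cancel [simp] =
  cmp_eq_ext[OF whisker_inv(1)[OF struct_cancel(1)]] cmp_eq_ext[OF whisker_inv(2)[OF struct_cancel(1)]]
  cmp_eq_ext[OF whisker_inv(1)[OF struct_cancel(2)]] cmp_eq_ext[OF whisker_inv(2)[OF struct_cancel(2)]]
  cmp_eq_ext[OF whisker_inv(1)[OF struct_cancel(3)]] cmp_eq_ext[OF whisker_inv(2)[OF struct_cancel(3)]]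
  cmp_eq_ext[OF whisker_inv(1)[OF struct_cancel(4)]] cmp_eq_ext[OF whisker_inv(2)[OF struct_cancel(4)]]
  cmp_eq_ext[OF whisker_inv(1)[OF struct_cancel(5)]] cmp_eq_ext[OF whisker_inv(2)[OF struct_cancel(5)]]
  cmp_eq_ext[OF whisker_inv(1)[OF struct_cancel(6)]] cmp_eq_ext[OF whisker_inv(2)[OF struct_cancel(6)]]
  cmp_eq_ext[OF whisker_inv(1)[OF struct_cancel(7)]] cmp_eq_ext[OF whisker_inv(2)[OF struct_cancel(7)]]

section \<open>Naturality of the structural isomorphisms and unit coherence\<close>

lemma assoc_nat:
  assumes "f \<in> arr C" "g \<in> arr C" "h \<in> arr C" "tgt C f = X'" "tgt C g = Y'" "tgt C h = Z'"
  shows "\<alpha> X' Y' Z' \<cdot> ((f \<boxdot> g) \<boxdot> h) = (f \<boxdot> (g \<boxdot> h)) \<cdot> \<alpha> (src C f) (src C g) (src C h)"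
  using assoc_natural[of f "src C f" X' g "src C g" Y' h "src C h" Z'] assms by simp

lemma assoc_nat3:
  assumes "X \<in> obj C" "Y \<in> obj C" "h \<in> arr C" "tgt C h = Z'"
  shows "\<alpha> X Y Z' \<cdot> (X \<boxtimes> Y) \<lhd> h = X \<lhd> (Y \<lhd> h) \<cdot> \<alpha> X Y (src C h)"
  using assoc_nat[of "ident C X" "ident C Y" h X Y Z'] assms by simp

lemma assoc_inv_nat:
  assumes "f \<in> arr C" "g \<in> arr C" "h \<in> arr C" "tgt C f = X'" "tgt C g = Y'" "tgt C h = Z'"
  shows "\<beta> X' Y' Z' \<cdot> (f \<boxdot> (g \<boxdot> h)) = ((f \<boxdot> g) \<boxdot> h) \<cdot> \<beta> (src C f) (src C g) (src C h)"
proof -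
  have o: "X' \<in> obj C" "Y' \<in> obj C" "Z' \<in> obj C" using assms by auto
  have "\<beta> X' Y' Z' \<cdot> (f \<boxdot> (g \<boxdot> h)) =
      \<beta> X' Y' Z' \<cdot> ((f \<boxdot> (g \<boxdot> h)) \<cdot> \<alpha> (src C f) (src C g) (src C h)) \<cdot> \<beta> (src C f) (src C g) (src C h)"
    using assms o by simp
  also have "\<dots> = ((f \<boxdot> g) \<boxdot> h) \<cdot> \<beta> (src C f) (src C g) (src C h)"
    unfolding assoc_nat[OF assms, symmetric] using assms o by simp
  finally show ?thesis .
qed

lemma assoc_inv_nat1:
  assumes "f \<in> arr C" "tgt C f = X'" "Y \<in> obj C" "Z \<in> obj C"
  shows "\<beta> X' Y Z \<cdot> f \<rhd> (Y \<boxtimes> Z) = (f \<rhd> Y) \<rhd> Z \<cdot> \<beta> (src C f) Y Z"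
  using assoc_inv_nat[of f "ident C Y" "ident C Z" X' Y Z] assms by simp

lemma assoc_nat1:
  assumes "f \<in> arr C" "src C f = X" "tgt C f = X'" "Y \<in> obj C" "Z \<in> obj C"
  shows "f \<rhd> (Y \<boxtimes> Z) \<cdot> \<alpha> X Y Z = \<alpha> X' Y Z \<cdot> (f \<rhd> Y) \<rhd> Z"
  using assoc_nat[of f "ident C Y" "ident C Z" X' Y Z] assms by simp

lemma lunit_nat:
  assumes "f \<in> arr C" "tgt C f = X'"
  shows "lu X' \<cdot> U \<lhd> f = f \<cdot> lu (src C f)"
  using lunit_natural[of f "src C f" X'] assms by simp

lemma lunit_inv_nat:
  assumes "f \<in> arr C" "src C f = X"
  shows "U \<lhd> f \<cdot> lu' X = lu' (tgt C f) \<cdot> f"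
proof -
  have o: "X \<in> obj C" using assms by auto
  have "U \<lhd> f \<cdot> lu' X = lu' (tgt C f) \<cdot> (lu (tgt C f) \<cdot> U \<lhd> f) \<cdot> lu' X"
    using assms o by simp
  also have "\<dots> = lu' (tgt C f) \<cdot> f"
    using assms o by (subst lunit_nat) simp_all
  finally show ?thesis .
qed

lemma runit_nat:
  assumes "f \<in> arr C" "tgt C f = X'"
  shows "ru X' \<cdot> f \<rhd> U = f \<cdot> ru (src C f)"
  using runit_natural[of f "src C f" X'] assms by simp

lemma runit_inv_nat:
  assumes "f \<in> arr C" "src C f = X"
  shows "f \<rhd> U \<cdot> ru' X = ru' (tgt C f) \<cdot> f"
proof -
  have o: "X \<in> obj C" using assms by auto
  have "f \<rhd> U \<cdot> ru' X = ru' (tgt C f) \<cdot> (ru (tgt C f) \<cdot> f \<rhd> U) \<cdot> ru' X"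
    using assms o by simp
  also have "\<dots> = ru' (tgt C f) \<cdot> f"
    using assms o by (subst runit_nat) simp_all
  finally show ?thesis .
qed

lemma swap_nat:
  assumes "f \<in> arr C" "g \<in> arr C" "tgt C f = X'" "tgt C g = Y'"
  shows "sw X' Y' \<cdot> (f \<boxdot> g) = (g \<boxdot> f) \<cdot> sw (src C f) (src C g)"
  using swap_natural[of f "src C f" X' g "src C g" Y'] assms by simp

text \<open>Tensoring with \<open>U\<close> is naturally isomorphic to the identity functor.\<close>

lemma whisker_left_unit_faithful:
  assumes "U \<lhd> f = U \<lhd> g" "f \<in> arr C" "g \<in> arr C" "src C g = src C f" "tgt C g = tgt C f"
  shows "f = g"
proof (rule split_epi_cancel[of _ "lu (src C f)"])
  show "f \<cdot> lu (src C f) = g \<cdot> lu (src C f)"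
    using lunit_nat[of f "tgt C f"] lunit_nat[of g "tgt C f"] assms by simp
  show "lu (src C f) \<cdot> lu' (src C f) = ident C (src C f)" using assms by simp
qed (use assms in simp_all)

lemma whisker_right_unit_faithful:
  assumes "f \<rhd> U = g \<rhd> U" "f \<in> arr C" "g \<in> arr C" "src C g = src C f" "tgt C g = tgt C f"
  shows "f = g"
proof (rule split_epi_cancel[of _ "ru (src C f)"])
  show "f \<cdot> ru (src C f) = g \<cdot> ru (src C f)"
    using runit_nat[of f "tgt C f"] runit_nat[of g "tgt C f"] assms by simp
  show "ru (src C f) \<cdot> ru' (src C f) = ident C (src C f)" using assms by simp
qed (use assms in simp_all)

text \<open>Kelly: the second unit triangle follows from the first one and the pentagon.\<close>

lemma lunit_tensor:
  assumes [simp]: "X \<in> obj C" "Y \<in> obj C"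
  shows "lu (X \<boxtimes> Y) \<cdot> \<alpha> U X Y = lu X \<rhd> Y"
proof (rule whisker_left_unit_faithful)
  \<comment> \<open>An isomorphism, chosen so that the associators on the left form one side of the
    pentagon for \<open>U\<close>, \<open>U\<close>, \<open>X\<close>, \<open>Y\<close>.\<close>
  let ?e = "\<alpha> U (U \<boxtimes> X) Y \<cdot> \<alpha> U U X \<rhd> Y"
  show "U \<lhd> (lu (X \<boxtimes> Y) \<cdot> \<alpha> U X Y) = U \<lhd> (lu X \<rhd> Y)"
  proof (rule split_epi_cancel[of _ ?e])
    have "U \<lhd> (lu (X \<boxtimes> Y) \<cdot> \<alpha> U X Y) \<cdot> ?e = U \<lhd> lu (X \<boxtimes> Y) \<cdot> (U \<lhd> \<alpha> U X Y \<cdot> ?e)"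
      by simp
    also have "U \<lhd> \<alpha> U X Y \<cdot> ?e = \<alpha> U U (X \<boxtimes> Y) \<cdot> \<alpha> (U \<boxtimes> U) X Y"
      by (simp add: pentagon)
    also have "U \<lhd> lu (X \<boxtimes> Y) \<cdot> \<dots> = ru U \<rhd> (X \<boxtimes> Y) \<cdot> \<alpha> (U \<boxtimes> U) X Y"
      by (simp add: cmp_eq_ext[OF triangle])
    also have "\<dots> = \<alpha> U X Y \<cdot> (ru U \<rhd> X) \<rhd> Y"
      by (rule assoc_nat1) simp_all
    also have "\<dots> = \<alpha> U X Y \<cdot> (U \<lhd> lu X \<cdot> \<alpha> U U X) \<rhd> Y"
      by (simp only: triangle assms tunit_obj)
    also have "\<dots> = (\<alpha> U X Y \<cdot> (U \<lhd> lu X) \<rhd> Y) \<cdot> \<alpha> U U X \<rhd> Y"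
      by simp
    also have "\<dots> = (U \<lhd> (lu X \<rhd> Y) \<cdot> \<alpha> U (U \<boxtimes> X) Y) \<cdot> \<alpha> U U X \<rhd> Y"
      by (subst assoc_nat) simp_all
    finally show "U \<lhd> (lu (X \<boxtimes> Y) \<cdot> \<alpha> U X Y) \<cdot> ?e = U \<lhd> (lu X \<rhd> Y) \<cdot> ?e"
      by simp
    show "?e \<cdot> (\<beta> U U X \<rhd> Y \<cdot> \<beta> U (U \<boxtimes> X) Y) = ident C (U \<boxtimes> ((U \<boxtimes> X) \<boxtimes> Y))"
      by simp
  qed simp_all
qed simp_all

text \<open>After tensoring with \<open>U\<close> the identity follows from the hexagon for
  \<open>X\<close>, \<open>U\<close>, \<open>U\<close> and the two unit triangles;
  \<open>sw X U\<close>, being invertible, can be cancelled.\<close>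

lemma runit_swap:
  assumes X [simp]: "X \<in> obj C"
  shows "ru X = lu X \<cdot> sw X U"
proof (rule whisker_right_unit_faithful)
  let ?e = "\<alpha> X U U"
  have "lu X \<rhd> U \<cdot> sw X U \<rhd> U = lu (X \<boxtimes> U) \<cdot> \<alpha> U X U \<cdot> sw X U \<rhd> U"
    using cmp_eq_ext[OF lunit_tensor[of X U], of "sw X U \<rhd> U"] by simp
  then have "sw X U \<cdot> (lu X \<rhd> U \<cdot> sw X U \<rhd> U) = (sw X U \<cdot> lu (X \<boxtimes> U)) \<cdot> \<alpha> U X U \<cdot> sw X U \<rhd> U"
    by simp
  also have "sw X U \<cdot> lu (X \<boxtimes> U) = lu (U \<boxtimes> X) \<cdot> U \<lhd> sw X U"
    by (simp add: lunit_nat)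
  also have "\<dots> \<cdot> \<alpha> U X U \<cdot> sw X U \<rhd> U = lu (U \<boxtimes> X) \<cdot> \<alpha> U U X \<cdot> sw X (U \<boxtimes> U) \<cdot> \<alpha> X U U"
    by (simp add: hexagon)
  also have "\<dots> = (lu U \<rhd> X \<cdot> sw X (U \<boxtimes> U)) \<cdot> \<alpha> X U U"
    using cmp_eq_ext[OF lunit_tensor[of U X], of "sw X (U \<boxtimes> U) \<cdot> \<alpha> X U U"] by simp
  also have "lu U \<rhd> X \<cdot> sw X (U \<boxtimes> U) = sw X U \<cdot> X \<lhd> lu U"
    by (simp add: swap_nat)
  also have "\<dots> \<cdot> \<alpha> X U U = sw X U \<cdot> ru X \<rhd> U"
    using triangle[of X U] by simp
  finally have "sw X U \<cdot> (lu X \<rhd> U \<cdot> sw X U \<rhd> U) = sw X U \<cdot> ru X \<rhd> U" .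
  from split_mono_cancel[OF this, of "sw U X"] show "ru X \<rhd> U = (lu X \<cdot> sw X U) \<rhd> U"
    by simp
qed simp_all

lemma swap_unit:
  assumes [simp]: "X \<in> obj C"
  shows "sw U X \<cdot> lu' X = ru' X" "ru X \<cdot> sw U X = lu X"
proof -
  show 1: "ru X \<cdot> sw U X = lu X" by (simp add: runit_swap)
  have "sw U X \<cdot> lu' X = ru' X \<cdot> (ru X \<cdot> sw U X) \<cdot> lu' X" by (simp)
  then show "sw U X \<cdot> lu' X = ru' X" unfolding 1 by simp
qed

text \<open>The symmetry acting on the two outer factors. For algebras on \<open>a\<close> and
  \<open>b\<close> it is the distributive law between the monads \<open>a \<boxtimes> -\<close> and
  \<open>b \<boxtimes> -\<close>, and it keeps associators out of statements about commuting
  actions.\<close>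

definition tau :: "'o \<Rightarrow> 'o \<Rightarrow> 'o \<Rightarrow> 'm" where
  "tau a b X = \<alpha> b a X \<cdot> sw a b \<rhd> X \<cdot> \<beta> a b X"

lemma tau_simps [simp]:
  assumes "a \<in> obj C" "b \<in> obj C" "X \<in> obj C"
  shows "tau a b X \<in> arr C" "src C (tau a b X) = a \<boxtimes> (b \<boxtimes> X)" "tgt C (tau a b X) = b \<boxtimes> (a \<boxtimes> X)"
    "tau b a X \<cdot> tau a b X = ident C (a \<boxtimes> (b \<boxtimes> X))"
  using assms by (simp_all add: tau_def)

lemma tau_nat:
  assumes "a \<in> obj C" "b \<in> obj C" "g \<in> arr C" "src C g = X"
  shows "b \<lhd> (a \<lhd> g) \<cdot> tau a b X = tau a b (tgt C g) \<cdot> a \<lhd> (b \<lhd> g)"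
proof -
  have [simp]: "X \<in> obj C" using assms by auto
  have "tau a b (tgt C g) \<cdot> a \<lhd> (b \<lhd> g) =
      \<alpha> b a (tgt C g) \<cdot> (sw a b \<rhd> tgt C g \<cdot> (a \<boxtimes> b) \<lhd> g) \<cdot> \<beta> a b X"
    using assms by (simp add: tau_def assoc_inv_nat)
  also have "sw a b \<rhd> tgt C g \<cdot> (a \<boxtimes> b) \<lhd> g = (b \<boxtimes> a) \<lhd> g \<cdot> sw a b \<rhd> X"
    using assms by (simp add: whisker_exchange)
  also have "\<alpha> b a (tgt C g) \<cdot> (\<dots>) \<cdot> \<beta> a b X = (\<alpha> b a (tgt C g) \<cdot> (b \<boxtimes> a) \<lhd> g) \<cdot> sw a b \<rhd> X \<cdot> \<beta> a b X"
    using assms by simp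
  also have "\<dots> = b \<lhd> (a \<lhd> g) \<cdot> tau a b X"
    using assms by (simp add: assoc_nat3 tau_def)
  finally show ?thesis by simp
qed

lemma tau_nat_left:
  assumes "f \<in> arr C" "src C f = a" "b \<in> obj C" "X \<in> obj C"
  shows "b \<lhd> (f \<rhd> X) \<cdot> tau a b X = tau (tgt C f) b X \<cdot> f \<rhd> (b \<boxtimes> X)"
proof -
  have [simp]: "a \<in> obj C" using assms by auto
  have "tau (tgt C f) b X \<cdot> f \<rhd> (b \<boxtimes> X) =
      \<alpha> b (tgt C f) X \<cdot> (sw (tgt C f) b \<cdot> f \<rhd> b) \<rhd> X \<cdot> \<beta> a b X"
    using assms by (simp add: tau_def assoc_inv_nat1)
  also have "sw (tgt C f) b \<cdot> f \<rhd> b = b \<lhd> f \<cdot> sw a b"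
    using assms by (simp add: swap_nat)
  also have "\<alpha> b (tgt C f) X \<cdot> (\<dots>) \<rhd> X \<cdot> \<beta> a b X = (\<alpha> b (tgt C f) X \<cdot> (b \<lhd> f) \<rhd> X) \<cdot> sw a b \<rhd> X \<cdot> \<beta> a b X"
    using assms by simp
  also have "\<dots> = b \<lhd> (f \<rhd> X) \<cdot> tau a b X"
    using assms by (simp add: assoc_nat tau_def)
  finally show ?thesis by simp
qed

text \<open>Naturality in the left factor, conjugated by the inverse exchange.\<close>

lemma tau_nat_right:
  assumes "g \<in> arr C" "src C g = b" "a \<in> obj C" "X \<in> obj C"
  shows "g \<rhd> (a \<boxtimes> X) \<cdot> tau a b X = tau a (tgt C g) X \<cdot> a \<lhd> (g \<rhd> X)"
proof -
  have [simp]: "b \<in> obj C" using assms by auto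
  have "tau a (tgt C g) X \<cdot> a \<lhd> (g \<rhd> X) =
      tau a (tgt C g) X \<cdot> (a \<lhd> (g \<rhd> X) \<cdot> tau b a X) \<cdot> tau a b X"
    using assms by simp
  also have "\<dots> = tau a (tgt C g) X \<cdot> (tau (tgt C g) a X \<cdot> g \<rhd> (a \<boxtimes> X)) \<cdot> tau a b X"
    using assms by (subst tau_nat_left) simp_all
  also have "\<dots> = g \<rhd> (a \<boxtimes> X) \<cdot> tau a b X"
    using assms cmp_eq_ext[OF tau_simps(4)[of "tgt C g" a X], of "g \<rhd> (a \<boxtimes> X) \<cdot> tau a b X"] by simp
  finally show ?thesis by simp
qed

text \<open>One pentagon on either side of the symmetry, joined by naturality of the
  associator.\<close>

lemma tau_tensor_right:
  assumes [simp]: "a \<in> obj C" "b \<in> obj C" "c \<in> obj C" "X \<in> obj C"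
  shows "tau b a (c \<boxtimes> X) \<cdot> b \<lhd> \<alpha> a c X \<cdot> \<alpha> b (a \<boxtimes> c) X = a \<lhd> \<alpha> b c X \<cdot> \<alpha> a (b \<boxtimes> c) X \<cdot> tau b a c \<rhd> X"
proof -
  have "\<beta> b a (c \<boxtimes> X) \<cdot> b \<lhd> \<alpha> a c X \<cdot> \<alpha> b (a \<boxtimes> c) X =
      \<beta> b a (c \<boxtimes> X) \<cdot> (b \<lhd> \<alpha> a c X \<cdot> \<alpha> b (a \<boxtimes> c) X \<cdot> \<alpha> b a c \<rhd> X) \<cdot> \<beta> b a c \<rhd> X"
    by simp
  also have "\<dots> = \<alpha> (b \<boxtimes> a) c X \<cdot> \<beta> b a c \<rhd> X"
    by (subst pentagon[symmetric]) simp_all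
  finally have 1: "\<beta> b a (c \<boxtimes> X) \<cdot> b \<lhd> \<alpha> a c X \<cdot> \<alpha> b (a \<boxtimes> c) X = \<alpha> (b \<boxtimes> a) c X \<cdot> \<beta> b a c \<rhd> X" .
  have "tau b a (c \<boxtimes> X) \<cdot> b \<lhd> \<alpha> a c X \<cdot> \<alpha> b (a \<boxtimes> c) X =
      \<alpha> a b (c \<boxtimes> X) \<cdot> (sw b a \<rhd> (c \<boxtimes> X) \<cdot> \<alpha> (b \<boxtimes> a) c X) \<cdot> \<beta> b a c \<rhd> X"
    by (simp add: tau_def 1)
  also have "sw b a \<rhd> (c \<boxtimes> X) \<cdot> \<alpha> (b \<boxtimes> a) c X = \<alpha> (a \<boxtimes> b) c X \<cdot> (sw b a \<rhd> c) \<rhd> X"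
    by (rule assoc_nat1) simp_all
  also have "\<alpha> a b (c \<boxtimes> X) \<cdot> (\<dots>) \<cdot> \<beta> b a c \<rhd> X =
      (\<alpha> a b (c \<boxtimes> X) \<cdot> \<alpha> (a \<boxtimes> b) c X) \<cdot> (sw b a \<rhd> c) \<rhd> X \<cdot> \<beta> b a c \<rhd> X"
    by simp
  also have "\<dots> = a \<lhd> \<alpha> b c X \<cdot> \<alpha> a (b \<boxtimes> c) X \<cdot> tau b a c \<rhd> X"
    unfolding pentagon[OF assms(1,2,3,4)] by (simp add: tau_def)
  finally show ?thesis .
qed

text \<open>The second hexagon: as the symmetry is its own inverse, inverting the given hexagon
  yields it.\<close>

lemma swap_tensor_left:
  assumes [simp]: "a \<in> obj C" "a' \<in> obj C" "b \<in> obj C"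
  shows "sw (a \<boxtimes> a') b = tau a b a' \<cdot> a \<lhd> sw a' b \<cdot> \<alpha> a a' b"
proof -
  let ?r = "tau a b a' \<cdot> a \<lhd> sw a' b \<cdot> \<alpha> a a' b"
  have "?r \<cdot> sw b (a \<boxtimes> a') = tau a b a' \<cdot> a \<lhd> sw a' b \<cdot> (\<alpha> a a' b \<cdot> sw b (a \<boxtimes> a') \<cdot> \<alpha> b a a') \<cdot> \<beta> b a a'"
    by simp
  also have "\<dots> = ident C (b \<boxtimes> (a \<boxtimes> a'))"
    by (subst hexagon) (simp_all add: tau_def)
  finally have "?r \<cdot> sw b (a \<boxtimes> a') = ident C (b \<boxtimes> (a \<boxtimes> a'))" .
  from cmp_eq_ext[OF this, of "sw (a \<boxtimes> a') b"] show ?thesis by simp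
qed

text \<open>Exchanging \<open>b\<close> with \<open>a \<boxtimes> a'\<close> in two stages. With
  naturality this becomes compatibility of \<open>tau\<close> with multiplications.\<close>

lemma tau_tensor_left:
  assumes [simp]: "a \<in> obj C" "a' \<in> obj C" "b \<in> obj C" "X \<in> obj C"
  shows "b \<lhd> \<alpha> a a' X \<cdot> tau (a \<boxtimes> a') b X = tau a b (a' \<boxtimes> X) \<cdot> a \<lhd> tau a' b X \<cdot> \<alpha> a a' (b \<boxtimes> X)"
proof -
  have "b \<lhd> \<alpha> a a' X \<cdot> tau (a \<boxtimes> a') b X =
      (b \<lhd> \<alpha> a a' X \<cdot> \<alpha> b (a \<boxtimes> a') X \<cdot> tau a b a' \<rhd> X) \<cdot> (a \<lhd> sw a' b \<cdot> \<alpha> a a' b) \<rhd> X \<cdot> \<beta> (a \<boxtimes> a') b X"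
    by (simp add: tau_def[of "a \<boxtimes> a'"] swap_tensor_left)
  also have "b \<lhd> \<alpha> a a' X \<cdot> \<alpha> b (a \<boxtimes> a') X \<cdot> tau a b a' \<rhd> X =
      tau a b (a' \<boxtimes> X) \<cdot> a \<lhd> \<alpha> b a' X \<cdot> \<alpha> a (b \<boxtimes> a') X"
    by (rule tau_tensor_right[symmetric]) simp_all
  also have "\<dots> \<cdot> (a \<lhd> sw a' b \<cdot> \<alpha> a a' b) \<rhd> X \<cdot> \<beta> (a \<boxtimes> a') b X =
      tau a b (a' \<boxtimes> X) \<cdot> a \<lhd> \<alpha> b a' X \<cdot> (\<alpha> a (b \<boxtimes> a') X \<cdot> (a \<lhd> sw a' b) \<rhd> X) \<cdot> \<alpha> a a' b \<rhd> X \<cdot> \<beta> (a \<boxtimes> a') b X"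
    by simp
  also have "\<alpha> a (b \<boxtimes> a') X \<cdot> (a \<lhd> sw a' b) \<rhd> X = a \<lhd> (sw a' b \<rhd> X) \<cdot> \<alpha> a (a' \<boxtimes> b) X"
    by (simp add: assoc_nat)
  also have "tau a b (a' \<boxtimes> X) \<cdot> a \<lhd> \<alpha> b a' X \<cdot> (\<dots>) \<cdot> \<alpha> a a' b \<rhd> X \<cdot> \<beta> (a \<boxtimes> a') b X =
      tau a b (a' \<boxtimes> X) \<cdot> a \<lhd> \<alpha> b a' X \<cdot> a \<lhd> (sw a' b \<rhd> X) \<cdot> a \<lhd> \<beta> a' b X \<cdot>
        (a \<lhd> \<alpha> a' b X \<cdot> \<alpha> a (a' \<boxtimes> b) X \<cdot> \<alpha> a a' b \<rhd> X) \<cdot> \<beta> (a \<boxtimes> a') b X"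
    by simp
  also have "a \<lhd> \<alpha> a' b X \<cdot> \<alpha> a (a' \<boxtimes> b) X \<cdot> \<alpha> a a' b \<rhd> X = \<alpha> a a' (b \<boxtimes> X) \<cdot> \<alpha> (a \<boxtimes> a') b X"
    by (simp add: pentagon)
  finally show ?thesis by (simp add: tau_def[of a'])
qed

text \<open>Rewrites the middle-four interchange in the multiplication of a tensor algebra as one
  exchange \<open>tau c a\<close> on right-nested factors.\<close>

lemma interchange_coherence:
  assumes [simp]: "a \<in> obj C" "c \<in> obj C" "X \<in> obj C"
  shows "a \<lhd> tau c a (c \<boxtimes> X) \<cdot> \<alpha> a c (a \<boxtimes> (c \<boxtimes> X)) \<cdot> (a \<boxtimes> c) \<lhd> \<alpha> a c X \<cdot> \<alpha> (a \<boxtimes> c) (a \<boxtimes> c) X =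
    \<alpha> a a (c \<boxtimes> (c \<boxtimes> X)) \<cdot> (a \<boxtimes> a) \<lhd> \<alpha> c c X \<cdot> \<alpha> (a \<boxtimes> a) (c \<boxtimes> c) X \<cdot> interchange C a c a c \<rhd> X"
proof -
  have I: "interchange C a c a c = \<beta> a a (c \<boxtimes> c) \<cdot> a \<lhd> tau c a c \<cdot> \<alpha> a c (a \<boxtimes> c)"
    by (simp add: interchange_def tau_def)
  have "\<alpha> a a (c \<boxtimes> (c \<boxtimes> X)) \<cdot> (a \<boxtimes> a) \<lhd> \<alpha> c c X \<cdot> \<alpha> (a \<boxtimes> a) (c \<boxtimes> c) X \<cdot> interchange C a c a c \<rhd> X =
    a \<lhd> (a \<lhd> \<alpha> c c X) \<cdot> (\<alpha> a a ((c \<boxtimes> c) \<boxtimes> X) \<cdot> \<alpha> (a \<boxtimes> a) (c \<boxtimes> c) X) \<cdot> interchange C a c a c \<rhd> X"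
    using cmp_eq_ext[OF assoc_nat3[of a a "\<alpha> c c X"]] by (simp add: I)
  also have "\<dots> = a \<lhd> (a \<lhd> \<alpha> c c X) \<cdot> (a \<lhd> \<alpha> a (c \<boxtimes> c) X \<cdot> \<alpha> a (a \<boxtimes> (c \<boxtimes> c)) X \<cdot> \<alpha> a a (c \<boxtimes> c) \<rhd> X) \<cdot>
      interchange C a c a c \<rhd> X"
    by (simp only: pentagon[of a a "c \<boxtimes> c" X] assms tens_obj)
  also have "\<dots> = a \<lhd> (a \<lhd> \<alpha> c c X) \<cdot> a \<lhd> \<alpha> a (c \<boxtimes> c) X \<cdot> (\<alpha> a (a \<boxtimes> (c \<boxtimes> c)) X \<cdot>
      (a \<lhd> tau c a c) \<rhd> X) \<cdot> \<alpha> a c (a \<boxtimes> c) \<rhd> X"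
    by (simp add: I)
  also have "\<alpha> a (a \<boxtimes> (c \<boxtimes> c)) X \<cdot> (a \<lhd> tau c a c) \<rhd> X = a \<lhd> (tau c a c \<rhd> X) \<cdot> \<alpha> a (c \<boxtimes> (a \<boxtimes> c)) X"
    by (simp add: assoc_nat)
  also have "a \<lhd> (a \<lhd> \<alpha> c c X) \<cdot> a \<lhd> \<alpha> a (c \<boxtimes> c) X \<cdot> (\<dots>) \<cdot> \<alpha> a c (a \<boxtimes> c) \<rhd> X =
      a \<lhd> (a \<lhd> \<alpha> c c X \<cdot> \<alpha> a (c \<boxtimes> c) X \<cdot> tau c a c \<rhd> X) \<cdot> \<alpha> a (c \<boxtimes> (a \<boxtimes> c)) X \<cdot> \<alpha> a c (a \<boxtimes> c) \<rhd> X"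
    by simp
  also have "a \<lhd> \<alpha> c c X \<cdot> \<alpha> a (c \<boxtimes> c) X \<cdot> tau c a c \<rhd> X = tau c a (c \<boxtimes> X) \<cdot> c \<lhd> \<alpha> a c X \<cdot> \<alpha> c (a \<boxtimes> c) X"
    by (simp add: tau_tensor_right)
  also have "a \<lhd> \<dots> \<cdot> \<alpha> a (c \<boxtimes> (a \<boxtimes> c)) X \<cdot> \<alpha> a c (a \<boxtimes> c) \<rhd> X =
      a \<lhd> tau c a (c \<boxtimes> X) \<cdot> a \<lhd> (c \<lhd> \<alpha> a c X) \<cdot>
      (a \<lhd> \<alpha> c (a \<boxtimes> c) X \<cdot> \<alpha> a (c \<boxtimes> (a \<boxtimes> c)) X \<cdot> \<alpha> a c (a \<boxtimes> c) \<rhd> X)"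
    by simp
  also have "a \<lhd> \<alpha> c (a \<boxtimes> c) X \<cdot> \<alpha> a (c \<boxtimes> (a \<boxtimes> c)) X \<cdot> \<alpha> a c (a \<boxtimes> c) \<rhd> X =
      \<alpha> a c ((a \<boxtimes> c) \<boxtimes> X) \<cdot> \<alpha> (a \<boxtimes> c) (a \<boxtimes> c) X"
    by (simp add: pentagon)
  also have "a \<lhd> (c \<lhd> \<alpha> a c X) \<cdot> \<dots> = \<alpha> a c (a \<boxtimes> (c \<boxtimes> X)) \<cdot> (a \<boxtimes> c) \<lhd> \<alpha> a c X \<cdot> \<alpha> (a \<boxtimes> c) (a \<boxtimes> c) X"
    using cmp_eq_ext[OF assoc_nat3[of a c "\<alpha> a c X"], of "a \<boxtimes> (c \<boxtimes> X)" "\<alpha> (a \<boxtimes> c) (a \<boxtimes> c) X"] by simp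
  finally show ?thesis by simp
qed

end

section \<open>Algebras and modules\<close>

context additive_closed_monoidal
begin

lemma pentagon_inv:
  assumes [simp]: "W \<in> obj C" "X \<in> obj C" "Y \<in> obj C" "Z \<in> obj C"
  shows "\<alpha> W X Y \<rhd> Z \<cdot> \<beta> (W \<boxtimes> X) Y Z \<cdot> \<beta> W X (Y \<boxtimes> Z) = \<beta> W (X \<boxtimes> Y) Z \<cdot> W \<lhd> \<beta> X Y Z"
proof -
  have "\<beta> W (X \<boxtimes> Y) Z \<cdot> W \<lhd> \<beta> X Y Z = \<beta> W (X \<boxtimes> Y) Z \<cdot> W \<lhd> \<beta> X Y Z \<cdot>
      (\<alpha> W X (Y \<boxtimes> Z) \<cdot> \<alpha> (W \<boxtimes> X) Y Z) \<cdot> \<beta> (W \<boxtimes> X) Y Z \<cdot> \<beta> W X (Y \<boxtimes> Z)"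
    by simp
  also have "\<dots> = \<alpha> W X Y \<rhd> Z \<cdot> \<beta> (W \<boxtimes> X) Y Z \<cdot> \<beta> W X (Y \<boxtimes> Z)"
    unfolding pentagon[OF assms] by simp
  finally show ?thesis by simp
qed

text \<open>Multiplication and, below, unit of the monad \<open>alg_obj A \<boxtimes> -\<close> at
  \<open>X\<close>. Modules are its Eilenberg-Moore algebras, and in this form their axioms contain
  no associators.\<close>

definition mu :: "('o, 'm) alg \<Rightarrow> 'o \<Rightarrow> 'm" where
  "mu A X = alg_mult A \<rhd> X \<cdot> \<beta> (alg_obj A) (alg_obj A) X"

definition eta :: "('o, 'm) alg \<Rightarrow> 'o \<Rightarrow> 'm" where
  "eta A X = alg_unit A \<rhd> X \<cdot> lu' X"

section \<open>Algebras and their opposites\<close>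

lemma unital_algebra_simps [simp]:
  assumes "unital_algebra C A"
  shows "alg_obj A \<in> obj C" "alg_mult A \<in> arr C" "src C (alg_mult A) = alg_obj A \<boxtimes> alg_obj A"
    "tgt C (alg_mult A) = alg_obj A" "alg_unit A \<in> arr C" "src C (alg_unit A) = U"
    "tgt C (alg_unit A) = alg_obj A"
  using assms unfolding unital_algebra_def Let_def Hom_iff by blast+

lemma unital_algebra_laws:
  assumes "unital_algebra C A"
  shows "alg_mult A \<cdot> alg_mult A \<rhd> alg_obj A =
      alg_mult A \<cdot> alg_obj A \<lhd> alg_mult A \<cdot> \<alpha> (alg_obj A) (alg_obj A) (alg_obj A)"
    "alg_mult A \<cdot> alg_unit A \<rhd> alg_obj A = lu (alg_obj A)"
    "alg_mult A \<cdot> alg_obj A \<lhd> alg_unit A = ru (alg_obj A)"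
  using assms unfolding unital_algebra_def Let_def Hom_iff by blast+

lemma algebra_hom_simps:
  assumes "algebra_hom C A B f"
  shows "f \<in> arr C" "src C f = alg_obj A" "tgt C f = alg_obj B"
    "f \<cdot> alg_mult A = alg_mult B \<cdot> (f \<boxdot> f)" "f \<cdot> alg_unit A = alg_unit B"
  using assms unfolding algebra_hom_def Hom_iff by blast+

lemma algebra_hom_ident: "unital_algebra C A \<Longrightarrow> algebra_hom C A A (ident C (alg_obj A))"
  by (simp add: algebra_hom_def)

lemma op_alg_simps [simp]:
  "alg_obj (op_alg C A) = alg_obj A" "alg_unit (op_alg C A) = alg_unit A"
  "alg_mult (op_alg C A) = alg_mult A \<cdot> sw (alg_obj A) (alg_obj A)"
  by (simp_all add: op_alg_def)

lemma swap_assoc: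
  assumes [simp]: "a \<in> obj C"
  shows "\<alpha> a a a \<cdot> sw a (a \<boxtimes> a) = a \<lhd> sw a a \<cdot> tau a a a"
proof -
  have "\<alpha> a a a \<cdot> sw a (a \<boxtimes> a) = (\<alpha> a a a \<cdot> sw a (a \<boxtimes> a) \<cdot> \<alpha> a a a) \<cdot> \<beta> a a a"
    by simp
  then show ?thesis unfolding hexagon[OF assms assms assms] by (simp add: tau_def)
qed

text \<open>The two ways of reversing a triple product agree by the hexagon
  (\<open>swap_assoc\<close>), which reduces associativity of the opposite multiplication to that of
  the original one.\<close>

lemma unital_algebra_op:
  assumes A [simp]: "unital_algebra C A"
  shows "unital_algebra C (op_alg C A)"
proof -
  define a m u where "a = alg_obj A" "m = alg_mult A" "u = alg_unit A"
  have [simp]: "a \<in> obj C" "m \<in> arr C" "src C m = a \<boxtimes> a" "tgt C m = a"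
    "u \<in> arr C" "src C u = U" "tgt C u = a" by (simp_all add: a_m_u_def)
  have laws: "m \<cdot> m \<rhd> a = m \<cdot> a \<lhd> m \<cdot> \<alpha> a a a" "m \<cdot> u \<rhd> a = lu a" "m \<cdot> a \<lhd> u = ru a"
    using unital_algebra_laws[OF A] by (simp_all add: a_m_u_def)
  let ?s = "sw a a"
  have unit: "(m \<cdot> ?s) \<cdot> u \<rhd> a = lu a" "(m \<cdot> ?s) \<cdot> a \<lhd> u = ru a"
  proof -
    have "(m \<cdot> ?s) \<cdot> u \<rhd> a = (m \<cdot> a \<lhd> u) \<cdot> sw U a" by (simp add: swap_nat)
    then show "(m \<cdot> ?s) \<cdot> u \<rhd> a = lu a" unfolding laws by (simp add: swap_unit)
    have "(m \<cdot> ?s) \<cdot> a \<lhd> u = (m \<cdot> u \<rhd> a) \<cdot> sw a U" by (simp add: swap_nat)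
    then show "(m \<cdot> ?s) \<cdot> a \<lhd> u = ru a" unfolding laws by (simp add: runit_swap)
  qed
  have "(m \<cdot> ?s) \<cdot> (m \<cdot> ?s) \<rhd> a = m \<cdot> (?s \<cdot> m \<rhd> a) \<cdot> ?s \<rhd> a" by simp
  also have "?s \<cdot> m \<rhd> a = a \<lhd> m \<cdot> sw (a \<boxtimes> a) a" by (simp add: swap_nat)
  also have "m \<cdot> (\<dots>) \<cdot> ?s \<rhd> a = m \<cdot> a \<lhd> m \<cdot> \<alpha> a a a \<cdot> ?s \<rhd> a \<cdot> \<beta> a a a \<cdot> a \<lhd> ?s \<cdot> \<alpha> a a a \<cdot> ?s \<rhd> a"
    by (simp add: swap_tensor_left tau_def)
  also have "\<beta> a a a \<cdot> a \<lhd> ?s \<cdot> \<alpha> a a a \<cdot> ?s \<rhd> a = \<beta> a a a \<cdot> (\<alpha> a a a \<cdot> sw a (a \<boxtimes> a)) \<cdot> \<alpha> a a a"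
    unfolding swap_assoc[OF \<open>a \<in> obj C\<close>] by (simp add: tau_def)
  also have "m \<cdot> a \<lhd> m \<cdot> \<alpha> a a a \<cdot> ?s \<rhd> a \<cdot> \<dots> = (m \<cdot> a \<lhd> m \<cdot> \<alpha> a a a) \<cdot> ?s \<rhd> a \<cdot> sw a (a \<boxtimes> a) \<cdot> \<alpha> a a a"
    by simp
  also have "\<dots> = m \<cdot> ((m \<cdot> ?s) \<rhd> a \<cdot> sw a (a \<boxtimes> a)) \<cdot> \<alpha> a a a"
    unfolding laws(1)[symmetric] by simp
  also have "(m \<cdot> ?s) \<rhd> a \<cdot> sw a (a \<boxtimes> a) = ?s \<cdot> a \<lhd> (m \<cdot> ?s)"
    using swap_nat[of "ident C a" "m \<cdot> ?s" a a] by (simp del: whisker_left_cmp whisker_right_cmp)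
  finally have "(m \<cdot> ?s) \<cdot> (m \<cdot> ?s) \<rhd> a = (m \<cdot> ?s) \<cdot> a \<lhd> (m \<cdot> ?s) \<cdot> \<alpha> a a a"
    by simp
  then show ?thesis
    using unit unital_algebra_simps[OF A] unfolding unital_algebra_def Let_def a_m_u_def op_alg_simps
    by (intro conjI) simp_all
qed

section \<open>The monad of an algebra\<close>

lemma mu_simps [simp]:
  assumes "unital_algebra C A" "X \<in> obj C"
  shows "mu A X \<in> arr C" "src C (mu A X) = alg_obj A \<boxtimes> (alg_obj A \<boxtimes> X)" "tgt C (mu A X) = alg_obj A \<boxtimes> X"
    "eta A X \<in> arr C" "src C (eta A X) = X" "tgt C (eta A X) = alg_obj A \<boxtimes> X"
  using assms by (simp_all add: mu_def eta_def)

lemma mu_nat: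
  assumes "unital_algebra C A" "alg_obj A = a" "g \<in> arr C" "tgt C g = Y"
  shows "mu A Y \<cdot> a \<lhd> (a \<lhd> g) = a \<lhd> g \<cdot> mu A (src C g)"
proof -
  have [simp]: "a \<in> obj C" "Y \<in> obj C" using assms by auto
  have "mu A Y \<cdot> a \<lhd> (a \<lhd> g) = (alg_mult A \<rhd> Y \<cdot> (a \<boxtimes> a) \<lhd> g) \<cdot> \<beta> a a (src C g)"
    using assms assoc_inv_nat[of "ident C a" "ident C a" g] by (simp add: mu_def)
  also have "\<dots> = a \<lhd> g \<cdot> mu A (src C g)"
    using assms by (subst whisker_exchange) (simp_all add: mu_def)
  finally show ?thesis .
qed

lemma eta_nat:
  assumes "unital_algebra C A" "g \<in> arr C" "tgt C g = Y"
  shows "eta A Y \<cdot> g = alg_obj A \<lhd> g \<cdot> eta A (src C g)"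
proof -
  have [simp]: "Y \<in> obj C" using assms by auto
  have "eta A Y \<cdot> g = alg_unit A \<rhd> Y \<cdot> U \<lhd> g \<cdot> lu' (src C g)"
    using assms by (simp add: eta_def lunit_inv_nat)
  also have "\<dots> = (alg_unit A \<rhd> Y \<cdot> U \<lhd> g) \<cdot> lu' (src C g)" using assms by simp
  also have "\<dots> = alg_obj A \<lhd> g \<cdot> eta A (src C g)"
    using assms by (subst whisker_exchange) (simp_all add: eta_def)
  finally show ?thesis .
qed

lemma mu_assoc:
  assumes A: "unital_algebra C A" and a: "alg_obj A = a" and X [simp]: "X \<in> obj C"
  shows "mu A X \<cdot> mu A (a \<boxtimes> X) = mu A X \<cdot> a \<lhd> mu A X"
proof -
  define m where "m = alg_mult A"
  have [simp]: "a \<in> obj C" "m \<in> arr C" "src C m = a \<boxtimes> a" "tgt C m = a"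
    using unital_algebra_simps[OF A] by (simp_all add: m_def a)
  have law: "m \<cdot> m \<rhd> a = m \<cdot> a \<lhd> m \<cdot> \<alpha> a a a"
    using unital_algebra_laws[OF A] by (simp add: m_def a)
  have "mu A X \<cdot> mu A (a \<boxtimes> X) = m \<rhd> X \<cdot> (\<beta> a a X \<cdot> m \<rhd> (a \<boxtimes> X)) \<cdot> \<beta> a a (a \<boxtimes> X)"
    by (simp add: mu_def a m_def[symmetric])
  also have "\<beta> a a X \<cdot> m \<rhd> (a \<boxtimes> X) = (m \<rhd> a) \<rhd> X \<cdot> \<beta> (a \<boxtimes> a) a X"
    by (simp add: assoc_inv_nat1)
  also have "m \<rhd> X \<cdot> (\<dots>) \<cdot> \<beta> a a (a \<boxtimes> X) = (m \<cdot> m \<rhd> a) \<rhd> X \<cdot> \<beta> (a \<boxtimes> a) a X \<cdot> \<beta> a a (a \<boxtimes> X)"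
    by simp
  also have "\<dots> = (m \<cdot> a \<lhd> m) \<rhd> X \<cdot> \<alpha> a a a \<rhd> X \<cdot> \<beta> (a \<boxtimes> a) a X \<cdot> \<beta> a a (a \<boxtimes> X)"
    unfolding law by simp
  also have "\<alpha> a a a \<rhd> X \<cdot> \<beta> (a \<boxtimes> a) a X \<cdot> \<beta> a a (a \<boxtimes> X) = \<beta> a (a \<boxtimes> a) X \<cdot> a \<lhd> \<beta> a a X"
    by (simp add: pentagon_inv)
  also have "(m \<cdot> a \<lhd> m) \<rhd> X \<cdot> \<dots> = m \<rhd> X \<cdot> ((a \<lhd> m) \<rhd> X \<cdot> \<beta> a (a \<boxtimes> a) X) \<cdot> a \<lhd> \<beta> a a X"
    by simp
  also have "(a \<lhd> m) \<rhd> X \<cdot> \<beta> a (a \<boxtimes> a) X = \<beta> a a X \<cdot> a \<lhd> (m \<rhd> X)"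
    by (simp add: assoc_inv_nat)
  finally show ?thesis by (simp add: mu_def a m_def[symmetric])
qed

lemma mu_eta:
  assumes A: "unital_algebra C A" and a: "alg_obj A = a" and X [simp]: "X \<in> obj C"
  shows "mu A X \<cdot> eta A (a \<boxtimes> X) = ident C (a \<boxtimes> X)" "mu A X \<cdot> a \<lhd> eta A X = ident C (a \<boxtimes> X)"
proof -
  define m u where "m = alg_mult A" and "u = alg_unit A"
  have [simp]: "a \<in> obj C" "m \<in> arr C" "src C m = a \<boxtimes> a" "tgt C m = a"
    "u \<in> arr C" "src C u = U" "tgt C u = a"
    using unital_algebra_simps[OF A] by (simp_all add: m_def u_def a)
  have law: "m \<cdot> u \<rhd> a = lu a" "m \<cdot> a \<lhd> u = ru a"
    using unital_algebra_laws[OF A] by (simp_all add: m_def u_def a)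
  have "mu A X \<cdot> eta A (a \<boxtimes> X) = m \<rhd> X \<cdot> (\<beta> a a X \<cdot> u \<rhd> (a \<boxtimes> X)) \<cdot> lu' (a \<boxtimes> X)"
    by (simp add: mu_def eta_def a m_def[symmetric] u_def[symmetric])
  also have "\<beta> a a X \<cdot> u \<rhd> (a \<boxtimes> X) = (u \<rhd> a) \<rhd> X \<cdot> \<beta> U a X"
    by (simp add: assoc_inv_nat1)
  also have "m \<rhd> X \<cdot> (\<dots>) \<cdot> lu' (a \<boxtimes> X) = (m \<cdot> u \<rhd> a) \<rhd> X \<cdot> \<beta> U a X \<cdot> lu' (a \<boxtimes> X)"
    by simp
  also have "\<dots> = lu a \<rhd> X \<cdot> \<beta> U a X \<cdot> lu' (a \<boxtimes> X)"
    unfolding law ..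
  also have "\<dots> = (lu (a \<boxtimes> X) \<cdot> \<alpha> U a X) \<cdot> \<beta> U a X \<cdot> lu' (a \<boxtimes> X)"
    by (simp only: lunit_tensor \<open>a \<in> obj C\<close> X)
  also have "\<dots> = ident C (a \<boxtimes> X)" by simp
  finally show "mu A X \<cdot> eta A (a \<boxtimes> X) = ident C (a \<boxtimes> X)" .
  have "mu A X \<cdot> a \<lhd> eta A X = m \<rhd> X \<cdot> (\<beta> a a X \<cdot> a \<lhd> (u \<rhd> X)) \<cdot> a \<lhd> lu' X"
    by (simp add: mu_def eta_def a m_def[symmetric] u_def[symmetric])
  also have "\<beta> a a X \<cdot> a \<lhd> (u \<rhd> X) = (a \<lhd> u) \<rhd> X \<cdot> \<beta> a U X"
    by (simp add: assoc_inv_nat)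
  also have "m \<rhd> X \<cdot> (\<dots>) \<cdot> a \<lhd> lu' X = (m \<cdot> a \<lhd> u) \<rhd> X \<cdot> \<beta> a U X \<cdot> a \<lhd> lu' X"
    by simp
  also have "\<dots> = (a \<lhd> lu X \<cdot> \<alpha> a U X) \<cdot> \<beta> a U X \<cdot> a \<lhd> lu' X"
    unfolding law by (simp only: triangle \<open>a \<in> obj C\<close> X)
  also have "\<dots> = ident C (a \<boxtimes> X)" by simp
  finally show "mu A X \<cdot> a \<lhd> eta A X = ident C (a \<boxtimes> X)" .
qed

text \<open>The associator and the unitor are absorbed by \<open>mu\<close> and \<open>eta\<close>;
  being invertible, they can be moved across the axioms in both directions.\<close>

lemma left_module_iff:
  assumes A: "unital_algebra C A" and a: "alg_obj A = a"
  shows "left_module C A (X, x) \<longleftrightarrow> X \<in> obj C \<and> x \<in> arr C \<and> src C x = a \<boxtimes> X \<and> tgt C x = X \<and>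
    x \<cdot> mu A X = x \<cdot> a \<lhd> x \<and> x \<cdot> eta A X = ident C X"
proof (cases "X \<in> obj C \<and> x \<in> arr C \<and> src C x = a \<boxtimes> X \<and> tgt C x = X")
  case True
  then have [simp]: "X \<in> obj C" "x \<in> arr C" "src C x = a \<boxtimes> X" "tgt C x = X" by auto
  have [simp]: "a \<in> obj C" "alg_mult A \<in> arr C" "src C (alg_mult A) = a \<boxtimes> a" "tgt C (alg_mult A) = a"
    "alg_unit A \<in> arr C" "src C (alg_unit A) = U" "tgt C (alg_unit A) = a"
    using unital_algebra_simps[OF A] by (simp_all add: a)
  have "x \<cdot> alg_mult A \<rhd> X = x \<cdot> a \<lhd> x \<cdot> \<alpha> a a X \<longleftrightarrow> x \<cdot> mu A X = x \<cdot> a \<lhd> x"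
  proof
    assume "x \<cdot> alg_mult A \<rhd> X = x \<cdot> a \<lhd> x \<cdot> \<alpha> a a X"
    from cmp_eq_ext[OF this, of "\<beta> a a X"] show "x \<cdot> mu A X = x \<cdot> a \<lhd> x"
      by (simp add: mu_def a)
  next
    assume "x \<cdot> mu A X = x \<cdot> a \<lhd> x"
    then have "(x \<cdot> mu A X) \<cdot> \<alpha> a a X = (x \<cdot> a \<lhd> x) \<cdot> \<alpha> a a X" by (rule arg_cong)
    then show "x \<cdot> alg_mult A \<rhd> X = x \<cdot> a \<lhd> x \<cdot> \<alpha> a a X" by (simp add: mu_def a)
  qed
  moreover have "x \<cdot> alg_unit A \<rhd> X = lu X \<longleftrightarrow> x \<cdot> eta A X = ident C X"
  proof
    assume "x \<cdot> alg_unit A \<rhd> X = lu X"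
    from cmp_eq_ext[OF this, of "lu' X"] show "x \<cdot> eta A X = ident C X"
      by (simp add: eta_def a)
  next
    assume "x \<cdot> eta A X = ident C X"
    then have "(x \<cdot> eta A X) \<cdot> lu X = ident C X \<cdot> lu X" by (rule arg_cong)
    then show "x \<cdot> alg_unit A \<rhd> X = lu X" by (simp add: eta_def a)
  qed
  ultimately show ?thesis by (simp add: left_module_def a Let_def)
qed (auto simp: left_module_def a Let_def)

lemma module_map_iff:
  "module_map C A (X, x) h (Y, y) \<longleftrightarrow> left_module C A (X, x) \<and> left_module C A (Y, y) \<and>
    h \<in> arr C \<and> src C h = X \<and> tgt C h = Y \<and> h \<cdot> x = y \<cdot> alg_obj A \<lhd> h"
  by (auto simp: module_map_def)

text \<open>The two conditions for \<open>f \<rhd> X\<close> to be a morphism of monads, from which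
  restriction of scalars and the map between free modules are obtained.\<close>

lemma hom_mu_eta:
  assumes f: "algebra_hom C A B f" and A: "unital_algebra C A" and B: "unital_algebra C B"
    and [simp]: "X \<in> obj C"
  shows "f \<rhd> X \<cdot> mu A X = mu B X \<cdot> alg_obj B \<lhd> (f \<rhd> X) \<cdot> f \<rhd> (alg_obj A \<boxtimes> X)"
    "f \<rhd> X \<cdot> eta A X = eta B X"
proof -
  note [simp] = unital_algebra_simps[OF A] unital_algebra_simps[OF B] algebra_hom_simps(1-3)[OF f]
  have "f \<rhd> X \<cdot> mu A X = (f \<cdot> alg_mult A) \<rhd> X \<cdot> \<beta> (alg_obj A) (alg_obj A) X"
    by (simp add: mu_def)
  also have "\<dots> = alg_mult B \<rhd> X \<cdot> ((f \<boxdot> f) \<rhd> X \<cdot> \<beta> (alg_obj A) (alg_obj A) X)"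
    unfolding algebra_hom_simps(4)[OF f] by simp
  also have "(f \<boxdot> f) \<rhd> X \<cdot> \<beta> (alg_obj A) (alg_obj A) X = \<beta> (alg_obj B) (alg_obj B) X \<cdot> (f \<boxdot> (f \<rhd> X))"
    by (simp add: assoc_inv_nat)
  also have "f \<boxdot> (f \<rhd> X) = alg_obj B \<lhd> (f \<rhd> X) \<cdot> f \<rhd> (alg_obj A \<boxtimes> X)"
    by (simp add: tens_right_left)
  finally show "f \<rhd> X \<cdot> mu A X = mu B X \<cdot> alg_obj B \<lhd> (f \<rhd> X) \<cdot> f \<rhd> (alg_obj A \<boxtimes> X)"
    by (simp add: mu_def)
  have "f \<rhd> X \<cdot> eta A X = (f \<cdot> alg_unit A) \<rhd> X \<cdot> lu' X"
    by (simp add: eta_def)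
  then show "f \<rhd> X \<cdot> eta A X = eta B X"
    unfolding algebra_hom_simps(5)[OF f] by (simp add: eta_def)
qed

text \<open>With \<open>tau_eta\<close> and the primed versions, these are Beck's axioms of a
  distributive law.\<close>

lemma tau_mu:
  assumes A: "unital_algebra C A" and a: "alg_obj A = a" and [simp]: "b \<in> obj C" "X \<in> obj C"
  shows "tau a b X \<cdot> mu A (b \<boxtimes> X) = b \<lhd> mu A X \<cdot> tau a b (a \<boxtimes> X) \<cdot> a \<lhd> tau a b X"
proof -
  define m where "m = alg_mult A"
  have [simp]: "a \<in> obj C" "m \<in> arr C" "src C m = a \<boxtimes> a" "tgt C m = a"
    using unital_algebra_simps[OF A] by (simp_all add: m_def a)
  have "tau a b X \<cdot> mu A (b \<boxtimes> X) = (tau a b X \<cdot> m \<rhd> (b \<boxtimes> X)) \<cdot> \<beta> a a (b \<boxtimes> X)"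
    by (simp add: mu_def a m_def[symmetric])
  also have "tau a b X \<cdot> m \<rhd> (b \<boxtimes> X) = b \<lhd> (m \<rhd> X) \<cdot> tau (a \<boxtimes> a) b X"
    using tau_nat_left[of m "a \<boxtimes> a" b X] by simp
  also have "(\<dots>) \<cdot> \<beta> a a (b \<boxtimes> X) =
      b \<lhd> (m \<rhd> X) \<cdot> b \<lhd> \<beta> a a X \<cdot> (b \<lhd> \<alpha> a a X \<cdot> tau (a \<boxtimes> a) b X) \<cdot> \<beta> a a (b \<boxtimes> X)"
    by simp
  also have "\<dots> = b \<lhd> mu A X \<cdot> tau a b (a \<boxtimes> X) \<cdot> a \<lhd> tau a b X"
    by (subst tau_tensor_left) (simp_all add: mu_def m_def[symmetric] a)
  finally show ?thesis .
qed

lemma tau_eta: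
  assumes A: "unital_algebra C A" and a: "alg_obj A = a" and [simp]: "b \<in> obj C" "X \<in> obj C"
  shows "tau a b X \<cdot> eta A (b \<boxtimes> X) = b \<lhd> eta A X"
proof -
  define u where "u = alg_unit A"
  have [simp]: "a \<in> obj C" "u \<in> arr C" "src C u = U" "tgt C u = a"
    using unital_algebra_simps[OF A] by (simp_all add: u_def a)
  have "tau a b X \<cdot> eta A (b \<boxtimes> X) = (tau a b X \<cdot> u \<rhd> (b \<boxtimes> X)) \<cdot> lu' (b \<boxtimes> X)"
    by (simp add: eta_def u_def[symmetric])
  also have "tau a b X \<cdot> u \<rhd> (b \<boxtimes> X) = b \<lhd> (u \<rhd> X) \<cdot> tau U b X"
    using tau_nat_left[of u U b X] by simp
  finally have 1: "tau a b X \<cdot> eta A (b \<boxtimes> X) = b \<lhd> (u \<rhd> X) \<cdot> tau U b X \<cdot> lu' (b \<boxtimes> X)"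
    by simp
  have "\<beta> U b X \<cdot> lu' (b \<boxtimes> X) = (lu' b \<rhd> X \<cdot> lu b \<rhd> X) \<cdot> \<beta> U b X \<cdot> lu' (b \<boxtimes> X)"
    by simp
  also have "\<dots> = lu' b \<rhd> X \<cdot> (lu b \<rhd> X) \<cdot> \<beta> U b X \<cdot> lu' (b \<boxtimes> X)"
    by simp
  also have "lu b \<rhd> X = lu (b \<boxtimes> X) \<cdot> \<alpha> U b X" by (simp add: lunit_tensor)
  finally have "\<beta> U b X \<cdot> lu' (b \<boxtimes> X) = lu' b \<rhd> X" by simp
  then have "tau U b X \<cdot> lu' (b \<boxtimes> X) = \<alpha> b U X \<cdot> (sw U b \<cdot> lu' b) \<rhd> X"
    by (simp add: tau_def)
  also have "\<dots> = b \<lhd> lu' X \<cdot> (b \<lhd> lu X \<cdot> \<alpha> b U X) \<cdot> ru' b \<rhd> X"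
    by (simp add: swap_unit)
  also have "\<dots> = b \<lhd> lu' X"
    by (subst triangle) simp_all
  finally show ?thesis using 1 by (simp add: eta_def u_def[symmetric])
qed

text \<open>\<open>tau_mu\<close> conjugated by the inverse exchange.\<close>

lemma tau_mu':
  assumes A: "unital_algebra C A" and a: "alg_obj A = a" and b [simp]: "b \<in> obj C" and X [simp]: "X \<in> obj C"
  shows "tau b a X \<cdot> b \<lhd> mu A X = mu A (b \<boxtimes> X) \<cdot> a \<lhd> tau b a X \<cdot> tau b a (a \<boxtimes> X)"
proof -
  have [simp]: "a \<in> obj C" using A a by auto
  note [simp] = mu_simps[OF A, unfolded a]
  note inv = whisker_inv(1)[OF tau_simps(4)]
  have "mu A (b \<boxtimes> X) \<cdot> a \<lhd> tau b a X \<cdot> tau b a (a \<boxtimes> X) =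
      tau b a X \<cdot> (tau a b X \<cdot> mu A (b \<boxtimes> X)) \<cdot> a \<lhd> tau b a X \<cdot> tau b a (a \<boxtimes> X)"
    using cmp_eq_ext[OF tau_simps(4)[of a b X]] by simp
  also have "\<dots> = tau b a X \<cdot> b \<lhd> mu A X"
    unfolding tau_mu[OF A a b X]
    using cmp_eq_ext[OF inv[of b a X a]] by simp
  finally show ?thesis by simp
qed

lemma tau_eta':
  assumes A: "unital_algebra C A" and a: "alg_obj A = a" and b [simp]: "b \<in> obj C" and X [simp]: "X \<in> obj C"
  shows "tau b a X \<cdot> b \<lhd> eta A X = eta A (b \<boxtimes> X)"
proof -
  have [simp]: "a \<in> obj C" using A a by auto
  note [simp] = mu_simps[OF A, unfolded a]
  show ?thesis
    unfolding tau_eta[OF A a b X, symmetric] using cmp_eq_ext[OF tau_simps(4)[of a b X]] by simp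
qed

end

section \<open>Modules over a tensor product of algebras\<close>

context additive_closed_monoidal
begin

text \<open>Restriction of an action of the tensor algebra along
  \<open>x \<mapsto> x \<otimes> 1\<close>; \<open>rho\<close> is the restriction along
  \<open>y \<mapsto> 1 \<otimes> y\<close>.\<close>

definition lam :: "('o, 'm) alg \<Rightarrow> ('o, 'm) alg \<Rightarrow> ('o, 'm) module_obj \<Rightarrow> 'm" where
  "lam A A' P = snd P \<cdot> \<beta> (alg_obj A) (alg_obj A') (fst P) \<cdot> alg_obj A \<lhd> eta A' (fst P)"

definition rho :: "('o, 'm) alg \<Rightarrow> ('o, 'm) alg \<Rightarrow> ('o, 'm) module_obj \<Rightarrow> 'm" where
  "rho A A' P = snd P \<cdot> \<beta> (alg_obj A) (alg_obj A') (fst P) \<cdot> eta A (alg_obj A' \<boxtimes> fst P)"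

definition biaction :: "('o, 'm) alg \<Rightarrow> ('o, 'm) alg \<Rightarrow> 'o \<Rightarrow> 'm \<Rightarrow> 'm \<Rightarrow> bool" where
  "biaction A A' X l r \<longleftrightarrow> left_module C A (X, l) \<and> left_module C A' (X, r) \<and>
     r \<cdot> alg_obj A' \<lhd> l = l \<cdot> alg_obj A \<lhd> r \<cdot> tau (alg_obj A') (alg_obj A) X"

definition tensor_module :: "('o, 'm) alg \<Rightarrow> ('o, 'm) alg \<Rightarrow> 'o \<Rightarrow> 'm \<Rightarrow> 'm \<Rightarrow> ('o, 'm) module_obj" where
  "tensor_module A A' X l r = (X, l \<cdot> alg_obj A \<lhd> r \<cdot> \<alpha> (alg_obj A) (alg_obj A') X)"

lemma tensor_alg_simps [simp]:
  "alg_obj (tensor_alg C A A') = alg_obj A \<boxtimes> alg_obj A'"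
  by (simp add: tensor_alg_def)

end

locale two_algebras = additive_closed_monoidal C for C :: "('o, 'm) moncat" (structure) +
  fixes A A' :: "('o, 'm) alg"
  assumes A [simp]: "unital_algebra C A" and A' [simp]: "unital_algebra C A'"
begin

abbreviation "a \<equiv> alg_obj A"
abbreviation "a' \<equiv> alg_obj A'"
abbreviation "E \<equiv> tensor_alg C A A'"

lemmas monad_nat = mu_nat[OF A HOL.refl] mu_nat[OF A' HOL.refl] eta_nat[OF A] eta_nat[OF A']
  tau_nat[symmetric]

lemmas monad_nat_ext = cmp_eq_ext[OF mu_nat[OF A HOL.refl]] cmp_eq_ext[OF mu_nat[OF A' HOL.refl]]
  cmp_eq_ext[OF eta_nat[OF A]] cmp_eq_ext[OF eta_nat[OF A']]

text \<open>Up to the associator \<open>\<alpha> a a' X\<close>, the monad of the tensor algebra is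
  the composite of the monads of \<open>A\<close> and \<open>A'\<close> along the distributive law
  \<open>tau\<close>.\<close>

lemma composite_mult_coherence:
  assumes [simp]: "X \<in> obj C"
  shows "\<alpha> a a' X \<cdot> alg_mult E \<rhd> X =
    mu A (a' \<boxtimes> X) \<cdot> a \<lhd> (a \<lhd> mu A' X) \<cdot> a \<lhd> tau a' a (a' \<boxtimes> X) \<cdot>
    \<alpha> a a' (a \<boxtimes> (a' \<boxtimes> X)) \<cdot> (a \<boxtimes> a') \<lhd> \<alpha> a a' X \<cdot> \<alpha> (a \<boxtimes> a') (a \<boxtimes> a') X"
proof -
  define m m' where "m = alg_mult A" and "m' = alg_mult A'"
  have [simp]: "m \<in> arr C" "src C m = a \<boxtimes> a" "tgt C m = a" "m' \<in> arr C" "src C m' = a' \<boxtimes> a'" "tgt C m' = a'"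
    by (simp_all add: m_def m'_def)
  let ?I = "interchange C a a' a a'"
  have I [simp]: "?I \<in> arr C" "src C ?I = (a \<boxtimes> a') \<boxtimes> (a \<boxtimes> a')" "tgt C ?I = (a \<boxtimes> a) \<boxtimes> (a' \<boxtimes> a')"
    by (simp_all add: interchange_def)
  have "\<alpha> a a' X \<cdot> alg_mult E \<rhd> X = (\<alpha> a a' X \<cdot> (m \<boxdot> m') \<rhd> X) \<cdot> ?I \<rhd> X"
    by (simp add: tensor_alg_def m_def m'_def)
  also have "\<alpha> a a' X \<cdot> (m \<boxdot> m') \<rhd> X = (m \<boxdot> (m' \<rhd> X)) \<cdot> \<alpha> (a \<boxtimes> a) (a' \<boxtimes> a') X"
    by (simp add: assoc_nat)
  also have "m \<boxdot> (m' \<rhd> X) = m \<rhd> (a' \<boxtimes> X) \<cdot> (a \<boxtimes> a) \<lhd> (m' \<rhd> X)"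
    by (simp add: tens_left_right)
  also have "(a \<boxtimes> a) \<lhd> (m' \<rhd> X) = (a \<boxtimes> a) \<lhd> mu A' X \<cdot> (a \<boxtimes> a) \<lhd> \<alpha> a' a' X"
    by (simp add: mu_def m'_def[symmetric])
  also have "m \<rhd> (a' \<boxtimes> X) \<cdot> (a \<boxtimes> a) \<lhd> mu A' X \<cdot> (a \<boxtimes> a) \<lhd> \<alpha> a' a' X =
      m \<rhd> (a' \<boxtimes> X) \<cdot> ((a \<boxtimes> a) \<lhd> mu A' X \<cdot> \<beta> a a (a' \<boxtimes> (a' \<boxtimes> X))) \<cdot> \<alpha> a a (a' \<boxtimes> (a' \<boxtimes> X)) \<cdot> (a \<boxtimes> a) \<lhd> \<alpha> a' a' X"
    by simp
  also have "(a \<boxtimes> a) \<lhd> mu A' X \<cdot> \<beta> a a (a' \<boxtimes> (a' \<boxtimes> X)) = \<beta> a a (a' \<boxtimes> X) \<cdot> a \<lhd> (a \<lhd> mu A' X)"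
    using assoc_inv_nat[of "ident C a" "ident C a" "mu A' X" a a "a' \<boxtimes> X"] by simp
  finally have "\<alpha> a a' X \<cdot> alg_mult E \<rhd> X = mu A (a' \<boxtimes> X) \<cdot> a \<lhd> (a \<lhd> mu A' X) \<cdot>
      (\<alpha> a a (a' \<boxtimes> (a' \<boxtimes> X)) \<cdot> (a \<boxtimes> a) \<lhd> \<alpha> a' a' X \<cdot> \<alpha> (a \<boxtimes> a) (a' \<boxtimes> a') X \<cdot> ?I \<rhd> X)"
    by (simp add: mu_def[of A] m_def)
  then show ?thesis unfolding interchange_coherence[OF unital_algebra_simps(1)[OF A] unital_algebra_simps(1)[OF A'] assms, symmetric] .
qed

lemma composite_unit_coherence:
  assumes [simp]: "X \<in> obj C"
  shows "\<alpha> a a' X \<cdot> alg_unit E \<rhd> X = eta A (a' \<boxtimes> X) \<cdot> alg_unit A' \<rhd> X"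
proof -
  define u u' where "u = alg_unit A" and "u' = alg_unit A'"
  have [simp]: "u \<in> arr C" "src C u = U" "tgt C u = a" "u' \<in> arr C" "src C u' = U" "tgt C u' = a'"
    by (simp_all add: u_def u'_def)
  have "lu' (U \<boxtimes> X) \<cdot> (lu (U \<boxtimes> X) \<cdot> \<alpha> U U X) \<cdot> lu' U \<rhd> X = lu' (U \<boxtimes> X)"
    unfolding lunit_tensor[OF tunit_obj assms] by simp
  then have 1: "\<alpha> U U X \<cdot> lu' U \<rhd> X = lu' (U \<boxtimes> X)" by simp
  have "\<alpha> a a' X \<cdot> alg_unit E \<rhd> X = (\<alpha> a a' X \<cdot> (u \<boxdot> u') \<rhd> X) \<cdot> lu' U \<rhd> X"
    by (simp add: tensor_alg_def u_def u'_def)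
  also have "\<alpha> a a' X \<cdot> (u \<boxdot> u') \<rhd> X = (u \<boxdot> (u' \<rhd> X)) \<cdot> \<alpha> U U X"
    by (simp add: assoc_nat)
  also have "u \<boxdot> (u' \<rhd> X) = u \<rhd> (a' \<boxtimes> X) \<cdot> U \<lhd> (u' \<rhd> X)"
    by (simp add: tens_left_right)
  finally have "\<alpha> a a' X \<cdot> alg_unit E \<rhd> X = u \<rhd> (a' \<boxtimes> X) \<cdot> U \<lhd> (u' \<rhd> X) \<cdot> \<alpha> U U X \<cdot> lu' U \<rhd> X"
    by simp
  also have "\<dots> = u \<rhd> (a' \<boxtimes> X) \<cdot> lu' (a' \<boxtimes> X) \<cdot> u' \<rhd> X"
    unfolding 1 by (simp add: lunit_inv_nat)
  finally show ?thesis by (simp add: eta_def u_def u'_def)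
qed

text \<open>Cancelling invertible associators turns the axioms over the tensor algebra into those of
  an algebra for the composite monad.\<close>

lemma tensor_module_iff:
  assumes [simp]: "X \<in> obj C" "x \<in> arr C" "src C x = a \<boxtimes> (a' \<boxtimes> X)" "tgt C x = X"
  shows "left_module C E (X, x \<cdot> \<alpha> a a' X) \<longleftrightarrow>
    x \<cdot> mu A (a' \<boxtimes> X) \<cdot> a \<lhd> (a \<lhd> mu A' X) \<cdot> a \<lhd> tau a' a (a' \<boxtimes> X) = x \<cdot> a \<lhd> (a' \<lhd> x) \<and>
    x \<cdot> eta A (a' \<boxtimes> X) \<cdot> eta A' X = ident C X"
    (is "_ \<longleftrightarrow> ?M = ?R \<and> ?u = _")
proof -
  let ?e = "a \<boxtimes> a'"
  \<comment> \<open>\<open>?\<Phi>\<close> gathers the associators common to both sides and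
    \<open>?\<Psi>\<close> is its inverse, so the two sides may be compared without them.\<close>
  let ?\<Phi> = "\<alpha> a a' (a \<boxtimes> (a' \<boxtimes> X)) \<cdot> ?e \<lhd> \<alpha> a a' X \<cdot> \<alpha> ?e ?e X"
  let ?\<Psi> = "\<beta> ?e ?e X \<cdot> ?e \<lhd> \<beta> a a' X \<cdot> \<beta> a a' (a \<boxtimes> (a' \<boxtimes> X))"
  have l: "(x \<cdot> \<alpha> a a' X) \<cdot> alg_mult E \<rhd> X = ?M \<cdot> ?\<Phi>"
    using composite_mult_coherence[OF assms(1)] by (simp add: tensor_alg_def interchange_def)
  have r: "(x \<cdot> \<alpha> a a' X) \<cdot> ?e \<lhd> (x \<cdot> \<alpha> a a' X) \<cdot> \<alpha> ?e ?e X = ?R \<cdot> ?\<Phi>"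
    using cmp_eq_ext[OF assoc_nat3[of a a' x X], of "?e \<lhd> \<alpha> a a' X \<cdot> \<alpha> ?e ?e X"] by simp
  have "?M \<cdot> ?\<Phi> = ?R \<cdot> ?\<Phi> \<longleftrightarrow> ?M = ?R"
  proof
    assume eq: "?M \<cdot> ?\<Phi> = ?R \<cdot> ?\<Phi>"
    show "?M = ?R" by (rule split_epi_cancel[OF eq, of ?\<Psi>]) simp_all
  qed (rule arg_cong)
  moreover have "(x \<cdot> \<alpha> a a' X) \<cdot> alg_unit E \<rhd> X = lu X \<longleftrightarrow> ?u = ident C X"
  proof -
    have eq: "(x \<cdot> \<alpha> a a' X) \<cdot> alg_unit E \<rhd> X = (x \<cdot> eta A (a' \<boxtimes> X)) \<cdot> alg_unit A' \<rhd> X"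
      using composite_unit_coherence[OF assms(1)] by (simp add: tensor_alg_def)
    show ?thesis
      unfolding eq
    proof
      assume "(x \<cdot> eta A (a' \<boxtimes> X)) \<cdot> alg_unit A' \<rhd> X = lu X"
      from cmp_eq_ext[OF this, of "lu' X"] show "?u = ident C X" by (simp add: eta_def[of A'])
    next
      assume "?u = ident C X"
      then have "?u \<cdot> lu X = ident C X \<cdot> lu X" by (rule arg_cong)
      then show "(x \<cdot> eta A (a' \<boxtimes> X)) \<cdot> alg_unit A' \<rhd> X = lu X" by (simp add: eta_def[of A'])
    qed
  qed
  ultimately show ?thesis
    unfolding left_module_def Let_def prod.case tensor_alg_simps l r by simp
qed

lemma biaction_simps:
  assumes "biaction A A' X l r"
  shows "X \<in> obj C" "l \<in> arr C" "src C l = a \<boxtimes> X" "tgt C l = X" "r \<in> arr C" "src C r = a' \<boxtimes> X" "tgt C r = X"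
    and "l \<cdot> mu A X = l \<cdot> a \<lhd> l" "r \<cdot> mu A' X = r \<cdot> a' \<lhd> r" "l \<cdot> eta A X = ident C X" "r \<cdot> eta A' X = ident C X"
    "r \<cdot> a' \<lhd> l = l \<cdot> a \<lhd> r \<cdot> tau a' a X"
  using assms unfolding biaction_def left_module_iff[OF A HOL.refl] left_module_iff[OF A' HOL.refl] by blast+

lemma left_module_tensor_module:
  assumes b: "biaction A A' X l r"
  shows "left_module C E (tensor_module A A' X l r)"
proof -
  note [simp] = biaction_simps(1-7)[OF b]
  note law = biaction_simps(8-12)[OF b]
  let ?x = "l \<cdot> a \<lhd> r"
  have "?x \<cdot> mu A (a' \<boxtimes> X) \<cdot> a \<lhd> (a \<lhd> mu A' X) \<cdot> a \<lhd> tau a' a (a' \<boxtimes> X) =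
      (l \<cdot> mu A X) \<cdot> a \<lhd> (a \<lhd> (r \<cdot> mu A' X)) \<cdot> a \<lhd> tau a' a (a' \<boxtimes> X)"
    using cmp_eq_ext[OF mu_nat[OF A HOL.refl, of r X], of "a \<lhd> (a \<lhd> mu A' X) \<cdot> a \<lhd> tau a' a (a' \<boxtimes> X)"]
    by simp
  also have "\<dots> = l \<cdot> a \<lhd> (l \<cdot> a \<lhd> r \<cdot> (a \<lhd> (a' \<lhd> r) \<cdot> tau a' a (a' \<boxtimes> X)))"
    unfolding law by simp
  also have "a \<lhd> (a' \<lhd> r) \<cdot> tau a' a (a' \<boxtimes> X) = tau a' a X \<cdot> a' \<lhd> (a \<lhd> r)"
    using tau_nat[of a' a r] by simp
  also have "l \<cdot> a \<lhd> (l \<cdot> a \<lhd> r \<cdot> (\<dots>)) = l \<cdot> a \<lhd> ((l \<cdot> a \<lhd> r \<cdot> tau a' a X) \<cdot> a' \<lhd> (a \<lhd> r))"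
    by simp
  also have "\<dots> = ?x \<cdot> a \<lhd> (a' \<lhd> ?x)"
    unfolding law(5)[symmetric] by simp
  finally have 1: "?x \<cdot> mu A (a' \<boxtimes> X) \<cdot> a \<lhd> (a \<lhd> mu A' X) \<cdot> a \<lhd> tau a' a (a' \<boxtimes> X) = ?x \<cdot> a \<lhd> (a' \<lhd> ?x)" .
  have "?x \<cdot> eta A (a' \<boxtimes> X) \<cdot> eta A' X = (l \<cdot> eta A X) \<cdot> r \<cdot> eta A' X"
    using cmp_eq_ext[OF eta_nat[OF A, of r X], of "eta A' X"] by simp
  then have "?x \<cdot> eta A (a' \<boxtimes> X) \<cdot> eta A' X = ident C X" unfolding law by simp
  with 1 tensor_module_iff[of X ?x] show ?thesis by (simp add: tensor_module_def)
qed

text \<open>Beck's description of algebras over a composite monad. In elements, \<open>(x \<otimes>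
  1) (1 \<otimes> y) = x \<otimes> y = (1 \<otimes> y) (x \<otimes> 1)\<close>: inserting units into
  the multiplication axiom recovers the action from its two restrictions and makes them
  commute.\<close>

lemma tensor_module_eq:
  assumes P: "left_module C E P"
  shows "biaction A A' (fst P) (lam A A' P) (rho A A' P)"
    "tensor_module A A' (fst P) (lam A A' P) (rho A A' P) = P"
proof -
  define X where "X = fst P"
  define x where "x = snd P \<cdot> \<beta> a a' X"
  have P': "X \<in> obj C" "snd P \<in> arr C" "src C (snd P) = (a \<boxtimes> a') \<boxtimes> X" "tgt C (snd P) = X"
    using P by (auto simp: left_module_def X_def Let_def split: prod.splits)
  have x [simp]: "X \<in> obj C" "x \<in> arr C" "src C x = a \<boxtimes> (a' \<boxtimes> X)" "tgt C x = X"
    and Px: "P = (X, x \<cdot> \<alpha> a a' X)"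
    using P' by (simp_all add: x_def prod_eq_iff X_def)
  have M: "x \<cdot> mu A (a' \<boxtimes> X) \<cdot> a \<lhd> (a \<lhd> mu A' X) \<cdot> a \<lhd> tau a' a (a' \<boxtimes> X) = x \<cdot> a \<lhd> (a' \<lhd> x)"
    and u: "x \<cdot> eta A (a' \<boxtimes> X) \<cdot> eta A' X = ident C X"
    using P tensor_module_iff[OF x] unfolding Px by auto
  define l r where "l = x \<cdot> a \<lhd> eta A' X" and "r = x \<cdot> eta A (a' \<boxtimes> X)"
  have l [simp]: "l \<in> arr C" "src C l = a \<boxtimes> X" "tgt C l = X" and r [simp]: "r \<in> arr C" "src C r = a' \<boxtimes> X" "tgt C r = X"
    by (simp_all add: l_def r_def)
  have lr: "lam A A' P = l" "rho A A' P = r"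
    using P' by (simp_all add: lam_def rho_def l_def r_def x_def X_def)
  \<comment> \<open>The multiplication axiom with a tail \<open>y\<close>; each of the four
    identities below chooses \<open>y\<close> so that two of the four algebra factors are
    units.\<close>
  have Mx: "x \<cdot> a \<lhd> (a' \<lhd> x) \<cdot> y =
      x \<cdot> mu A (a' \<boxtimes> X) \<cdot> a \<lhd> (a \<lhd> mu A' X) \<cdot> a \<lhd> tau a' a (a' \<boxtimes> X) \<cdot> y"
    if "y \<in> arr C" "tgt C y = a \<boxtimes> (a' \<boxtimes> (a \<boxtimes> (a' \<boxtimes> X)))" for y
    using cmp_eq_ext[OF M[symmetric], of y] that by simp
  note nat = monad_nat(1-4)[symmetric] cmp_eq_ext[OF tau_simps(4)]
  note te = cmp_eq_ext[OF tau_eta[OF A HOL.refl]] cmp_eq_ext[OF tau_eta[OF A' HOL.refl]]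
    cmp_eq_ext[OF tau_eta'[OF A HOL.refl]] cmp_eq_ext[OF tau_eta'[OF A' HOL.refl]]
    tau_eta[OF A HOL.refl] tau_eta[OF A' HOL.refl] tau_eta'[OF A HOL.refl] tau_eta'[OF A' HOL.refl]
  note me = mu_eta[OF A HOL.refl] mu_eta[OF A' HOL.refl] cmp_eq_ext[OF mu_eta(1)[OF A HOL.refl]]
    cmp_eq_ext[OF mu_eta(2)[OF A HOL.refl]] cmp_eq_ext[OF mu_eta(1)[OF A' HOL.refl]]
    cmp_eq_ext[OF mu_eta(2)[OF A' HOL.refl]]
  have xr: "l \<cdot> a \<lhd> r = x"
  proof -
    have "l \<cdot> a \<lhd> r = x \<cdot> a \<lhd> (eta A' X \<cdot> x \<cdot> eta A (a' \<boxtimes> X))" by (simp add: l_def r_def)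
    also have "eta A' X \<cdot> x \<cdot> eta A (a' \<boxtimes> X) = a' \<lhd> x \<cdot> eta A' (a \<boxtimes> (a' \<boxtimes> X)) \<cdot> eta A (a' \<boxtimes> X)"
      by (simp add: monad_nat_ext)
    also have "x \<cdot> a \<lhd> (\<dots>) = x \<cdot> mu A (a' \<boxtimes> X) \<cdot> a \<lhd> (a \<lhd> mu A' X \<cdot> (tau a' a (a' \<boxtimes> X) \<cdot> eta A' (a \<boxtimes> (a' \<boxtimes> X))) \<cdot> eta A (a' \<boxtimes> X))"
      by (simp add: Mx)
    also have "tau a' a (a' \<boxtimes> X) \<cdot> eta A' (a \<boxtimes> (a' \<boxtimes> X)) = a \<lhd> eta A' (a' \<boxtimes> X)" by (simp add: te)
    also have "a \<lhd> mu A' X \<cdot> a \<lhd> eta A' (a' \<boxtimes> X) \<cdot> eta A (a' \<boxtimes> X) = eta A (a' \<boxtimes> X)"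
      using cmp_eq_ext[OF whisker_inv(1)[OF mu_eta(1)[OF A' HOL.refl, of X], of a]] by simp
    also have "x \<cdot> mu A (a' \<boxtimes> X) \<cdot> a \<lhd> eta A (a' \<boxtimes> X) = x" by (simp add: me)
    finally show ?thesis .
  qed
  have "l \<cdot> a \<lhd> l = x \<cdot> a \<lhd> (eta A' X \<cdot> x \<cdot> a \<lhd> eta A' X)" by (simp add: l_def)
  also have "eta A' X \<cdot> x \<cdot> a \<lhd> eta A' X = a' \<lhd> x \<cdot> eta A' (a \<boxtimes> (a' \<boxtimes> X)) \<cdot> a \<lhd> eta A' X"
    by (simp add: monad_nat_ext)
  also have "x \<cdot> a \<lhd> (\<dots>) = x \<cdot> mu A (a' \<boxtimes> X) \<cdot> a \<lhd> (a \<lhd> mu A' X \<cdot> (tau a' a (a' \<boxtimes> X) \<cdot> eta A' (a \<boxtimes> (a' \<boxtimes> X))) \<cdot> a \<lhd> eta A' X)"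
    by (simp add: Mx)
  also have "tau a' a (a' \<boxtimes> X) \<cdot> eta A' (a \<boxtimes> (a' \<boxtimes> X)) = a \<lhd> eta A' (a' \<boxtimes> X)" by (simp add: te)
  also have "a \<lhd> mu A' X \<cdot> a \<lhd> eta A' (a' \<boxtimes> X) \<cdot> a \<lhd> eta A' X = a \<lhd> eta A' X"
    using cmp_eq_ext[OF whisker_inv(1)[OF mu_eta(1)[OF A' HOL.refl, of X], of a]] by simp
  finally have ll: "l \<cdot> mu A X = l \<cdot> a \<lhd> l" by (simp add: l_def mu_nat)
  have "r \<cdot> a' \<lhd> r = x \<cdot> (eta A (a' \<boxtimes> X) \<cdot> a' \<lhd> x) \<cdot> a' \<lhd> eta A (a' \<boxtimes> X)" by (simp add: r_def)
  also have "eta A (a' \<boxtimes> X) \<cdot> a' \<lhd> x = a \<lhd> (a' \<lhd> x) \<cdot> eta A (a' \<boxtimes> (a \<boxtimes> (a' \<boxtimes> X)))"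
    by (simp add: eta_nat)
  also have "x \<cdot> (\<dots>) \<cdot> a' \<lhd> eta A (a' \<boxtimes> X) =
      x \<cdot> mu A (a' \<boxtimes> X) \<cdot> (a \<lhd> (a \<lhd> mu A' X \<cdot> tau a' a (a' \<boxtimes> X)) \<cdot> eta A (a' \<boxtimes> (a \<boxtimes> (a' \<boxtimes> X)))) \<cdot> a' \<lhd> eta A (a' \<boxtimes> X)"
    by (simp add: Mx)
  also have "a \<lhd> (a \<lhd> mu A' X \<cdot> tau a' a (a' \<boxtimes> X)) \<cdot> eta A (a' \<boxtimes> (a \<boxtimes> (a' \<boxtimes> X))) =
      eta A (a \<boxtimes> (a' \<boxtimes> X)) \<cdot> a \<lhd> mu A' X \<cdot> tau a' a (a' \<boxtimes> X)"
    using eta_nat[OF A, of "a \<lhd> mu A' X \<cdot> tau a' a (a' \<boxtimes> X)"] by (simp del: whisker_left_cmp)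
  also have "x \<cdot> mu A (a' \<boxtimes> X) \<cdot> (\<dots>) \<cdot> a' \<lhd> eta A (a' \<boxtimes> X) = x \<cdot> a \<lhd> mu A' X \<cdot> tau a' a (a' \<boxtimes> X) \<cdot> a' \<lhd> eta A (a' \<boxtimes> X)"
    by (simp add: me)
  also have "tau a' a (a' \<boxtimes> X) \<cdot> a' \<lhd> eta A (a' \<boxtimes> X) = eta A (a' \<boxtimes> (a' \<boxtimes> X))"
    by (simp add: te)
  also have "a \<lhd> mu A' X \<cdot> \<dots> = eta A (a' \<boxtimes> X) \<cdot> mu A' X"
    by (simp add: eta_nat)
  finally have rr: "r \<cdot> mu A' X = r \<cdot> a' \<lhd> r" by (simp add: r_def)
  \<comment> \<open>The units sit in the outer positions of
    \<open>(1 \<otimes> y) (x \<otimes> 1)\<close>, so both multiplications are absorbed and only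
    the exchange \<open>tau a' a X\<close> remains.\<close>
  have "r \<cdot> a' \<lhd> l = x \<cdot> (eta A (a' \<boxtimes> X) \<cdot> a' \<lhd> x) \<cdot> a' \<lhd> (a \<lhd> eta A' X)" by (simp add: r_def l_def)
  also have "eta A (a' \<boxtimes> X) \<cdot> a' \<lhd> x = a \<lhd> (a' \<lhd> x) \<cdot> eta A (a' \<boxtimes> (a \<boxtimes> (a' \<boxtimes> X)))"
    by (simp add: eta_nat)
  also have "x \<cdot> (\<dots>) \<cdot> a' \<lhd> (a \<lhd> eta A' X) =
      x \<cdot> mu A (a' \<boxtimes> X) \<cdot> (a \<lhd> (a \<lhd> mu A' X \<cdot> tau a' a (a' \<boxtimes> X)) \<cdot> eta A (a' \<boxtimes> (a \<boxtimes> (a' \<boxtimes> X)))) \<cdot> a' \<lhd> (a \<lhd> eta A' X)"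
    by (simp add: Mx)
  also have "a \<lhd> (a \<lhd> mu A' X \<cdot> tau a' a (a' \<boxtimes> X)) \<cdot> eta A (a' \<boxtimes> (a \<boxtimes> (a' \<boxtimes> X))) =
      eta A (a \<boxtimes> (a' \<boxtimes> X)) \<cdot> a \<lhd> mu A' X \<cdot> tau a' a (a' \<boxtimes> X)"
    using eta_nat[OF A, of "a \<lhd> mu A' X \<cdot> tau a' a (a' \<boxtimes> X)"] by (simp del: whisker_left_cmp)
  also have "x \<cdot> mu A (a' \<boxtimes> X) \<cdot> (\<dots>) \<cdot> a' \<lhd> (a \<lhd> eta A' X) = x \<cdot> a \<lhd> mu A' X \<cdot> tau a' a (a' \<boxtimes> X) \<cdot> a' \<lhd> (a \<lhd> eta A' X)"
    by (simp add: me)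
  also have "tau a' a (a' \<boxtimes> X) \<cdot> a' \<lhd> (a \<lhd> eta A' X) = a \<lhd> (a' \<lhd> eta A' X) \<cdot> tau a' a X"
    using tau_nat[of a' a "eta A' X"] by simp
  also have "x \<cdot> a \<lhd> mu A' X \<cdot> \<dots> = x \<cdot> tau a' a X"
    using cmp_eq_ext[OF whisker_inv(1)[OF mu_eta(2)[OF A' HOL.refl, of X], of a]] by simp
  finally have rl: "r \<cdot> a' \<lhd> l = l \<cdot> a \<lhd> r \<cdot> tau a' a X"
    using cmp_eq_ext[OF xr, of "tau a' a X"] by simp
  have "l \<cdot> eta A X = ident C X" using u by (simp add: l_def monad_nat(3))
  moreover have "r \<cdot> eta A' X = ident C X" using u by (simp add: r_def)
  ultimately show "biaction A A' (fst P) (lam A A' P) (rho A A' P)"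
    using ll rr rl by (simp add: lr biaction_def left_module_iff[OF A HOL.refl] left_module_iff[OF A' HOL.refl] X_def[symmetric])
  show "tensor_module A A' (fst P) (lam A A' P) (rho A A' P) = P"
    using cmp_eq_ext[OF xr, of "\<alpha> a a' X"] Px[symmetric] by (simp add: lr tensor_module_def X_def[symmetric])
qed

lemma lam_rho_tensor_module:
  assumes b: "biaction A A' X l r"
  shows "lam A A' (tensor_module A A' X l r) = l" "rho A A' (tensor_module A A' X l r) = r"
proof -
  note [simp] = biaction_simps(1-7)[OF b] and law = biaction_simps(8-12)[OF b]
  show "lam A A' (tensor_module A A' X l r) = l"
    using whisker_inv(1)[OF law(4), of a] by (simp add: lam_def tensor_module_def)
  show "rho A A' (tensor_module A A' X l r) = r"
    using eta_nat[OF A, of r X] cmp_eq_ext[OF law(3), of r] by (simp add: rho_def tensor_module_def)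
qed

text \<open>Linearity over the tensor algebra is tested on each factor by inserting the unit of the
  other.\<close>

lemma tensor_module_map_iff:
  assumes b: "biaction A A' X l r" and b': "biaction A A' Y l' r'"
  shows "module_map C E (tensor_module A A' X l r) h (tensor_module A A' Y l' r') \<longleftrightarrow>
    module_map C A (X, l) h (Y, l') \<and> module_map C A' (X, r) h (Y, r')"
proof (cases "h \<in> Hom C X Y")
  case True
  note [simp] = biaction_simps(1-7)[OF b] biaction_simps(1-7)[OF b']
  note law = biaction_simps(8-12)[OF b] and law' = biaction_simps(8-12)[OF b']
  have [simp]: "h \<in> arr C" "src C h = X" "tgt C h = Y" using True by auto
  have "h \<cdot> l \<cdot> a \<lhd> r \<cdot> \<alpha> a a' X = (l' \<cdot> a \<lhd> r' \<cdot> \<alpha> a a' Y) \<cdot> (a \<boxtimes> a') \<lhd> h \<longleftrightarrow>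
      h \<cdot> l = l' \<cdot> a \<lhd> h \<and> h \<cdot> r = r' \<cdot> a' \<lhd> h"
  proof
    assume "h \<cdot> l \<cdot> a \<lhd> r \<cdot> \<alpha> a a' X = (l' \<cdot> a \<lhd> r' \<cdot> \<alpha> a a' Y) \<cdot> (a \<boxtimes> a') \<lhd> h"
    then have "(h \<cdot> l \<cdot> a \<lhd> r) \<cdot> \<alpha> a a' X = (l' \<cdot> a \<lhd> r' \<cdot> a \<lhd> (a' \<lhd> h)) \<cdot> \<alpha> a a' X"
      by (simp add: assoc_nat3)
    from split_epi_cancel[OF this, of "\<beta> a a' X"]
    have eq: "h \<cdot> l \<cdot> a \<lhd> r = l' \<cdot> a \<lhd> r' \<cdot> a \<lhd> (a' \<lhd> h)" by simp
    have "h \<cdot> l \<cdot> a \<lhd> (r \<cdot> eta A' X) = (l' \<cdot> a \<lhd> r' \<cdot> a \<lhd> (a' \<lhd> h)) \<cdot> a \<lhd> eta A' X"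
      unfolding eq[symmetric] by simp
    also have "\<dots> = l' \<cdot> a \<lhd> (r' \<cdot> (a' \<lhd> h \<cdot> eta A' X))" by simp
    also have "a' \<lhd> h \<cdot> eta A' X = eta A' Y \<cdot> h" by (simp add: eta_nat)
    also have "l' \<cdot> a \<lhd> (r' \<cdot> \<dots>) = l' \<cdot> a \<lhd> ((r' \<cdot> eta A' Y) \<cdot> h)" by simp
    finally have 1: "h \<cdot> l = l' \<cdot> a \<lhd> h" unfolding law law' by simp
    have "h \<cdot> (l \<cdot> eta A X) \<cdot> r = (h \<cdot> l \<cdot> a \<lhd> r) \<cdot> eta A (a' \<boxtimes> X)"
      by (simp add: eta_nat)
    also have "\<dots> = l' \<cdot> (a \<lhd> (r' \<cdot> a' \<lhd> h) \<cdot> eta A (a' \<boxtimes> X))" unfolding eq by simp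
    also have "a \<lhd> (r' \<cdot> a' \<lhd> h) \<cdot> eta A (a' \<boxtimes> X) = eta A Y \<cdot> r' \<cdot> a' \<lhd> h"
      using eta_nat[OF A, of "r' \<cdot> a' \<lhd> h"] by (simp del: whisker_left_cmp)
    also have "l' \<cdot> \<dots> = (l' \<cdot> eta A Y) \<cdot> r' \<cdot> a' \<lhd> h" by simp
    finally have 2: "h \<cdot> r = r' \<cdot> a' \<lhd> h" unfolding law law' by simp
    from 1 2 show "h \<cdot> l = l' \<cdot> a \<lhd> h \<and> h \<cdot> r = r' \<cdot> a' \<lhd> h" ..
  next
    assume eq: "h \<cdot> l = l' \<cdot> a \<lhd> h \<and> h \<cdot> r = r' \<cdot> a' \<lhd> h"
    have "h \<cdot> l \<cdot> a \<lhd> r \<cdot> \<alpha> a a' X = (h \<cdot> l) \<cdot> a \<lhd> r \<cdot> \<alpha> a a' X" by simp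
    also have "\<dots> = (l' \<cdot> a \<lhd> h) \<cdot> a \<lhd> r \<cdot> \<alpha> a a' X" unfolding conjunct1[OF eq] ..
    also have "\<dots> = l' \<cdot> a \<lhd> (h \<cdot> r) \<cdot> \<alpha> a a' X" by simp
    also have "\<dots> = l' \<cdot> a \<lhd> r' \<cdot> a \<lhd> (a' \<lhd> h) \<cdot> \<alpha> a a' X" unfolding conjunct2[OF eq] by simp
    finally show "h \<cdot> l \<cdot> a \<lhd> r \<cdot> \<alpha> a a' X = (l' \<cdot> a \<lhd> r' \<cdot> \<alpha> a a' Y) \<cdot> (a \<boxtimes> a') \<lhd> h"
      by (simp add: assoc_nat3)
  qed
  then show ?thesis
    using left_module_tensor_module[OF b] left_module_tensor_module[OF b'] b b'
    by (simp add: tensor_module_def module_map_iff biaction_def)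
qed (auto simp: module_map_def tensor_module_def)

end

section \<open>Induction along algebra homomorphisms\<close>

context additive_closed_monoidal
begin

text \<open>\<open>Y\<close> is the module \<open>E' \<otimes>\<^sub>E X\<close> induced along
  \<open>g\<close>, with unit \<open>u\<close>, characterised as a universal arrow from
  \<open>X\<close> to restriction of scalars in place of a relative tensor product.\<close>

definition universal :: "('o, 'm) alg \<Rightarrow> ('o, 'm) alg \<Rightarrow> 'm \<Rightarrow> ('o, 'm) module_obj \<Rightarrow> 'm
    \<Rightarrow> ('o, 'm) module_obj \<Rightarrow> bool" where
  "universal E E' g X u Y \<longleftrightarrow> left_module C E' Y \<and> module_map C E X u (restrict_obj C g Y) \<and>
     (\<forall>Z k. left_module C E' Z \<longrightarrow> module_map C E X k (restrict_obj C g Z) \<longrightarrow>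
        (\<exists>!h. module_map C E' Y h Z \<and> h \<cdot> u = k))"

text \<open>Isolates what induction asks of \<open>g\<close>, so that it can be verified for
  \<open>f \<boxdot> f'\<close> through pairs of commuting actions instead of algebra axioms for
  tensor algebras.\<close>

definition restricts :: "('o, 'm) alg \<Rightarrow> ('o, 'm) alg \<Rightarrow> 'm \<Rightarrow> bool" where
  "restricts E E' g \<longleftrightarrow> alg_obj E \<in> obj C \<and> alg_obj E' \<in> obj C \<and> g \<in> Hom C (alg_obj E) (alg_obj E') \<and>
     (\<forall>Z. left_module C E' Z \<longrightarrow> left_module C E (restrict_obj C g Z))"

definition retraction :: "('o, 'm) alg \<Rightarrow> ('o, 'm) module_obj \<Rightarrow> ('o, 'm) module_obj \<Rightarrow> 'm \<Rightarrow> 'm \<Rightarrow> bool" where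
  "retraction E X F i p \<longleftrightarrow> module_map C E X i F \<and> module_map C E F p X \<and> p \<cdot> i = ident C (fst X)"

definition free_module :: "('o, 'm) alg \<Rightarrow> 'o \<Rightarrow> ('o, 'm) module_obj" where
  "free_module A V = (alg_obj A \<boxtimes> V, mu A V)"

text \<open>Concrete form of relative projectivity over one algebra: up to a retraction, maps out of
  such a module are prescribed on the generators \<open>V\<close> by arrows of
  \<open>C\<close>.\<close>

definition free_summand :: "('o, 'm) alg \<Rightarrow> ('o, 'm) module_obj \<Rightarrow> bool" where
  "free_summand A X \<longleftrightarrow> (\<exists>V\<in>obj C. \<exists>i p. retraction A X (free_module A V) i p)"

section \<open>Module maps and restriction of scalars\<close>

lemma restrictsD:
  assumes "restricts E E' g"
  shows "alg_obj E \<in> obj C" "alg_obj E' \<in> obj C" "g \<in> arr C" "src C g = alg_obj E" "tgt C g = alg_obj E'"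
    "left_module C E' Z \<Longrightarrow> left_module C E (restrict_obj C g Z)"
  using assms unfolding restricts_def Hom_iff by blast+

lemma left_module_simps:
  assumes "left_module C E X"
  shows "fst X \<in> obj C" "snd X \<in> arr C" "src C (snd X) = alg_obj E \<boxtimes> fst X" "tgt C (snd X) = fst X"
  using assms unfolding left_module_def Let_def Hom_iff case_prod_beta by blast+

lemma module_map_simps:
  assumes "module_map C E X h Y"
  shows "left_module C E X" "left_module C E Y" "h \<in> arr C" "src C h = fst X" "tgt C h = fst Y"
    "h \<cdot> snd X = snd Y \<cdot> alg_obj E \<lhd> h"
  using assms unfolding module_map_def Hom_iff by blast+

lemma module_mapI:
  assumes "left_module C E X" "left_module C E Y" "h \<in> arr C" "src C h = fst X" "tgt C h = fst Y"
    "h \<cdot> snd X = snd Y \<cdot> alg_obj E \<lhd> h"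
  shows "module_map C E X h Y"
  using assms by (simp only: module_map_def Hom_iff)

lemma module_map_ident:
  assumes "alg_obj E \<in> obj C" "left_module C E X"
  shows "module_map C E X (ident C (fst X)) X"
  using assms left_module_simps[OF assms(2)] by (intro module_mapI) simp_all

lemma module_map_cmp:
  assumes "alg_obj E \<in> obj C" and f: "module_map C E X f Y" and g: "module_map C E Y g Z"
  shows "module_map C E X (g \<cdot> f) Z"
proof (rule module_mapI)
  note s [simp] = module_map_simps(3-5)[OF f] module_map_simps(3-5)[OF g] assms(1)
    left_module_simps[OF module_map_simps(1)[OF f]] left_module_simps[OF module_map_simps(1)[OF g]]
    left_module_simps[OF module_map_simps(2)[OF g]]
  have "(g \<cdot> f) \<cdot> snd X = g \<cdot> (f \<cdot> snd X)" by simp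
  also have "\<dots> = (g \<cdot> snd Y) \<cdot> alg_obj E \<lhd> f" unfolding module_map_simps(6)[OF f] by simp
  also have "\<dots> = snd Z \<cdot> alg_obj E \<lhd> (g \<cdot> f)" unfolding module_map_simps(6)[OF g] by simp
  finally show "(g \<cdot> f) \<cdot> snd X = snd Z \<cdot> alg_obj E \<lhd> (g \<cdot> f)" .
qed (use module_map_simps[OF f] module_map_simps[OF g] in simp_all)

lemma module_map_zero:
  assumes "alg_obj E \<in> obj C" and X: "left_module C E X" and Y: "left_module C E Y"
  shows "module_map C E X (zero_arr C (fst X) (fst Y)) Y"
  using assms left_module_simps[OF X] left_module_simps[OF Y] by (intro module_mapI) simp_all

lemma module_map_add:
  assumes "alg_obj E \<in> obj C" and f: "module_map C E X f Y" and g: "module_map C E X g Y"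
  shows "module_map C E X (f \<boxplus> g) Y"
proof (rule module_mapI)
  note s [simp] = module_map_simps(3-5)[OF f] module_map_simps(3-5)[OF g] assms(1)
    left_module_simps[OF module_map_simps(1)[OF f]] left_module_simps[OF module_map_simps(2)[OF g]]
  show "(f \<boxplus> g) \<cdot> snd X = snd Y \<cdot> alg_obj E \<lhd> (f \<boxplus> g)"
    using module_map_simps(6)[OF f] module_map_simps(6)[OF g] by simp
qed (use module_map_simps[OF f] module_map_simps[OF g] in simp_all)

lemma module_map_neg:
  assumes "alg_obj E \<in> obj C" and f: "module_map C E X f Y"
  shows "module_map C E X (neg_arr C f) Y"
proof (rule module_mapI)
  note s [simp] = module_map_simps(3-5)[OF f] assms(1)
    left_module_simps[OF module_map_simps(1)[OF f]] left_module_simps[OF module_map_simps(2)[OF f]]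
  show "neg_arr C f \<cdot> snd X = snd Y \<cdot> alg_obj E \<lhd> neg_arr C f"
    using module_map_simps(6)[OF f] by simp
qed (use module_map_simps[OF f] in simp_all)

lemma fst_restrict_obj [simp]: "fst (restrict_obj C g X) = fst X"
  by (simp add: restrict_obj_def split: prod.splits)

lemma snd_restrict_obj: "snd (restrict_obj C g X) = snd X \<cdot> g \<rhd> fst X"
  by (simp add: restrict_obj_def split: prod.splits)

lemma restrict_module_map:
  assumes r: "restricts E E' g" and h: "module_map C E' X h Y"
  shows "module_map C E (restrict_obj C g X) h (restrict_obj C g Y)"
proof (rule module_mapI)
  have [simp]: "alg_obj E \<in> obj C" "alg_obj E' \<in> obj C" "g \<in> arr C" "src C g = alg_obj E" "tgt C g = alg_obj E'"
    by (rule restrictsD[OF r])+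
  note s [simp] = module_map_simps(3-5)[OF h]
    left_module_simps[OF module_map_simps(1)[OF h]] left_module_simps[OF module_map_simps(2)[OF h]]
  have "h \<cdot> snd X \<cdot> g \<rhd> fst X = (h \<cdot> snd X) \<cdot> g \<rhd> fst X" by simp
  also have "\<dots> = snd Y \<cdot> (alg_obj E' \<lhd> h \<cdot> g \<rhd> fst X)"
    unfolding module_map_simps(6)[OF h] by simp
  also have "alg_obj E' \<lhd> h \<cdot> g \<rhd> fst X = g \<rhd> fst Y \<cdot> alg_obj E \<lhd> h"
    by (simp add: whisker_exchange)
  finally show "h \<cdot> snd (restrict_obj C g X) = snd (restrict_obj C g Y) \<cdot> alg_obj E \<lhd> h"
    by (simp add: snd_restrict_obj)
qed (use restrictsD(6)[OF r] module_map_simps[OF h] in simp_all)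

lemma restricts_algebra_hom:
  assumes f: "algebra_hom C A B f" and A [simp]: "unital_algebra C A" and B [simp]: "unital_algebra C B"
  shows "restricts A B f"
  unfolding restricts_def
proof (intro conjI allI impI)
  fix Z assume Z: "left_module C B Z"
  obtain Y y where Zy: "Z = (Y, y)" by (cases Z)
  note [simp] = algebra_hom_simps(1-3)[OF f]
  have y: "Y \<in> obj C" "y \<in> arr C" "src C y = alg_obj B \<boxtimes> Y" "tgt C y = Y"
    "y \<cdot> mu B Y = y \<cdot> alg_obj B \<lhd> y" "y \<cdot> eta B Y = ident C Y"
    using Z left_module_iff[OF B HOL.refl] unfolding Zy by auto
  note [simp] = y(1-4)
  have "(y \<cdot> f \<rhd> Y) \<cdot> mu A Y = (y \<cdot> mu B Y) \<cdot> alg_obj B \<lhd> (f \<rhd> Y) \<cdot> f \<rhd> (alg_obj A \<boxtimes> Y)"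
    using hom_mu_eta(1)[OF f A B, of Y] by simp
  also have "\<dots> = y \<cdot> alg_obj B \<lhd> (y \<cdot> f \<rhd> Y) \<cdot> f \<rhd> (alg_obj A \<boxtimes> Y)"
    unfolding y(5) by simp
  also have "alg_obj B \<lhd> (y \<cdot> f \<rhd> Y) \<cdot> f \<rhd> (alg_obj A \<boxtimes> Y) = f \<rhd> Y \<cdot> alg_obj A \<lhd> (y \<cdot> f \<rhd> Y)"
    by (simp add: whisker_exchange del: whisker_left_cmp)
  finally show "left_module C A (restrict_obj C f Z)"
    using y(6) hom_mu_eta(2)[OF f A B, of Y]
    by (simp add: Zy restrict_obj_def left_module_iff[OF A HOL.refl])
qed (use algebra_hom_simps[OF f] in simp_all)

section \<open>Free modules and universal arrows\<close>

lemma left_module_free: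
  assumes "unital_algebra C A" "V \<in> obj C"
  shows "left_module C A (free_module A V)"
  using assms mu_assoc[OF assms(1) HOL.refl assms(2)] mu_eta[OF assms(1) HOL.refl assms(2)]
  by (simp add: free_module_def left_module_iff)

lemma free_ext:
  assumes A [simp]: "unital_algebra C A" and X: "left_module C A X" and k [simp]: "k \<in> arr C" "src C k = V" "tgt C k = fst X"
  shows "module_map C A (free_module A V) (snd X \<cdot> alg_obj A \<lhd> k) X" "(snd X \<cdot> alg_obj A \<lhd> k) \<cdot> eta A V = k"
proof -
  note [simp] = left_module_simps[OF X]
  have V [simp]: "V \<in> obj C" using src_in_obj[OF k(1)] by simp
  have law: "snd X \<cdot> mu A (fst X) = snd X \<cdot> alg_obj A \<lhd> snd X" "snd X \<cdot> eta A (fst X) = ident C (fst X)"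
    using X left_module_iff[OF A HOL.refl, of "fst X" "snd X"] by auto
  have "(snd X \<cdot> alg_obj A \<lhd> k) \<cdot> mu A V = (snd X \<cdot> mu A (fst X)) \<cdot> alg_obj A \<lhd> (alg_obj A \<lhd> k)"
    by (simp add: mu_nat[OF A HOL.refl])
  then show "module_map C A (free_module A V) (snd X \<cdot> alg_obj A \<lhd> k) X"
    unfolding law by (intro module_mapI left_module_free X) (simp_all add: free_module_def)
  show "(snd X \<cdot> alg_obj A \<lhd> k) \<cdot> eta A V = k"
    using eta_nat[OF A, of k "fst X"] cmp_eq_ext[OF law(2), of k] by simp
qed

lemma free_unique:
  assumes A [simp]: "unital_algebra C A" and V [simp]: "V \<in> obj C" and h: "module_map C A (free_module A V) h X"
  shows "h = snd X \<cdot> alg_obj A \<lhd> (h \<cdot> eta A V)"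
proof -
  note [simp] = module_map_simps(3-5)[OF h, unfolded free_module_def fst_conv]
    left_module_simps[OF module_map_simps(2)[OF h]]
  have eq: "h \<cdot> mu A V = snd X \<cdot> alg_obj A \<lhd> h"
    using module_map_simps(6)[OF h] by (simp add: free_module_def)
  show ?thesis
    using cmp_eq_ext[OF eq, of "alg_obj A \<lhd> eta A V"] mu_eta(2)[OF A HOL.refl V] by simp
qed

lemma free_module_map_eqI:
  assumes "unital_algebra C A" "V \<in> obj C" "module_map C A (free_module A V) h X"
    "module_map C A (free_module A V) h' X" "h \<cdot> eta A V = h' \<cdot> eta A V"
  shows "h = h'"
  using free_unique[OF assms(1-3)] free_unique[OF assms(1,2,4)] assms(5) by simp

lemma free_hom_map:
  assumes f: "algebra_hom C A B f" and A [simp]: "unital_algebra C A" and B [simp]: "unital_algebra C B"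
    and V [simp]: "V \<in> obj C"
  shows "module_map C A (free_module A V) (f \<rhd> V) (restrict_obj C f (free_module B V))"
proof (rule module_mapI)
  note [simp] = algebra_hom_simps(1-3)[OF f]
  show "left_module C A (restrict_obj C f (free_module B V))"
    by (rule restrictsD(6)[OF restricts_algebra_hom[OF f A B] left_module_free[OF B V]])
  have "f \<rhd> V \<cdot> mu A V = mu B V \<cdot> (alg_obj B \<lhd> (f \<rhd> V) \<cdot> f \<rhd> (alg_obj A \<boxtimes> V))"
    by (rule hom_mu_eta(1)[OF f A B V])
  also have "alg_obj B \<lhd> (f \<rhd> V) \<cdot> f \<rhd> (alg_obj A \<boxtimes> V) = f \<rhd> (alg_obj B \<boxtimes> V) \<cdot> alg_obj A \<lhd> (f \<rhd> V)"
    by (simp add: whisker_exchange)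
  finally show "f \<rhd> V \<cdot> snd (free_module A V) =
      snd (restrict_obj C f (free_module B V)) \<cdot> alg_obj A \<lhd> (f \<rhd> V)"
    by (simp add: free_module_def restrict_obj_def)
qed (use algebra_hom_simps(1-3)[OF f] left_module_free[OF A V] in \<open>simp_all add: free_module_def\<close>)

text \<open>Module maps out of \<open>free_module A V\<close> and out of
  \<open>free_module B V\<close> are both given by arrows out of \<open>V\<close>, and
  \<open>f \<rhd> V\<close> matches the two units.\<close>

lemma universal_free:
  assumes f: "algebra_hom C A B f" and A [simp]: "unital_algebra C A" and B [simp]: "unital_algebra C B"
    and V [simp]: "V \<in> obj C"
  shows "universal A B f (free_module A V) (f \<rhd> V) (free_module B V)"
  unfolding universal_def
proof (intro conjI allI impI)
  fix Z k assume Z: "left_module C B Z" and k: "module_map C A (free_module A V) k (restrict_obj C f Z)"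
  note [simp] = algebra_hom_simps(1-3)[OF f] left_module_simps[OF Z]
  have k' [simp]: "k \<in> arr C" "src C k = alg_obj A \<boxtimes> V" "tgt C k = fst Z"
    using module_map_simps(3-5)[OF k] by (simp_all add: free_module_def)
  note r = restricts_algebra_hom[OF f A B]
  let ?h = "snd Z \<cdot> alg_obj B \<lhd> (k \<cdot> eta A V)"
  have h: "module_map C B (free_module B V) ?h Z" "?h \<cdot> eta B V = k \<cdot> eta A V"
    by (rule free_ext[OF B Z]; simp)+
  have gen: "(h \<cdot> f \<rhd> V) \<cdot> eta A V = h \<cdot> eta B V" if "module_map C B (free_module B V) h Z" for h
    using module_map_simps(3-5)[OF that] hom_mu_eta(2)[OF f A B V] by (simp add: free_module_def)
  show "\<exists>!h. module_map C B (free_module B V) h Z \<and> h \<cdot> f \<rhd> V = k"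
  proof (intro ex1I[of _ ?h] conjI h(1))
    have "module_map C A (free_module A V) (?h \<cdot> f \<rhd> V) (restrict_obj C f Z)"
      by (rule module_map_cmp[OF _ free_hom_map[OF f A B V] restrict_module_map[OF r h(1)]]) simp
    then show "?h \<cdot> f \<rhd> V = k"
      by (rule free_module_map_eqI[OF A V _ k]) (simp only: gen[OF h(1)] h(2))
  next
    fix h assume h': "module_map C B (free_module B V) h Z \<and> h \<cdot> f \<rhd> V = k"
    show "h = ?h"
      by (rule free_module_map_eqI[OF B V conjunct1[OF h'] h(1)])
        (simp only: h(2) gen[OF conjunct1[OF h'], symmetric] conjunct2[OF h'])
  qed
qed (use left_module_free[OF B V] free_hom_map[OF f A B V] in simp_all)

text \<open>A map out of \<open>X\<close> is extended over \<open>F\<close> by \<open>p\<close>,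
  then through the universal arrow, and pulled back along \<open>i'\<close>; uniqueness is tested
  after composition with \<open>p'\<close>.\<close>

lemma universal_retract:
  assumes r: "restricts E E' g" and u: "universal E E' g F t F'"
    and X: "retraction E X F i p" and X': "retraction E' X' F' i' p'"
    and e: "e \<in> Hom C (fst X) (fst X')" "t \<cdot> i = i' \<cdot> e" "e \<cdot> p = p' \<cdot> t"
  shows "universal E E' g X e X'"
proof -
  have E [simp]: "alg_obj E \<in> obj C" "alg_obj E' \<in> obj C" by (rule restrictsD[OF r])+
  have i: "module_map C E X i F" "module_map C E F p X" "p \<cdot> i = ident C (fst X)"
    and i': "module_map C E' X' i' F'" "module_map C E' F' p' X'" "p' \<cdot> i' = ident C (fst X')"
    using X X' by (auto simp: retraction_def)
  have t: "module_map C E F t (restrict_obj C g F')" using u by (simp add: universal_def)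
  note [simp] = module_map_simps(3-5)[OF i(1)] module_map_simps(3-5)[OF i(2)]
    module_map_simps(3-5)[OF i'(1)] module_map_simps(3-5)[OF i'(2)] module_map_simps(3-5)[OF t]
  have [simp]: "e \<in> arr C" "src C e = fst X" "tgt C e = fst X'" using e(1) by auto
  have [simp]: "fst X \<in> obj C" "fst X' \<in> obj C"
    using left_module_simps(1)[OF module_map_simps(1)[OF i(1)]] left_module_simps(1)[OF module_map_simps(1)[OF i'(1)]] .
  have "e = (e \<cdot> p) \<cdot> i" using i(3) by simp
  then have e': "e = p' \<cdot> t \<cdot> i" unfolding e(3) by simp
  have em: "module_map C E X e (restrict_obj C g X')"
    unfolding e' by (rule module_map_cmp[OF E(1) module_map_cmp[OF E(1) i(1) t] restrict_module_map[OF r i'(2)]])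
  show ?thesis
    unfolding universal_def
  proof (intro conjI allI impI em module_map_simps(1)[OF i'(1)])
    fix Z k assume Z: "left_module C E' Z" and k: "module_map C E X k (restrict_obj C g Z)"
    have kp: "module_map C E F (k \<cdot> p) (restrict_obj C g Z)"
      by (rule module_map_cmp[OF E(1) i(2) k])
    note [simp] = module_map_simps(3-5)[OF k]
    have uk: "\<exists>!h. module_map C E' F' h Z \<and> h \<cdot> t = k \<cdot> p"
      using u Z kp unfolding universal_def by blast
    then obtain h where h: "module_map C E' F' h Z" "h \<cdot> t = k \<cdot> p" by blast
    note [simp] = module_map_simps(3-5)[OF h(1)]
    show "\<exists>!h. module_map C E' X' h Z \<and> h \<cdot> e = k"
    proof (intro ex1I[of _ "h \<cdot> i'"] conjI)
      show "module_map C E' X' (h \<cdot> i') Z" by (rule module_map_cmp[OF E(2) i'(1) h(1)])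
      have "(h \<cdot> i') \<cdot> e = (h \<cdot> t) \<cdot> i" by (simp add: e(2))
      then show "(h \<cdot> i') \<cdot> e = k" unfolding h(2) using i(3) by simp
    next
      fix h' assume h': "module_map C E' X' h' Z \<and> h' \<cdot> e = k"
      then have m: "module_map C E' X' h' Z" by simp
      note [simp] = module_map_simps(3-5)[OF m]
      have "(h' \<cdot> p') \<cdot> t = (h' \<cdot> e) \<cdot> p" by (simp add: e(3))
      then have "(h' \<cdot> p') \<cdot> t = k \<cdot> p" using h' by simp
      moreover have "module_map C E' F' (h' \<cdot> p') Z" by (rule module_map_cmp[OF E(2) i'(2) m])
      ultimately have "h' \<cdot> p' = h" using uk h by blast
      then show "h' = h \<cdot> i'" using i'(3) by auto
    qed
  qed
qed

text \<open>The kernel of \<open>1 - e\<close> is the image of \<open>e\<close>: \<open>e\<close>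
  factors through it, and the factor \<open>p\<close> is a retraction because a kernel is
  monic.\<close>

lemma idempotent_splitting:
  assumes "has_kernels C" and e: "e \<in> arr C" "src C e = F" "tgt C e = F" "e \<cdot> e = e"
  obtains X i p where "i \<in> Hom C X F" "p \<in> Hom C F X" "p \<cdot> i = ident C X" "i \<cdot> p = e"
proof -
  note [simp] = e(1-3)
  have F [simp]: "F \<in> obj C" using src_in_obj[OF e(1)] by simp
  let ?k = "ident C F \<boxplus> neg_arr C e"
  have "?k \<in> arr C" by simp
  then obtain i where ker: "is_kernel C ?k i" using assms(1) unfolding has_kernels_def by blast
  have i [simp]: "i \<in> arr C" "tgt C i = F" and ki: "?k \<cdot> i = zero_arr C (src C i) F"
    and ex: "\<And>g. g \<in> arr C \<Longrightarrow> tgt C g = F \<Longrightarrow> ?k \<cdot> g = zero_arr C (src C g) F \<Longrightarrow>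
      \<exists>!h. h \<in> Hom C (src C g) (src C i) \<and> i \<cdot> h = g"
    using ker by (auto simp: is_kernel_def)
  have ei: "e \<cdot> i = i"
  proof -
    have "e \<cdot> i \<boxplus> ?k \<cdot> i = i" by (simp add: add_arr_left_comm)
    then show ?thesis unfolding ki by simp
  qed
  have "?k \<cdot> e = zero_arr C (src C e) F" using e(4) by simp
  then obtain p where p: "p \<in> Hom C F (src C i)" "i \<cdot> p = e" using ex[of e] by auto
  have "i \<cdot> (p \<cdot> i) = i" using cmp_eq_ext[OF p(2), of i] p(1) ei by simp
  moreover have "i \<cdot> ident C (src C i) = i" by simp
  moreover have "\<exists>!h. h \<in> Hom C (src C i) (src C i) \<and> i \<cdot> h = i" using ex[of i] ki by simp
  moreover have "p \<cdot> i \<in> Hom C (src C i) (src C i)" "ident C (src C i) \<in> Hom C (src C i) (src C i)"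
    using p(1) by simp_all
  ultimately have "p \<cdot> i = ident C (src C i)" by blast
  with p show ?thesis by (intro that[of i "src C i" p]) simp_all
qed

text \<open>The splitting in \<open>C\<close> inherits the action
  \<open>p \<cdot> x \<cdot> alg_obj E \<lhd> i\<close> because \<open>e\<close> is linear. The
  hypotheses on \<open>E\<close> are typings, which tensor algebras satisfy by construction.\<close>

lemma module_idempotent_splitting:
  assumes "has_kernels C" and E [simp]: "alg_obj E \<in> obj C"
    and m: "alg_mult E \<in> Hom C (alg_obj E \<boxtimes> alg_obj E) (alg_obj E)" and u: "alg_unit E \<in> Hom C U (alg_obj E)"
    and e: "module_map C E F e F" "e \<cdot> e = e"
  obtains X i p where "retraction E X F i p" "i \<cdot> p = e"
proof -
  define x where "x = snd F"
  have F: "left_module C E F" by (rule module_map_simps(1)[OF e(1)])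
  note [simp] = module_map_simps(3-5)[OF e(1)] left_module_simps[OF F, folded x_def]
  have ex: "e \<cdot> x = x \<cdot> alg_obj E \<lhd> e" using module_map_simps(6)[OF e(1)] by (simp add: x_def)
  have laws: "x \<cdot> alg_mult E \<rhd> fst F = x \<cdot> alg_obj E \<lhd> x \<cdot> \<alpha> (alg_obj E) (alg_obj E) (fst F)"
    "x \<cdot> alg_unit E \<rhd> fst F = lu (fst F)"
    using F unfolding left_module_def Let_def x_def case_prod_beta by blast+
  have [simp]: "alg_mult E \<in> arr C" "src C (alg_mult E) = alg_obj E \<boxtimes> alg_obj E" "tgt C (alg_mult E) = alg_obj E"
    "alg_unit E \<in> arr C" "src C (alg_unit E) = U" "tgt C (alg_unit E) = alg_obj E"
    using m u by auto
  obtain X i p where ip: "i \<in> Hom C X (fst F)" "p \<in> Hom C (fst F) X" "p \<cdot> i = ident C X" "i \<cdot> p = e"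
    using idempotent_splitting[OF assms(1), of e "fst F"] e(2) by auto
  have [simp]: "i \<in> arr C" "src C i = X" "tgt C i = fst F" "p \<in> arr C" "src C p = fst F" "tgt C p = X"
    using ip by auto
  have X [simp]: "X \<in> obj C" using src_in_obj[of i] by simp
  have pe: "p \<cdot> e = p" using cmp_eq_ext[OF ip(3), of p] by (simp flip: ip(4))
  have ei: "e \<cdot> i = i" using cmp_eq_ext[OF ip(4)] ip(3) by (metis \<open>i \<in> arr C\<close> \<open>p \<in> arr C\<close> \<open>src C i = X\<close> \<open>src C p = fst F\<close> \<open>tgt C i = fst F\<close> \<open>tgt C p = X\<close> cmp_ident(1))
  let ?a = "alg_obj E"
  define y where "y = p \<cdot> x \<cdot> ?a \<lhd> i"
  have [simp]: "y \<in> arr C" "src C y = ?a \<boxtimes> X" "tgt C y = X" by (simp_all add: y_def)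
  have iy: "i \<cdot> y = x \<cdot> ?a \<lhd> i"
  proof -
    have "i \<cdot> y = (e \<cdot> x) \<cdot> ?a \<lhd> i" using cmp_eq_ext[OF ip(4), of "x \<cdot> ?a \<lhd> i"] by (simp add: y_def)
    also have "\<dots> = x \<cdot> ?a \<lhd> (e \<cdot> i)" unfolding ex by simp
    finally show ?thesis unfolding ei .
  qed
  have py: "p \<cdot> x = y \<cdot> ?a \<lhd> p"
  proof -
    have "y \<cdot> ?a \<lhd> p = p \<cdot> x \<cdot> ?a \<lhd> (i \<cdot> p)" by (simp add: y_def)
    also have "\<dots> = (p \<cdot> e) \<cdot> x" using ex by (simp add: ip(4))
    finally show ?thesis unfolding pe by simp
  qed
  have 1: "y \<cdot> alg_mult E \<rhd> X = y \<cdot> ?a \<lhd> y \<cdot> \<alpha> ?a ?a X"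
  proof -
    have "y \<cdot> alg_mult E \<rhd> X = p \<cdot> x \<cdot> (?a \<lhd> i \<cdot> alg_mult E \<rhd> X)" by (simp add: y_def)
    also have "?a \<lhd> i \<cdot> alg_mult E \<rhd> X = alg_mult E \<rhd> fst F \<cdot> (?a \<boxtimes> ?a) \<lhd> i"
      by (simp add: whisker_exchange)
    also have "p \<cdot> x \<cdot> \<dots> = p \<cdot> (x \<cdot> alg_mult E \<rhd> fst F) \<cdot> (?a \<boxtimes> ?a) \<lhd> i" by simp
    also have "\<dots> = p \<cdot> x \<cdot> ?a \<lhd> x \<cdot> (\<alpha> ?a ?a (fst F) \<cdot> (?a \<boxtimes> ?a) \<lhd> i)"
      unfolding laws by simp
    also have "\<alpha> ?a ?a (fst F) \<cdot> (?a \<boxtimes> ?a) \<lhd> i = ?a \<lhd> (?a \<lhd> i) \<cdot> \<alpha> ?a ?a X"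
      by (simp add: assoc_nat3)
    also have "p \<cdot> x \<cdot> ?a \<lhd> x \<cdot> \<dots> = (p \<cdot> x) \<cdot> ?a \<lhd> (x \<cdot> ?a \<lhd> i) \<cdot> \<alpha> ?a ?a X" by simp
    also have "\<dots> = y \<cdot> ?a \<lhd> (p \<cdot> i \<cdot> y) \<cdot> \<alpha> ?a ?a X" unfolding py iy[symmetric] by simp
    also have "p \<cdot> i \<cdot> y = y" using cmp_eq_ext[OF ip(3), of y] by simp
    finally show ?thesis .
  qed
  have 2: "y \<cdot> alg_unit E \<rhd> X = lu X"
  proof -
    have "y \<cdot> alg_unit E \<rhd> X = p \<cdot> x \<cdot> (?a \<lhd> i \<cdot> alg_unit E \<rhd> X)" by (simp add: y_def)
    also have "?a \<lhd> i \<cdot> alg_unit E \<rhd> X = alg_unit E \<rhd> fst F \<cdot> U \<lhd> i"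
      by (simp add: whisker_exchange)
    also have "p \<cdot> x \<cdot> \<dots> = p \<cdot> (x \<cdot> alg_unit E \<rhd> fst F) \<cdot> U \<lhd> i" by simp
    also have "\<dots> = (p \<cdot> i) \<cdot> lu X" unfolding laws by (simp add: lunit_nat)
    finally show ?thesis unfolding ip by simp
  qed
  have "left_module C E (X, y)" using 1 2 by (simp add: left_module_def Let_def)
  then have "retraction E (X, y) F i p"
    using F iy py ip(3) by (simp add: retraction_def module_map_def x_def)
  then show ?thesis using that ip(4) by blast
qed

text \<open>The idempotent \<open>i \<cdot> p\<close> of \<open>F\<close> extends along
  \<open>t\<close> to an endomorphism \<open>d\<close> of \<open>F'\<close>, idempotent by
  uniqueness, and the splitting of \<open>d\<close> is the induced module.\<close>

lemma induced_module:
  assumes ker: "has_kernels C" and r: "restricts E E' g"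
    and E: "alg_mult E' \<in> Hom C (alg_obj E' \<boxtimes> alg_obj E') (alg_obj E')" "alg_unit E' \<in> Hom C U (alg_obj E')"
    and u: "universal E E' g F t F'" and X: "retraction E X F i p"
  obtains X' i' p' e where "retraction E' X' F' i' p'" "e \<in> Hom C (fst X) (fst X')"
    "t \<cdot> i = i' \<cdot> e" "e \<cdot> p = p' \<cdot> t"
proof -
  have [simp]: "alg_obj E \<in> obj C" "alg_obj E' \<in> obj C" by (rule restrictsD[OF r])+
  have i: "module_map C E X i F" "module_map C E F p X" "p \<cdot> i = ident C (fst X)"
    using X by (auto simp: retraction_def)
  have t: "module_map C E F t (restrict_obj C g F')" and F': "left_module C E' F'"
    and uni: "\<And>k. module_map C E F k (restrict_obj C g F') \<Longrightarrow> \<exists>!h. module_map C E' F' h F' \<and> h \<cdot> t = k"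
    using u unfolding universal_def by blast+
  note [simp] = module_map_simps(3-5)[OF i(1)] module_map_simps(3-5)[OF i(2)] module_map_simps(3-5)[OF t]
  have ip: "module_map C E F (t \<cdot> i \<cdot> p) (restrict_obj C g F')"
    by (intro module_map_cmp[OF _ _ t] module_map_cmp[OF _ i(2) i(1)]) simp_all
  obtain d where d: "module_map C E' F' d F'" "d \<cdot> t = t \<cdot> i \<cdot> p" using uni[OF ip] by blast
  note [simp] = module_map_simps(3-5)[OF d(1)]
  have "(d \<cdot> d) \<cdot> t = d \<cdot> (t \<cdot> i \<cdot> p)" using d(2) by simp
  also have "\<dots> = (d \<cdot> t) \<cdot> i \<cdot> p" by simp
  also have "\<dots> = t \<cdot> i \<cdot> p" unfolding d(2) using cmp_eq_ext[OF i(3), of p] by simp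
  finally have "(d \<cdot> d) \<cdot> t = t \<cdot> i \<cdot> p" .
  moreover have "module_map C E' F' (d \<cdot> d) F'" by (rule module_map_cmp[OF _ d(1) d(1)]) simp
  ultimately have "d \<cdot> d = d" using uni[OF ip] d by blast
  from module_idempotent_splitting[OF ker _ E d(1) this] obtain X' i' p' where
    X': "retraction E' X' F' i' p'" "i' \<cdot> p' = d" by (metis restrictsD(2)[OF r])
  have i': "module_map C E' X' i' F'" "module_map C E' F' p' X'" "p' \<cdot> i' = ident C (fst X')"
    using X' by (auto simp: retraction_def)
  note [simp] = module_map_simps(3-5)[OF i'(1)] module_map_simps(3-5)[OF i'(2)]
  let ?e = "p' \<cdot> t \<cdot> i"
  have "i' \<cdot> ?e = (d \<cdot> t) \<cdot> i" using cmp_eq_ext[OF X'(2), of "t \<cdot> i"] by simp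
  also have "\<dots> = t \<cdot> i" unfolding d(2) using i(3) by simp
  finally have 1: "t \<cdot> i = i' \<cdot> ?e" by simp
  have "?e \<cdot> p = p' \<cdot> (d \<cdot> t)" unfolding d(2) by simp
  also have "\<dots> = (p' \<cdot> i') \<cdot> p' \<cdot> t" using X'(2) cmp_eq_ext[OF X'(2), of t] by simp
  also have "\<dots> = p' \<cdot> t" unfolding i'(3) by simp
  finally show ?thesis using 1 X'(1) by (intro that[of X' i' p' ?e]) simp_all
qed

text \<open>The remaining unit coherence, again by tensoring with \<open>U\<close> and combining
  pentagon and triangle.\<close>

lemma runit_tensor:
  assumes [simp]: "X \<in> obj C" "Y \<in> obj C"
  shows "X \<lhd> ru Y \<cdot> \<alpha> X Y U = ru (X \<boxtimes> Y)"
proof (rule whisker_right_unit_faithful)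
  have "\<alpha> X Y U \<cdot> ru (X \<boxtimes> Y) \<rhd> U = (\<alpha> X Y U \<cdot> (X \<boxtimes> Y) \<lhd> lu U) \<cdot> \<alpha> (X \<boxtimes> Y) U U"
    by (simp add: triangle)
  also have "\<dots> = X \<lhd> (Y \<lhd> lu U) \<cdot> (\<alpha> X Y (U \<boxtimes> U) \<cdot> \<alpha> (X \<boxtimes> Y) U U)"
    by (simp add: assoc_nat3)
  also have "\<dots> = X \<lhd> (Y \<lhd> lu U \<cdot> \<alpha> Y U U) \<cdot> \<alpha> X (Y \<boxtimes> U) U \<cdot> \<alpha> X Y U \<rhd> U"
    by (simp add: pentagon)
  also have "\<dots> = (X \<lhd> (ru Y \<rhd> U) \<cdot> \<alpha> X (Y \<boxtimes> U) U) \<cdot> \<alpha> X Y U \<rhd> U"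
    by (subst triangle) simp_all
  also have "X \<lhd> (ru Y \<rhd> U) \<cdot> \<alpha> X (Y \<boxtimes> U) U = \<alpha> X Y U \<cdot> (X \<lhd> ru Y) \<rhd> U"
    by (simp add: assoc_nat)
  finally have "\<alpha> X Y U \<cdot> ru (X \<boxtimes> Y) \<rhd> U = \<alpha> X Y U \<cdot> ((X \<lhd> ru Y) \<rhd> U \<cdot> \<alpha> X Y U \<rhd> U)"
    by simp
  from split_mono_cancel[OF this, of "\<beta> X Y U"]
  show "(X \<lhd> ru Y \<cdot> \<alpha> X Y U) \<rhd> U = ru (X \<boxtimes> Y) \<rhd> U" by simp
qed simp_all

text \<open>The right unitor identifies the regular module with the free module on the unit
  object.\<close>

lemma retraction_regular:
  assumes A [simp]: "unital_algebra C A"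
  shows "retraction A (alg_obj A, alg_mult A) (free_module A U) (ru' (alg_obj A)) (ru (alg_obj A))"
proof -
  let ?a = "alg_obj A" and ?m = "alg_mult A"
  have "?m \<cdot> mu A ?a = ?m \<cdot> ?a \<lhd> ?m"
  proof -
    have "?m \<cdot> mu A ?a = (?m \<cdot> ?m \<rhd> ?a) \<cdot> \<beta> ?a ?a ?a" by (simp add: mu_def)
    then show ?thesis unfolding unital_algebra_laws(1)[OF A] by simp
  qed
  moreover have "?m \<cdot> eta A ?a = (?m \<cdot> alg_unit A \<rhd> ?a) \<cdot> lu' ?a" by (simp add: eta_def)
  then have "?m \<cdot> eta A ?a = ident C ?a" unfolding unital_algebra_laws(2)[OF A] by simp
  ultimately have l: "left_module C A (?a, ?m)" by (simp add: left_module_iff[OF A HOL.refl])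
  have "ru ?a \<cdot> mu A U = (ru ?a \<cdot> ?m \<rhd> U) \<cdot> \<beta> ?a ?a U" by (simp add: mu_def)
  also have "\<dots> = ?m \<cdot> ru (?a \<boxtimes> ?a) \<cdot> \<beta> ?a ?a U" by (simp add: runit_nat)
  also have "\<dots> = ?m \<cdot> ?a \<lhd> ru ?a" by (simp flip: runit_tensor)
  finally have 1: "ru ?a \<cdot> mu A U = ?m \<cdot> ?a \<lhd> ru ?a" .
  have "ru' ?a \<cdot> ?m = ru' ?a \<cdot> (?m \<cdot> ?a \<lhd> ru ?a) \<cdot> ?a \<lhd> ru' ?a" by simp
  also have "\<dots> = mu A U \<cdot> ?a \<lhd> ru' ?a" unfolding 1[symmetric] by simp
  finally have 2: "ru' ?a \<cdot> ?m = mu A U \<cdot> ?a \<lhd> ru' ?a" .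
  show ?thesis
    using l left_module_free[OF A tunit_obj] 1 2
    by (simp add: retraction_def module_map_def free_module_def)
qed

text \<open>Both algebras are free on \<open>U\<close>. Applied to the opposite algebras, this
  covers the augmentation term in the right half of the induction.\<close>

lemma universal_regular:
  assumes f: "algebra_hom C A B f" and A [simp]: "unital_algebra C A" and B [simp]: "unital_algebra C B"
  shows "universal A B f (alg_obj A, alg_mult A) f (alg_obj B, alg_mult B)"
proof -
  note [simp] = algebra_hom_simps(1-3)[OF f]
  show ?thesis
    by (rule universal_retract[OF restricts_algebra_hom[OF f A B] universal_free[OF f A B tunit_obj]
          retraction_regular[OF A] retraction_regular[OF B]])
      (simp_all add: runit_nat runit_inv_nat)
qed

lemma algebra_hom_op:
  assumes f: "algebra_hom C A B f" and A [simp]: "unital_algebra C A" and B [simp]: "unital_algebra C B"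
  shows "algebra_hom C (op_alg C A) (op_alg C B) f"
proof -
  note [simp] = algebra_hom_simps(1-3)[OF f]
  have "f \<cdot> alg_mult A \<cdot> sw (alg_obj A) (alg_obj A) = (f \<cdot> alg_mult A) \<cdot> sw (alg_obj A) (alg_obj A)"
    by simp
  also have "\<dots> = alg_mult B \<cdot> (f \<boxdot> f) \<cdot> sw (alg_obj A) (alg_obj A)"
    unfolding algebra_hom_simps(4)[OF f] by simp
  also have "(f \<boxdot> f) \<cdot> sw (alg_obj A) (alg_obj A) = sw (alg_obj B) (alg_obj B) \<cdot> (f \<boxdot> f)"
    by (simp add: swap_nat)
  finally show ?thesis using algebra_hom_simps(5)[OF f] by (simp add: algebra_hom_def)
qed

text \<open>Commutation of the two regular actions is associativity, with the factors brought into
  order by \<open>swap_assoc\<close>.\<close>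

lemma biaction_regular:
  assumes A [simp]: "unital_algebra C A"
  shows "biaction A (op_alg C A) (alg_obj A) (alg_mult A) (alg_mult (op_alg C A))"
    "regular_bimodule C A = tensor_module A (op_alg C A) (alg_obj A) (alg_mult A) (alg_mult (op_alg C A))"
proof -
  let ?a = "alg_obj A" and ?m = "alg_mult A"
  note A' [simp] = unital_algebra_op[OF A]
  have "left_module C A (?a, ?m)" "left_module C (op_alg C A) (?a, alg_mult (op_alg C A))"
    using retraction_regular[OF A] retraction_regular[OF A'] by (simp_all add: retraction_def module_map_def)
  moreover have "(?m \<cdot> sw ?a ?a) \<cdot> ?a \<lhd> ?m = ?m \<cdot> ?a \<lhd> (?m \<cdot> sw ?a ?a) \<cdot> tau ?a ?a ?a"
  proof -
    have "(?m \<cdot> sw ?a ?a) \<cdot> ?a \<lhd> ?m = (?m \<cdot> ?m \<rhd> ?a) \<cdot> sw ?a (?a \<boxtimes> ?a)"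
      by (simp add: swap_nat)
    also have "\<dots> = ?m \<cdot> ?a \<lhd> ?m \<cdot> (\<alpha> ?a ?a ?a \<cdot> sw ?a (?a \<boxtimes> ?a))"
      unfolding unital_algebra_laws(1)[OF A] by simp
    also have "\<alpha> ?a ?a ?a \<cdot> sw ?a (?a \<boxtimes> ?a) = ?a \<lhd> sw ?a ?a \<cdot> tau ?a ?a ?a"
      by (simp add: swap_assoc)
    finally show ?thesis by simp
  qed
  ultimately show "biaction A (op_alg C A) ?a ?m (alg_mult (op_alg C A))"
    by (simp add: biaction_def)
  show "regular_bimodule C A = tensor_module A (op_alg C A) ?a ?m (alg_mult (op_alg C A))"
    by (simp add: regular_bimodule_def tensor_module_def Let_def)
qed

end

section \<open>Free bimodules\<close>

context two_algebras
begin

text \<open>The free module over the tensor algebra, kept as two nested free modules. In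
  \<open>bifree_r\<close> the acting factor \<open>a'\<close> must first pass \<open>a\<close>,
  which is the role of \<open>tau\<close>.\<close>

abbreviation "bifree_obj V \<equiv> a \<boxtimes> (a' \<boxtimes> V)"
abbreviation "bifree_l V \<equiv> mu A (a' \<boxtimes> V)"
abbreviation "bifree_r V \<equiv> a \<lhd> mu A' V \<cdot> tau a' a (a' \<boxtimes> V)"

definition bifree :: "'o \<Rightarrow> ('o, 'm) module_obj" where
  "bifree V = tensor_module A A' (bifree_obj V) (bifree_l V) (bifree_r V)"

text \<open>The axioms of the right action and the commutation come from the axioms of the
  distributive law \<open>tau\<close>, together with the monad laws of \<open>A'\<close> and
  naturality of \<open>mu\<close>.\<close>

lemma biaction_bifree:
  assumes [simp]: "V \<in> obj C"
  shows "biaction A A' (bifree_obj V) (bifree_l V) (bifree_r V)"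
proof -
  have "bifree_r V \<cdot> mu A' (bifree_obj V) = a \<lhd> (mu A' V \<cdot> mu A' (a' \<boxtimes> V)) \<cdot> tau a' a (a' \<boxtimes> (a' \<boxtimes> V)) \<cdot> a' \<lhd> tau a' a (a' \<boxtimes> V)"
    by (simp add: tau_mu)
  also have "\<dots> = a \<lhd> mu A' V \<cdot> (a \<lhd> (a' \<lhd> mu A' V) \<cdot> tau a' a (a' \<boxtimes> (a' \<boxtimes> V))) \<cdot> a' \<lhd> tau a' a (a' \<boxtimes> V)"
    by (subst mu_assoc) simp_all
  also have "a \<lhd> (a' \<lhd> mu A' V) \<cdot> tau a' a (a' \<boxtimes> (a' \<boxtimes> V)) = tau a' a (a' \<boxtimes> V) \<cdot> a' \<lhd> (a \<lhd> mu A' V)"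
    using tau_nat[of a' a "mu A' V"] by simp
  finally have 1: "bifree_r V \<cdot> mu A' (bifree_obj V) = bifree_r V \<cdot> a' \<lhd> bifree_r V" by simp
  have 2: "bifree_r V \<cdot> eta A' (bifree_obj V) = ident C (bifree_obj V)"
    using whisker_inv(1)[OF mu_eta(1)[OF A' HOL.refl, of V], of a] by (simp add: tau_eta)
  have "bifree_r V \<cdot> a' \<lhd> bifree_l V = (a \<lhd> mu A' V \<cdot> mu A (a' \<boxtimes> (a' \<boxtimes> V))) \<cdot> a \<lhd> tau a' a (a' \<boxtimes> V) \<cdot> tau a' a (bifree_obj V)"
    by (simp add: tau_mu')
  also have "a \<lhd> mu A' V \<cdot> mu A (a' \<boxtimes> (a' \<boxtimes> V)) = mu A (a' \<boxtimes> V) \<cdot> a \<lhd> (a \<lhd> mu A' V)"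
    by (simp add: mu_nat)
  finally have 3: "bifree_r V \<cdot> a' \<lhd> bifree_l V = bifree_l V \<cdot> a \<lhd> bifree_r V \<cdot> tau a' a (bifree_obj V)"
    by simp
  have "left_module C A (bifree_obj V, bifree_l V)"
    using left_module_free[OF A, of "a' \<boxtimes> V"] by (simp add: free_module_def)
  with 1 2 3 show ?thesis
    by (simp add: biaction_def left_module_iff[OF A' HOL.refl])
qed

text \<open>The extension proceeds in two stages, over \<open>A'\<close> from \<open>V\<close> and
  then over \<open>A\<close> from \<open>a' \<boxtimes> V\<close>; the second stage stays
  \<open>A'\<close>-linear since the two actions on \<open>X\<close> commute.\<close>

lemma bifree_ext:
  assumes b: "biaction A A' X l r" and k [simp]: "k \<in> arr C" "src C k = V" "tgt C k = X"
  shows "module_map C E (bifree V) (l \<cdot> a \<lhd> (r \<cdot> a' \<lhd> k)) (tensor_module A A' X l r)"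
    "(l \<cdot> a \<lhd> (r \<cdot> a' \<lhd> k)) \<cdot> eta A (a' \<boxtimes> V) \<cdot> eta A' V = k"
proof -
  note [simp] = biaction_simps(1-7)[OF b] and law = biaction_simps(8-12)[OF b]
  have V [simp]: "V \<in> obj C" using src_in_obj[OF k(1)] by simp
  have l: "left_module C A (X, l)" and r: "left_module C A' (X, r)"
    using b by (simp_all add: biaction_def)
  let ?k = "r \<cdot> a' \<lhd> k" and ?h = "l \<cdot> a \<lhd> (r \<cdot> a' \<lhd> k)"
  have k': "module_map C A' (free_module A' V) ?k (X, r)" "?k \<cdot> eta A' V = k"
    using free_ext[OF A' r, of k V] by simp_all
  have h: "module_map C A (free_module A (a' \<boxtimes> V)) ?h (X, l)" "?h \<cdot> eta A (a' \<boxtimes> V) = ?k"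
    using free_ext[OF A l, of ?k "a' \<boxtimes> V"] by simp_all
  have "?k \<cdot> mu A' V = r \<cdot> a' \<lhd> ?k"
    using module_map_simps(6)[OF k'(1)] by (simp add: free_module_def)
  then have "?h \<cdot> bifree_r V = l \<cdot> a \<lhd> (r \<cdot> a' \<lhd> ?k) \<cdot> tau a' a (a' \<boxtimes> V)"
    using whisker_left_cmp[of "mu A' V" ?k a] by simp
  also have "\<dots> = l \<cdot> a \<lhd> r \<cdot> (a \<lhd> (a' \<lhd> ?k) \<cdot> tau a' a (a' \<boxtimes> V))"
    by simp
  also have "a \<lhd> (a' \<lhd> ?k) \<cdot> tau a' a (a' \<boxtimes> V) = tau a' a X \<cdot> a' \<lhd> (a \<lhd> ?k)"
    using tau_nat[of a' a ?k "a' \<boxtimes> V"] by (simp del: whisker_left_cmp)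
  also have "l \<cdot> a \<lhd> r \<cdot> \<dots> = (l \<cdot> a \<lhd> r \<cdot> tau a' a X) \<cdot> a' \<lhd> (a \<lhd> ?k)" by simp
  also have "\<dots> = r \<cdot> a' \<lhd> ?h" unfolding law(5)[symmetric] by simp
  finally have "?h \<cdot> bifree_r V = r \<cdot> a' \<lhd> ?h" .
  then have "module_map C A' (bifree_obj V, bifree_r V) ?h (X, r)"
    using biaction_bifree[OF V] r by (simp add: module_map_iff biaction_def)
  then show "module_map C E (bifree V) ?h (tensor_module A A' X l r)"
    unfolding bifree_def tensor_module_map_iff[OF biaction_bifree[OF V] b]
    using h(1) by (simp add: free_module_def)
  have "?h \<cdot> eta A (a' \<boxtimes> V) \<cdot> eta A' V = (?h \<cdot> eta A (a' \<boxtimes> V)) \<cdot> eta A' V" by simp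
  then show "?h \<cdot> eta A (a' \<boxtimes> V) \<cdot> eta A' V = k" unfolding h(2) k'(2) .
qed

text \<open>Retraces both stages: \<open>A\<close>-linearity reduces \<open>h\<close> to its
  restriction to \<open>a' \<boxtimes> V\<close>, and this restriction is \<open>A'\<close>-linear,
  hence determined on \<open>V\<close>.\<close>

lemma bifree_unique:
  assumes V [simp]: "V \<in> obj C" and b: "biaction A A' X l r"
    and h: "module_map C E (bifree V) h (tensor_module A A' X l r)"
  shows "h = l \<cdot> a \<lhd> (r \<cdot> a' \<lhd> (h \<cdot> eta A (a' \<boxtimes> V) \<cdot> eta A' V))"
proof -
  note [simp] = biaction_simps(1-7)[OF b]
  have h1: "module_map C A (bifree_obj V, bifree_l V) h (X, l)" and h2: "module_map C A' (bifree_obj V, bifree_r V) h (X, r)"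
    using h unfolding bifree_def tensor_module_map_iff[OF biaction_bifree[OF V] b] by auto
  have [simp]: "h \<in> arr C" "src C h = bifree_obj V" "tgt C h = X"
    using module_map_simps(3-5)[OF h1] by simp_all
  have eq: "h \<cdot> bifree_r V = r \<cdot> a' \<lhd> h" using module_map_simps(6)[OF h2] by simp
  let ?k = "h \<cdot> eta A (a' \<boxtimes> V)"
  have "?k \<cdot> mu A' V = h \<cdot> a \<lhd> mu A' V \<cdot> (tau a' a (a' \<boxtimes> V) \<cdot> a' \<lhd> eta A (a' \<boxtimes> V))"
    by (simp add: eta_nat tau_eta')
  also have "\<dots> = (h \<cdot> bifree_r V) \<cdot> a' \<lhd> eta A (a' \<boxtimes> V)" by simp
  also have "\<dots> = r \<cdot> a' \<lhd> ?k" unfolding eq by simp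
  finally have "module_map C A' (free_module A' V) ?k (X, r)"
    using left_module_free[OF A' V] b by (simp add: free_module_def module_map_iff biaction_def)
  from free_unique[OF A' V this] have "?k = r \<cdot> a' \<lhd> (?k \<cdot> eta A' V)"
    by (simp only: snd_conv)
  then have 1: "?k = r \<cdot> a' \<lhd> (h \<cdot> eta A (a' \<boxtimes> V) \<cdot> eta A' V)" by simp
  have "h = l \<cdot> a \<lhd> ?k"
    using free_unique[OF A _ h1[folded free_module_def]] by simp
  then show ?thesis unfolding 1[symmetric] .
qed

lemma bifree_map_eqI:
  assumes V: "V \<in> obj C" and X: "left_module C E X"
    and h: "module_map C E (bifree V) h X" and h': "module_map C E (bifree V) h' X"
    and eq: "h \<cdot> eta A (a' \<boxtimes> V) \<cdot> eta A' V = h' \<cdot> eta A (a' \<boxtimes> V) \<cdot> eta A' V"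
  shows "h = h'"
  using bifree_unique[OF V tensor_module_eq(1)[OF X], unfolded tensor_module_eq(2)[OF X], OF h]
    bifree_unique[OF V tensor_module_eq(1)[OF X], unfolded tensor_module_eq(2)[OF X], OF h'] eq by simp

text \<open>The exchange \<open>tau\<close> identifies the right part of a free bimodule with the
  free module on \<open>a \<boxtimes> V\<close>, so bimodule projectivity passes to the right part
  as well.\<close>

lemma retraction_bifree_right:
  assumes V [simp]: "V \<in> obj C"
  shows "retraction A' (bifree_obj V, bifree_r V) (free_module A' (a \<boxtimes> V)) (tau a a' V) (tau a' a V)"
proof -
  have 1: "mu A' (a \<boxtimes> V) \<cdot> a' \<lhd> tau a a' V = tau a a' V \<cdot> bifree_r V"
  proof -
    have "tau a a' V \<cdot> bifree_r V = (tau a a' V \<cdot> a \<lhd> mu A' V) \<cdot> tau a' a (a' \<boxtimes> V)" by simp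
    also have "\<dots> = mu A' (a \<boxtimes> V) \<cdot> a' \<lhd> tau a a' V"
      by (subst tau_mu') simp_all
    finally show ?thesis by simp
  qed
  have "tau a' a V \<cdot> mu A' (a \<boxtimes> V) = bifree_r V \<cdot> a' \<lhd> tau a' a V"
    by (simp add: tau_mu)
  with 1 show ?thesis
    using biaction_bifree[OF V] left_module_free[OF A', of "a \<boxtimes> V"]
    by (simp add: retraction_def module_map_def free_module_def biaction_def)
qed

end

text \<open>Serves both halves of the induction, with an identity in place of \<open>f\<close> or of
  \<open>f'\<close>.\<close>

locale two_algebra_homs = additive_closed_monoidal C for C :: "('o, 'm) moncat" (structure) +
  fixes A A' B B' :: "('o, 'm) alg" and f f' :: 'm
  assumes A: "unital_algebra C A" and A': "unital_algebra C A'"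
    and B: "unital_algebra C B" and B': "unital_algebra C B'"
    and f: "algebra_hom C A B f" and f': "algebra_hom C A' B' f'"
begin

sublocale AA: two_algebras C A A' by unfold_locales (fact A A')+
sublocale BB: two_algebras C B B' by unfold_locales (fact B B')+

abbreviation "a \<equiv> alg_obj A"
abbreviation "a' \<equiv> alg_obj A'"
abbreviation "b \<equiv> alg_obj B"
abbreviation "b' \<equiv> alg_obj B'"

lemmas [simp] = algebra_hom_simps(1-3)[OF f] algebra_hom_simps(1-3)[OF f']

text \<open>Restriction along \<open>f \<boxdot> f'\<close> acts on the two actions separately;
  naturality of \<open>tau\<close> keeps them commuting.\<close>

lemma restrict_tensor_module:
  assumes bi: "biaction B B' X l r"
  shows "biaction A A' X (l \<cdot> f \<rhd> X) (r \<cdot> f' \<rhd> X)"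
    "restrict_obj C (f \<boxdot> f') (tensor_module B B' X l r) = tensor_module A A' X (l \<cdot> f \<rhd> X) (r \<cdot> f' \<rhd> X)"
proof -
  note [simp] = BB.biaction_simps(1-7)[OF bi] and law = BB.biaction_simps(12)[OF bi]
  have "left_module C A (restrict_obj C f (X, l))" "left_module C A' (restrict_obj C f' (X, r))"
    using bi by (auto simp: biaction_def intro!: restrictsD(6)[OF restricts_algebra_hom[OF f]]
        restrictsD(6)[OF restricts_algebra_hom[OF f']])
  moreover have "(r \<cdot> f' \<rhd> X) \<cdot> a' \<lhd> (l \<cdot> f \<rhd> X) = (l \<cdot> f \<rhd> X) \<cdot> a \<lhd> (r \<cdot> f' \<rhd> X) \<cdot> tau a' a X"
  proof -
    have "(r \<cdot> f' \<rhd> X) \<cdot> a' \<lhd> (l \<cdot> f \<rhd> X) = r \<cdot> (f' \<rhd> X \<cdot> a' \<lhd> l) \<cdot> a' \<lhd> (f \<rhd> X)"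
      by simp
    also have "f' \<rhd> X \<cdot> a' \<lhd> l = b' \<lhd> l \<cdot> f' \<rhd> (b \<boxtimes> X)"
      by (simp add: whisker_exchange)
    also have "r \<cdot> (\<dots>) \<cdot> a' \<lhd> (f \<rhd> X) = (r \<cdot> b' \<lhd> l) \<cdot> f' \<rhd> (b \<boxtimes> X) \<cdot> a' \<lhd> (f \<rhd> X)"
      by simp
    also have "\<dots> = l \<cdot> b \<lhd> r \<cdot> (tau b' b X \<cdot> f' \<rhd> (b \<boxtimes> X)) \<cdot> a' \<lhd> (f \<rhd> X)"
      unfolding law by simp
    also have "tau b' b X \<cdot> f' \<rhd> (b \<boxtimes> X) = b \<lhd> (f' \<rhd> X) \<cdot> tau a' b X"
      using tau_nat_left[of f' a' b X] by simp
    also have "l \<cdot> b \<lhd> r \<cdot> (\<dots>) \<cdot> a' \<lhd> (f \<rhd> X) = l \<cdot> b \<lhd> r \<cdot> b \<lhd> (f' \<rhd> X) \<cdot> (tau a' b X \<cdot> a' \<lhd> (f \<rhd> X))"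
      by simp
    also have "tau a' b X \<cdot> a' \<lhd> (f \<rhd> X) = f \<rhd> (a' \<boxtimes> X) \<cdot> tau a' a X"
      using tau_nat_right[of f a a' X] by simp
    also have "l \<cdot> b \<lhd> r \<cdot> b \<lhd> (f' \<rhd> X) \<cdot> \<dots> = l \<cdot> (b \<lhd> (r \<cdot> f' \<rhd> X) \<cdot> f \<rhd> (a' \<boxtimes> X)) \<cdot> tau a' a X"
      by simp
    also have "b \<lhd> (r \<cdot> f' \<rhd> X) \<cdot> f \<rhd> (a' \<boxtimes> X) = f \<rhd> X \<cdot> a \<lhd> (r \<cdot> f' \<rhd> X)"
      by (subst whisker_exchange) simp_all
    finally show ?thesis by simp
  qed
  ultimately show "biaction A A' X (l \<cdot> f \<rhd> X) (r \<cdot> f' \<rhd> X)"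
    by (simp add: biaction_def restrict_obj_def)
  have "(l \<cdot> b \<lhd> r \<cdot> \<alpha> b b' X) \<cdot> (f \<boxdot> f') \<rhd> X = l \<cdot> b \<lhd> r \<cdot> (f \<boxdot> (f' \<rhd> X)) \<cdot> \<alpha> a a' X"
    by (simp add: assoc_nat)
  also have "f \<boxdot> (f' \<rhd> X) = b \<lhd> (f' \<rhd> X) \<cdot> f \<rhd> (a' \<boxtimes> X)"
    by (simp add: tens_right_left)
  also have "l \<cdot> b \<lhd> r \<cdot> (\<dots>) \<cdot> \<alpha> a a' X = l \<cdot> (b \<lhd> (r \<cdot> f' \<rhd> X) \<cdot> f \<rhd> (a' \<boxtimes> X)) \<cdot> \<alpha> a a' X"
    by simp
  also have "b \<lhd> (r \<cdot> f' \<rhd> X) \<cdot> f \<rhd> (a' \<boxtimes> X) = f \<rhd> X \<cdot> a \<lhd> (r \<cdot> f' \<rhd> X)"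
    by (subst whisker_exchange) simp_all
  finally show "restrict_obj C (f \<boxdot> f') (tensor_module B B' X l r) = tensor_module A A' X (l \<cdot> f \<rhd> X) (r \<cdot> f' \<rhd> X)"
    by (simp add: restrict_obj_def tensor_module_def)
qed

lemma restricts_tensor: "restricts (tensor_alg C A A') (tensor_alg C B B') (f \<boxdot> f')"
  unfolding restricts_def
proof (intro conjI allI impI)
  fix Z assume Z: "left_module C (tensor_alg C B B') Z"
  note b = BB.tensor_module_eq(1)[OF Z]
  from AA.left_module_tensor_module[OF restrict_tensor_module(1)[OF b]]
  show "left_module C (tensor_alg C A A') (restrict_obj C (f \<boxdot> f') Z)"
    unfolding restrict_tensor_module(2)[OF b, symmetric] BB.tensor_module_eq(2)[OF Z] .
qed simp_all

text \<open>Linearity is checked on the two actions separately: \<open>f\<close> and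
  \<open>f'\<close> respect multiplications, and \<open>tau\<close> is natural in each
  factor.\<close>

lemma bifree_hom_map:
  assumes V [simp]: "V \<in> obj C"
  shows "module_map C (tensor_alg C A A') (AA.bifree V) (f \<boxdot> (f' \<rhd> V))
    (restrict_obj C (f \<boxdot> f') (BB.bifree V))"
    "(f \<boxdot> (f' \<rhd> V)) \<cdot> eta A (a' \<boxtimes> V) \<cdot> eta A' V = eta B (b' \<boxtimes> V) \<cdot> eta B' V"
proof -
  let ?t = "f \<boxdot> (f' \<rhd> V)"
  note eB = hom_mu_eta(2)[OF f AA.A BB.A] and eB' = hom_mu_eta(2)[OF f' AA.A' BB.A']
  note mB = hom_mu_eta(1)[OF f AA.A BB.A] and mB' = hom_mu_eta(1)[OF f' AA.A' BB.A']
  have t: "?t = f \<rhd> (b' \<boxtimes> V) \<cdot> a \<lhd> (f' \<rhd> V)" "?t = b \<lhd> (f' \<rhd> V) \<cdot> f \<rhd> (a' \<boxtimes> V)"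
    by (simp_all add: tens_left_right tens_right_left)
  have "?t \<cdot> eta A (a' \<boxtimes> V) \<cdot> eta A' V = b \<lhd> (f' \<rhd> V) \<cdot> (f \<rhd> (a' \<boxtimes> V) \<cdot> eta A (a' \<boxtimes> V)) \<cdot> eta A' V"
    by (simp add: t(2))
  also have "\<dots> = (b \<lhd> (f' \<rhd> V) \<cdot> eta B (a' \<boxtimes> V)) \<cdot> eta A' V"
    by (subst eB) simp_all
  also have "b \<lhd> (f' \<rhd> V) \<cdot> eta B (a' \<boxtimes> V) = eta B (b' \<boxtimes> V) \<cdot> f' \<rhd> V"
    using eta_nat[OF BB.A, of "f' \<rhd> V"] by simp
  also have "(\<dots>) \<cdot> eta A' V = eta B (b' \<boxtimes> V) \<cdot> eta B' V"
    by (simp add: eB')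
  finally show "?t \<cdot> eta A (a' \<boxtimes> V) \<cdot> eta A' V = eta B (b' \<boxtimes> V) \<cdot> eta B' V" .
  note bB = BB.biaction_bifree[OF V]
  have 1: "?t \<cdot> AA.bifree_l V = (BB.bifree_l V \<cdot> f \<rhd> (b \<boxtimes> (b' \<boxtimes> V))) \<cdot> a \<lhd> ?t"
  proof -
    have "?t \<cdot> AA.bifree_l V = b \<lhd> (f' \<rhd> V) \<cdot> f \<rhd> (a' \<boxtimes> V) \<cdot> mu A (a' \<boxtimes> V)"
      by (simp add: t(2))
    also have "\<dots> = (b \<lhd> (f' \<rhd> V) \<cdot> mu B (a' \<boxtimes> V)) \<cdot> b \<lhd> (f \<rhd> (a' \<boxtimes> V)) \<cdot> f \<rhd> (a \<boxtimes> (a' \<boxtimes> V))"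
      unfolding mB[OF tens_obj[OF unital_algebra_simps(1)[OF AA.A'] V]] by simp
    also have "b \<lhd> (f' \<rhd> V) \<cdot> mu B (a' \<boxtimes> V) = mu B (b' \<boxtimes> V) \<cdot> b \<lhd> (b \<lhd> (f' \<rhd> V))"
      by (simp add: mu_nat)
    also have "(\<dots>) \<cdot> b \<lhd> (f \<rhd> (a' \<boxtimes> V)) \<cdot> f \<rhd> (a \<boxtimes> (a' \<boxtimes> V)) = mu B (b' \<boxtimes> V) \<cdot> (b \<lhd> ?t \<cdot> f \<rhd> (a \<boxtimes> (a' \<boxtimes> V)))"
      by (simp add: t(2))
    also have "b \<lhd> ?t \<cdot> f \<rhd> (a \<boxtimes> (a' \<boxtimes> V)) = f \<rhd> (b \<boxtimes> (b' \<boxtimes> V)) \<cdot> a \<lhd> ?t"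
      using whisker_exchange[of f ?t a "b \<boxtimes> (b' \<boxtimes> V)"] by simp
    finally show ?thesis by simp
  qed
  have 2: "?t \<cdot> AA.bifree_r V = (BB.bifree_r V \<cdot> f' \<rhd> (b \<boxtimes> (b' \<boxtimes> V))) \<cdot> a' \<lhd> ?t"
  proof -
    have "(BB.bifree_r V \<cdot> f' \<rhd> (b \<boxtimes> (b' \<boxtimes> V))) \<cdot> a' \<lhd> ?t =
        b \<lhd> mu B' V \<cdot> (tau b' b (b' \<boxtimes> V) \<cdot> f' \<rhd> (b \<boxtimes> (b' \<boxtimes> V))) \<cdot> a' \<lhd> ?t"
      by simp
    also have "tau b' b (b' \<boxtimes> V) \<cdot> f' \<rhd> (b \<boxtimes> (b' \<boxtimes> V)) = b \<lhd> (f' \<rhd> (b' \<boxtimes> V)) \<cdot> tau a' b (b' \<boxtimes> V)"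
      using tau_nat_left[of f' a' b "b' \<boxtimes> V"] by simp
    also have "b \<lhd> mu B' V \<cdot> (\<dots>) \<cdot> a' \<lhd> ?t =
        b \<lhd> mu B' V \<cdot> b \<lhd> (f' \<rhd> (b' \<boxtimes> V)) \<cdot> (tau a' b (b' \<boxtimes> V) \<cdot> a' \<lhd> (b \<lhd> (f' \<rhd> V))) \<cdot> a' \<lhd> (f \<rhd> (a' \<boxtimes> V))"
      by (simp add: t(2))
    also have "tau a' b (b' \<boxtimes> V) \<cdot> a' \<lhd> (b \<lhd> (f' \<rhd> V)) = b \<lhd> (a' \<lhd> (f' \<rhd> V)) \<cdot> tau a' b (a' \<boxtimes> V)"
      using tau_nat[of a' b "f' \<rhd> V"] by simp
    also have "b \<lhd> mu B' V \<cdot> b \<lhd> (f' \<rhd> (b' \<boxtimes> V)) \<cdot> (\<dots>) \<cdot> a' \<lhd> (f \<rhd> (a' \<boxtimes> V)) =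
        b \<lhd> mu B' V \<cdot> b \<lhd> (f' \<rhd> (b' \<boxtimes> V) \<cdot> a' \<lhd> (f' \<rhd> V)) \<cdot> (tau a' b (a' \<boxtimes> V) \<cdot> a' \<lhd> (f \<rhd> (a' \<boxtimes> V)))"
      by simp
    also have "tau a' b (a' \<boxtimes> V) \<cdot> a' \<lhd> (f \<rhd> (a' \<boxtimes> V)) = f \<rhd> (a' \<boxtimes> (a' \<boxtimes> V)) \<cdot> tau a' a (a' \<boxtimes> V)"
      using tau_nat_right[of f a a' "a' \<boxtimes> V"] by simp
    also have "f' \<rhd> (b' \<boxtimes> V) \<cdot> a' \<lhd> (f' \<rhd> V) = b' \<lhd> (f' \<rhd> V) \<cdot> f' \<rhd> (a' \<boxtimes> V)"
      by (simp add: whisker_exchange)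
    also have "b \<lhd> mu B' V \<cdot> b \<lhd> (\<dots>) \<cdot> f \<rhd> (a' \<boxtimes> (a' \<boxtimes> V)) \<cdot> tau a' a (a' \<boxtimes> V) =
        b \<lhd> (mu B' V \<cdot> b' \<lhd> (f' \<rhd> V) \<cdot> f' \<rhd> (a' \<boxtimes> V)) \<cdot> f \<rhd> (a' \<boxtimes> (a' \<boxtimes> V)) \<cdot> tau a' a (a' \<boxtimes> V)"
      by simp
    also have "mu B' V \<cdot> b' \<lhd> (f' \<rhd> V) \<cdot> f' \<rhd> (a' \<boxtimes> V) = f' \<rhd> V \<cdot> mu A' V"
      by (simp add: mB')
    also have "b \<lhd> (\<dots>) \<cdot> f \<rhd> (a' \<boxtimes> (a' \<boxtimes> V)) \<cdot> tau a' a (a' \<boxtimes> V) =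
        b \<lhd> (f' \<rhd> V) \<cdot> (b \<lhd> mu A' V \<cdot> f \<rhd> (a' \<boxtimes> (a' \<boxtimes> V))) \<cdot> tau a' a (a' \<boxtimes> V)"
      by simp
    also have "b \<lhd> mu A' V \<cdot> f \<rhd> (a' \<boxtimes> (a' \<boxtimes> V)) = f \<rhd> (a' \<boxtimes> V) \<cdot> a \<lhd> mu A' V"
      by (simp add: whisker_exchange)
    finally show ?thesis by (simp add: t(2))
  qed
  show "module_map C (tensor_alg C A A') (AA.bifree V) ?t (restrict_obj C (f \<boxdot> f') (BB.bifree V))"
    unfolding AA.bifree_def BB.bifree_def restrict_tensor_module(2)[OF bB]
      AA.tensor_module_map_iff[OF AA.biaction_bifree[OF V] restrict_tensor_module(1)[OF bB]]
    using AA.biaction_bifree[OF V] restrict_tensor_module(1)[OF bB] 1 2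
    by (simp only: module_map_iff biaction_def) simp
qed

text \<open>As for one-sided free modules, maps on both sides are determined on \<open>V\<close>,
  here through the two units.\<close>

lemma universal_bifree:
  assumes V [simp]: "V \<in> obj C"
  shows "universal (tensor_alg C A A') (tensor_alg C B B') (f \<boxdot> f') (AA.bifree V) (f \<boxdot> (f' \<rhd> V)) (BB.bifree V)"
  unfolding universal_def
proof (intro conjI allI impI bifree_hom_map(1))
  let ?E = "tensor_alg C A A'" and ?E' = "tensor_alg C B B'" and ?t = "f \<boxdot> (f' \<rhd> V)"
  show "left_module C ?E' (BB.bifree V)"
    unfolding BB.bifree_def by (rule BB.left_module_tensor_module[OF BB.biaction_bifree[OF V]])
  fix Z k assume Z: "left_module C ?E' Z" and k: "module_map C ?E (AA.bifree V) k (restrict_obj C (f \<boxdot> f') Z)"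
  note r = restricts_tensor
  have k' [simp]: "k \<in> arr C" "src C k = a \<boxtimes> (a' \<boxtimes> V)" "tgt C k = fst Z"
    using module_map_simps(3-5)[OF k] by (simp_all add: AA.bifree_def tensor_module_def)
  let ?k = "k \<cdot> eta A (a' \<boxtimes> V) \<cdot> eta A' V"
  obtain h where h: "module_map C ?E' (BB.bifree V) h Z" "h \<cdot> eta B (b' \<boxtimes> V) \<cdot> eta B' V = ?k"
    using BB.bifree_ext[OF BB.tensor_module_eq(1)[OF Z], of ?k V] unfolding BB.tensor_module_eq(2)[OF Z] by auto
  have gen: "(h \<cdot> ?t) \<cdot> eta A (a' \<boxtimes> V) \<cdot> eta A' V = h \<cdot> eta B (b' \<boxtimes> V) \<cdot> eta B' V"
    if "module_map C ?E' (BB.bifree V) h Z" for h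
    unfolding bifree_hom_map(2)[OF V, symmetric]
    using module_map_simps(3-5)[OF that] by (simp add: BB.bifree_def tensor_module_def)
  show "\<exists>!h. module_map C ?E' (BB.bifree V) h Z \<and> h \<cdot> ?t = k"
  proof (intro ex1I[of _ h] conjI h(1))
    have "module_map C ?E (AA.bifree V) (h \<cdot> ?t) (restrict_obj C (f \<boxdot> f') Z)"
      by (rule module_map_cmp[OF _ bifree_hom_map(1)[OF V] restrict_module_map[OF r h(1)]]) simp
    then show "h \<cdot> ?t = k"
      by (rule AA.bifree_map_eqI[OF V restrictsD(6)[OF r Z] _ k]) (simp only: gen[OF h(1)] h(2))
  next
    fix h' assume h': "module_map C ?E' (BB.bifree V) h' Z \<and> h' \<cdot> ?t = k"
    show "h' = h"
      by (rule BB.bifree_map_eqI[OF V Z conjunct1[OF h'] h(1)])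
        (simp only: h(2) gen[OF conjunct1[OF h'], symmetric] conjunct2[OF h'])
  qed
qed (rule V)

end

section \<open>Module categories\<close>

context additive_closed_monoidal
begin

lemma LMod_simps [simp]:
  "X \<in> obj (LMod C E) \<longleftrightarrow> left_module C E X"
  "(X, h, Y) \<in> arr (LMod C E) \<longleftrightarrow> module_map C E X h Y"
  "src (LMod C E) (X, h, Y) = X" "tgt (LMod C E) (X, h, Y) = Y"
  "ident (LMod C E) X = (X, ident C (fst X), X)"
  "(Y', g, Z) \<cdot>\<^bsub>LMod C E\<^esub> (X, h, Y) = (X, g \<cdot> h, Z)"
  "(X, h, Y) \<boxplus>\<^bsub>LMod C E\<^esub> (X', h', Y') = (X, h \<boxplus> h', Y)"
  "zero_arr (LMod C E) X Y = (X, zero_arr C (fst X) (fst Y), Y)"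
  by (simp_all add: LMod_def)

lemma LMod_HomE:
  assumes "t \<in> Hom (LMod C E) X Y"
  obtains h where "t = (X, h, Y)" "module_map C E X h Y"
  using assms by (cases t) auto

lemma LMod_arrE:
  assumes "t \<in> arr (LMod C E)"
  obtains X h Y where "t = (X, h, Y)" "module_map C E X h Y"
  using assms by (cases t) auto

lemma preadditive_LMod:
  assumes E [simp]: "alg_obj E \<in> obj C"
  shows "preadditive_category (LMod C E)"
proof (intro preadditive_category.intro category.intro preadditive_category_axioms.intro)
  fix f assume "f \<in> arr (LMod C E)"
  then show "src (LMod C E) f \<in> obj (LMod C E)" "tgt (LMod C E) f \<in> obj (LMod C E)"
    by (elim LMod_arrE; simp add: module_map_simps(1,2))+
next
  fix X assume "X \<in> obj (LMod C E)"
  then show "ident (LMod C E) X \<in> Hom (LMod C E) X X"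
    by (simp add: module_map_ident)
next
  fix f X Y g Z assume "f \<in> Hom (LMod C E) X Y" "g \<in> Hom (LMod C E) Y Z"
  then show "g \<cdot>\<^bsub>LMod C E\<^esub> f \<in> Hom (LMod C E) X Z"
    by (elim LMod_HomE) (simp add: module_map_cmp[OF E])
next
  fix f X Y assume "f \<in> Hom (LMod C E) X Y"
  then show "f \<cdot>\<^bsub>LMod C E\<^esub> ident (LMod C E) X = f" "ident (LMod C E) Y \<cdot>\<^bsub>LMod C E\<^esub> f = f"
    by (elim LMod_HomE; simp add: module_map_simps(3-5))+
next
  fix f W X g Y h Z
  assume "f \<in> Hom (LMod C E) W X" "g \<in> Hom (LMod C E) X Y" "h \<in> Hom (LMod C E) Y Z"
  then show "(h \<cdot>\<^bsub>LMod C E\<^esub> g) \<cdot>\<^bsub>LMod C E\<^esub> f = h \<cdot>\<^bsub>LMod C E\<^esub> g \<cdot>\<^bsub>LMod C E\<^esub> f"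
    by (elim LMod_HomE) (simp add: module_map_simps(3-5))
next
  fix f X Y f' g Z
  assume "f \<in> Hom (LMod C E) X Y" "f' \<in> Hom (LMod C E) X Y" "g \<in> Hom (LMod C E) Y Z"
  then show "g \<cdot>\<^bsub>LMod C E\<^esub> (f \<boxplus>\<^bsub>LMod C E\<^esub> f') = (g \<cdot>\<^bsub>LMod C E\<^esub> f) \<boxplus>\<^bsub>LMod C E\<^esub> (g \<cdot>\<^bsub>LMod C E\<^esub> f')"
    by (elim LMod_HomE) (simp add: module_map_simps(3-5))
next
  fix f X Y g Z g'
  assume "f \<in> Hom (LMod C E) X Y" "g \<in> Hom (LMod C E) Y Z" "g' \<in> Hom (LMod C E) Y Z"
  then show "(g \<boxplus>\<^bsub>LMod C E\<^esub> g') \<cdot>\<^bsub>LMod C E\<^esub> f = (g \<cdot>\<^bsub>LMod C E\<^esub> f) \<boxplus>\<^bsub>LMod C E\<^esub> (g' \<cdot>\<^bsub>LMod C E\<^esub> f)"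
    by (elim LMod_HomE) (simp add: module_map_simps(3-5))
next
  fix X Y assume "X \<in> obj (LMod C E)" "Y \<in> obj (LMod C E)"
  then have X: "left_module C E X" and Y: "left_module C E Y" by simp_all
  show "comm_group (hom_group (LMod C E) X Y)"
  proof (rule comm_groupI)
    show "\<one>\<^bsub>hom_group (LMod C E) X Y\<^esub> \<in> carrier (hom_group (LMod C E) X Y)"
      using module_map_zero[OF E X Y] by (simp add: hom_group_def)
  next
    fix x y assume "x \<in> carrier (hom_group (LMod C E) X Y)" "y \<in> carrier (hom_group (LMod C E) X Y)"
    then have "x \<in> Hom (LMod C E) X Y" "y \<in> Hom (LMod C E) X Y" by (simp_all add: hom_group_def)
    then show "x \<otimes>\<^bsub>hom_group (LMod C E) X Y\<^esub> y \<in> carrier (hom_group (LMod C E) X Y)"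
      "x \<otimes>\<^bsub>hom_group (LMod C E) X Y\<^esub> y = y \<otimes>\<^bsub>hom_group (LMod C E) X Y\<^esub> x"
      by (elim LMod_HomE; simp add: hom_group_def module_map_add[OF E] add_arr_comm module_map_simps(3-5))+
  next
    fix x y z assume "x \<in> carrier (hom_group (LMod C E) X Y)" "y \<in> carrier (hom_group (LMod C E) X Y)"
      "z \<in> carrier (hom_group (LMod C E) X Y)"
    then have "x \<in> Hom (LMod C E) X Y" "y \<in> Hom (LMod C E) X Y" "z \<in> Hom (LMod C E) X Y"
      by (simp_all add: hom_group_def)
    then show "(x \<otimes>\<^bsub>hom_group (LMod C E) X Y\<^esub> y) \<otimes>\<^bsub>hom_group (LMod C E) X Y\<^esub> z =
        x \<otimes>\<^bsub>hom_group (LMod C E) X Y\<^esub> (y \<otimes>\<^bsub>hom_group (LMod C E) X Y\<^esub> z)"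
      by (elim LMod_HomE) (simp add: hom_group_def add_arr_assoc module_map_simps(3-5))
  next
    fix x assume "x \<in> carrier (hom_group (LMod C E) X Y)"
    then have x: "x \<in> Hom (LMod C E) X Y" by (simp add: hom_group_def)
    then show "\<one>\<^bsub>hom_group (LMod C E) X Y\<^esub> \<otimes>\<^bsub>hom_group (LMod C E) X Y\<^esub> x = x"
      by (elim LMod_HomE) (simp add: hom_group_def module_map_simps(3-5))
    from x obtain h where h: "x = (X, h, Y)" "module_map C E X h Y" by (rule LMod_HomE)
    then show "\<exists>y\<in>carrier (hom_group (LMod C E) X Y).
        y \<otimes>\<^bsub>hom_group (LMod C E) X Y\<^esub> x = \<one>\<^bsub>hom_group (LMod C E) X Y\<^esub>"
      using module_map_neg[OF E h(2)] module_map_simps[OF h(2)]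
      by (intro bexI[of _ "(X, neg_arr C h, Y)"]) (simp_all add: hom_group_def)
  qed
qed

lemma neg_arr_LMod:
  assumes E: "alg_obj E \<in> obj C" and h: "module_map C E X h Y"
  shows "neg_arr (LMod C E) (X, h, Y) = (X, neg_arr C h, Y)"
proof -
  interpret M: preadditive_category "LMod C E" by (rule preadditive_LMod[OF E])
  show ?thesis
    by (rule M.neg_arr_unique) (use h module_map_neg[OF E h] module_map_simps[OF h] in simp_all)
qed

lemma zero_object_LMod_iff:
  assumes E: "alg_obj E \<in> obj C"
  shows "zero_object (LMod C E) X \<longleftrightarrow> left_module C E X \<and> ident C (fst X) = zero_arr C (fst X) (fst X)"
proof -
  interpret M: preadditive_category "LMod C E" by (rule preadditive_LMod[OF E])
  show ?thesis
  proof (cases "left_module C E X")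
    case True
    then show ?thesis using M.zero_object_iff_ident_zero[of X] by simp
  next
    case False
    then show ?thesis by (simp add: zero_object_def)
  qed
qed

lemma zero_object_module_map:
  assumes E: "alg_obj E \<in> obj C" and X: "zero_object (LMod C E) X" and h: "h \<in> arr C"
  shows "src C h = fst X \<Longrightarrow> h = zero_arr C (fst X) (tgt C h)" "tgt C h = fst X \<Longrightarrow> h = zero_arr C (src C h) (fst X)"
proof -
  have X': "left_module C E X" "ident C (fst X) = zero_arr C (fst X) (fst X)"
    using X zero_object_LMod_iff[OF E] by blast+
  note left_module_simps(1)[OF X'(1)]
  then have "zero_object C (fst X)" using X'(2) zero_object_iff_ident_zero by simp
  from zero_object_arr[OF this h] show "src C h = fst X \<Longrightarrow> h = zero_arr C (fst X) (tgt C h)"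
    "tgt C h = fst X \<Longrightarrow> h = zero_arr C (src C h) (fst X)" by blast+
qed

text \<open>Arrows of \<open>LMod\<close> carry their source and target. Separating the modules from
  the underlying arrows lets chain conditions be stated in \<open>C\<close>;
  \<open>chain_complex_LModE\<close> brings every complex of modules into this form.\<close>

definition module_cplx :: "(int \<Rightarrow> ('o, 'm) module_obj) \<Rightarrow> (int \<Rightarrow> 'm)
    \<Rightarrow> (('o, 'm) module_obj, ('o, 'm) module_arr) cplx" where
  "module_cplx X d = (X, \<lambda>n. (X n, d n, X (n - 1)))"

lemma module_cplx_simps [simp]:
  "fst (module_cplx X d) = X" "snd (module_cplx X d) n = (X n, d n, X (n - 1))"
  by (simp_all add: module_cplx_def)

lemma chain_complex_module_cplx:
  "chain_complex (LMod C E) (module_cplx X d) \<longleftrightarrow>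
    (\<forall>n. module_map C E (X n) (d n) (X (n - 1)) \<and> d (n - 1) \<cdot> d n = zero_arr C (fst (X n)) (fst (X (n - 2))))"
  by (auto simp: chain_complex_def dest: module_map_simps(1))

lemma chain_complex_LModE:
  assumes "chain_complex (LMod C E) X"
  obtains d where "X = module_cplx (fst X) d"
proof -
  have "snd X n \<in> Hom (LMod C E) (fst X n) (fst X (n - 1))" for n
    using assms unfolding chain_complex_def by blast
  then have "snd X n = (fst X n, forget_arr (snd X n), fst X (n - 1))" for n
    by (rule LMod_HomE[of "snd X n"]) (simp add: forget_arr_def)
  then have "X = module_cplx (fst X) (\<lambda>n. forget_arr (snd X n))"
    unfolding module_cplx_def by (metis (no_types, lifting) ext prod.collapse)
  then show ?thesis by (rule that)
qed

lemma chain_map_module_cplx: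
  "chain_map (LMod C E) (module_cplx X d) (module_cplx Y e) (\<lambda>n. (X n, g n, Y n)) \<longleftrightarrow>
    chain_complex (LMod C E) (module_cplx X d) \<and> chain_complex (LMod C E) (module_cplx Y e) \<and>
    (\<forall>n. module_map C E (X n) (g n) (Y n) \<and> e n \<cdot> g n = g (n - 1) \<cdot> d n)"
  by (auto simp: chain_map_def)

lemma chain_map_LModE:
  assumes "chain_map (LMod C E) X Y t"
  obtains g where "t = (\<lambda>n. (fst X n, g n, fst Y n))"
proof -
  have "t n \<in> Hom (LMod C E) (fst X n) (fst Y n)" for n
    using assms unfolding chain_map_def by blast
  then have "t n = (fst X n, forget_arr (t n), fst Y n)" for n
    by (rule LMod_HomE[of "t n"]) (simp add: forget_arr_def)
  then have "t = (\<lambda>n. (fst X n, forget_arr (t n), fst Y n))" by (rule ext)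
  then show ?thesis by (rule that)
qed

lemma chain_homotopic_module_cplxE:
  assumes "chain_homotopic (LMod C E) (module_cplx X d) (module_cplx Y e)
    (\<lambda>n. (X n, g n, Y n)) (\<lambda>n. (X n, g' n, Y n))"
  obtains h where "\<And>n. module_map C E (X n) (h n) (Y (n + 1))"
    "\<And>n. g n = g' n \<boxplus> ((e (n + 1) \<cdot> h n) \<boxplus> (h (n - 1) \<cdot> d n))"
proof -
  obtain t where t: "\<And>n. t n \<in> Hom (LMod C E) (X n) (Y (n + 1))"
    and eq: "\<And>n. (X n, g n, Y n) = (X n, g' n, Y n) \<boxplus>\<^bsub>LMod C E\<^esub>
      ((snd (module_cplx Y e) (n + 1) \<cdot>\<^bsub>LMod C E\<^esub> t n) \<boxplus>\<^bsub>LMod C E\<^esub>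
       (t (n - 1) \<cdot>\<^bsub>LMod C E\<^esub> snd (module_cplx X d) n))"
    using assms unfolding chain_homotopic_def by auto
  have t': "t n = (X n, forget_arr (t n), Y (n + 1)) \<and> module_map C E (X n) (forget_arr (t n)) (Y (n + 1))" for n
    using t[of n] by (elim LMod_HomE) (auto simp: forget_arr_def)
  have t0: "t n = (X n, forget_arr (t n), Y (n + 1))" for n using t' by blast
  show ?thesis
  proof (rule that[of "\<lambda>n. forget_arr (t n)"])
    fix n
    show "module_map C E (X n) (forget_arr (t n)) (Y (n + 1))" using t' by blast
    have "(X n, g n, Y n) = (X n, g' n, Y n) \<boxplus>\<^bsub>LMod C E\<^esub>
      (((Y (n + 1), e (n + 1), Y (n + 1 - 1)) \<cdot>\<^bsub>LMod C E\<^esub> (X n, forget_arr (t n), Y (n + 1))) \<boxplus>\<^bsub>LMod C E\<^esub>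
       ((X (n - 1), forget_arr (t (n - 1)), Y (n - 1 + 1)) \<cdot>\<^bsub>LMod C E\<^esub> (X n, d n, X (n - 1))))"
      using eq[of n] t0[of n] t0[of "n - 1"] unfolding module_cplx_simps by metis
    then show "g n = g' n \<boxplus> (e (n + 1) \<cdot> forget_arr (t n) \<boxplus> forget_arr (t (n - 1)) \<cdot> d n)"
      by simp
  qed
qed

lemma forget_module_cplx [simp]:
  "fst (map_cplx forget_obj forget_arr (module_cplx X d)) n = fst (X n)"
  "snd (map_cplx forget_obj forget_arr (module_cplx X d)) n = d n"
  by (simp_all add: map_cplx_def forget_obj_def forget_arr_def module_cplx_def)

lemma exact_module_cplxI:
  assumes cX: "chain_complex (LMod C E) (module_cplx X d)"
    and h: "\<And>n. h n \<in> Hom C (fst (X n)) (fst (X (n + 1)))"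
    and eq: "\<And>n. ident C (fst (X n)) = d (n + 1) \<cdot> h n \<boxplus> h (n - 1) \<cdot> d n"
  shows "exact_complex C E (module_cplx X d)"
proof -
  let ?F = "map_cplx forget_obj forget_arr (module_cplx X d)"
  have d: "module_map C E (X n) (d n) (X (n - 1))" "d (n - 1) \<cdot> d n = zero_arr C (fst (X n)) (fst (X (n - 2)))" for n
    using cX unfolding chain_complex_module_cplx by blast+
  have X: "fst (X n) \<in> obj C" for n using left_module_simps(1)[OF module_map_simps(1)[OF d(1)]] .
  note [simp] = module_map_simps(3-5)[OF d(1)]
  have F: "chain_complex C ?F" using d(2) X by (simp add: chain_complex_def)
  have "contractible C ?F"
    unfolding contractible_def chain_homotopic_def
  proof (intro conjI exI[of _ h] allI F chain_map_ident chain_map_zero)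
    fix n
    show "h n \<in> Hom C (fst ?F n) (fst ?F (n + 1))" using h by simp
    have "ident C (fst (X n)) = zero_arr C (fst (X n)) (fst (X n)) \<boxplus> ident C (fst (X n))"
      using X by simp
    then show "ident C (fst ?F n) = zero_arr C (fst ?F n) (fst ?F n) \<boxplus>
        (snd ?F (n + 1) \<cdot> h n \<boxplus> h (n - 1) \<cdot> snd ?F n)"
      using eq[of n] by simp
  qed
  then show ?thesis using cX by (simp add: exact_complex_def)
qed

lemma contractible_module_cplxE:
  assumes "contractible C (map_cplx forget_obj forget_arr (module_cplx X d))"
  obtains h where "\<And>n. h n \<in> Hom C (fst (X n)) (fst (X (n + 1)))"
    "\<And>n. ident C (fst (X n)) = d (n + 1) \<cdot> h n \<boxplus> h (n - 1) \<cdot> d n"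
proof -
  let ?F = "map_cplx forget_obj forget_arr (module_cplx X d)"
  have cF: "chain_complex C ?F" using assms by (simp add: contractible_def)
  obtain h where h: "\<And>n. h n \<in> arr C" "\<And>n. src C (h n) = fst ?F n" "\<And>n. tgt C (h n) = fst ?F (n + 1)"
    and eq: "\<And>n. ident C (fst ?F n) = zero_arr C (fst ?F n) (fst ?F n) \<boxplus>
      (snd ?F (n + 1) \<cdot> h n \<boxplus> h (n - 1) \<cdot> snd ?F n)"
    using chain_homotopicE[OF conjunct2[OF assms[unfolded contractible_def]]] by blast
  have d: "d n \<in> arr C" "src C (d n) = fst (X n)" "tgt C (d n) = fst (X (n - 1))" for n
    using chain_complex_simps(2-4)[OF cF, of n] by simp_all
  show ?thesis
  proof (rule that[of h])
    fix n
    show "h n \<in> Hom C (fst (X n)) (fst (X (n + 1)))" using h by simp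
    show "ident C (fst (X n)) = d (n + 1) \<cdot> h n \<boxplus> h (n - 1) \<cdot> d n"
      using eq[of n] h[of n] h[of "n - 1"] d[of n] d[of "n + 1"] by simp
  qed
qed

text \<open>A contraction of \<open>Z\<close> in \<open>C\<close> need not be linear, yet it solves
  the lifting problem on generators, and freeness extends that solution to a linear one.\<close>

lemma free_summand_lifts:
  assumes A [simp]: "unital_algebra C A" and X: "free_summand A X" and Z: "exact_complex C A Z"
  shows "lifts_against (LMod C A) Z X"
proof -
  obtain Y d where Zd: "Z = module_cplx Y d"
    using Z by (auto simp: exact_complex_def elim!: chain_complex_LModE)
  have d: "module_map C A (Y n) (d n) (Y (n - 1))" for n
    using Z unfolding exact_complex_def Zd chain_complex_module_cplx by blast
  note [simp] = module_map_simps(3-5)[OF d]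
  have Y: "left_module C A (Y n)" for n by (rule module_map_simps(1)[OF d])
  note [simp] = left_module_simps[OF Y]
  obtain h where h: "\<And>n. h n \<in> Hom C (fst (Y n)) (fst (Y (n + 1)))"
    and eq: "\<And>n. ident C (fst (Y n)) = d (n + 1) \<cdot> h n \<boxplus> h (n - 1) \<cdot> d n"
    using contractible_module_cplxE[OF conjunct2[OF Z[unfolded exact_complex_def Zd]]] by blast
  have [simp]: "h n \<in> arr C" "src C (h n) = fst (Y n)" "tgt C (h n) = fst (Y (n + 1))" for n
    using h[of n] by auto
  obtain V i p where V [simp]: "V \<in> obj C" and ip: "module_map C A X i (free_module A V)"
    "module_map C A (free_module A V) p X" "p \<cdot> i = ident C (fst X)"
    using X by (auto simp: free_summand_def retraction_def)
  have p [simp]: "p \<in> arr C" "src C p = alg_obj A \<boxtimes> V" "tgt C p = fst X"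
    "i \<in> arr C" "src C i = fst X" "tgt C i = alg_obj A \<boxtimes> V"
    using module_map_simps(3-5)[OF ip(2)] module_map_simps(3-5)[OF ip(1)] by (simp_all add: free_module_def)
  have E: "alg_obj A \<in> obj C" by simp
  show ?thesis
    unfolding lifts_against_def Zd module_cplx_simps
  proof (intro allI impI)
    fix n t assume "t \<in> Hom (LMod C A) X (Y n)"
      and t0: "(Y n, d n, Y (n - 1)) \<cdot>\<^bsub>LMod C A\<^esub> t = zero_arr (LMod C A) X (Y (n - 1))"
    then obtain g where t: "t = (X, g, Y n)" and g: "module_map C A X g (Y n)" by (elim LMod_HomE)
    note [simp] = module_map_simps(3-5)[OF g]
    have dg: "d n \<cdot> g = zero_arr C (fst X) (fst (Y (n - 1)))" using t0 by (simp add: t)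
    \<comment> \<open>The restriction of \<open>g \<cdot> p\<close> to generators; it is a cycle, so
      \<open>h n \<cdot> ?k\<close> has boundary \<open>?k\<close>.\<close>
    let ?k = "g \<cdot> p \<cdot> eta A V"
    have dk: "d n \<cdot> ?k = zero_arr C V (fst (Y (n - 1)))"
      using cmp_eq_ext[OF dg, of "p \<cdot> eta A V"] by simp
    obtain q where q: "module_map C A (free_module A V) q (Y (n + 1))" "q \<cdot> eta A V = h n \<cdot> ?k"
      using free_ext[OF A Y[of "n + 1"], of "h n \<cdot> ?k" V] by auto
    note [simp] = module_map_simps(3-5)[OF q(1), unfolded free_module_def fst_conv]
    have dq: "module_map C A (free_module A V) (d (n + 1) \<cdot> q) (Y n)"
      using module_map_cmp[OF E q(1) d[of "n + 1"]] by simp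
    have gp: "module_map C A (free_module A V) (g \<cdot> p) (Y n)" by (rule module_map_cmp[OF E ip(2) g])
    have "(d (n + 1) \<cdot> q) \<cdot> eta A V = d (n + 1) \<cdot> h n \<cdot> ?k"
      by (simp add: q(2))
    also have "\<dots> = (d (n + 1) \<cdot> h n \<boxplus> h (n - 1) \<cdot> d n) \<cdot> ?k"
    proof -
      have "(d (n + 1) \<cdot> h n \<boxplus> h (n - 1) \<cdot> d n) \<cdot> ?k = (d (n + 1) \<cdot> h n) \<cdot> ?k \<boxplus> h (n - 1) \<cdot> (d n \<cdot> ?k)"
        by simp
      then show ?thesis unfolding dk by simp
    qed
    also have "\<dots> = ?k" unfolding eq[symmetric] by simp
    finally have "d (n + 1) \<cdot> q = g \<cdot> p"
      by (intro free_module_map_eqI[OF A V dq gp]) simp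
    then have "d (n + 1) \<cdot> q \<cdot> i = g"
      using cmp_eq_ext[of "d (n + 1)" q "g \<cdot> p" i] ip(3) by simp
    moreover have "module_map C A X (q \<cdot> i) (Y (n + 1))" by (rule module_map_cmp[OF E ip(1) q(1)])
    ultimately show "\<exists>b\<in>Hom (LMod C A) X (Y (n + 1)).
        (Y (n + 1), d (n + 1), Y (n + 1 - 1)) \<cdot>\<^bsub>LMod C A\<^esub> b = t"
      by (intro bexI[of _ "(X, q \<cdot> i, Y (n + 1))"]) (simp_all add: t)
  qed
qed

section \<open>Quasi-isomorphisms and maps out of complexes of free summands\<close>

lemma quasi_isosE:
  assumes "w \<in> quasi_isos C A"
  obtains X Y g Z where "w = ho_arrow (LMod C A) X Y g" "chain_map (LMod C A) X Y g"
    "mapping_cone (LMod C A) X Y g Z" "exact_complex C A Z"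
  using assms by (auto simp: quasi_isos_def ho_arrow_def)

text \<open>Bounded below complexes of free summands are K-projective: the two halves of
  \<open>cone_lifting\<close> give surjectivity and injectivity of composition with a
  quasi-isomorphism.\<close>

lemma inverts_quasi_isos:
  assumes A [simp]: "unital_algebra C A" and X: "chain_complex (LMod C A) X"
    and free: "\<And>n. free_summand A (fst X n)" and bdd: "\<And>n. n < N \<Longrightarrow> zero_object (LMod C A) (fst X n)"
  shows "inverts (homotopy_category (LMod C A)) (quasi_isos C A) X"
  unfolding inverts_def
proof (intro ballI impI)
  interpret M: preadditive_category "LMod C A" by (rule preadditive_LMod) simp
  let ?K = "homotopy_category (LMod C A)"
  fix w assume "w \<in> quasi_isos C A"
  then obtain Y Y' g Z where w: "w = ho_arrow (LMod C A) Y Y' g" "chain_map (LMod C A) Y Y' g"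
    and Z: "mapping_cone (LMod C A) Y Y' g Z" "exact_complex C A Z" by (rule quasi_isosE)
  note lift = M.cone_lifting[OF w(2) Z(1) X bdd free_summand_lifts[OF A free Z(2)]]
  have "inj_on (\<lambda>\<phi>. w \<cdot>\<^bsub>?K\<^esub> \<phi>) (Hom ?K X Y)"
  proof (rule inj_onI)
    fix \<phi> \<psi> assume "\<phi> \<in> Hom ?K X Y" "\<psi> \<in> Hom ?K X Y" and eq: "w \<cdot>\<^bsub>?K\<^esub> \<phi> = w \<cdot>\<^bsub>?K\<^esub> \<psi>"
    then obtain k k' where k: "\<phi> = ho_arrow (LMod C A) X Y k" "chain_map (LMod C A) X Y k"
      "\<psi> = ho_arrow (LMod C A) X Y k'" "chain_map (LMod C A) X Y k'"
      by (elim M.homotopy_category_HomE)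
    have "chain_homotopic (LMod C A) X Y' (\<lambda>n. g n \<cdot>\<^bsub>LMod C A\<^esub> k n) (\<lambda>n. g n \<cdot>\<^bsub>LMod C A\<^esub> k' n)"
      using eq M.ho_arrow_eq_iff[OF M.chain_map_cmp[OF k(2) w(2)]] by (simp add: k w)
    from lift(2)[OF _ k(2) k(4) this] show "\<phi> = \<psi>" by (simp add: k M.ho_arrow_eq_iff)
  qed
  moreover have "(\<lambda>\<phi>. w \<cdot>\<^bsub>?K\<^esub> \<phi>) ` Hom ?K X Y = Hom ?K X Y'"
  proof (intro equalityI subsetI)
    fix \<psi> assume "\<psi> \<in> (\<lambda>\<phi>. w \<cdot>\<^bsub>?K\<^esub> \<phi>) ` Hom ?K X Y"
    then obtain \<phi> where \<phi>: "\<phi> \<in> Hom ?K X Y" "\<psi> = w \<cdot>\<^bsub>?K\<^esub> \<phi>" by blast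
    from \<phi>(1) obtain k where "\<phi> = ho_arrow (LMod C A) X Y k" "chain_map (LMod C A) X Y k"
      by (elim M.homotopy_category_HomE)
    then show "\<psi> \<in> Hom ?K X Y'" using \<phi>(2) by (simp add: w M.chain_map_cmp)
  next
    fix \<psi> assume "\<psi> \<in> Hom ?K X Y'"
    then obtain k where k: "\<psi> = ho_arrow (LMod C A) X Y' k" "chain_map (LMod C A) X Y' k"
      by (elim M.homotopy_category_HomE)
    obtain k' where k': "chain_map (LMod C A) X Y k'"
      "chain_homotopic (LMod C A) X Y' (\<lambda>n. g n \<cdot>\<^bsub>LMod C A\<^esub> k' n) k"
      using lift(1)[OF _ k(2)] by blast
    have "w \<cdot>\<^bsub>?K\<^esub> ho_arrow (LMod C A) X Y k' = \<psi>"
      using k' w by (simp add: k(1) M.ho_arrow_eq_iff M.chain_map_cmp)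
    then show "\<psi> \<in> (\<lambda>\<phi>. w \<cdot>\<^bsub>?K\<^esub> \<phi>) ` Hom ?K X Y"
      using k'(1) by (intro image_eqI[of _ _ "ho_arrow (LMod C A) X Y k'"]) simp_all
  qed
  ultimately show "bij_betw (\<lambda>\<phi>. w \<cdot>\<^bsub>?K\<^esub> \<phi>) (Hom ?K X (src ?K w)) (Hom ?K X (tgt ?K w))"
    by (simp add: bij_betw_def w del: Hom_iff)
qed

end

section \<open>Additive functors and restriction of scalars\<close>

lemma map_cplx_simps [simp]:
  "fst (map_cplx Fo Fa X) n = Fo (fst X n)" "snd (map_cplx Fo Fa X) n = Fa (snd X n)"
  by (simp_all add: map_cplx_def)

locale additive_functor = M: preadditive_category M + N: preadditive_category N
  for M :: "('o, 'm, 'x) addcat_scheme" and N :: "('p, 'n, 'y) addcat_scheme"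
    and Fo :: "'o \<Rightarrow> 'p" and Fa :: "'m \<Rightarrow> 'n" +
  assumes F_obj [simp]: "X \<in> obj M \<Longrightarrow> Fo X \<in> obj N"
    and F_arr: "f \<in> arr M \<Longrightarrow> Fa f \<in> Hom N (Fo (src M f)) (Fo (tgt M f))"
    and F_ident [simp]: "X \<in> obj M \<Longrightarrow> Fa (ident M X) = ident N (Fo X)"
    and F_cmp [simp]: "f \<in> arr M \<Longrightarrow> g \<in> arr M \<Longrightarrow> src M g = tgt M f
      \<Longrightarrow> Fa (g \<cdot>\<^bsub>M\<^esub> f) = Fa g \<cdot>\<^bsub>N\<^esub> Fa f"
    and F_add [simp]: "f \<in> arr M \<Longrightarrow> g \<in> arr M \<Longrightarrow> src M g = src M f \<Longrightarrow> tgt M g = tgt M f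
      \<Longrightarrow> Fa (f \<boxplus>\<^bsub>M\<^esub> g) = Fa f \<boxplus>\<^bsub>N\<^esub> Fa g"
begin

lemma F_simps [simp]:
  assumes "f \<in> arr M"
  shows "Fa f \<in> arr N" "src N (Fa f) = Fo (src M f)" "tgt N (Fa f) = Fo (tgt M f)"
  using F_arr[OF assms] by simp_all

lemma F_zero [simp]:
  assumes "X \<in> obj M" "Y \<in> obj M"
  shows "Fa (zero_arr M X Y) = zero_arr N (Fo X) (Fo Y)"
proof (rule N.add_arr_left_cancel[of "Fa (zero_arr M X Y)"])
  have "zero_arr M X Y \<boxplus>\<^bsub>M\<^esub> zero_arr M X Y = zero_arr M X Y" using assms by simp
  then have "Fa (zero_arr M X Y) \<boxplus>\<^bsub>N\<^esub> Fa (zero_arr M X Y) = Fa (zero_arr M X Y)"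
    using assms F_add[of "zero_arr M X Y" "zero_arr M X Y"] by simp
  then show "Fa (zero_arr M X Y) \<boxplus>\<^bsub>N\<^esub> Fa (zero_arr M X Y) = Fa (zero_arr M X Y) \<boxplus>\<^bsub>N\<^esub> zero_arr N (Fo X) (Fo Y)"
    using assms by simp
qed (use assms in simp_all)

lemma F_neg [simp]:
  assumes "f \<in> arr M"
  shows "Fa (neg_arr M f) = neg_arr N (Fa f)"
  by (rule N.neg_arr_unique[symmetric]) (use assms F_add[of f "neg_arr M f", symmetric] in simp_all)

lemma F_chain_complex:
  assumes "chain_complex M X"
  shows "chain_complex N (map_cplx Fo Fa X)"
proof -
  note [simp] = M.chain_complex_simps(1-4)[OF assms]
  have "Fa (snd X (n - 1)) \<cdot>\<^bsub>N\<^esub> Fa (snd X n) = zero_arr N (Fo (fst X n)) (Fo (fst X (n - 2)))" for n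
    using F_cmp[of "snd X n" "snd X (n - 1)"] M.chain_complex_simps(5)[OF assms, of n] by simp
  then show ?thesis by (simp add: chain_complex_def)
qed

lemma F_chain_map:
  assumes "chain_map M X Y f"
  shows "chain_map N (map_cplx Fo Fa X) (map_cplx Fo Fa Y) (Fa \<circ> f)"
proof -
  note [simp] = M.chain_map_simps[OF assms]
  have "Fa (snd Y n) \<cdot>\<^bsub>N\<^esub> Fa (f n) = Fa (f (n - 1)) \<cdot>\<^bsub>N\<^esub> Fa (snd X n)" for n
    using arg_cong[OF M.chain_map_comm[OF assms, of n], of Fa] by simp
  then show ?thesis by (simp add: chain_map_def F_chain_complex)
qed

lemma F_chain_homotopic:
  assumes "chain_homotopic M X Y f g"
  shows "chain_homotopic N (map_cplx Fo Fa X) (map_cplx Fo Fa Y) (Fa \<circ> f) (Fa \<circ> g)"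
proof -
  note maps = M.chain_homotopic_maps[OF assms]
  note [simp] = M.chain_map_simps[OF maps(1)] M.chain_map_simps[OF maps(2)]
  obtain h where h [simp]: "\<And>n. h n \<in> arr M" "\<And>n. src M (h n) = fst X n" "\<And>n. tgt M (h n) = fst Y (n + 1)"
    and eq: "\<And>n. f n = g n \<boxplus>\<^bsub>M\<^esub> ((snd Y (n + 1) \<cdot>\<^bsub>M\<^esub> h n) \<boxplus>\<^bsub>M\<^esub> (h (n - 1) \<cdot>\<^bsub>M\<^esub> snd X n))"
    using M.chain_homotopicE[OF assms] by blast
  show ?thesis
    unfolding chain_homotopic_def
  proof (intro conjI F_chain_map maps exI[of _ "Fa \<circ> h"] allI)
    fix n
    show "(Fa \<circ> f) n = (Fa \<circ> g) n \<boxplus>\<^bsub>N\<^esub> (snd (map_cplx Fo Fa Y) (n + 1) \<cdot>\<^bsub>N\<^esub> (Fa \<circ> h) n \<boxplus>\<^bsub>N\<^esub>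
        (Fa \<circ> h) (n - 1) \<cdot>\<^bsub>N\<^esub> snd (map_cplx Fo Fa X) n)"
      using arg_cong[OF eq[of n], of Fa] by simp
  qed simp
qed

lemma map_ho_arr_ho_arrow:
  assumes "chain_map M X Y f"
  shows "map_ho_arr N Fo Fa (ho_arrow M X Y f) = ho_arrow N (map_cplx Fo Fa X) (map_cplx Fo Fa Y) (Fa \<circ> f)"
proof -
  have eq: "homotopy_class N (map_cplx Fo Fa X) (map_cplx Fo Fa Y) (Fa \<circ> g) =
      homotopy_class N (map_cplx Fo Fa X) (map_cplx Fo Fa Y) (Fa \<circ> f)"
    if "g \<in> homotopy_class M X Y f" for g
  proof -
    have "chain_homotopic M X Y f g" using that by (simp add: homotopy_class_def)
    from N.homotopy_class_eq[OF F_chain_homotopic[OF this]] show ?thesis by (rule HOL.sym)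
  qed
  have "(\<Union>g\<in>homotopy_class M X Y f. homotopy_class N (map_cplx Fo Fa X) (map_cplx Fo Fa Y) (Fa \<circ> g)) =
      homotopy_class N (map_cplx Fo Fa X) (map_cplx Fo Fa Y) (Fa \<circ> f)"
    by (rule UN_constant_eq[OF M.homotopy_class_self[OF assms]]) (rule ballI, erule eq)
  then show ?thesis by (simp add: map_ho_arr_def ho_arrow_def)
qed

lemma F_biproduct:
  assumes "biproduct M X Y S i j p q" "X \<in> obj M" "Y \<in> obj M"
  shows "biproduct N (Fo X) (Fo Y) (Fo S) (Fa i) (Fa j) (Fa p) (Fa q)"
proof -
  have [simp]: "i \<in> arr M" "j \<in> arr M" "p \<in> arr M" "q \<in> arr M" "src M i = X" "src M j = Y"
    "src M p = S" "src M q = S" "tgt M i = S" "tgt M j = S" "tgt M p = X" "tgt M q = Y"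
    using assms(1) unfolding biproduct_def Hom_iff by blast+
  have S: "S \<in> obj M" using M.tgt_in_obj[of i] by simp
  have eqs: "p \<cdot>\<^bsub>M\<^esub> i = ident M X" "q \<cdot>\<^bsub>M\<^esub> j = ident M Y" "p \<cdot>\<^bsub>M\<^esub> j = zero_arr M Y X"
    "q \<cdot>\<^bsub>M\<^esub> i = zero_arr M X Y" "(i \<cdot>\<^bsub>M\<^esub> p) \<boxplus>\<^bsub>M\<^esub> (j \<cdot>\<^bsub>M\<^esub> q) = ident M S"
    using assms(1) unfolding biproduct_def by blast+
  have "Fa p \<cdot>\<^bsub>N\<^esub> Fa i = Fa (p \<cdot>\<^bsub>M\<^esub> i)" "Fa q \<cdot>\<^bsub>N\<^esub> Fa j = Fa (q \<cdot>\<^bsub>M\<^esub> j)"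
    "Fa p \<cdot>\<^bsub>N\<^esub> Fa j = Fa (p \<cdot>\<^bsub>M\<^esub> j)" "Fa q \<cdot>\<^bsub>N\<^esub> Fa i = Fa (q \<cdot>\<^bsub>M\<^esub> i)"
    "(Fa i \<cdot>\<^bsub>N\<^esub> Fa p) \<boxplus>\<^bsub>N\<^esub> (Fa j \<cdot>\<^bsub>N\<^esub> Fa q) = Fa ((i \<cdot>\<^bsub>M\<^esub> p) \<boxplus>\<^bsub>M\<^esub> (j \<cdot>\<^bsub>M\<^esub> q))"
    by simp_all
  then show ?thesis
    unfolding eqs biproduct_def using assms(2,3) S by simp
qed

text \<open>Additive functors preserve biproducts, hence every chosen cone, so a quasi-isomorphism
  can be transported together with the cone that witnesses it.\<close>

lemma F_mapping_cone:
  assumes f: "chain_map M X Y f" and cone: "mapping_cone M X Y f Z"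
  shows "mapping_cone N (map_cplx Fo Fa X) (map_cplx Fo Fa Y) (Fa \<circ> f) (map_cplx Fo Fa Z)"
proof -
  note [simp] = M.chain_map_simps[OF f]
  have Z: "chain_complex M Z" using cone by (simp add: mapping_cone_def)
  obtain i j p q where b: "\<And>n. biproduct M (fst X (n - 1)) (fst Y n) (fst Z n) (i n) (j n) (p n) (q n)"
    and D: "\<And>n. snd Z n = (i (n - 1) \<cdot>\<^bsub>M\<^esub> neg_arr M (snd X (n - 1)) \<cdot>\<^bsub>M\<^esub> p n) \<boxplus>\<^bsub>M\<^esub>
      (j (n - 1) \<cdot>\<^bsub>M\<^esub> f (n - 1) \<cdot>\<^bsub>M\<^esub> p n) \<boxplus>\<^bsub>M\<^esub> (j (n - 1) \<cdot>\<^bsub>M\<^esub> snd Y n \<cdot>\<^bsub>M\<^esub> q n)"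
    using cone unfolding mapping_cone_def by metis
  have b' [simp]: "i n \<in> arr M" "src M (i n) = fst X (n - 1)" "tgt M (i n) = fst Z n"
    "j n \<in> arr M" "src M (j n) = fst Y n" "tgt M (j n) = fst Z n"
    "p n \<in> arr M" "src M (p n) = fst Z n" "tgt M (p n) = fst X (n - 1)"
    "q n \<in> arr M" "src M (q n) = fst Z n" "tgt M (q n) = fst Y n" for n
    using b[of n] by (auto simp: biproduct_def)
  show ?thesis
    unfolding mapping_cone_def
  proof (rule conjI[OF F_chain_complex[OF Z]], rule exI[of _ "Fa \<circ> i"], rule exI[of _ "Fa \<circ> j"],
      rule exI[of _ "Fa \<circ> p"], rule exI[of _ "Fa \<circ> q"], intro allI conjI)
    fix n
    show "biproduct N (fst (map_cplx Fo Fa X) (n - 1)) (fst (map_cplx Fo Fa Y) n) (fst (map_cplx Fo Fa Z) n)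
        ((Fa \<circ> i) n) ((Fa \<circ> j) n) ((Fa \<circ> p) n) ((Fa \<circ> q) n)"
      using F_biproduct[OF b[of n]] by simp
    show "snd (map_cplx Fo Fa Z) n =
        ((Fa \<circ> i) (n - 1) \<cdot>\<^bsub>N\<^esub> neg_arr N (snd (map_cplx Fo Fa X) (n - 1)) \<cdot>\<^bsub>N\<^esub> (Fa \<circ> p) n) \<boxplus>\<^bsub>N\<^esub>
        ((Fa \<circ> j) (n - 1) \<cdot>\<^bsub>N\<^esub> (Fa \<circ> f) (n - 1) \<cdot>\<^bsub>N\<^esub> (Fa \<circ> p) n) \<boxplus>\<^bsub>N\<^esub>
        ((Fa \<circ> j) (n - 1) \<cdot>\<^bsub>N\<^esub> snd (map_cplx Fo Fa Y) n \<cdot>\<^bsub>N\<^esub> (Fa \<circ> q) n)"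
    proof -
      have "neg_arr M (snd X (n - 1)) \<in> arr M" "src M (neg_arr M (snd X (n - 1))) = fst X (n - 1)"
        "tgt M (neg_arr M (snd X (n - 1))) = fst X (n - 1 - 1)" by simp_all
      then have "Fa (snd Z n) = (Fa (i (n - 1)) \<cdot>\<^bsub>N\<^esub> Fa (neg_arr M (snd X (n - 1))) \<cdot>\<^bsub>N\<^esub> Fa (p n)) \<boxplus>\<^bsub>N\<^esub>
        (Fa (j (n - 1)) \<cdot>\<^bsub>N\<^esub> Fa (f (n - 1)) \<cdot>\<^bsub>N\<^esub> Fa (p n)) \<boxplus>\<^bsub>N\<^esub>
        (Fa (j (n - 1)) \<cdot>\<^bsub>N\<^esub> Fa (snd Y n) \<cdot>\<^bsub>N\<^esub> Fa (q n))"
        unfolding D by (simp del: M.cmp_neg_left M.cmp_neg_right N.cmp_neg_left N.cmp_neg_right F_neg)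
      then show ?thesis by simp
    qed
  qed
qed

lemma localising_functor_homotopy:
  assumes "\<And>w. w \<in> W \<Longrightarrow> w \<in> arr (homotopy_category M) \<Longrightarrow> map_ho_arr N Fo Fa w \<in> V"
  shows "localising_functor (homotopy_category M) (homotopy_category N) W V (map_cplx Fo Fa) (map_ho_arr N Fo Fa)"
proof (intro localising_functor.intro localising_functor_axioms.intro M.category_homotopy_category
    N.category_homotopy_category assms)
  fix t X Y assume "t \<in> Hom (homotopy_category M) X Y"
  then show "map_ho_arr N Fo Fa t \<in> Hom (homotopy_category N) (map_cplx Fo Fa X) (map_cplx Fo Fa Y)"
    by (elim M.homotopy_category_HomE) (simp add: map_ho_arr_ho_arrow F_chain_map)
next
  fix X assume X: "X \<in> obj (homotopy_category M)"
  then have X': "chain_complex M X" by simp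
  have "Fa \<circ> (\<lambda>n. ident M (fst X n)) = (\<lambda>n. ident N (fst (map_cplx Fo Fa X) n))"
    using M.chain_complex_simps(1)[OF X'] by auto
  then show "map_ho_arr N Fo Fa (ident (homotopy_category M) X) = ident (homotopy_category N) (map_cplx Fo Fa X)"
    using X' by (simp add: map_ho_arr_ho_arrow M.chain_map_ident)
next
  fix s t X Y Z assume "s \<in> Hom (homotopy_category M) X Y" "t \<in> Hom (homotopy_category M) Y Z"
  then obtain g h where g: "s = ho_arrow M X Y g" "chain_map M X Y g" and h: "t = ho_arrow M Y Z h" "chain_map M Y Z h"
    by (elim M.homotopy_category_HomE)
  have "Fa \<circ> (\<lambda>n. h n \<cdot>\<^bsub>M\<^esub> g n) = (\<lambda>n. (Fa \<circ> h) n \<cdot>\<^bsub>N\<^esub> (Fa \<circ> g) n)"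
    using M.chain_map_simps[OF g(2)] M.chain_map_simps[OF h(2)] by auto
  then show "map_ho_arr N Fo Fa (t \<cdot>\<^bsub>homotopy_category M\<^esub> s) =
      map_ho_arr N Fo Fa t \<cdot>\<^bsub>homotopy_category N\<^esub> map_ho_arr N Fo Fa s"
    using g h N.ho_arrow_cmp[OF F_chain_map[OF g(2)] F_chain_map[OF h(2)]]
    by (simp add: map_ho_arr_ho_arrow M.chain_map_cmp)
qed

end

section \<open>Restriction of scalars on complexes\<close>

context additive_closed_monoidal
begin

lemma restrict_arr_simps [simp]:
  "restrict_arr C f (X, h, Y) = (restrict_obj C f X, h, restrict_obj C f Y)"
  by (simp add: restrict_arr_def)

lemma additive_functor_restrict:
  assumes r: "restricts A B f"
  shows "additive_functor (LMod C B) (LMod C A) (restrict_obj C f) (restrict_arr C f)"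
proof (intro additive_functor.intro additive_functor_axioms.intro preadditive_LMod)
  show "alg_obj B \<in> obj C" "alg_obj A \<in> obj C" by (fact restrictsD[OF r])+
next
  fix X assume X: "X \<in> obj (LMod C B)"
  then show "restrict_obj C f X \<in> obj (LMod C A)" by (simp add: restrictsD(6)[OF r])
  show "restrict_arr C f (ident (LMod C B) X) = ident (LMod C A) (restrict_obj C f X)"
    by simp
next
  fix t assume "t \<in> arr (LMod C B)"
  then show "restrict_arr C f t \<in> Hom (LMod C A) (restrict_obj C f (src (LMod C B) t)) (restrict_obj C f (tgt (LMod C B) t))"
    by (elim LMod_arrE) (simp add: restrict_module_map[OF r])
next
  fix s t assume "s \<in> arr (LMod C B)" "t \<in> arr (LMod C B)"
  then show "restrict_arr C f (t \<cdot>\<^bsub>LMod C B\<^esub> s) = restrict_arr C f t \<cdot>\<^bsub>LMod C A\<^esub> restrict_arr C f s"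
    "restrict_arr C f (s \<boxplus>\<^bsub>LMod C B\<^esub> t) = restrict_arr C f s \<boxplus>\<^bsub>LMod C A\<^esub> restrict_arr C f t"
    by (elim LMod_arrE; simp)+
qed

lemma derived_restrict_obj_module_cplx:
  "derived_restrict_obj C f (module_cplx X d) = module_cplx (\<lambda>n. restrict_obj C f (X n)) d"
  by (auto simp: derived_restrict_obj_def map_cplx_def module_cplx_def)

text \<open>Restriction leaves the underlying complex in \<open>C\<close> unchanged, and
  contractibility concerns that complex.\<close>

lemma exact_restrict:
  assumes r: "restricts A B f" and Z: "exact_complex C B Z"
  shows "exact_complex C A (map_cplx (restrict_obj C f) (restrict_arr C f) Z)"
proof -
  interpret F: additive_functor "LMod C B" "LMod C A" "restrict_obj C f" "restrict_arr C f"
    by (rule additive_functor_restrict[OF r])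
  have "map_cplx forget_obj forget_arr (map_cplx (restrict_obj C f) (restrict_arr C f) Z) =
      map_cplx forget_obj forget_arr Z"
    by (auto simp: map_cplx_def forget_obj_def forget_arr_def restrict_arr_def split: prod.splits)
  then show ?thesis using Z by (simp add: exact_complex_def F.F_chain_complex)
qed

lemma localising_functor_restrict:
  assumes r: "restricts A B f"
  shows "localising_functor (homotopy_category (LMod C B)) (homotopy_category (LMod C A))
    (quasi_isos C B) (quasi_isos C A) (derived_restrict_obj C f)
    (map_ho_arr (LMod C A) (restrict_obj C f) (restrict_arr C f))"
proof -
  interpret F: additive_functor "LMod C B" "LMod C A" "restrict_obj C f" "restrict_arr C f"
    by (rule additive_functor_restrict[OF r])
  show ?thesis
    unfolding derived_restrict_obj_def
  proof (rule F.localising_functor_homotopy)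
    fix w assume "w \<in> quasi_isos C B"
    then obtain X Y g Z where w: "w = ho_arrow (LMod C B) X Y g" "chain_map (LMod C B) X Y g"
      and Z: "mapping_cone (LMod C B) X Y g Z" "exact_complex C B Z" by (rule quasi_isosE)
    show "map_ho_arr (LMod C A) (restrict_obj C f) (restrict_arr C f) w \<in> quasi_isos C A"
      unfolding w(1) F.map_ho_arr_ho_arrow[OF w(2)] unfolding ho_arrow_def quasi_isos_def
      using F.F_chain_map[OF w(2)] F.F_mapping_cone[OF w(2) Z(1)] exact_restrict[OF r Z(2)] by blast
  qed
qed

section \<open>Projective modules\<close>

text \<open>A module map with a section in \<open>C\<close> is the quotient map of a semi-split
  extension, whose kernel is the image of \<open>1 - s \<cdot> p\<close>. Projectivity lifts the
  identity of \<open>P\<close> through it.\<close>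

lemma projective_section:
  assumes ker: "has_kernels C" and E [simp]: "alg_obj E \<in> obj C"
    and m: "alg_mult E \<in> Hom C (alg_obj E \<boxtimes> alg_obj E) (alg_obj E)" and u: "alg_unit E \<in> Hom C U (alg_obj E)"
    and P: "projective_module C E P" and p: "module_map C E F p P"
    and s: "s \<in> Hom C (fst P) (fst F)" "p \<cdot> s = ident C (fst P)"
  obtains t where "retraction E P F t p"
proof -
  let ?a = "alg_obj E" and ?M = "LMod C E"
  note lP = module_map_simps(2)[OF p] and lF = module_map_simps(1)[OF p]
  note [simp] = module_map_simps(3-5)[OF p] left_module_simps[OF lP] left_module_simps[OF lF]
  have [simp]: "s \<in> arr C" "src C s = fst P" "tgt C s = fst F" using s by auto
  have [simp]: "alg_mult E \<in> arr C" "src C (alg_mult E) = ?a \<boxtimes> ?a" "tgt C (alg_mult E) = ?a"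
    "alg_unit E \<in> arr C" "src C (alg_unit E) = U" "tgt C (alg_unit E) = ?a"
    using m u by auto
  have plin: "p \<cdot> snd F = snd P \<cdot> ?a \<lhd> p" by (rule module_map_simps(6)[OF p])
  have laws: "snd F \<cdot> alg_mult E \<rhd> fst F = snd F \<cdot> ?a \<lhd> snd F \<cdot> \<alpha> ?a ?a (fst F)"
    "snd F \<cdot> alg_unit E \<rhd> fst F = lu (fst F)"
    using lF unfolding left_module_def Let_def case_prod_beta by blast+
  let ?e = "ident C (fst F) \<boxplus> neg_arr C (s \<cdot> p)"
  have "?e \<cdot> ?e = ?e"
    using cmp_eq_ext[OF s(2), of p] by (simp add: neg_add_arr add_arr_ac)
  then obtain K i r where ir: "i \<in> Hom C K (fst F)" "r \<in> Hom C (fst F) K" "r \<cdot> i = ident C K" "i \<cdot> r = ?e"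
    using idempotent_splitting[OF ker, of ?e "fst F"] by auto
  have [simp]: "i \<in> arr C" "src C i = K" "tgt C i = fst F" "r \<in> arr C" "src C r = fst F" "tgt C r = K"
    using ir by auto
  have K [simp]: "K \<in> obj C" using src_in_obj[of i] by simp
  have sum: "i \<cdot> r \<boxplus> s \<cdot> p = ident C (fst F)"
    unfolding ir(4) by (simp add: add_arr_assoc)
  have "p \<cdot> ?e = zero_arr C (fst F) (fst P)"
    using cmp_eq_ext[OF s(2), of p] by simp
  then have "(p \<cdot> i \<cdot> r) \<cdot> i = zero_arr C K (fst P)" unfolding ir(4) by simp
  then have pi: "p \<cdot> i = zero_arr C K (fst P)" using ir(3) by simp
  have "?e \<cdot> s = zero_arr C (fst P) (fst F)" using s(2) by simp
  then have "r \<cdot> (i \<cdot> r) \<cdot> s = zero_arr C (fst P) K" unfolding ir(4) by simp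
  then have rs: "r \<cdot> s = zero_arr C (fst P) K" using cmp_eq_ext[OF ir(3), of "r \<cdot> s"] by simp
  have monoI: "g = h" if "i \<cdot> g = i \<cdot> h" "g \<in> arr C" "h \<in> arr C" "tgt C g = K" "tgt C h = K" for g h
    by (rule split_mono_cancel[OF that(1) ir(3)]) (use that in simp_all)
  \<comment> \<open>The action on the kernel. The identity \<open>iy\<close> holds because
    \<open>p\<close> is linear and kills \<open>i\<close>; as \<open>i\<close> is split monic, the
    module axioms descend from \<open>F\<close>.\<close>
  define y where "y = r \<cdot> snd F \<cdot> ?a \<lhd> i"
  have [simp]: "y \<in> arr C" "src C y = ?a \<boxtimes> K" "tgt C y = K" by (simp_all add: y_def)
  have iy: "i \<cdot> y = snd F \<cdot> ?a \<lhd> i"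
  proof -
    have "(s \<cdot> p) \<cdot> snd F \<cdot> ?a \<lhd> i = s \<cdot> (p \<cdot> snd F) \<cdot> ?a \<lhd> i" by simp
    also have "\<dots> = s \<cdot> snd P \<cdot> ?a \<lhd> (p \<cdot> i)" unfolding plin by simp
    also have "\<dots> = zero_arr C (?a \<boxtimes> K) (fst F)" unfolding pi by simp
    finally have 0: "(s \<cdot> p) \<cdot> snd F \<cdot> ?a \<lhd> i = zero_arr C (?a \<boxtimes> K) (fst F)" .
    have "snd F \<cdot> ?a \<lhd> i = (i \<cdot> r \<boxplus> s \<cdot> p) \<cdot> snd F \<cdot> ?a \<lhd> i" unfolding sum by simp
    also have "\<dots> = i \<cdot> y \<boxplus> (s \<cdot> p) \<cdot> snd F \<cdot> ?a \<lhd> i" by (simp add: y_def)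
    finally show ?thesis unfolding 0 by simp
  qed
  have lK: "left_module C E (K, y)"
  proof -
    have "i \<cdot> y \<cdot> alg_mult E \<rhd> K = snd F \<cdot> (?a \<lhd> i \<cdot> alg_mult E \<rhd> K)"
      using cmp_eq_ext[OF iy, of "alg_mult E \<rhd> K"] by simp
    also have "?a \<lhd> i \<cdot> alg_mult E \<rhd> K = alg_mult E \<rhd> fst F \<cdot> (?a \<boxtimes> ?a) \<lhd> i"
      by (simp add: whisker_exchange)
    also have "snd F \<cdot> \<dots> = (snd F \<cdot> alg_mult E \<rhd> fst F) \<cdot> (?a \<boxtimes> ?a) \<lhd> i" by simp
    also have "\<dots> = snd F \<cdot> ?a \<lhd> snd F \<cdot> (\<alpha> ?a ?a (fst F) \<cdot> (?a \<boxtimes> ?a) \<lhd> i)"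
      unfolding laws by simp
    also have "\<alpha> ?a ?a (fst F) \<cdot> (?a \<boxtimes> ?a) \<lhd> i = ?a \<lhd> (?a \<lhd> i) \<cdot> \<alpha> ?a ?a K"
      by (simp add: assoc_nat3)
    also have "snd F \<cdot> ?a \<lhd> snd F \<cdot> \<dots> = snd F \<cdot> ?a \<lhd> (snd F \<cdot> ?a \<lhd> i) \<cdot> \<alpha> ?a ?a K" by simp
    also have "\<dots> = snd F \<cdot> ?a \<lhd> (i \<cdot> y) \<cdot> \<alpha> ?a ?a K" unfolding iy ..
    also have "\<dots> = (snd F \<cdot> ?a \<lhd> i) \<cdot> ?a \<lhd> y \<cdot> \<alpha> ?a ?a K" by simp
    also have "\<dots> = i \<cdot> y \<cdot> ?a \<lhd> y \<cdot> \<alpha> ?a ?a K" unfolding iy[symmetric] by simp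
    finally have 1: "y \<cdot> alg_mult E \<rhd> K = y \<cdot> ?a \<lhd> y \<cdot> \<alpha> ?a ?a K" by (rule monoI) simp_all
    have "i \<cdot> y \<cdot> alg_unit E \<rhd> K = snd F \<cdot> (?a \<lhd> i \<cdot> alg_unit E \<rhd> K)"
      using cmp_eq_ext[OF iy, of "alg_unit E \<rhd> K"] by simp
    also have "?a \<lhd> i \<cdot> alg_unit E \<rhd> K = alg_unit E \<rhd> fst F \<cdot> U \<lhd> i"
      by (simp add: whisker_exchange)
    also have "snd F \<cdot> \<dots> = (snd F \<cdot> alg_unit E \<rhd> fst F) \<cdot> U \<lhd> i" by simp
    also have "\<dots> = i \<cdot> lu K" unfolding laws by (simp add: lunit_nat)
    finally have 2: "y \<cdot> alg_unit E \<rhd> K = lu K" by (rule monoI) simp_all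
    from 1 2 show ?thesis by (simp add: left_module_def Let_def)
  qed
  have i: "module_map C E (K, y) i F" using lK lF iy by (intro module_mapI) simp_all
  have "is_kernel ?M (F, p, P) ((K, y), i, F)"
    unfolding is_kernel_def
  proof (intro conjI ballI impI)
    fix t assume "t \<in> arr ?M" and t: "tgt ?M t = src ?M (F, p, P) \<and>
      (F, p, P) \<cdot>\<^bsub>?M\<^esub> t = zero_arr ?M (src ?M t) (tgt ?M (F, p, P))"
    then obtain G g where tg: "t = (G, g, F)" "module_map C E G g F" by (elim LMod_arrE) auto
    have pg: "p \<cdot> g = zero_arr C (fst G) (fst P)" using t by (simp add: tg)
    note [simp] = module_map_simps(3-5)[OF tg(2)] left_module_simps[OF module_map_simps(1)[OF tg(2)]]
    have "g = (i \<cdot> r \<boxplus> s \<cdot> p) \<cdot> g" unfolding sum by simp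
    also have "\<dots> = i \<cdot> r \<cdot> g \<boxplus> s \<cdot> p \<cdot> g" by simp
    finally have irg: "i \<cdot> r \<cdot> g = g" unfolding pg by simp
    \<comment> \<open>\<open>r\<close> need not be linear, but \<open>r \<cdot> g\<close> is,
      because \<open>i \<cdot> r \<cdot> g = g\<close> and \<open>i\<close> is monic.\<close>
    have rg: "module_map C E G (r \<cdot> g) (K, y)"
    proof (rule module_mapI[OF module_map_simps(1)[OF tg(2)] lK])
      have "i \<cdot> (r \<cdot> g) \<cdot> snd G = g \<cdot> snd G" using cmp_eq_ext[OF irg, of "snd G"] by simp
      also have "\<dots> = snd F \<cdot> ?a \<lhd> (i \<cdot> r \<cdot> g)" unfolding irg by (rule module_map_simps(6)[OF tg(2)])
      also have "\<dots> = i \<cdot> y \<cdot> ?a \<lhd> (r \<cdot> g)" using cmp_eq_ext[OF iy, of "?a \<lhd> (r \<cdot> g)"] by simp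
      finally show "(r \<cdot> g) \<cdot> snd G = snd (K, y) \<cdot> ?a \<lhd> (r \<cdot> g)" unfolding snd_conv by (rule monoI) simp_all
    qed simp_all
    show "\<exists>!h. h \<in> Hom ?M (src ?M t) (src ?M ((K, y), i, F)) \<and> ((K, y), i, F) \<cdot>\<^bsub>?M\<^esub> h = t"
    proof (intro ex1I[of _ "(G, r \<cdot> g, (K, y))"])
      fix h assume h: "h \<in> Hom ?M (src ?M t) (src ?M ((K, y), i, F)) \<and> ((K, y), i, F) \<cdot>\<^bsub>?M\<^esub> h = t"
      then have "h \<in> Hom ?M G (K, y)" by (simp add: tg)
      then obtain h' where h': "h = (G, h', (K, y))" "module_map C E G h' (K, y)" by (rule LMod_HomE)
      have "i \<cdot> h' = i \<cdot> r \<cdot> g" using h irg by (simp add: tg h'(1))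
      then have "h' = r \<cdot> g" by (rule monoI) (use module_map_simps[OF h'(2)] in simp_all)
      then show "h = (G, r \<cdot> g, (K, y))" by (simp add: h')
    qed (use rg irg in \<open>simp add: tg\<close>)
  qed (use i p pi in simp_all)
  moreover have "is_cokernel ?M ((K, y), i, F) (F, p, P)"
    unfolding is_cokernel_def
  proof (intro conjI ballI impI)
    fix t assume "t \<in> arr ?M" and t: "src ?M t = tgt ?M ((K, y), i, F) \<and>
      t \<cdot>\<^bsub>?M\<^esub> ((K, y), i, F) = zero_arr ?M (src ?M ((K, y), i, F)) (tgt ?M t)"
    then obtain G g where tg: "t = (F, g, G)" "module_map C E F g G" by (elim LMod_arrE) auto
    have gi: "g \<cdot> i = zero_arr C K (fst G)" using t by (simp add: tg)
    note [simp] = module_map_simps(3-5)[OF tg(2)] left_module_simps[OF module_map_simps(2)[OF tg(2)]]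
    have "g = g \<cdot> (i \<cdot> r \<boxplus> s \<cdot> p)" unfolding sum by simp
    also have "\<dots> = (g \<cdot> i) \<cdot> r \<boxplus> g \<cdot> s \<cdot> p" by simp
    finally have gsp: "g \<cdot> s \<cdot> p = g" unfolding gi by simp
    have epiI: "h = h'" if "h \<cdot> p = h' \<cdot> p" "h \<in> arr C" "h' \<in> arr C" "src C h = fst P" "src C h' = fst P" for h h'
      by (rule split_epi_cancel[OF that(1) s(2)]) (use that in simp_all)
    \<comment> \<open>Dually, \<open>s\<close> need not be linear, but \<open>g \<cdot> s\<close>
      is, as seen after composition with the split epimorphism \<open>?a \<lhd> p\<close>.\<close>
    have gs: "module_map C E P (g \<cdot> s) G"
    proof (rule module_mapI[OF lP module_map_simps(2)[OF tg(2)]])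
      have "((g \<cdot> s) \<cdot> snd P) \<cdot> ?a \<lhd> p = g \<cdot> s \<cdot> (p \<cdot> snd F)" unfolding plin by simp
      also have "\<dots> = g \<cdot> snd F" using cmp_eq_ext[of "g \<cdot> s" p g "snd F"] gsp by simp
      also have "\<dots> = snd G \<cdot> ?a \<lhd> (g \<cdot> s \<cdot> p)" unfolding gsp by (rule module_map_simps(6)[OF tg(2)])
      finally have eq: "((g \<cdot> s) \<cdot> snd P) \<cdot> ?a \<lhd> p = (snd G \<cdot> ?a \<lhd> (g \<cdot> s)) \<cdot> ?a \<lhd> p" by simp
      show "(g \<cdot> s) \<cdot> snd P = snd G \<cdot> ?a \<lhd> (g \<cdot> s)"
        by (rule split_epi_cancel[OF eq whisker_inv(1)[OF s(2)]]) simp_all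
    qed simp_all
    show "\<exists>!h. h \<in> Hom ?M (tgt ?M (F, p, P)) (tgt ?M t) \<and> h \<cdot>\<^bsub>?M\<^esub> (F, p, P) = t"
    proof (intro ex1I[of _ "(P, g \<cdot> s, G)"])
      fix h assume h: "h \<in> Hom ?M (tgt ?M (F, p, P)) (tgt ?M t) \<and> h \<cdot>\<^bsub>?M\<^esub> (F, p, P) = t"
      then have "h \<in> Hom ?M P G" by (simp add: tg)
      then obtain h' where h': "h = (P, h', G)" "module_map C E P h' G" by (rule LMod_HomE)
      have "h' \<cdot> p = (g \<cdot> s) \<cdot> p" using h gsp by (simp add: tg h'(1))
      then have "h' = g \<cdot> s" by (rule epiI) (use module_map_simps[OF h'(2)] in simp_all)
      then show "h = (P, g \<cdot> s, G)" by (simp add: h')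
    qed (use gs gsp in \<open>simp add: tg\<close>)
  qed (use i p pi in simp_all)
  moreover have "splits C i p"
    unfolding splits_def
    by (intro exI[of _ r] exI[of _ s]) (use ir s pi rs sum in \<open>simp add: biproduct_def\<close>)
  ultimately have ss: "semisplit_extension C E ((K, y), i, F) (F, p, P)"
    by (simp add: semisplit_extension_def forget_arr_def)
  have "(\<lambda>g. (F, p, P) \<cdot>\<^bsub>?M\<^esub> g) ` Hom ?M P (src ?M (F, p, P)) = Hom ?M P (tgt ?M (F, p, P))"
    using P ss unfolding projective_module_def Let_def by blast
  then have "(\<lambda>g. (F, p, P) \<cdot>\<^bsub>?M\<^esub> g) ` Hom ?M P F = Hom ?M P P"
    unfolding LMod_simps .
  moreover have "ident ?M P \<in> Hom ?M P P" using module_map_ident[OF E lP] by simp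
  ultimately obtain t where "t \<in> Hom ?M P F" "ident ?M P = (F, p, P) \<cdot>\<^bsub>?M\<^esub> t" by blast
  then obtain t' where "module_map C E P t' F" "p \<cdot> t' = ident C (fst P)" by (elim LMod_HomE) auto
  then show ?thesis using p by (intro that[of t']) (simp add: retraction_def)
qed

text \<open>Exactness at the first two terms is the kernel property of \<open>i\<close>.
  Surjectivity at the third is the lifting property of \<open>F\<close>, passed to the retract
  \<open>P\<close>; the section in \<open>C\<close> that it asks for comes from the splitting of the
  extension.\<close>

lemma projective_moduleI:
  assumes E [simp]: "alg_obj E \<in> obj C" and ret: "retraction E P F i0 p0"
    and lift: "\<And>Y Z p s g. module_map C E Y p Z \<Longrightarrow> s \<in> Hom C (fst Z) (fst Y) \<Longrightarrow> p \<cdot> s = ident C (fst Z) \<Longrightarrow>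
      module_map C E F g Z \<Longrightarrow> \<exists>k. module_map C E F k Y \<and> p \<cdot> k = g"
  shows "projective_module C E P"
  unfolding projective_module_def Let_def
proof (intro conjI allI impI)
  let ?M = "LMod C E"
  interpret M: preadditive_category ?M by (rule preadditive_LMod[OF E])
  have i0: "module_map C E P i0 F" "module_map C E F p0 P" "p0 \<cdot> i0 = ident C (fst P)"
    using ret by (auto simp: retraction_def)
  show "P \<in> obj ?M" using module_map_simps(1)[OF i0(1)] by simp
  then have P [simp]: "left_module C E P" by simp
  fix i p assume ss: "semisplit_extension C E i p"
  then have k: "is_kernel ?M p i" and spl: "splits C (forget_arr i) (forget_arr p)"
    by (simp_all add: semisplit_extension_def)
  have ip [simp]: "i \<in> arr ?M" "p \<in> arr ?M" "tgt ?M i = src ?M p"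
    and pi: "p \<cdot>\<^bsub>?M\<^esub> i = zero_arr ?M (src ?M i) (tgt ?M p)"
    and ex: "\<And>g. g \<in> arr ?M \<Longrightarrow> tgt ?M g = src ?M p \<Longrightarrow> p \<cdot>\<^bsub>?M\<^esub> g = zero_arr ?M (src ?M g) (tgt ?M p) \<Longrightarrow>
      \<exists>!h. h \<in> Hom ?M (src ?M g) (src ?M i) \<and> i \<cdot>\<^bsub>?M\<^esub> h = g"
    using k unfolding is_kernel_def by auto
  have pig: "p \<cdot>\<^bsub>?M\<^esub> i \<cdot>\<^bsub>?M\<^esub> g = zero_arr ?M P (tgt ?M p)" if "g \<in> Hom ?M P (src ?M i)" for g
  proof -
    have "p \<cdot>\<^bsub>?M\<^esub> i \<cdot>\<^bsub>?M\<^esub> g = zero_arr ?M (src ?M i) (tgt ?M p) \<cdot>\<^bsub>?M\<^esub> g"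
      using M.cmp_eq_ext[OF pi, of g] that by simp
    also have "\<dots> = zero_arr ?M P (tgt ?M p)"
      using that M.cmp_zero_left[of g "tgt ?M p" "src ?M i"] M.tgt_in_obj[OF ip(2)] by (simp del: LMod_simps)
    finally show ?thesis .
  qed
  show "inj_on (\<lambda>g. i \<cdot>\<^bsub>?M\<^esub> g) (Hom ?M P (src ?M i))"
  proof (rule inj_onI)
    fix g g' assume g: "g \<in> Hom ?M P (src ?M i)" "g' \<in> Hom ?M P (src ?M i)" "i \<cdot>\<^bsub>?M\<^esub> g = i \<cdot>\<^bsub>?M\<^esub> g'"
    have "\<exists>!h. h \<in> Hom ?M P (src ?M i) \<and> i \<cdot>\<^bsub>?M\<^esub> h = i \<cdot>\<^bsub>?M\<^esub> g'"
      using ex[of "i \<cdot>\<^bsub>?M\<^esub> g'"] g(2) pig[OF g(2)] by simp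
    then show "g = g'" using g by blast
  qed
  show "(\<lambda>g. i \<cdot>\<^bsub>?M\<^esub> g) ` Hom ?M P (src ?M i) =
      {g \<in> Hom ?M P (tgt ?M i). p \<cdot>\<^bsub>?M\<^esub> g = zero_arr ?M P (tgt ?M p)}"
  proof (intro equalityI subsetI)
    fix g assume "g \<in> (\<lambda>g. i \<cdot>\<^bsub>?M\<^esub> g) ` Hom ?M P (src ?M i)"
    then obtain h where "g = i \<cdot>\<^bsub>?M\<^esub> h" "h \<in> Hom ?M P (src ?M i)" by blast
    then show "g \<in> {g \<in> Hom ?M P (tgt ?M i). p \<cdot>\<^bsub>?M\<^esub> g = zero_arr ?M P (tgt ?M p)}"
      using pig[of h] by simp
  next
    fix g assume "g \<in> {g \<in> Hom ?M P (tgt ?M i). p \<cdot>\<^bsub>?M\<^esub> g = zero_arr ?M P (tgt ?M p)}"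
    then have "g \<in> arr ?M" "src ?M g = P" "tgt ?M g = src ?M p" "p \<cdot>\<^bsub>?M\<^esub> g = zero_arr ?M (src ?M g) (tgt ?M p)"
      by (auto simp del: LMod_simps)
    from ex[OF this(1,3,4)] this(2) show "g \<in> (\<lambda>g. i \<cdot>\<^bsub>?M\<^esub> g) ` Hom ?M P (src ?M i)"
      by (metis imageI)
  qed
  obtain Y q Z where q: "p = (Y, q, Z)" "module_map C E Y q Z" using LMod_arrE[OF ip(2)] .
  obtain r s where "biproduct C (src C (forget_arr i)) (tgt C q) (tgt C (forget_arr i)) (forget_arr i) s r q"
    using spl by (auto simp: splits_def q(1) forget_arr_def)
  then have s: "q \<cdot> s = ident C (fst Z)" "s \<in> Hom C (fst Z) (fst Y)"
    using module_map_simps(3-5)[OF q(2)] by (auto simp: biproduct_def)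
  show "(\<lambda>g. p \<cdot>\<^bsub>?M\<^esub> g) ` Hom ?M P (src ?M p) = Hom ?M P (tgt ?M p)"
  proof (intro equalityI subsetI)
    fix g assume "g \<in> (\<lambda>g. p \<cdot>\<^bsub>?M\<^esub> g) ` Hom ?M P (src ?M p)"
    then show "g \<in> Hom ?M P (tgt ?M p)" by auto
  next
    fix g assume "g \<in> Hom ?M P (tgt ?M p)"
    then have "g \<in> Hom ?M P Z" by (simp add: q)
    then obtain g' where g: "g = (P, g', Z)" "module_map C E P g' Z" by (rule LMod_HomE)
    have "module_map C E F (g' \<cdot> p0) Z" by (rule module_map_cmp[OF E i0(2) g(2)])
    then obtain h where h: "module_map C E F h Y" "q \<cdot> h = g' \<cdot> p0" using lift[OF q(2) s(2,1)] by blast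
    note [simp] = module_map_simps(3-5)[OF h(1)] module_map_simps(3-5)[OF g(2)] module_map_simps(3-5)[OF i0(1)]
      module_map_simps(3-5)[OF i0(2)] module_map_simps(3-5)[OF q(2)]
    have "q \<cdot> h \<cdot> i0 = g'" using cmp_eq_ext[OF h(2), of i0] i0(3) by simp
    moreover have "module_map C E P (h \<cdot> i0) Y" by (rule module_map_cmp[OF E i0(1) h(1)])
    ultimately show "g \<in> (\<lambda>g. p \<cdot>\<^bsub>?M\<^esub> g) ` Hom ?M P (src ?M p)"
      by (intro image_eqI[of _ _ "(P, h \<cdot> i0, Y)"]) (simp_all add: q g)
  qed
qed

end

section \<open>Projective bimodules as summands of free ones\<close>

context two_algebras
begin

lemma tensor_alg_typed:
  "alg_mult E \<in> Hom C (alg_obj E \<boxtimes> alg_obj E) (alg_obj E)" "alg_unit E \<in> Hom C U (alg_obj E)"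
  by (simp_all add: tensor_alg_def interchange_def)

text \<open>The section \<open>s\<close> lifts the generators, and freeness extends this lift to a
  linear map.\<close>

lemma bifree_lift:
  assumes V [simp]: "V \<in> obj C" and p: "module_map C E Y p Z" and s: "s \<in> Hom C (fst Z) (fst Y)" "p \<cdot> s = ident C (fst Z)"
    and g: "module_map C E (bifree V) g Z"
  shows "\<exists>k. module_map C E (bifree V) k Y \<and> p \<cdot> k = g"
proof -
  have [simp]: "g \<in> arr C" "src C g = bifree_obj V" "tgt C g = fst Z"
    using module_map_simps(3-5)[OF g] by (simp_all add: bifree_def tensor_module_def)
  have [simp]: "s \<in> arr C" "src C s = fst Z" "tgt C s = fst Y" using s by auto
  note [simp] = module_map_simps(3-5)[OF p]
  note Y = tensor_module_eq[OF module_map_simps(1)[OF p]]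
  let ?k = "g \<cdot> eta A (a' \<boxtimes> V) \<cdot> eta A' V"
  obtain k where k: "module_map C E (bifree V) k Y" "k \<cdot> eta A (a' \<boxtimes> V) \<cdot> eta A' V = s \<cdot> ?k"
    using bifree_ext[OF Y(1), of "s \<cdot> ?k" V] unfolding Y(2) by auto
  have [simp]: "k \<in> arr C" "src C k = bifree_obj V" "tgt C k = fst Y"
    using module_map_simps(3-5)[OF k(1)] by (simp_all add: bifree_def tensor_module_def)
  have "p \<cdot> k = g"
  proof (rule bifree_map_eqI[OF V module_map_simps(2)[OF g] _ g])
    show "module_map C E (bifree V) (p \<cdot> k) Z" by (rule module_map_cmp[OF _ k(1) p]) simp
    have "(p \<cdot> k) \<cdot> eta A (a' \<boxtimes> V) \<cdot> eta A' V = p \<cdot> s \<cdot> ?k" by (simp add: k(2))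
    then show "(p \<cdot> k) \<cdot> eta A (a' \<boxtimes> V) \<cdot> eta A' V = ?k"
      using cmp_eq_ext[OF s(2), of ?k] by simp
  qed
  then show ?thesis using k(1) by blast
qed

lemma projective_bifree_summand:
  assumes "V \<in> obj C" "retraction E P (bifree V) i p"
  shows "projective_module C E P"
  by (rule projective_moduleI[OF _ assms(2) bifree_lift[OF assms(1)]]) simp_all

text \<open>The action map to \<open>P\<close> from the free bimodule on \<open>fst P\<close> has
  the two units as a section in \<open>C\<close>; projectivity replaces it by a linear
  section.\<close>

lemma projective_bifree_summandE:
  assumes ker: "has_kernels C" and P: "projective_module C E P"
  obtains i p where "retraction E P (bifree (fst P)) i p"
proof -
  have l: "left_module C E P" using P by (simp add: projective_module_def Let_def)
  note V [simp] = left_module_simps(1)[OF l] and Pe = tensor_module_eq[OF l]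
  define p where "p = lam A A' P \<cdot> a \<lhd> (rho A A' P \<cdot> a' \<lhd> ident C (fst P))"
  have p: "module_map C E (bifree (fst P)) p P" "p \<cdot> eta A (a' \<boxtimes> fst P) \<cdot> eta A' (fst P) = ident C (fst P)"
    using bifree_ext[OF Pe(1), of "ident C (fst P)" "fst P"] unfolding Pe(2) p_def by simp_all
  have "eta A (a' \<boxtimes> fst P) \<cdot> eta A' (fst P) \<in> Hom C (fst P) (fst (bifree (fst P)))"
    by (simp add: bifree_def tensor_module_def)
  from projective_section[OF ker _ tensor_alg_typed P p(1) this p(2)] that show ?thesis by auto
qed

end

section \<open>Inducing a bimodule resolution\<close>

context additive_closed_monoidal
begin

definition left_part :: "('o, 'm) alg \<Rightarrow> ('o, 'm) alg \<Rightarrow> ('o, 'm) module_obj \<Rightarrow> ('o, 'm) module_obj" where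
  "left_part A A' P = (fst P, lam A A' P)"

definition right_part :: "('o, 'm) alg \<Rightarrow> ('o, 'm) alg \<Rightarrow> ('o, 'm) module_obj \<Rightarrow> ('o, 'm) module_obj" where
  "right_part A A' P = (fst P, rho A A' P)"

lemma fst_parts [simp]: "fst (left_part A A' P) = fst P" "fst (right_part A A' P) = fst P"
  by (simp_all add: left_part_def right_part_def)

lemma universal_extE:
  assumes "universal E E' g X u Y" "left_module C E' Z" "module_map C E X k (restrict_obj C g Z)"
  obtains h where "module_map C E' Y h Z" "h \<cdot> u = k"
  using assms unfolding universal_def by blast

lemma universal_eqI:
  assumes r: "restricts E E' g" and u: "universal E E' g X u Y"
    and h: "module_map C E' Y h Z" "module_map C E' Y h' Z" "h \<cdot> u = h' \<cdot> u"
  shows "h = h'"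
proof -
  have "module_map C E X (h \<cdot> u) (restrict_obj C g Z)"
    using u module_map_cmp[OF restrictsD(1)[OF r] _ restrict_module_map[OF r h(1)]]
    unfolding universal_def by blast
  then have "\<exists>!k. module_map C E' Y k Z \<and> k \<cdot> u = h \<cdot> u"
    using u module_map_simps(2)[OF h(1)] unfolding universal_def by blast
  then show ?thesis using h by metis
qed

lemma universal_map:
  assumes "universal E E' g X u Y"
  shows "module_map C E X u (restrict_obj C g Y)" "left_module C E' Y" "u \<in> arr C" "src C u = fst X" "tgt C u = fst Y"
proof -
  show m: "module_map C E X u (restrict_obj C g Y)" and "left_module C E' Y"
    using assms by (simp_all add: universal_def)
  show "u \<in> arr C" "src C u = fst X" "tgt C u = fst Y"
    using module_map_simps(3-5)[OF m] by simp_all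
qed

text \<open>If \<open>X\<close> vanishes, so does \<open>u\<close>, and the identity and zero of
  \<open>Y\<close> agree after \<open>u\<close>. This is what preserves the length of the
  resolution.\<close>

lemma universal_zero_object:
  assumes r: "restricts E E' g" and u: "universal E E' g X u Y" and X: "zero_object (LMod C E) X"
  shows "zero_object (LMod C E') Y"
proof -
  note E = restrictsD(1,2)[OF r] and um = universal_map[OF u]
  note [simp] = um(3-5) left_module_simps(1)[OF um(2)]
  have X': "fst X \<in> obj C" using src_in_obj[OF um(3)] by simp
  have "u = zero_arr C (fst X) (fst Y)" using zero_object_module_map(1)[OF E(1) X um(3)] by simp
  then have "ident C (fst Y) \<cdot> u = zero_arr C (fst Y) (fst Y) \<cdot> u" using X' by simp
  then have "ident C (fst Y) = zero_arr C (fst Y) (fst Y)"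
    by (rule universal_eqI[OF r u module_map_ident[OF E(2) um(2)] module_map_zero[OF E(2) um(2) um(2)]])
  then show ?thesis using um(2) by (simp add: zero_object_LMod_iff[OF E(2)])
qed

lemma retraction_cmp:
  assumes E: "alg_obj E \<in> obj C" and X: "retraction E X Y i p" and Y: "retraction E Y Z j q"
  shows "retraction E X Z (j \<cdot> i) (p \<cdot> q)"
proof -
  have m: "module_map C E X i Y" "module_map C E Y p X" "p \<cdot> i = ident C (fst X)"
    "module_map C E Y j Z" "module_map C E Z q Y" "q \<cdot> j = ident C (fst Y)"
    using X Y by (auto simp: retraction_def)
  note [simp] = module_map_simps(3-5)[OF m(1)] module_map_simps(3-5)[OF m(2)]
    module_map_simps(3-5)[OF m(4)] module_map_simps(3-5)[OF m(5)]
  have "(p \<cdot> q) \<cdot> j \<cdot> i = ident C (fst X)"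
    using cmp_eq_ext[OF m(6), of i] m(3) by simp
  then show ?thesis
    using module_map_cmp[OF E m(1,4)] module_map_cmp[OF E m(5,2)] by (simp add: retraction_def)
qed

end

section \<open>One-sided parts of bimodules\<close>

context two_algebras
begin

abbreviation "Lp \<equiv> left_part A A'"
abbreviation "Rp \<equiv> right_part A A'"

lemma parts_module:
  assumes "left_module C E P"
  shows "left_module C A (Lp P)" "left_module C A' (Rp P)"
  using tensor_module_eq(1)[OF assms] by (simp_all add: biaction_def left_part_def right_part_def)

lemma module_map_parts_iff:
  assumes P: "left_module C E P" and Q: "left_module C E Q"
  shows "module_map C E P h Q \<longleftrightarrow> module_map C A (Lp P) h (Lp Q) \<and> module_map C A' (Rp P) h (Rp Q)"
  using tensor_module_map_iff[OF tensor_module_eq(1)[OF P] tensor_module_eq(1)[OF Q], of h]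
  unfolding tensor_module_eq(2)[OF P] tensor_module_eq(2)[OF Q] left_part_def right_part_def .

lemma module_map_parts:
  assumes "module_map C E P h Q"
  shows "module_map C A (Lp P) h (Lp Q)" "module_map C A' (Rp P) h (Rp Q)"
  using module_map_parts_iff[OF module_map_simps(1,2)[OF assms]] assms by blast+

lemma retraction_parts:
  assumes "retraction E P F i p"
  shows "retraction A (Lp P) (Lp F) i p" "retraction A' (Rp P) (Rp F) i p"
  using assms module_map_parts by (auto simp: retraction_def)

lemma parts_tensor_module:
  assumes "biaction A A' X l r"
  shows "Lp (tensor_module A A' X l r) = (X, l)" "Rp (tensor_module A A' X l r) = (X, r)"
  using lam_rho_tensor_module[OF assms] by (simp_all add: left_part_def right_part_def tensor_module_def)

lemma parts_bifree:
  assumes "V \<in> obj C"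
  shows "Lp (bifree V) = free_module A (a' \<boxtimes> V)" "Rp (bifree V) = (bifree_obj V, bifree_r V)"
  using parts_tensor_module[OF biaction_bifree[OF assms]] by (simp_all add: bifree_def free_module_def)

text \<open>A free bimodule is free over either algebra, for the right part through
  \<open>tau\<close>.\<close>

lemma free_summand_parts:
  assumes V: "V \<in> obj C" and r: "retraction E P (bifree V) i p"
  shows "free_summand A (Lp P)" "free_summand A' (Rp P)"
proof -
  show "free_summand A (Lp P)"
    using retraction_parts(1)[OF r] V unfolding parts_bifree[OF V] free_summand_def
    by (meson A' tens_obj unital_algebra_simps(1))
  have "retraction A' (Rp P) (free_module A' (a \<boxtimes> V)) (tau a a' V \<cdot> i) (p \<cdot> tau a' a V)"
    using retraction_cmp[OF _ retraction_parts(2)[OF r] retraction_bifree_right[OF V, folded parts_bifree[OF V]]]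
    by simp
  then show "free_summand A' (Rp P)"
    using V unfolding free_summand_def by (meson A tens_obj unital_algebra_simps(1))
qed

end

section \<open>Inducing projective bimodules on one side\<close>

context two_algebra_homs
begin

abbreviation "EA \<equiv> tensor_alg C A A'"
abbreviation "EB \<equiv> tensor_alg C B B'"

lemma restrict_parts:
  assumes Z: "left_module C EB Z"
  shows "AA.Lp (restrict_obj C (f \<boxdot> f') Z) = restrict_obj C f (BB.Lp Z)"
    "AA.Rp (restrict_obj C (f \<boxdot> f') Z) = restrict_obj C f' (BB.Rp Z)"
proof -
  note b = BB.tensor_module_eq[OF Z]
  have "restrict_obj C (f \<boxdot> f') Z = tensor_module A A' (fst Z) (lam B B' Z \<cdot> f \<rhd> fst Z) (rho B B' Z \<cdot> f' \<rhd> fst Z)"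
    using restrict_tensor_module(2)[OF b(1)] unfolding b(2) .
  then show "AA.Lp (restrict_obj C (f \<boxdot> f') Z) = restrict_obj C f (BB.Lp Z)"
    "AA.Rp (restrict_obj C (f \<boxdot> f') Z) = restrict_obj C f' (BB.Rp Z)"
    using AA.parts_tensor_module[OF restrict_tensor_module(1)[OF b(1)]]
    by (simp_all add: left_part_def right_part_def restrict_obj_def)
qed

lemma bimodule_induction:
  assumes ker: "has_kernels C" and V: "V \<in> obj C" and P: "retraction EA P (AA.bifree V) i p"
  obtains R e i' p' where "retraction EB R (BB.bifree V) i' p'" "universal EA EB (f \<boxdot> f') P e R"
    "e \<in> Hom C (fst P) (fst R)"
    "(f \<boxdot> (f' \<rhd> V)) \<cdot> i = i' \<cdot> e" "e \<cdot> p = p' \<cdot> (f \<boxdot> (f' \<rhd> V))"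
proof -
  obtain R i' p' e where R: "retraction EB R (BB.bifree V) i' p'" "e \<in> Hom C (fst P) (fst R)"
    "(f \<boxdot> (f' \<rhd> V)) \<cdot> i = i' \<cdot> e" "e \<cdot> p = p' \<cdot> (f \<boxdot> (f' \<rhd> V))"
    using induced_module[OF ker restricts_tensor BB.tensor_alg_typed universal_bifree[OF V] P] .
  show ?thesis
    by (rule that[OF R(1) universal_retract[OF restricts_tensor universal_bifree[OF V] P R] R(2-4)])
qed

end

context additive_closed_monoidal
begin

text \<open>One arrow \<open>e\<close> is universal twice, for bimodules and for their right parts.
  The second property is what allows a contraction that is linear over \<open>A'\<close> alone to be
  induced.\<close>

lemma induction_right:
  assumes A: "unital_algebra C A" and A': "unital_algebra C A'" and B': "unital_algebra C B'"
    and f: "algebra_hom C A' B' f" and ker: "has_kernels C" and V: "V \<in> obj C"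
    and P: "retraction (tensor_alg C A A') P (two_algebras.bifree C A A' V) i p"
  obtains R e i' p' where "retraction (tensor_alg C A B') R (two_algebras.bifree C A B' V) i' p'"
    "universal (tensor_alg C A A') (tensor_alg C A B') (alg_obj A \<lhd> f) P e R"
    "universal A' B' f (right_part A A' P) e (right_part A B' R)"
proof -
  interpret H: two_algebra_homs C A A' A B' "ident C (alg_obj A)" f
    by unfold_locales (fact A A' B' f algebra_hom_ident[OF A])+
  have a [simp]: "alg_obj A \<in> obj C" and [simp]: "V \<in> obj C" using A V by simp_all
  note [simp] = algebra_hom_simps(1-3)[OF f]
  obtain R e i' p' where R: "retraction H.EB R (H.BB.bifree V) i' p'" "universal H.EA H.EB (alg_obj A \<lhd> f) P e R"
    "e \<in> Hom C (fst P) (fst R)"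
    "(alg_obj A \<lhd> (f \<rhd> V)) \<cdot> i = i' \<cdot> e" "e \<cdot> p = p' \<cdot> (alg_obj A \<lhd> (f \<rhd> V))"
    using H.bimodule_induction[OF ker V P] .
  note r = restricts_algebra_hom[OF f A' B']
  \<comment> \<open>The right parts of the free bimodules are free up to \<open>tau\<close>, and
    naturality of \<open>tau\<close> matches the arrow between them with
    \<open>f \<rhd> (alg_obj A \<boxtimes> V)\<close>.\<close>
  have fr: "universal A' B' f (H.AA.Rp (H.AA.bifree V)) (alg_obj A \<lhd> (f \<rhd> V)) (H.BB.Rp (H.BB.bifree V))"
    unfolding H.AA.parts_bifree[OF V] H.BB.parts_bifree[OF V]
  proof (rule universal_retract[OF r universal_free[OF f A' B', of "alg_obj A \<boxtimes> V"]
        H.AA.retraction_bifree_right[OF V] H.BB.retraction_bifree_right[OF V]])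
    show "f \<rhd> (alg_obj A \<boxtimes> V) \<cdot> tau (alg_obj A) (alg_obj A') V = tau (alg_obj A) (alg_obj B') V \<cdot> alg_obj A \<lhd> (f \<rhd> V)"
      using tau_nat_right[of f "alg_obj A'" "alg_obj A" V] by simp
    show "alg_obj A \<lhd> (f \<rhd> V) \<cdot> tau (alg_obj A') (alg_obj A) V = tau (alg_obj B') (alg_obj A) V \<cdot> f \<rhd> (alg_obj A \<boxtimes> V)"
      using tau_nat_left[of f "alg_obj A'" "alg_obj A" V] by simp
  qed simp_all
  have "universal A' B' f (H.AA.Rp P) e (H.BB.Rp R)"
    by (rule universal_retract[OF r fr H.AA.retraction_parts(2)[OF P] H.BB.retraction_parts(2)[OF R(1)]])
      (use R(3-5) in simp_all)
  with R(1,2) show ?thesis by (rule that)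
qed

text \<open>Mirror image of the right case, where the left part of a free bimodule is free on the
  nose. Universality of left parts is the adjunction used in
  \<open>derived_contraction\<close>.\<close>

lemma induction_left:
  assumes A: "unital_algebra C A" and A': "unital_algebra C A'" and B: "unital_algebra C B"
    and f: "algebra_hom C A B f" and ker: "has_kernels C" and V: "V \<in> obj C"
    and P: "retraction (tensor_alg C A A') P (two_algebras.bifree C A A' V) i p"
  obtains R e i' p' where "retraction (tensor_alg C B A') R (two_algebras.bifree C B A' V) i' p'"
    "universal (tensor_alg C A A') (tensor_alg C B A') (f \<rhd> alg_obj A') P e R"
    "universal A B f (left_part A A' P) e (left_part B A' R)"
proof -
  interpret H: two_algebra_homs C A A' B A' f "ident C (alg_obj A')"
    by unfold_locales (fact A A' B f algebra_hom_ident[OF A'])+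
  have a [simp]: "alg_obj A' \<in> obj C" and [simp]: "V \<in> obj C" using A' V by simp_all
  note [simp] = algebra_hom_simps(1-3)[OF f]
  obtain R e i' p' where R: "retraction H.EB R (H.BB.bifree V) i' p'" "universal H.EA H.EB (f \<rhd> alg_obj A') P e R"
    "e \<in> Hom C (fst P) (fst R)"
    "(f \<rhd> (alg_obj A' \<boxtimes> V)) \<cdot> i = i' \<cdot> e" "e \<cdot> p = p' \<cdot> (f \<rhd> (alg_obj A' \<boxtimes> V))"
    using H.bimodule_induction[OF ker V P] unfolding tens_ident[OF a V] .
  note r = restricts_algebra_hom[OF f A B]
  have fr: "universal A B f (H.AA.Lp (H.AA.bifree V)) (f \<rhd> (alg_obj A' \<boxtimes> V)) (H.BB.Lp (H.BB.bifree V))"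
    unfolding H.AA.parts_bifree[OF V] H.BB.parts_bifree[OF V]
    by (rule universal_free[OF f A B]) simp
  have "universal A B f (H.AA.Lp P) e (H.BB.Lp R)"
    by (rule universal_retract[OF r fr H.AA.retraction_parts(1)[OF P] H.BB.retraction_parts(1)[OF R(1)]])
      (use R(3-5) in simp_all)
  with R(1,2) show ?thesis by (rule that)
qed

text \<open>Stores the augmented complex as one complex with the algebra in degree -1, so that
  induction and contractions treat the augmentation as one more differential.\<close>

definition augmented_resolution :: "('o, 'm) alg \<Rightarrow> (int \<Rightarrow> ('o, 'm) module_obj) \<Rightarrow> (int \<Rightarrow> 'm) \<Rightarrow> bool" where
  "augmented_resolution A X d \<longleftrightarrow> X (-1) = regular_bimodule C A \<and>
     chain_complex (LMod C (env_alg C A)) (module_cplx X d) \<and>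
     (\<forall>n. n \<noteq> -1 \<longrightarrow> projective_module C (env_alg C A) (X n)) \<and>
     (\<forall>n. n < -1 \<longrightarrow> zero_object (LMod C (env_alg C A)) (X n)) \<and>
     contractible C (map_cplx forget_obj forget_arr (module_cplx X d))"

lemma projective_resolution_augmented:
  assumes "projective_bimodule_resolution C A P \<epsilon>"
  obtains d where "augmented_resolution A (\<lambda>n. if n = -1 then regular_bimodule C A else fst P n) d"
proof -
  let ?M = "LMod C (env_alg C A)" and ?R = "regular_bimodule C A"
  let ?Q = "augmented ?M P \<epsilon> ?R"
  have Q: "chain_complex ?M ?Q" "contractible C (map_cplx forget_obj forget_arr ?Q)"
    and P: "\<And>n. projective_module C (env_alg C A) (fst P n)" "\<And>n. n < 0 \<Longrightarrow> zero_object ?M (fst P n)"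
    using assms unfolding projective_bimodule_resolution_def Let_def by blast+
  obtain d where d: "?Q = module_cplx (fst ?Q) d" using chain_complex_LModE[OF Q(1)] .
  have fQ: "fst ?Q = (\<lambda>n. if n = -1 then ?R else fst P n)" by (simp add: augmented_def)
  show ?thesis
    by (rule that[of d]) (use Q P d fQ in \<open>simp add: augmented_resolution_def\<close>)
qed

text \<open>Deletes degree -1 again. Its place is taken by \<open>X (-2)\<close>, which in an
  augmented resolution is a zero object with a module structure at hand.\<close>

definition trunc_obj :: "(int \<Rightarrow> ('o, 'm) module_obj) \<Rightarrow> int \<Rightarrow> ('o, 'm) module_obj" where
  "trunc_obj X n = (if n = -1 then X (-2) else X n)"

definition trunc_diff :: "(int \<Rightarrow> ('o, 'm) module_obj) \<Rightarrow> (int \<Rightarrow> 'm) \<Rightarrow> int \<Rightarrow> 'm" where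
  "trunc_diff X d n = (if n = 0 \<or> n = -1 then zero_arr C (fst (trunc_obj X n)) (fst (trunc_obj X (n - 1))) else d n)"

lemma chain_complex_trunc:
  assumes E: "alg_obj E \<in> obj C" and X: "chain_complex (LMod C E) (module_cplx X d)"
  shows "chain_complex (LMod C E) (module_cplx (trunc_obj X) (trunc_diff X d))"
proof -
  have d: "module_map C E (X n) (d n) (X (n - 1))" "d (n - 1) \<cdot> d n = zero_arr C (fst (X n)) (fst (X (n - 2)))" for n
    using X unfolding chain_complex_module_cplx by blast+
  have lX: "left_module C E (X n)" for n by (rule module_map_simps(1)[OF d(1)])
  then have lT: "left_module C E (trunc_obj X n)" for n by (simp add: trunc_obj_def)
  note oX = left_module_simps(1)[OF lX] and oT = left_module_simps(1)[OF lT]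
  note [simp] = oT
  have m: "module_map C E (trunc_obj X n) (trunc_diff X d n) (trunc_obj X (n - 1))" for n
  proof (cases "n = 0 \<or> n = -1")
    case True
    then show ?thesis using module_map_zero[OF E lT lT] unfolding trunc_diff_def by simp
  next
    case False
    then show ?thesis using d(1)[of n] by (simp add: trunc_obj_def trunc_diff_def)
  qed
  note [simp] = module_map_simps(3-5)[OF m]
  have "trunc_diff X d (n - 1) \<cdot> trunc_diff X d n = zero_arr C (fst (trunc_obj X n)) (fst (trunc_obj X (n - 2)))" for n
  proof (cases "n = 0 \<or> n = -1 \<or> n = 1")
    case True
    then have "n = 0 \<or> n = -1 \<or> n - 1 = 0" by auto
    then show ?thesis
    proof (elim disjE)
      assume n: "n = 0"
      have "trunc_diff X d n = zero_arr C (fst (trunc_obj X n)) (fst (trunc_obj X (n - 1)))" using n by (simp add: trunc_diff_def)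
      then show ?thesis using module_map_simps(3-5)[OF m[of "n - 1"]] by simp
    next
      assume n: "n = -1"
      have "trunc_diff X d n = zero_arr C (fst (trunc_obj X n)) (fst (trunc_obj X (n - 1)))" using n by (simp add: trunc_diff_def)
      then show ?thesis using module_map_simps(3-5)[OF m[of "n - 1"]] by simp
    next
      assume n: "n - 1 = 0"
      have "trunc_diff X d (n - 1) = zero_arr C (fst (trunc_obj X (n - 1))) (fst (trunc_obj X (n - 1 - 1)))"
        using n by (simp add: trunc_diff_def)
      then show ?thesis using module_map_simps(3-5)[OF m[of n]] by simp
    qed
  next
    case False
    then show ?thesis using d(2)[of n] by (simp add: trunc_obj_def trunc_diff_def)
  qed
  then show ?thesis using m unfolding chain_complex_module_cplx by blast
qed

lemma projective_resolution_trunc: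
  assumes A: "unital_algebra C A" and X: "augmented_resolution A X d"
  shows "projective_bimodule_resolution C A (module_cplx (trunc_obj X) (trunc_diff X d)) (X 0, d 0, X (-1))"
proof -
  let ?E = "env_alg C A" let ?M = "LMod C ?E" and ?R = "regular_bimodule C A"
  let ?P = "module_cplx (trunc_obj X) (trunc_diff X d)"
  have E: "alg_obj ?E \<in> obj C" using A by (simp add: env_alg_def)
  have X1: "X (-1) = ?R" and cX: "chain_complex ?M (module_cplx X d)"
    and pX: "\<And>n. n \<noteq> -1 \<Longrightarrow> projective_module C ?E (X n)" and zX: "\<And>n. n < -1 \<Longrightarrow> zero_object ?M (X n)"
    and con: "contractible C (map_cplx forget_obj forget_arr (module_cplx X d))"
    using X unfolding augmented_resolution_def by blast+
  have d: "module_map C ?E (X n) (d n) (X (n - 1))" for n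
    using cX unfolding chain_complex_module_cplx by blast
  have d1: "d (-1) = zero_arr C (fst (X (-1))) (fst (X (-2)))"
    using zero_object_module_map(2)[OF E zX[of "-2"], of "d (-1)"] module_map_simps(3-5)[OF d[of "-1"]] by simp
  \<comment> \<open>Reinserting the degree deleted by truncation returns the complex on the nose;
    \<open>d (-1)\<close> is zero because it ends in a zero object.\<close>
  have "augmented ?M ?P (X 0, d 0, X (-1)) ?R = module_cplx X d"
    unfolding augmented_def module_cplx_def
    by (rule prod_eqI) (auto simp: fun_eq_iff X1[symmetric] d1 trunc_obj_def trunc_diff_def)
  moreover have "zero_object ?M (trunc_obj X n)" if "n < 0" for n
    using that zX by (simp add: trunc_obj_def)
  moreover have "projective_module C ?E (trunc_obj X n)" for n
    using pX by (simp add: trunc_obj_def)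
  moreover have "(X 0, d 0, X (-1)) \<in> Hom ?M (fst ?P 0) ?R"
    using d[of 0] X1 by (simp add: trunc_obj_def)
  ultimately show ?thesis
    unfolding projective_bimodule_resolution_def Let_def
    using chain_complex_trunc[OF E cX] cX con by (simp del: Hom_iff)
qed

text \<open>The identity is a map from a bounded below complex of free summands to an exact complex,
  hence null-homotopic through linear maps.\<close>

lemma contraction_of_free_summands:
  assumes A: "unital_algebra C A" and X: "exact_complex C A (module_cplx X d)"
    and free: "\<And>n. free_summand A (X n)" and bdd: "\<And>n. n < N \<Longrightarrow> zero_object (LMod C A) (X n)"
  obtains h where "\<And>n. module_map C A (X n) (h n) (X (n + 1))"
    "\<And>n. ident C (fst (X n)) = d (n + 1) \<cdot> h n \<boxplus> h (n - 1) \<cdot> d n"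
proof -
  let ?M = "LMod C A" and ?X = "module_cplx X d"
  have E: "alg_obj A \<in> obj C" using A by simp
  interpret M: preadditive_category ?M by (rule preadditive_LMod[OF E])
  have cX: "chain_complex ?M ?X" using X by (simp add: exact_complex_def)
  have d: "module_map C A (X n) (d n) (X (n - 1))" for n
    using cX unfolding chain_complex_module_cplx by blast
  have "chain_homotopic ?M ?X ?X (\<lambda>n. ident ?M (fst ?X n)) (\<lambda>n. zero_arr ?M (fst ?X n) (fst ?X n))"
    by (rule M.lifting_null_homotopic[OF M.chain_map_ident[OF cX], of N])
      (simp_all add: bdd free_summand_lifts[OF A free X])
  then have "chain_homotopic ?M ?X ?X (\<lambda>n. (X n, ident C (fst (X n)), X n)) (\<lambda>n. (X n, zero_arr C (fst (X n)) (fst (X n)), X n))"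
    by simp
  then obtain h where h: "\<And>n. module_map C A (X n) (h n) (X (n + 1))"
    and eq: "\<And>n. ident C (fst (X n)) = zero_arr C (fst (X n)) (fst (X n)) \<boxplus> (d (n + 1) \<cdot> h n \<boxplus> h (n - 1) \<cdot> d n)"
    by (rule chain_homotopic_module_cplxE) blast
  show ?thesis
  proof (rule that[OF h])
    fix n
    note [simp] = module_map_simps(3-5)[OF h[of n]] module_map_simps(3-5)[OF h[of "n - 1"]]
      module_map_simps(3-5)[OF d[of n]] module_map_simps(3-5)[OF d[of "n + 1"]]
    show "ident C (fst (X n)) = d (n + 1) \<cdot> h n \<boxplus> h (n - 1) \<cdot> d n"
      using eq[of n] by simp
  qed
qed

end

section \<open>Full faithfulness and exactness of the induced complex\<close>

context additive_closed_monoidal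
begin

text \<open>The involution \<open>s\<close> serves as injection and as projection, which leaves room
  for a sign.\<close>

lemma biproduct_zero_right:
  assumes E: "alg_obj E \<in> obj C" and X: "left_module C E X" and Z: "zero_object (LMod C E) Z"
    and s: "module_map C E X s X" "s \<cdot> s = ident C (fst X)"
  shows "biproduct (LMod C E) X Z X (X, s, X) (Z, zero_arr C (fst Z) (fst X), X)
    (X, s, X) (X, zero_arr C (fst X) (fst Z), Z)"
proof -
  have lZ: "left_module C E Z" and iZ: "ident C (fst Z) = zero_arr C (fst Z) (fst Z)"
    using Z by (auto simp: zero_object_LMod_iff[OF E])
  note [simp] = left_module_simps(1)[OF X] left_module_simps(1)[OF lZ] module_map_simps(3-5)[OF s(1)]
  show ?thesis
    using s module_map_zero[OF E lZ X] module_map_zero[OF E X lZ] iZ by (simp add: biproduct_def)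
qed

lemma biproduct_zero_left:
  assumes E: "alg_obj E \<in> obj C" and X: "left_module C E X" and Z: "zero_object (LMod C E) Z"
  shows "biproduct (LMod C E) Z X X (Z, zero_arr C (fst Z) (fst X), X) (X, ident C (fst X), X)
    (X, zero_arr C (fst X) (fst Z), Z) (X, ident C (fst X), X)"
proof -
  have lZ: "left_module C E Z" and iZ: "ident C (fst Z) = zero_arr C (fst Z) (fst Z)"
    using Z by (auto simp: zero_object_LMod_iff[OF E])
  note [simp] = left_module_simps(1)[OF X] left_module_simps(1)[OF lZ]
  show ?thesis
    using module_map_zero[OF E lZ X] module_map_zero[OF E X lZ] module_map_ident[OF E X] iZ
    by (simp add: biproduct_def)
qed

text \<open>The mapping cone of an augmentation is the shifted augmented complex. The signs of the shift
  are absorbed in the choice of the biproduct structure.\<close>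

lemma mapping_cone_augmentation:
  assumes E: "alg_obj E \<in> obj C" and Y: "chain_complex (LMod C E) (module_cplx Y d)"
    and W0: "W 0 = Y (-1)" and W: "\<And>n. n \<noteq> 0 \<Longrightarrow> zero_object (LMod C E) (W n)"
    and zY: "\<And>n. n < -1 \<Longrightarrow> zero_object (LMod C E) (Y n)"
    and q: "q 0 = d 0" "\<And>n. module_map C E (trunc_obj Y n) (q n) (W n)"
  shows "mapping_cone (LMod C E) (module_cplx (trunc_obj Y) (trunc_diff Y d))
    (module_cplx W (\<lambda>n. zero_arr C (fst (W n)) (fst (W (n - 1)))))
    (\<lambda>n. (trunc_obj Y n, q n, W n)) (module_cplx (\<lambda>n. Y (n - 1)) (\<lambda>n. d (n - 1)))"
    (is "mapping_cone ?M ?X ?W ?q ?Z")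
proof -
  have d: "module_map C E (Y n) (d n) (Y (n - 1))" "d (n - 1) \<cdot> d n = zero_arr C (fst (Y n)) (fst (Y (n - 2)))" for n
    using Y unfolding chain_complex_module_cplx by blast+
  have lY: "left_module C E (Y n)" for n by (rule module_map_simps(1)[OF d(1)])
  have lW: "left_module C E (W n)" for n by (rule module_map_simps(2)[OF q(2)])
  have oY [simp]: "fst (Y n) \<in> obj C" for n by (rule left_module_simps(1)[OF lY])
  have oW [simp]: "fst (W n) \<in> obj C" for n by (rule left_module_simps(1)[OF lW])
  note [simp] = module_map_simps(3-5)[OF d(1)] module_map_simps(3-5)[OF q(2)]
  have cT: "chain_complex ?M ?X" by (rule chain_complex_trunc[OF E Y])
  have t: "module_map C E (trunc_obj Y n) (trunc_diff Y d n) (trunc_obj Y (n - 1))" for n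
    using cT unfolding chain_complex_module_cplx by blast
  have lT: "left_module C E (trunc_obj Y n)" for n by (rule module_map_simps(1)[OF t])
  have oT [simp]: "fst (trunc_obj Y n) \<in> obj C" for n by (rule left_module_simps(1)[OF lT])
  note [simp] = module_map_simps(3-5)[OF t]
  \<comment> \<open>Alternating signs with \<open>sg (n - 1) \<cdot> neg_arr C (d (n - 1)) \<cdot>
    sg n = d (n - 1)\<close>, which undo the sign of the cone. Odd degrees carry the identity so
    that \<open>sg 1\<close> leaves \<open>q 0 = d 0\<close> unchanged.\<close>
  define sg where "sg n = (if odd n then ident C (fst (Y (n - 1))) else neg_arr C (ident C (fst (Y (n - 1)))))" for n :: int
  have sg: "module_map C E (Y (n - 1)) (sg n) (Y (n - 1))" "sg n \<cdot> sg n = ident C (fst (Y (n - 1)))" for n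
    using module_map_ident[OF E lY[of "n - 1"]] module_map_neg[OF E module_map_ident[OF E lY[of "n - 1"]]]
    by (simp_all add: sg_def)
  note [simp] = module_map_simps(3-5)[OF sg(1)]
  \<comment> \<open>In degree 0 the cone consists of \<open>W 0\<close> alone, in every other degree
    of the truncated complex alone; the remaining injections and projections are zero arrows at zero
    objects.\<close>
  define s where "s n = (if n = 0 then zero_arr C (fst (trunc_obj Y (-1))) (fst (Y (-1))) else sg n)" for n
  define s' where "s' n = (if n = 0 then zero_arr C (fst (Y (-1))) (fst (trunc_obj Y (-1))) else sg n)" for n
  define j where "j n = (if n = 0 then ident C (fst (Y (-1))) else zero_arr C (fst (W n)) (fst (Y (n - 1))))" for n
  define j' where "j' n = (if n = 0 then ident C (fst (Y (-1))) else zero_arr C (fst (Y (n - 1))) (fst (W n)))" for n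
  have zT: "zero_object ?M (trunc_obj Y (-1))" using zY[of "-2"] by (simp add: trunc_obj_def)
  have T: "trunc_obj Y n = Y n" if "n \<noteq> -1" for n using that by (simp add: trunc_obj_def)
  have bp: "biproduct ?M (trunc_obj Y (n - 1)) (W n) (Y (n - 1)) (trunc_obj Y (n - 1), s n, Y (n - 1))
      (W n, j n, Y (n - 1)) (Y (n - 1), s' n, trunc_obj Y (n - 1)) (Y (n - 1), j' n, W n)" for n
  proof (cases "n = 0")
    case True
    then show ?thesis
      using biproduct_zero_left[OF E lY[of "-1"] zT] W0 by (simp add: s_def s'_def j_def j'_def)
  next
    case False
    then show ?thesis
      using biproduct_zero_right[OF E lY[of "n - 1"] W[OF False] sg(1)[of n] sg(2)[of n]] T[of "n - 1"]
      by (simp add: s_def s'_def j_def j'_def)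
  qed
  have D: "d (n - 1) = (s (n - 1) \<cdot> neg_arr C (trunc_diff Y d (n - 1)) \<cdot> s' n) \<boxplus> (j (n - 1) \<cdot> q (n - 1) \<cdot> s' n) \<boxplus>
      (j (n - 1) \<cdot> zero_arr C (fst (W n)) (fst (W (n - 1))) \<cdot> j' n)" for n
  proof -
    have ty: "s n \<in> arr C" "src C (s n) = fst (trunc_obj Y (n - 1))" "tgt C (s n) = fst (Y (n - 1))"
      "s' n \<in> arr C" "src C (s' n) = fst (Y (n - 1))" "tgt C (s' n) = fst (trunc_obj Y (n - 1))"
      "j n \<in> arr C" "src C (j n) = fst (W n)" "tgt C (j n) = fst (Y (n - 1))"
      "j' n \<in> arr C" "src C (j' n) = fst (Y (n - 1))" "tgt C (j' n) = fst (W n)" for n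
      using bp[of n] by (auto simp: biproduct_def dest: module_map_simps(3-5))
    note [simp] = ty
    have d': "tgt C (d (n - 1)) = fst (Y (n - 1 - 1))" by (rule module_map_simps(5)[OF d(1)])
    \<comment> \<open>At the bottom the target is a zero object, for \<open>n = 1\<close> the
      summand with \<open>q\<close> is the augmentation, and above that only the summand with the
      differential of the truncated complex survives.\<close>
    consider "n - 1 < 0" | "n = 1" | "n - 1 > 0" by linarith
    then show ?thesis
    proof cases
      case 1
      then have "n - 1 - 1 < -1" by simp
      from zero_object_module_map(2)[OF E zY[OF this]]
      have "g = zero_arr C (src C g) (fst (Y (n - 1 - 1)))" if "g \<in> arr C" "tgt C g = fst (Y (n - 1 - 1))" for g
        using that by simp
      from this[of "d (n - 1)"] this[of "(s (n - 1) \<cdot> neg_arr C (trunc_diff Y d (n - 1)) \<cdot> s' n) \<boxplus> (j (n - 1) \<cdot> q (n - 1) \<cdot> s' n) \<boxplus>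
        (j (n - 1) \<cdot> zero_arr C (fst (W n)) (fst (W (n - 1))) \<cdot> j' n)"]
      show ?thesis by simp
    next
      case 2
      then show ?thesis
        using q(1) W0 by (simp add: s_def s'_def j_def sg_def T)
    next
      case 3
      then have n: "n \<noteq> 0" "n - 1 \<noteq> 0" "n - 1 \<noteq> -1" by auto
      have td: "trunc_diff Y d (n - 1) = d (n - 1)" using n by (simp add: trunc_diff_def)
      have T1: "trunc_obj Y (n - 1) = Y (n - 1)" "trunc_obj Y (n - 1 - 1) = Y (n - 1 - 1)"
        using n by (simp_all add: trunc_obj_def)
      have sgs: "s (n - 1) = sg (n - 1)" "s' n = sg n" "j (n - 1) = zero_arr C (fst (W (n - 1))) (fst (Y (n - 1 - 1)))"
        using n by (simp_all add: s_def s'_def j_def)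
      have "sg (n - 1) \<cdot> neg_arr C (d (n - 1)) \<cdot> sg n = d (n - 1)"
        using module_map_simps(3-5)[OF d(1)[of "n - 1"]] by (simp add: sg_def)
      then show ?thesis unfolding td sgs using T1 by simp
    qed
  qed
  have neg: "neg_arr ?M (snd ?X n) = (trunc_obj Y n, neg_arr C (trunc_diff Y d n), trunc_obj Y (n - 1))" for n
    using neg_arr_LMod[OF E t[of n]] by simp
  have cZ: "chain_complex ?M ?Z"
  proof -
    have "module_map C E (Y (n - 1)) (d (n - 1)) (Y (n - 1 - 1)) \<and>
      d (n - 1 - 1) \<cdot> d (n - 1) = zero_arr C (fst (Y (n - 1))) (fst (Y (n - 2 - 1)))" for n
      using d(1)[of "n - 1"] d(2)[of "n - 1"] by (simp add: algebra_simps)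
    then show ?thesis unfolding chain_complex_module_cplx by blast
  qed
  show ?thesis
    unfolding mapping_cone_def
  proof (rule conjI[OF cZ], rule exI[of _ "\<lambda>n. (trunc_obj Y (n - 1), s n, Y (n - 1))"],
      rule exI[of _ "\<lambda>n. (W n, j n, Y (n - 1))"], rule exI[of _ "\<lambda>n. (Y (n - 1), s' n, trunc_obj Y (n - 1))"],
      rule exI[of _ "\<lambda>n. (Y (n - 1), j' n, W n)"], intro allI conjI)
    fix n
    show "biproduct ?M (fst ?X (n - 1)) (fst ?W n) (fst ?Z n) (trunc_obj Y (n - 1), s n, Y (n - 1))
      (W n, j n, Y (n - 1)) (Y (n - 1), s' n, trunc_obj Y (n - 1)) (Y (n - 1), j' n, W n)"
      using bp[of n] by simp
    show "snd ?Z n = ((trunc_obj Y (n - 1 - 1), s (n - 1), Y (n - 1 - 1)) \<cdot>\<^bsub>?M\<^esub>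
          neg_arr ?M (snd ?X (n - 1)) \<cdot>\<^bsub>?M\<^esub> (Y (n - 1), s' n, trunc_obj Y (n - 1))) \<boxplus>\<^bsub>?M\<^esub>
        ((W (n - 1), j (n - 1), Y (n - 1 - 1)) \<cdot>\<^bsub>?M\<^esub> ?q (n - 1) \<cdot>\<^bsub>?M\<^esub> (Y (n - 1), s' n, trunc_obj Y (n - 1))) \<boxplus>\<^bsub>?M\<^esub>
        ((W (n - 1), j (n - 1), Y (n - 1 - 1)) \<cdot>\<^bsub>?M\<^esub> snd ?W n \<cdot>\<^bsub>?M\<^esub> (Y (n - 1), j' n, W n))"
      unfolding neg using D[of n] by simp
  qed
qed

lemma exact_shift:
  assumes Y: "chain_complex (LMod C E) (module_cplx Y d)"
    and h: "\<And>n. h n \<in> Hom C (fst (Y n)) (fst (Y (n + 1)))"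
    and eq: "\<And>n. ident C (fst (Y n)) = d (n + 1) \<cdot> h n \<boxplus> h (n - 1) \<cdot> d n"
  shows "exact_complex C E (module_cplx (\<lambda>n. Y (n - 1)) (\<lambda>n. d (n - 1)))"
proof (rule exact_module_cplxI[where h = "\<lambda>n. h (n - 1)"])
  have d: "module_map C E (Y n) (d n) (Y (n - 1))" "d (n - 1) \<cdot> d n = zero_arr C (fst (Y n)) (fst (Y (n - 2)))" for n
    using Y unfolding chain_complex_module_cplx by blast+
  have "module_map C E (Y (n - 1)) (d (n - 1)) (Y (n - 1 - 1)) \<and>
      d (n - 1 - 1) \<cdot> d (n - 1) = zero_arr C (fst (Y (n - 1))) (fst (Y (n - 2 - 1)))" for n
    using d(1)[of "n - 1"] d(2)[of "n - 1"] by (simp add: algebra_simps)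
  then show "chain_complex (LMod C E) (module_cplx (\<lambda>n. Y (n - 1)) (\<lambda>n. d (n - 1)))"
    unfolding chain_complex_module_cplx by blast
  fix n
  show "h (n - 1) \<in> Hom C (fst (Y (n - 1))) (fst (Y (n + 1 - 1)))" using h[of "n - 1"] by simp
  show "ident C (fst (Y (n - 1))) = d (n + 1 - 1) \<cdot> h (n - 1) \<boxplus> h (n - 1 - 1) \<cdot> d (n - 1)"
    using eq[of "n - 1"] by simp
qed

text \<open>In the application \<open>Y\<close> is \<open>R \<rightarrow> B\<close> over
  \<open>A\<close>, \<open>Z\<close> is \<open>Q \<rightarrow> B\<close> over \<open>B\<close>, and
  \<open>v\<close> is the unit of the induction, the identity in degree -1. The contraction
  \<open>k\<close> in \<open>C\<close> makes \<open>R\<close> a resolution of the restriction of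
  \<open>B\<close>; the one obtained for \<open>Z\<close> is composed of a section of the
  augmentation and of homotopies extended along \<open>v\<close>.\<close>

lemma derived_contraction:
  assumes A: "unital_algebra C A" and B: "unital_algebra C B"
    and iso: "isocohomological_embedding C A B f"
    and cY: "chain_complex (LMod C A) (module_cplx Y dY)" and cZ: "chain_complex (LMod C B) (module_cplx Z dZ)"
    and Y1: "Y (-1) = restrict_obj C f (Z (-1))" and v1: "v (-1) = ident C (fst (Z (-1)))"
    and v: "\<And>n. module_map C A (Y n) (v n) (restrict_obj C f (Z n))"
    and vd: "\<And>n. dZ n \<cdot> v n = v (n - 1) \<cdot> dY n"
    and u: "\<And>n. n \<noteq> -1 \<Longrightarrow> universal A B f (Y n) (v n) (Z n)"
    and freeY: "\<And>n. n \<noteq> -1 \<Longrightarrow> free_summand A (Y n)" and freeZ: "\<And>n. free_summand B (Z n)"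
    and zY: "\<And>n. n < -1 \<Longrightarrow> zero_object (LMod C A) (Y n)"
    and zZ: "\<And>n. n < -1 \<Longrightarrow> zero_object (LMod C B) (Z n)"
    and k: "\<And>n. k n \<in> Hom C (fst (Y n)) (fst (Y (n + 1)))"
      "\<And>n. ident C (fst (Y n)) = dY (n + 1) \<cdot> k n \<boxplus> k (n - 1) \<cdot> dY n"
  obtains t where "\<And>n. t n \<in> Hom C (fst (Z n)) (fst (Z (n + 1)))"
    "\<And>n. ident C (fst (Z n)) = dZ (n + 1) \<cdot> t n \<boxplus> t (n - 1) \<cdot> dZ n"
proof -
  let ?MA = "LMod C A" and ?MB = "LMod C B"
  let ?KA = "homotopy_category ?MA" and ?KB = "homotopy_category ?MB"
  let ?WA = "quasi_isos C A" and ?WB = "quasi_isos C B"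
  let ?Fo = "derived_restrict_obj C f" and ?Fa = "map_ho_arr ?MA (restrict_obj C f) (restrict_arr C f)"
  let ?r = "restrict_obj C f"
  have f: "algebra_hom C A B f"
    and ff: "fully_faithful (localisation ?KB ?WB) (localisation ?KA ?WA) ?Fo (map_loc_arr ?KA ?WA ?Fo ?Fa)"
    using iso unfolding isocohomological_embedding_def derived_category_def derived_restrict_arr_def by blast+
  have EA: "alg_obj A \<in> obj C" and EB: "alg_obj B \<in> obj C" using A B by simp_all
  note r = restricts_algebra_hom[OF f A B]
  interpret MA: preadditive_category ?MA by (rule preadditive_LMod[OF EA])
  interpret MB: preadditive_category ?MB by (rule preadditive_LMod[OF EB])
  interpret KA: category ?KA by (rule MA.category_homotopy_category)
  interpret KB: category ?KB by (rule MB.category_homotopy_category)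
  interpret F: additive_functor ?MB ?MA ?r "restrict_arr C f" by (rule additive_functor_restrict[OF r])
  interpret L: localising_functor ?KB ?KA ?WB ?WA ?Fo ?Fa by (rule localising_functor_restrict[OF r])
  have dZ: "module_map C B (Z n) (dZ n) (Z (n - 1))" "dZ (n - 1) \<cdot> dZ n = zero_arr C (fst (Z n)) (fst (Z (n - 2)))" for n
    using cZ unfolding chain_complex_module_cplx by blast+
  have dY: "module_map C A (Y n) (dY n) (Y (n - 1))" for n
    using cY unfolding chain_complex_module_cplx by blast
  have lZ: "left_module C B (Z n)" for n by (rule module_map_simps(1)[OF dZ(1)])
  have oZ [simp]: "fst (Z n) \<in> obj C" for n by (rule left_module_simps(1)[OF lZ])
  have oY [simp]: "fst (Y n) \<in> obj C" for n
    by (rule left_module_simps(1)[OF module_map_simps(1)[OF dY]])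
  note tdZ = module_map_simps(3-5)[OF dZ(1)] and tdY = module_map_simps(3-5)[OF dY] and tv = module_map_simps(3-5)[OF v, unfolded fst_restrict_obj]
  note [simp] = tdZ tdY tv

  let ?TZ = "trunc_obj Z" and ?eZ = "trunc_diff Z dZ" and ?TY = "trunc_obj Y" and ?eY = "trunc_diff Y dY"
  have cTZ: "chain_complex ?MB (module_cplx ?TZ ?eZ)" by (rule chain_complex_trunc[OF EB cZ])
  have cTY: "chain_complex ?MA (module_cplx ?TY ?eY)" by (rule chain_complex_trunc[OF EA cY])
  have eZ: "module_map C B (?TZ n) (?eZ n) (?TZ (n - 1))" for n
    using cTZ unfolding chain_complex_module_cplx by blast
  have eY: "module_map C A (?TY n) (?eY n) (?TY (n - 1))" for n
    using cTY unfolding chain_complex_module_cplx by blast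
  have lTZ: "left_module C B (?TZ n)" for n by (rule module_map_simps(1)[OF eZ])
  have lTY: "left_module C A (?TY n)" for n by (rule module_map_simps(1)[OF eY])
  have oT [simp]: "fst (?TZ n) \<in> obj C" "fst (?TY n) \<in> obj C" for n
    by (rule left_module_simps(1)[OF lTZ], rule left_module_simps(1)[OF lTY])
  note teZ = module_map_simps(3-5)[OF eZ] and teY = module_map_simps(3-5)[OF eY]
  note [simp] = teZ teY
  \<comment> \<open>The augmentation term as a complex in degree 0, filled up with the zero object
    \<open>Z (-2)\<close>.\<close>
  define W where "W n = (if n = 0 then Z (-1) else Z (-2))" for n :: int
  have lW: "left_module C B (W n)" for n by (simp add: W_def lZ)
  have oW [simp]: "fst (W n) \<in> obj C" for n by (simp add: W_def)
  have zW: "zero_object ?MB (W n)" if "n \<noteq> 0" for n using that zZ by (simp add: W_def)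
  let ?zW = "\<lambda>n. zero_arr C (fst (W n)) (fst (W (n - 1)))"
  have cW: "chain_complex ?MB (module_cplx W ?zW)"
    unfolding chain_complex_module_cplx using module_map_zero[OF EB lW lW] by simp
  define w where "w n = (if n = -1 then v (-2) else v n)" for n
  have w: "module_map C A (?TY n) (w n) (?r (?TZ n))" for n
    using v by (simp add: w_def trunc_obj_def)
  note tw = module_map_simps(3-5)[OF w, unfolded fst_restrict_obj]
  note [simp] = tw
  have wd: "?eZ n \<cdot> w n = w (n - 1) \<cdot> ?eY n" for n
  proof (cases "n = 0 \<or> n = -1")
    case True
    then have "?eZ n = zero_arr C (fst (?TZ n)) (fst (?TZ (n - 1)))" "?eY n = zero_arr C (fst (?TY n)) (fst (?TY (n - 1)))"
      by (simp_all add: trunc_diff_def)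
    then show ?thesis using tw[of n] tw[of "n - 1"] by simp
  next
    case False
    then show ?thesis using vd[of n] by (simp add: w_def trunc_diff_def)
  qed
  \<comment> \<open>The augmentation as a map of complexes from the truncation of \<open>Z\<close>
    to \<open>W\<close>.\<close>
  define e where "e n = (if n = 0 then dZ 0 else zero_arr C (fst (?TZ n)) (fst (W n)))" for n
  have e: "module_map C B (?TZ n) (e n) (W n)" for n
  proof (cases "n = 0")
    case True
    then show ?thesis using dZ(1)[of 0] by (simp add: e_def W_def trunc_obj_def)
  next
    case False
    then show ?thesis using module_map_zero[OF EB lTZ[of n] lW[of n]] by (simp add: e_def)
  qed
  note te = module_map_simps(3-5)[OF e]
  note [simp] = te
  have ed: "zero_arr C (fst (?TZ n)) (fst (W (n - 1))) = e (n - 1) \<cdot> ?eZ n" for n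
  proof (cases "n = 1")
    case True
    then show ?thesis using dZ(2)[of 1] by (simp add: e_def W_def trunc_obj_def trunc_diff_def)
  next
    case False
    then have "e (n - 1) = zero_arr C (fst (?TZ (n - 1))) (fst (W (n - 1)))" by (simp add: e_def)
    then show ?thesis using teZ[of n] by simp
  qed

  let ?Q = "module_cplx ?TZ ?eZ" and ?R = "module_cplx ?TY ?eY" and ?W = "module_cplx W ?zW"
  let ?em = "\<lambda>n. (?TZ n, e n, W n)" and ?wm = "\<lambda>n. (?TY n, w n, ?r (?TZ n))"
  let ?qm = "\<lambda>n. (?TY n, e n \<cdot> w n, ?r (W n))"
  have FQ: "?Fo ?Q = module_cplx (\<lambda>n. ?r (?TZ n)) ?eZ" and FW: "?Fo ?W = module_cplx (\<lambda>n. ?r (W n)) ?zW"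
    by (simp_all add: derived_restrict_obj_module_cplx)
  have cFQ: "chain_complex ?MA (?Fo ?Q)" and cFW: "chain_complex ?MA (?Fo ?W)"
    using F.F_chain_complex[OF cTZ] F.F_chain_complex[OF cW] by (simp_all add: derived_restrict_obj_def)
  have em: "chain_map ?MB ?Q ?W ?em"
    unfolding chain_map_module_cplx using cTZ cW e ed by simp
  have wm: "chain_map ?MA ?R (?Fo ?Q) ?wm"
    unfolding FQ chain_map_module_cplx using cTY cFQ w wd by (simp add: FQ)
  have q: "module_map C A (?TY n) (e n \<cdot> w n) (?r (W n))" for n
    by (rule module_map_cmp[OF EA w restrict_module_map[OF r e]])
  have qd: "zero_arr C (fst (W n)) (fst (W (n - 1))) \<cdot> e n \<cdot> w n = (e (n - 1) \<cdot> w (n - 1)) \<cdot> ?eY n" for n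
  proof -
    have "(e (n - 1) \<cdot> w (n - 1)) \<cdot> ?eY n = e (n - 1) \<cdot> ?eZ n \<cdot> w n"
      using wd[of n] tw[of "n - 1"] te[of "n - 1"] teY[of n] by simp
    also have "\<dots> = (e (n - 1) \<cdot> ?eZ n) \<cdot> w n" using tw[of n] te[of "n - 1"] teZ[of n] by simp
    finally show ?thesis unfolding ed[symmetric] by simp
  qed
  have qm: "chain_map ?MA ?R (?Fo ?W) ?qm"
    unfolding FW chain_map_module_cplx using cTY cFW q qd by (simp add: FW)
  \<comment> \<open>Since \<open>v (-1)\<close> is the identity, \<open>w\<close> followed by the
    augmentation of \<open>Z\<close> is the augmentation of \<open>Y\<close>. Its cone is therefore
    the shifted complex \<open>Y\<close>, which \<open>k\<close> contracts.\<close>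
  have q0: "e 0 \<cdot> w 0 = dY 0"
    using vd[of 0] v1 tdY[of 0] by (simp add: e_def w_def Y1)

  have cone: "mapping_cone ?MA ?R (?Fo ?W) ?qm (module_cplx (\<lambda>n. Y (n - 1)) (\<lambda>n. dY (n - 1)))"
  proof -
    have "mapping_cone ?MA ?R (module_cplx (\<lambda>n. ?r (W n)) (\<lambda>n. zero_arr C (fst (?r (W n))) (fst (?r (W (n - 1))))))
        ?qm (module_cplx (\<lambda>n. Y (n - 1)) (\<lambda>n. dY (n - 1)))"
    proof (rule mapping_cone_augmentation[OF EA cY _ _ zY])
      show "?r (W 0) = Y (-1)" by (simp add: W_def Y1)
      show "zero_object ?MA (?r (W n))" if "n \<noteq> 0" for n
        using zW[OF that] restrictsD(6)[OF r lW] by (simp add: zero_object_LMod_iff[OF EA] zero_object_LMod_iff[OF EB])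
    qed (use q0 q in simp_all)
    then show ?thesis by (simp add: FW)
  qed
  let ?qa = "ho_arrow ?MA ?R (?Fo ?W) ?qm" and ?wa = "ho_arrow ?MA ?R (?Fo ?Q) ?wm" and ?ea = "ho_arrow ?MB ?Q ?W ?em"
  have qW: "?qa \<in> ?WA"
    unfolding quasi_isos_def ho_arrow_def using qm cone exact_shift[OF cY k] by blast
  have qa: "?qa \<in> Hom ?KA ?R (?Fo ?W)" and wa: "?wa \<in> Hom ?KA ?R (?Fo ?Q)" and ea: "?ea \<in> Hom ?KB ?Q ?W"
    using qm wm em by simp_all
  \<comment> \<open>Maps out of \<open>?R\<close> in the derived category of \<open>A\<close>, and
    out of \<open>?W\<close> in that of \<open>B\<close>, are homotopy classes. For
    \<open>?W\<close> this rests on \<open>freeZ\<close> in degree -1, where the regular module is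
    free.\<close>
  have RW: "inverts ?KA ?WA ?R"
  proof (rule inverts_quasi_isos[OF A cTY])
    show "free_summand A (fst ?R n)" for n using freeY by (simp add: trunc_obj_def)
    show "zero_object ?MA (fst ?R n)" if "n < 0" for n using that zY by (simp add: trunc_obj_def)
  qed
  have WW: "inverts ?KB ?WB ?W"
  proof (rule inverts_quasi_isos[OF B cW])
    show "free_summand B (fst ?W n)" for n using freeZ by (simp add: W_def)
    show "zero_object ?MB (fst ?W n)" if "n < 0" for n using that zW by simp
  qed
  have Fea: "?Fa ?ea \<in> Hom ?KA (?Fo ?Q) (?Fo ?W)" by (rule L.F_Hom[OF ea])
  have "?Fa ?ea \<cdot>\<^bsub>?KA\<^esub> ?wa = ?qa"
  proof -
    have "?Fa ?ea = ho_arrow ?MA (?Fo ?Q) (?Fo ?W) (restrict_arr C f \<circ> ?em)"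
      using F.map_ho_arr_ho_arrow[OF em] by (simp add: derived_restrict_obj_def)
    moreover have "chain_map ?MA (?Fo ?Q) (?Fo ?W) (restrict_arr C f \<circ> ?em)"
      using F.F_chain_map[OF em] by (simp add: derived_restrict_obj_def)
    ultimately show ?thesis using MA.ho_arrow_cmp[OF wm] by simp
  qed
  note ewq = this

  \<comment> \<open>The formal inverse of the quasi-isomorphism \<open>?qa\<close> followed by the
    unit \<open>?wa\<close>. Fullness lifts it to a zigzag over \<open>B\<close>, which reduces to a
    single homotopy class \<open>\<phi>\<close>.\<close>
  have y: "zigzag ?KA ?WA (?Fo ?W) [Bwd ?qa, Fwd ?wa] (?Fo ?Q)"
    using qW qa wa cFQ cTY by simp
  obtain z where z: "zigzag ?KB ?WB ?W z ?Q"
    "zigzag_equiv ?KA ?WA (?Fo ?W) (?Fo ?Q) (map (map_step ?Fa) z) [Bwd ?qa, Fwd ?wa]"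
    using L.localisation_full[OF ff _ _ y] cW cTZ by auto
  obtain \<phi> where \<phi>: "\<phi> \<in> Hom ?KB ?W ?Q" "zigzag_equiv ?KB ?WB ?W ?Q z [Fwd \<phi>]"
    using KB.zigzag_equiv_Fwd[OF WW z(1)] .
  have F\<phi>: "?Fa \<phi> \<in> Hom ?KA (?Fo ?W) (?Fo ?Q)" by (rule L.F_Hom[OF \<phi>(1)])
  have \<phi>y: "zigzag_equiv ?KA ?WA (?Fo ?W) (?Fo ?Q) [Fwd (?Fa \<phi>)] [Bwd ?qa, Fwd ?wa]"
    using zigzag_equiv.trans[OF zigzag_equiv.sym[OF L.zigzag_equiv_map[OF \<phi>(2)]] z(2)] by simp

  \<comment> \<open>After restriction, \<open>\<phi>\<close> followed by the augmentation becomes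
    the inverse of \<open>?qa\<close> followed by \<open>?qa\<close>. Faithfulness removes the
    restriction, and \<open>inverts\<close> for \<open>?W\<close> turns equality in the localisation
    into a homotopy.\<close>
  have \<phi>e: "?ea \<cdot>\<^bsub>?KB\<^esub> \<phi> = ident ?KB ?W"
  proof -
    have "zigzag_equiv ?KA ?WA (?Fo ?W) (?Fo ?W) ([Fwd (?Fa \<phi>)] @ [Fwd (?Fa ?ea)]) ([Bwd ?qa, Fwd ?wa] @ [Fwd (?Fa ?ea)])"
      by (rule KA.zigzag_equiv_append_right[OF \<phi>y]) (use Fea cFW in simp)
    also have "zigzag_equiv ?KA ?WA (?Fo ?W) (?Fo ?W) ([Bwd ?qa, Fwd ?wa] @ [Fwd (?Fa ?ea)]) ([Bwd ?qa] @ [Fwd ?qa])"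
    proof -
      have "zigzag_equiv ?KA ?WA ?R (?Fo ?W) [Fwd ?wa, Fwd (?Fa ?ea)] [Fwd ?qa]"
        using zigzag_equiv.cmp[OF wa Fea] unfolding ewq .
      from KA.zigzag_equiv_append_left[OF _ this, of "?Fo ?W" "[Bwd ?qa]"] show ?thesis
        using qW qa cTY by simp
    qed
    also have "zigzag_equiv ?KA ?WA (?Fo ?W) (?Fo ?W) ([Bwd ?qa] @ [Fwd ?qa]) []"
      using zigzag_equiv.bwd_fwd[OF qW qa] by simp
    finally have "zigzag_equiv ?KA ?WA (?Fo ?W) (?Fo ?W) (map (map_step ?Fa) [Fwd \<phi>, Fwd ?ea]) (map (map_step ?Fa) [])"
      by simp
    then have "zigzag_equiv ?KB ?WB ?W ?W [Fwd \<phi>, Fwd ?ea] []"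
      by (rule L.localisation_faithful[OF ff, rotated 2]) (use \<phi>(1) ea cW in simp_all)
    then have "zigzag_equiv ?KB ?WB ?W ?W [Fwd (?ea \<cdot>\<^bsub>?KB\<^esub> \<phi>)] []"
      using zigzag_equiv.trans[OF zigzag_equiv.sym[OF zigzag_equiv.cmp[OF \<phi>(1) ea]]] by blast
    also have "zigzag_equiv ?KB ?WB ?W ?W [] [Fwd (ident ?KB ?W)]"
      by (rule zigzag_equiv.sym[OF zigzag_equiv.ident]) (use cW in simp)
    finally show ?thesis by (rule KB.zigzag_equiv_FwdD[OF WW])
  qed
  \<comment> \<open>Over \<open>A\<close> the same zigzag, precomposed with \<open>?qa\<close>,
    reduces to \<open>?wa\<close>; this is an equality of homotopy classes because its source is
    \<open>?R\<close>.\<close>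
  have \<phi>q: "?Fa \<phi> \<cdot>\<^bsub>?KA\<^esub> ?qa = ?wa"
  proof -
    have "zigzag_equiv ?KA ?WA ?R (?Fo ?Q) [Fwd (?Fa \<phi> \<cdot>\<^bsub>?KA\<^esub> ?qa)] ([Fwd ?qa] @ [Fwd (?Fa \<phi>)])"
      using zigzag_equiv.sym[OF zigzag_equiv.cmp[OF qa F\<phi>]] by simp
    also have "zigzag_equiv ?KA ?WA ?R (?Fo ?Q) ([Fwd ?qa] @ [Fwd (?Fa \<phi>)]) ([Fwd ?qa] @ [Bwd ?qa, Fwd ?wa])"
      by (rule KA.zigzag_equiv_append_left[OF _ \<phi>y]) (use qa cFW in simp)
    also have "zigzag_equiv ?KA ?WA ?R (?Fo ?Q) ([Fwd ?qa] @ [Bwd ?qa, Fwd ?wa]) [Fwd ?wa]"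
      using KA.zigzag_equiv_append_right[OF zigzag_equiv.fwd_bwd[OF qW qa], of "[Fwd ?wa]" "?Fo ?Q"] wa cFQ by simp
    finally show ?thesis by (rule KA.zigzag_equiv_FwdD[OF RW])
  qed

  obtain sm where \<phi>s: "\<phi> = ho_arrow ?MB ?W ?Q sm" "chain_map ?MB ?W ?Q sm"
    using MB.homotopy_category_HomE[OF \<phi>(1)] .
  obtain s where sm: "sm = (\<lambda>n. (W n, s n, ?TZ n))"
    using chain_map_LModE[OF \<phi>s(2)] by auto
  have s: "module_map C B (W n) (s n) (?TZ n)" for n
    using \<phi>s(2) unfolding sm chain_map_module_cplx by blast
  note ts = module_map_simps(3-5)[OF s]
  note [simp] = ts
  \<comment> \<open>\<open>?W\<close> has zero differentials, so homotopic endomorphisms of it are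
    equal and \<open>s 0\<close> is a strict section.\<close>
  have s0: "dZ 0 \<cdot> s 0 = ident C (fst (Z (-1)))"
  proof -
    have "chain_homotopic ?MB ?W ?W (\<lambda>n. ?em n \<cdot>\<^bsub>?MB\<^esub> sm n) (\<lambda>n. ident ?MB (fst ?W n))"
      using \<phi>e MB.ho_arrow_eq_iff[OF MB.chain_map_cmp[OF \<phi>s(2) em]] unfolding \<phi>s(1)
      by (simp add: MB.ho_arrow_cmp[OF \<phi>s(2) em])
    then have "chain_homotopic ?MB ?W ?W (\<lambda>n. (W n, e n \<cdot> s n, W n)) (\<lambda>n. (W n, ident C (fst (W n)), W n))"
      by (simp add: sm)
    then obtain h where h: "\<And>n. module_map C B (W n) (h n) (W (n + 1))"
      "\<And>n. e n \<cdot> s n = ident C (fst (W n)) \<boxplus> (?zW (n + 1) \<cdot> h n \<boxplus> h (n - 1) \<cdot> ?zW n)"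
      by (rule chain_homotopic_module_cplxE) blast
    have "e 0 \<cdot> s 0 = ident C (fst (W 0))"
      using h(2)[of 0] module_map_simps(3-5)[OF h(1)[of 0]] module_map_simps(3-5)[OF h(1)[of "-1"]] by simp
    then show ?thesis by (simp add: e_def W_def)
  qed
  have Fs: "chain_map ?MA (?Fo ?W) (?Fo ?Q) (\<lambda>n. (?r (W n), s n, ?r (?TZ n)))"
    using F.F_chain_map[OF \<phi>s(2)] by (simp add: derived_restrict_obj_def sm comp_def)
  have "?Fa \<phi> = ho_arrow ?MA (?Fo ?W) (?Fo ?Q) (\<lambda>n. (?r (W n), s n, ?r (?TZ n)))"
    using F.map_ho_arr_ho_arrow[OF \<phi>s(2)] by (simp add: derived_restrict_obj_def \<phi>s(1) sm comp_def)
  then have "ho_arrow ?MA ?R (?Fo ?Q) ?wm = ho_arrow ?MA ?R (?Fo ?Q) (\<lambda>n. (?TY n, s n \<cdot> e n \<cdot> w n, ?r (?TZ n)))"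
    using \<phi>q MA.ho_arrow_cmp[OF qm Fs] by simp
  then have "chain_homotopic ?MA ?R (module_cplx (\<lambda>n. ?r (?TZ n)) ?eZ) ?wm (\<lambda>n. (?TY n, s n \<cdot> e n \<cdot> w n, ?r (?TZ n)))"
    unfolding MA.ho_arrow_eq_iff[OF wm] unfolding FQ .
  \<comment> \<open>An \<open>A\<close>-linear homotopy between \<open>w\<close> and
    \<open>s \<cdot> e \<cdot> w\<close>, the arrows adjoint to the identity of \<open>?Q\<close>
    and to \<open>s \<cdot> e\<close>.\<close>
  then obtain h where h: "\<And>n. module_map C A (?TY n) (h n) (?r (?TZ (n + 1)))"
    "\<And>n. w n = s n \<cdot> e n \<cdot> w n \<boxplus> (?eZ (n + 1) \<cdot> h n \<boxplus> h (n - 1) \<cdot> ?eY n)"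
    by (rule chain_homotopic_module_cplxE) blast
  note th = module_map_simps(3-5)[OF h(1), unfolded fst_restrict_obj]

  have "\<exists>H. module_map C B (Z n) H (Z (n + 1)) \<and> H \<cdot> v n = h n" if "n \<ge> 0" for n
    using universal_extE[OF u[of n] lZ[of "n + 1"], of "h n"] h(1)[of n] that by (auto simp: trunc_obj_def)
  then obtain H where H: "\<And>n. n \<ge> 0 \<Longrightarrow> module_map C B (Z n) (H n) (Z (n + 1))" "\<And>n. n \<ge> 0 \<Longrightarrow> H n \<cdot> v n = h n"
    by metis
  \<comment> \<open>The section starts the contraction at the augmentation term, and the extensions
    \<open>H\<close> of the homotopy continue it in the degrees of \<open>?Q\<close>.\<close>
  define t where "t n = (if n < -1 then zero_arr C (fst (Z n)) (fst (Z (n + 1))) else if n = -1 then s 0 else H n)" for n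
  have t: "module_map C B (Z n) (t n) (Z (n + 1))" for n
  proof -
    consider "n < -1" | "n = -1" | "n \<ge> 0" by linarith
    then show ?thesis
    proof cases
      case 1
      then show ?thesis using module_map_zero[OF EB lZ lZ] by (simp add: t_def)
    next
      case 2
      then show ?thesis using s[of 0] by (simp add: t_def W_def trunc_obj_def)
    next
      case 3
      then show ?thesis using H(1) by (simp add: t_def)
    qed
  qed
  note tt = module_map_simps(3-5)[OF t]
  show ?thesis
  proof (rule that[of t])
    fix n
    show "t n \<in> Hom C (fst (Z n)) (fst (Z (n + 1)))" using tt[of n] by simp
    have sum: "module_map C B (Z n) (dZ (n + 1) \<cdot> t n \<boxplus> t (n - 1) \<cdot> dZ n) (Z n)"
      using module_map_add[OF EB module_map_cmp[OF EB t[of n] dZ(1)[of "n + 1", simplified]]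
          module_map_cmp[OF EB dZ(1)[of n] t[of "n - 1", simplified]]] by simp
    note typing = tt[of n] tt[of "n - 1"] tdZ[of n] tdZ[of "n + 1"] tv[of n] tv[of "n - 1"]
    \<comment> \<open>Degree -1 says that \<open>s 0\<close> is a section. From degree 0 on both
      sides are \<open>B\<close>-linear and are compared after \<open>v n\<close>; the term
      \<open>s \<cdot> e\<close> is visible in degree 0 only.\<close>
    consider "n < -1" | "n = -1" | "n = 0" | "n \<ge> 1" by linarith
    then show "ident C (fst (Z n)) = dZ (n + 1) \<cdot> t n \<boxplus> t (n - 1) \<cdot> dZ n"
    proof cases
      case 1
      have "g = zero_arr C (fst (Z n)) (fst (Z n))" if "g \<in> arr C" "src C g = fst (Z n)" "tgt C g = fst (Z n)" for g
        using zero_object_module_map(1)[OF EB zZ[OF 1], of g] that by simp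
      from this[of "ident C (fst (Z n))"] this[of "dZ (n + 1) \<cdot> t n \<boxplus> t (n - 1) \<cdot> dZ n"] show ?thesis
        using module_map_simps(3-5)[OF sum] by simp
    next
      case 2
      have "t (n - 1) = zero_arr C (fst (Z (n - 1))) (fst (Z n))" "t n = s 0" using 2 by (simp_all add: t_def)
      then show ?thesis using 2 s0 tdZ[of "-1"] by simp
    next
      case 3
      have eq: "ident C (fst (Z n)) \<cdot> v n = (dZ (n + 1) \<cdot> t n \<boxplus> t (n - 1) \<cdot> dZ n) \<cdot> v n"
      proof -
        have t0: "t 0 = H 0" "t (-1) = s 0" by (simp_all add: t_def)
        have W0: "fst (W 0) = fst (Z (-1))" "fst (?TZ 0) = fst (Z 0)" by (simp_all add: W_def trunc_obj_def)
        have "v 0 = s 0 \<cdot> dZ 0 \<cdot> v 0 \<boxplus> (dZ 1 \<cdot> h 0 \<boxplus> h (-1) \<cdot> ?eY 0)"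
          using h(2)[of 0] by (simp add: w_def e_def trunc_diff_def)
        moreover have "h (-1) \<cdot> ?eY 0 = zero_arr C (fst (Y 0)) (fst (Z 0))"
          using th[of "-1"] by (simp add: trunc_diff_def trunc_obj_def)
        moreover have "dZ 1 \<cdot> h 0 = (dZ 1 \<cdot> H 0) \<cdot> v 0"
          using H[of 0] module_map_simps(3-5)[OF H(1)[of 0]] tdZ[of 1] tv[of 0] by simp
        ultimately have "v 0 = s 0 \<cdot> dZ 0 \<cdot> v 0 \<boxplus> ((dZ 1 \<cdot> H 0) \<cdot> v 0 \<boxplus> zero_arr C (fst (Y 0)) (fst (Z 0)))"
          by simp
        also have "\<dots> = (dZ 1 \<cdot> t 0 \<boxplus> t (-1) \<cdot> dZ 0) \<cdot> v 0"
          using module_map_simps(3-5)[OF H(1)[of 0]] ts[of 0] tdZ[of 0] tdZ[of 1] tv[of 0]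
          by (simp add: t0 W0 add_arr_comm)
        finally show ?thesis using 3 tv[of 0] by simp
      qed
      show ?thesis
        by (rule universal_eqI[OF r u[of n] module_map_ident[OF EB lZ] sum eq]) (use 3 in simp)
    next
      case 4
      have eq: "ident C (fst (Z n)) \<cdot> v n = (dZ (n + 1) \<cdot> t n \<boxplus> t (n - 1) \<cdot> dZ n) \<cdot> v n"
      proof -
        have t0: "t n = H n" "t (n - 1) = H (n - 1)" using 4 by (simp_all add: t_def)
        have e0: "e n = zero_arr C (fst (Z n)) (fst (W n))" using 4 by (simp add: e_def trunc_obj_def)
        have TZ: "?TZ n = Z n" using 4 by (simp add: trunc_obj_def)
        have "v n = s n \<cdot> e n \<cdot> v n \<boxplus> (dZ (n + 1) \<cdot> h n \<boxplus> h (n - 1) \<cdot> dY n)"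
          using h(2)[of n] 4 by (simp add: w_def trunc_diff_def)
        moreover have "s n \<cdot> e n \<cdot> v n = zero_arr C (fst (Y n)) (fst (Z n))"
          using ts[of n] tv[of n] by (simp add: e0 TZ)
        moreover have "dZ (n + 1) \<cdot> h n = (dZ (n + 1) \<cdot> H n) \<cdot> v n"
          using H[of n] module_map_simps(3-5)[OF H(1)[of n]] 4 typing by simp
        moreover have "h (n - 1) \<cdot> dY n = (H (n - 1) \<cdot> dZ n) \<cdot> v n"
        proof -
          have "h (n - 1) \<cdot> dY n = (H (n - 1) \<cdot> v (n - 1)) \<cdot> dY n" using H(2)[of "n - 1"] 4 by simp
          also have "\<dots> = H (n - 1) \<cdot> dZ n \<cdot> v n"
            using module_map_simps(3-5)[OF H(1)[of "n - 1"]] 4 typing tdY[of n] vd[of n] by simp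
          finally show ?thesis using module_map_simps(3-5)[OF H(1)[of "n - 1"]] 4 typing by simp
        qed
        ultimately have "v n = zero_arr C (fst (Y n)) (fst (Z n)) \<boxplus>
            ((dZ (n + 1) \<cdot> H n) \<cdot> v n \<boxplus> (H (n - 1) \<cdot> dZ n) \<cdot> v n)" by simp
        also have "\<dots> = (dZ (n + 1) \<cdot> t n \<boxplus> t (n - 1) \<cdot> dZ n) \<cdot> v n"
          using typing by (simp add: t0)
        finally show ?thesis using typing by simp
      qed
      show ?thesis
        by (rule universal_eqI[OF r u[of n] module_map_ident[OF EB lZ] sum eq]) (use 4 in simp)
    qed
  qed
qed

end

section \<open>The induced bimodule resolution\<close>

context additive_closed_monoidal
begin

lemma restrict_obj_ident:
  assumes "left_module C E Z" "alg_obj E \<in> obj C"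
  shows "restrict_obj C (ident C (alg_obj E)) Z = Z"
  using left_module_simps[OF assms(1)] assms(2) by (simp add: prod_eq_iff snd_restrict_obj)

text \<open>The differentials are extensions along the universal arrows. In degree -1 the
  differential ends in a zero object, so \<open>u (-1)\<close> may be any module map and the
  augmentation term can be prescribed.\<close>

lemma induced_complex:
  assumes r: "restricts E E' g" and cX: "chain_complex (LMod C E) (module_cplx X d)"
    and zX: "\<And>n. n < -1 \<Longrightarrow> zero_object (LMod C E) (X n)"
    and u: "\<And>n. n \<noteq> -1 \<Longrightarrow> universal E E' g (X n) (u n) (R n)"
    and u1: "module_map C E (X (-1)) (u (-1)) (restrict_obj C g (R (-1)))" and R1: "left_module C E' (R (-1))"
  obtains dR where "chain_complex (LMod C E') (module_cplx R dR)" "\<And>n. dR n \<cdot> u n = u (n - 1) \<cdot> d n"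
proof -
  note E = restrictsD(1,2)[OF r]
  have d: "module_map C E (X n) (d n) (X (n - 1))" "d (n - 1) \<cdot> d n = zero_arr C (fst (X n)) (fst (X (n - 2)))" for n
    using cX unfolding chain_complex_module_cplx by blast+
  have lR: "left_module C E' (R n)" for n
    using universal_map(2)[OF u[of n]] R1 by (cases "n = -1") auto
  have um: "module_map C E (X n) (u n) (restrict_obj C g (R n))" for n
    using universal_map(1)[OF u[of n]] u1 by (cases "n = -1") auto
  note ty = module_map_simps(3-5)[OF d(1)] module_map_simps(3-5)[OF um, unfolded fst_restrict_obj]
  note [simp] = ty left_module_simps(1)[OF lR] left_module_simps(1)[OF module_map_simps(1)[OF d(1)]]
  have zR: "zero_object (LMod C E') (R n)" if "n < -1" for n
    using universal_zero_object[OF r u zX] that by simp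
  have "\<exists>h. module_map C E' (R n) h (R (n - 1)) \<and> h \<cdot> u n = u (n - 1) \<cdot> d n" for n
  proof (cases "n = -1")
    case True
    have "d n = zero_arr C (fst (X n)) (fst (X (n - 1)))"
      using zero_object_module_map(2)[OF E(1) zX[of "n - 1"], of "d n"] True ty(1-3)[of n] by simp
    then show ?thesis
      using module_map_zero[OF E(2) lR lR, of n "n - 1"] ty(4-6)[of n] ty(4-6)[of "n - 1"]
      by (intro exI[of _ "zero_arr C (fst (R n)) (fst (R (n - 1)))"]) simp
  next
    case False
    show ?thesis
      using universal_extE[OF u[OF False] lR[of "n - 1"] module_map_cmp[OF E(1) d(1)[of n] um[of "n - 1"]]] by blast
  qed
  then obtain dR where dR: "\<And>n. module_map C E' (R n) (dR n) (R (n - 1))" "\<And>n. dR n \<cdot> u n = u (n - 1) \<cdot> d n"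
    by metis
  note tR = module_map_simps(3-5)[OF dR(1)]
  have "dR (n - 1) \<cdot> dR n = zero_arr C (fst (R n)) (fst (R (n - 2)))" for n
  proof (cases "n = -1")
    case True
    then show ?thesis
      using zero_object_module_map(2)[OF E(2) zR[of "n - 2"], of "dR (n - 1) \<cdot> dR n"] tR[of n] tR[of "n - 1"] by simp
  next
    case False
    have m: "module_map C E' (R n) (dR (n - 1) \<cdot> dR n) (R (n - 2))"
      using module_map_cmp[OF E(2) dR(1)[of n] dR(1)[of "n - 1"]] by simp
    have "(dR (n - 1) \<cdot> dR n) \<cdot> u n = dR (n - 1) \<cdot> u (n - 1) \<cdot> d n"
      using tR[of n] tR[of "n - 1"] by (simp add: dR(2))
    also have "\<dots> = (dR (n - 1) \<cdot> u (n - 1)) \<cdot> d n" using tR[of "n - 1"] ty by simp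
    also have "\<dots> = u (n - 1 - 1) \<cdot> d (n - 1) \<cdot> d n" unfolding dR(2) using ty[of "n - 1"] ty[of n] ty[of "n - 1 - 1"] by simp
    also have "\<dots> = zero_arr C (fst (R n)) (fst (R (n - 2))) \<cdot> u n"
      using ty(4-6)[of "n - 2"] ty(4-6)[of n] by (simp add: d(2))
    finally show ?thesis
      by (rule universal_eqI[OF r u[OF False] m module_map_zero[OF E(2) lR lR]])
  qed
  then show ?thesis using dR by (intro that[of dR]) (auto simp: chain_complex_module_cplx)
qed

end

section \<open>Parts of complexes and of the regular bimodule\<close>

context two_algebras
begin

lemma chain_complex_parts:
  assumes "chain_complex (LMod C E) (module_cplx X d)"
  shows "chain_complex (LMod C A) (module_cplx (\<lambda>n. Lp (X n)) d)" "chain_complex (LMod C A') (module_cplx (\<lambda>n. Rp (X n)) d)"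
  using assms module_map_parts unfolding chain_complex_module_cplx fst_parts by blast+

lemma zero_object_parts:
  assumes "zero_object (LMod C E) P"
  shows "zero_object (LMod C A) (Lp P)" "zero_object (LMod C A') (Rp P)"
proof -
  have E: "alg_obj E \<in> obj C" "alg_obj A \<in> obj C" "alg_obj A' \<in> obj C" by simp_all
  have P: "left_module C E P" "ident C (fst P) = zero_arr C (fst P) (fst P)"
    using assms zero_object_LMod_iff[OF E(1)] by blast+
  show "zero_object (LMod C A) (Lp P)" "zero_object (LMod C A') (Rp P)"
    unfolding zero_object_LMod_iff[OF E(2)] zero_object_LMod_iff[OF E(3)] fst_parts
    using P(2) parts_module[OF P(1)] by blast+
qed

end

context additive_closed_monoidal
begin

lemma forget_parts:
  "map_cplx forget_obj forget_arr (module_cplx (\<lambda>n. left_part A A' (X n)) d) = map_cplx forget_obj forget_arr (module_cplx X d)"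
  "map_cplx forget_obj forget_arr (module_cplx (\<lambda>n. right_part A A' (X n)) d) = map_cplx forget_obj forget_arr (module_cplx X d)"
  by (auto simp: map_cplx_def module_cplx_def forget_obj_def forget_arr_def)

lemma parts_regular:
  assumes "unital_algebra C A"
  shows "left_module C (env_alg C A) (regular_bimodule C A)"
    "left_part A (op_alg C A) (regular_bimodule C A) = (alg_obj A, alg_mult A)"
    "right_part A (op_alg C A) (regular_bimodule C A) = (alg_obj A, alg_mult (op_alg C A))"
proof -
  interpret T: two_algebras C A "op_alg C A"
    by unfold_locales (fact assms unital_algebra_op[OF assms])+
  note b = biaction_regular[OF assms]
  show "left_module C (env_alg C A) (regular_bimodule C A)"
    unfolding b(2) env_alg_def by (rule T.left_module_tensor_module[OF b(1)])
  show "left_part A (op_alg C A) (regular_bimodule C A) = (alg_obj A, alg_mult A)"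
    "right_part A (op_alg C A) (regular_bimodule C A) = (alg_obj A, alg_mult (op_alg C A))"
    unfolding b(2) by (rule T.parts_tensor_module[OF b(1)])+
qed

lemma free_summand_regular:
  assumes "unital_algebra C A"
  shows "free_summand A (alg_obj A, alg_mult A)"
  using retraction_regular[OF assms] tunit_obj unfolding free_summand_def by blast

text \<open>Induction along the identity of \<open>A\<close> on the left and \<open>f\<close> on the
  right. The \<open>A\<^sup>o\<^sup>p\<close>-linear contraction of the augmented complex is carried
  along, and its underlying arrows in \<open>C\<close> are what is handed on.\<close>

lemma induce_right_resolution:
  assumes A: "unital_algebra C A" and B: "unital_algebra C B" and f: "algebra_hom C A B f" and ker: "has_kernels C"
    and X: "augmented_resolution A X d"
  obtains R dR k where
    "R (-1) = restrict_obj C (f \<rhd> alg_obj B) (regular_bimodule C B)"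
    "chain_complex (LMod C (tensor_alg C A (op_alg C B))) (module_cplx R dR)"
    "\<forall>n. n \<noteq> -1 \<longrightarrow> (\<exists>V\<in>obj C. \<exists>i p. retraction (tensor_alg C A (op_alg C B)) (R n) (two_algebras.bifree C A (op_alg C B) V) i p)"
    "\<forall>n. n \<noteq> -1 \<longrightarrow> zero_object (LMod C (env_alg C A)) (X n) \<longrightarrow> zero_object (LMod C (tensor_alg C A (op_alg C B))) (R n)"
    "\<And>n. k n \<in> Hom C (fst (R n)) (fst (R (n + 1)))"
    "\<And>n. ident C (fst (R n)) = dR (n + 1) \<cdot> k n \<boxplus> k (n - 1) \<cdot> dR n"
proof -
  let ?A' = "op_alg C A" and ?B' = "op_alg C B"
  note A' = unital_algebra_op[OF A] and B' = unital_algebra_op[OF B] and f' = algebra_hom_op[OF f A B]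
  interpret H: two_algebra_homs C A ?A' A ?B' "ident C (alg_obj A)" f
    by unfold_locales (fact A A' B' f' algebra_hom_ident[OF A])+
  interpret G: two_algebra_homs C A ?B' B ?B' f "ident C (alg_obj B)"
    using algebra_hom_ident[OF B'] by unfold_locales (simp_all add: A B B' f)
  have E: "alg_obj A \<in> obj C" "alg_obj B \<in> obj C" using A B by simp_all
  have EA: "env_alg C A = H.EA" by (simp add: env_alg_def)
  have X1: "X (-1) = regular_bimodule C A" and cX: "chain_complex (LMod C H.EA) (module_cplx X d)"
    and pX: "\<And>n. n \<noteq> -1 \<Longrightarrow> projective_module C H.EA (X n)"
    and zX: "\<And>n. n < -1 \<Longrightarrow> zero_object (LMod C H.EA) (X n)"
    and con: "contractible C (map_cplx forget_obj forget_arr (module_cplx X d))"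
    using X unfolding augmented_resolution_def EA by blast+
  have d: "module_map C H.EA (X n) (d n) (X (n - 1))" for n
    using cX unfolding chain_complex_module_cplx by blast
  have oX: "fst (X n) \<in> obj C" for n by (rule left_module_simps(1)[OF module_map_simps(1)[OF d]])
  have ret: "\<exists>i p. retraction H.EA (X n) (H.AA.bifree (fst (X n))) i p" if "n \<noteq> -1" for n
    using H.AA.projective_bifree_summandE[OF ker pX[OF that]] by blast
  have "\<exists>R e. (\<exists>i p. retraction H.EB R (H.BB.bifree (fst (X n))) i p) \<and>
      universal H.EA H.EB (alg_obj A \<lhd> f) (X n) e R \<and> universal ?A' ?B' f (H.AA.Rp (X n)) e (H.BB.Rp R)"
    if n: "n \<noteq> -1" for n
  proof -
    obtain i p where "retraction H.EA (X n) (H.AA.bifree (fst (X n))) i p" using ret[OF n] by blast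
    from induction_right[OF A A' B' f' ker oX this] show ?thesis by metis
  qed
  then obtain R0 e0 where R0: "\<And>n. n \<noteq> -1 \<Longrightarrow> \<exists>i p. retraction H.EB (R0 n) (H.BB.bifree (fst (X n))) i p"
    "\<And>n. n \<noteq> -1 \<Longrightarrow> universal H.EA H.EB (alg_obj A \<lhd> f) (X n) (e0 n) (R0 n)"
    "\<And>n. n \<noteq> -1 \<Longrightarrow> universal ?A' ?B' f (H.AA.Rp (X n)) (e0 n) (H.BB.Rp (R0 n))"
    by metis
  \<comment> \<open>The new augmentation term: \<open>B\<close> as a bimodule with \<open>A\<close>
    acting on the left through \<open>f\<close>.\<close>
  let ?R1 = "restrict_obj C (f \<rhd> alg_obj B) (regular_bimodule C B)"
  have lB: "left_module C G.EB (regular_bimodule C B)" using parts_regular(1)[OF B] by (simp add: env_alg_def)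
  have rG: "restricts G.EA G.EB (f \<rhd> alg_obj B)" using G.restricts_tensor by simp
  have lR1: "left_module C H.EB ?R1" by (rule restrictsD(6)[OF rG lB])
  have pR1: "H.BB.Lp ?R1 = restrict_obj C f (alg_obj B, alg_mult B)" "H.BB.Rp ?R1 = (alg_obj B, alg_mult ?B')"
  proof -
    have "left_module C ?B' (alg_obj B, alg_mult ?B')"
      using G.BB.parts_module(2)[OF lB] unfolding parts_regular(3)[OF B] .
    from restrict_obj_ident[OF this] E(2) have "restrict_obj C (ident C (alg_obj B)) (alg_obj B, alg_mult ?B') = (alg_obj B, alg_mult ?B')"
      by simp
    with G.restrict_parts[OF lB] show "H.BB.Lp ?R1 = restrict_obj C f (alg_obj B, alg_mult B)"
      "H.BB.Rp ?R1 = (alg_obj B, alg_mult ?B')"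
      unfolding parts_regular[OF B] by simp_all
  qed
  define R where "R n = (if n = -1 then ?R1 else R0 n)" for n
  define u where "u n = (if n = -1 then f else e0 n)" for n
  \<comment> \<open>For right parts universality extends to degree -1, since \<open>B\<close> is
    induced from \<open>A\<close> as a right module; \<open>uE\<close>, the version for bimodules,
    is confined to the other degrees.\<close>
  have uT: "universal ?A' ?B' f (H.AA.Rp (X n)) (u n) (H.BB.Rp (R n))" for n
  proof (cases "n = -1")
    case True
    then show ?thesis
      using universal_regular[OF f' A' B'] parts_regular(3)[OF A] pR1(2) by (simp add: R_def u_def X1)
  qed (simp add: R0(3) R_def u_def)
  have uE: "universal H.EA H.EB (alg_obj A \<lhd> f) (X n) (u n) (R n)" if "n \<noteq> -1" for n
    using R0(2)[OF that] that by (simp add: R_def u_def)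
  have r: "restricts H.EA H.EB (alg_obj A \<lhd> f)" by (rule H.restricts_tensor)
  have u1: "module_map C H.EA (X (-1)) (u (-1)) (restrict_obj C (alg_obj A \<lhd> f) (R (-1)))"
  proof -
    have "module_map C A (alg_obj A, alg_mult A) f (restrict_obj C f (alg_obj B, alg_mult B))"
      by (rule universal_map(1)[OF universal_regular[OF f A B]])
    moreover have "module_map C ?A' (alg_obj A, alg_mult ?A') f (restrict_obj C f (alg_obj B, alg_mult ?B'))"
      using universal_map(1)[OF universal_regular[OF f' A' B']] by simp
    moreover have "restrict_obj C (ident C (alg_obj A)) (restrict_obj C f (alg_obj B, alg_mult B)) = restrict_obj C f (alg_obj B, alg_mult B)"
      by (rule restrict_obj_ident[OF _ E(1)]) (rule module_map_simps(2)[OF calculation(1)])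
    ultimately show ?thesis
      unfolding X1 u_def R_def
      using H.AA.module_map_parts_iff[OF parts_regular(1)[OF A, unfolded EA] restrictsD(6)[OF r lR1], of f]
        H.restrict_parts[OF lR1] parts_regular(2,3)[OF A] pR1 by simp
  qed
  have R1: "left_module C H.EB (R (-1))" using lR1 by (simp add: R_def)
  obtain dR where dR: "chain_complex (LMod C H.EB) (module_cplx R dR)" "\<And>n. dR n \<cdot> u n = u (n - 1) \<cdot> d n"
    by (rule induced_complex[OF r cX zX uE u1 R1]) blast+
  have dRm: "module_map C H.EB (R n) (dR n) (R (n - 1))" for n
    using dR(1) unfolding chain_complex_module_cplx by blast

  \<comment> \<open>All terms, the regular one included, are summands of free right modules, so the
    augmented complex has an \<open>A\<^sup>o\<^sup>p\<close>-linear contraction.\<close>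
  have exT: "exact_complex C ?A' (module_cplx (\<lambda>n. H.AA.Rp (X n)) d)"
    using H.AA.chain_complex_parts(2)[OF cX] con by (simp add: exact_complex_def forget_parts)
  have frT: "free_summand ?A' (H.AA.Rp (X n))" for n
  proof (cases "n = -1")
    case True
    then show ?thesis using free_summand_regular[OF A'] parts_regular(3)[OF A] by (simp add: X1)
  next
    case False
    then show ?thesis using H.AA.free_summand_parts(2)[OF oX] ret by blast
  qed
  obtain h where h: "\<And>n. module_map C ?A' (H.AA.Rp (X n)) (h n) (H.AA.Rp (X (n + 1)))"
    "\<And>n. ident C (fst (H.AA.Rp (X n))) = d (n + 1) \<cdot> h n \<boxplus> h (n - 1) \<cdot> d n"
    by (rule contraction_of_free_summands[OF A' exT frT H.AA.zero_object_parts(2)[OF zX]]) blast+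
  note rT = restricts_algebra_hom[OF f' A' B']
  note um = universal_map[OF uT]
  have EA': "alg_obj ?A' \<in> obj C" "alg_obj ?B' \<in> obj C" using E by simp_all
  \<comment> \<open>Functoriality of induction on right modules, applied to the contraction
    \<open>h\<close>.\<close>
  have "\<exists>k. module_map C ?B' (H.BB.Rp (R n)) k (H.BB.Rp (R (n + 1))) \<and> k \<cdot> u n = u (n + 1) \<cdot> h n" for n
    using universal_extE[OF uT[of n] um(2)[of "n + 1"] module_map_cmp[OF EA'(1) h(1)[of n] um(1)[of "n + 1"]]] by blast
  then obtain k where k: "\<And>n. module_map C ?B' (H.BB.Rp (R n)) (k n) (H.BB.Rp (R (n + 1)))" "\<And>n. k n \<cdot> u n = u (n + 1) \<cdot> h n"
    by metis
  have dRT: "module_map C ?B' (H.BB.Rp (R n)) (dR n) (H.BB.Rp (R (n - 1)))" for n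
    by (rule H.BB.module_map_parts(2)[OF dRm])
  note tk = module_map_simps(3-5)[OF k(1), unfolded fst_parts] and tR = module_map_simps(3-5)[OF dRT, unfolded fst_parts]
    and th = module_map_simps(3-5)[OF h(1), unfolded fst_parts] and td = module_map_simps(3-5)[OF d]
    and tu = um(3-5)[unfolded fst_parts]
  have eq: "ident C (fst (R n)) = dR (n + 1) \<cdot> k n \<boxplus> k (n - 1) \<cdot> dR n" for n
  proof -
    note ty = tk[of n] tk[of "n - 1"] tR[of n] tR[of "n + 1"] th[of n] th[of "n - 1"] td[of n] td[of "n + 1"] tu[of n] tu[of "n + 1"] tu[of "n - 1"]
    have oR: "fst (R n) \<in> obj C" using left_module_simps(1)[OF um(2)[of n]] by simp
    have m: "module_map C ?B' (H.BB.Rp (R n)) (dR (n + 1) \<cdot> k n \<boxplus> k (n - 1) \<cdot> dR n) (H.BB.Rp (R n))"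
      using module_map_add[OF EA'(2) module_map_cmp[OF EA'(2) k(1)[of n] dRT[of "n + 1", simplified]]
          module_map_cmp[OF EA'(2) dRT[of n] k(1)[of "n - 1", simplified]]] by simp
    have "(dR (n + 1) \<cdot> k n \<boxplus> k (n - 1) \<cdot> dR n) \<cdot> u n = dR (n + 1) \<cdot> (k n \<cdot> u n) \<boxplus> k (n - 1) \<cdot> (dR n \<cdot> u n)"
      using ty by simp
    also have "\<dots> = (dR (n + 1) \<cdot> u (n + 1)) \<cdot> h n \<boxplus> (k (n - 1) \<cdot> u (n - 1)) \<cdot> d n"
      unfolding k(2)[of n] dR(2)[of n] using ty by simp
    also have "\<dots> = u n \<cdot> d (n + 1) \<cdot> h n \<boxplus> u n \<cdot> h (n - 1) \<cdot> d n"
      unfolding k(2)[of "n - 1"] dR(2)[of "n + 1"] using ty by simp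
    also have "\<dots> = u n \<cdot> (d (n + 1) \<cdot> h n \<boxplus> h (n - 1) \<cdot> d n)" using ty by simp
    also have "\<dots> = ident C (fst (R n)) \<cdot> u n" unfolding h(2)[symmetric] using ty by simp
    finally show ?thesis
      using universal_eqI[OF rT uT m module_map_ident[OF EA'(2) um(2)]] by simp
  qed
  show ?thesis
  proof (rule that[of R dR k])
    have "\<exists>V\<in>obj C. \<exists>i p. retraction H.EB (R n) (H.BB.bifree V) i p" if "n \<noteq> -1" for n
      using R0(1)[OF that] oX[of n] that unfolding R_def by auto
    then show "\<forall>n. n \<noteq> -1 \<longrightarrow> (\<exists>V\<in>obj C. \<exists>i p. retraction H.EB (R n) (H.BB.bifree V) i p)" by blast
    show "\<forall>n. n \<noteq> -1 \<longrightarrow> zero_object (LMod C (env_alg C A)) (X n) \<longrightarrow> zero_object (LMod C H.EB) (R n)"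
      using universal_zero_object[OF r uE] unfolding EA by blast
    show "k n \<in> Hom C (fst (R n)) (fst (R (n + 1)))" for n using tk[of n] by simp
  qed (use dR(1) eq in \<open>simp_all add: R_def\<close>)
qed

text \<open>The left half of the induction, followed by the derived argument. Zero terms are tracked
  separately because the length of the resolution is read off from them.\<close>

lemma induced_resolution:
  assumes A: "unital_algebra C A" and B: "unital_algebra C B" and iso: "isocohomological_embedding C A B f"
    and ker: "has_kernels C" and X: "augmented_resolution A X d"
  obtains Q dQ where "augmented_resolution B Q dQ"
    "\<forall>n. n \<noteq> -1 \<longrightarrow> zero_object (LMod C (env_alg C A)) (X n) \<longrightarrow> zero_object (LMod C (env_alg C B)) (Q n)"
proof -
  let ?B' = "op_alg C B"
  have f: "algebra_hom C A B f" using iso by (simp add: isocohomological_embedding_def)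
  note B' = unital_algebra_op[OF B]
  interpret G: two_algebra_homs C A ?B' B ?B' f "ident C (alg_obj B)"
    using algebra_hom_ident[OF B'] by unfold_locales (simp_all add: A B B' f)
  have EB: "env_alg C B = G.EB" by (simp add: env_alg_def)
  have E: "alg_obj A \<in> obj C" "alg_obj B \<in> obj C" "alg_obj G.EA \<in> obj C" "alg_obj G.EB \<in> obj C" using A B by simp_all
  obtain R dR k where R1: "R (-1) = restrict_obj C (f \<rhd> alg_obj B) (regular_bimodule C B)"
    and cR: "chain_complex (LMod C G.EA) (module_cplx R dR)"
    and ret': "\<forall>n. n \<noteq> -1 \<longrightarrow> (\<exists>V\<in>obj C. \<exists>i p. retraction G.EA (R n) (G.AA.bifree V) i p)"
    and zR': "\<forall>n. n \<noteq> -1 \<longrightarrow> zero_object (LMod C (env_alg C A)) (X n) \<longrightarrow> zero_object (LMod C G.EA) (R n)"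
    and k: "\<And>n. k n \<in> Hom C (fst (R n)) (fst (R (n + 1)))"
      "\<And>n. ident C (fst (R n)) = dR (n + 1) \<cdot> k n \<boxplus> k (n - 1) \<cdot> dR n"
    by (rule induce_right_resolution[OF A B f ker X]) blast
  note ret = ret'[rule_format] and zR = zR'[rule_format]
  have zX: "zero_object (LMod C (env_alg C A)) (X n)" if "n < -1" for n
    using X that unfolding augmented_resolution_def by blast
  have zR1: "zero_object (LMod C G.EA) (R n)" if "n < -1" for n using zR zX that by simp
  have "\<exists>Q e. (\<exists>V\<in>obj C. \<exists>i p. retraction G.EB Q (G.BB.bifree V) i p) \<and>
      universal G.EA G.EB (f \<rhd> alg_obj B) (R n) e Q \<and> universal A B f (G.AA.Lp (R n)) e (G.BB.Lp Q)"
    if n: "n \<noteq> -1" for n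
  proof -
    obtain V i p where V: "V \<in> obj C" "retraction G.EA (R n) (G.AA.bifree V) i p" using ret[OF n] by blast
    from induction_left[OF A B' B f ker V] V(1) show ?thesis by (metis op_alg_simps(1))
  qed
  then obtain Q0 e0 where Q0: "\<And>n. n \<noteq> -1 \<Longrightarrow> \<exists>V\<in>obj C. \<exists>i p. retraction G.EB (Q0 n) (G.BB.bifree V) i p"
    "\<And>n. n \<noteq> -1 \<Longrightarrow> universal G.EA G.EB (f \<rhd> alg_obj B) (R n) (e0 n) (Q0 n)"
    "\<And>n. n \<noteq> -1 \<Longrightarrow> universal A B f (G.AA.Lp (R n)) (e0 n) (G.BB.Lp (Q0 n))"
    by metis
  define Q where "Q n = (if n = -1 then regular_bimodule C B else Q0 n)" for n
  \<comment> \<open>In degree -1 nothing is induced: the augmentation term of \<open>R\<close> is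
    already the restriction of \<open>B\<close>.\<close>
  define v where "v n = (if n = -1 then ident C (alg_obj B) else e0 n)" for n
  have lB: "left_module C G.EB (regular_bimodule C B)" using parts_regular(1)[OF B] by (simp add: EB)
  have fB: "fst (regular_bimodule C B) = alg_obj B" by (simp add: regular_bimodule_def Let_def)
  have r: "restricts G.EA G.EB (f \<rhd> alg_obj B)" using G.restricts_tensor by simp
  have uE: "universal G.EA G.EB (f \<rhd> alg_obj B) (R n) (v n) (Q n)" if "n \<noteq> -1" for n
    using Q0(2)[OF that] that by (simp add: Q_def v_def)
  have uL: "universal A B f (G.AA.Lp (R n)) (v n) (G.BB.Lp (Q n))" if "n \<noteq> -1" for n
    using Q0(3)[OF that] that by (simp add: Q_def v_def)
  have v1: "module_map C G.EA (R (-1)) (v (-1)) (restrict_obj C (f \<rhd> alg_obj B) (Q (-1)))"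
    using module_map_ident[OF E(3) restrictsD(6)[OF r lB]] by (simp add: R1 v_def Q_def fB)
  have Q1: "left_module C G.EB (Q (-1))" using lB by (simp add: Q_def)
  obtain dQ where dQ: "chain_complex (LMod C G.EB) (module_cplx Q dQ)" "\<And>n. dQ n \<cdot> v n = v (n - 1) \<cdot> dR n"
    by (rule induced_complex[OF r cR zR1 uE v1 Q1]) blast+
  have zQ: "zero_object (LMod C G.EB) (Q n)" if "n \<noteq> -1" "zero_object (LMod C (env_alg C A)) (X n)" for n
    using universal_zero_object[OF r uE[OF that(1)] zR[OF that]] .
  have zQ': "zero_object (LMod C G.EB) (Q n)" if "n < -1" for n using zQ zX that by simp
  have Y1: "G.AA.Lp (R (-1)) = restrict_obj C f (G.BB.Lp (Q (-1)))"
    using G.restrict_parts(1)[OF lB] by (simp add: R1 Q_def)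
  have retQ: "\<exists>V\<in>obj C. \<exists>i p. retraction G.EB (Q n) (G.BB.bifree V) i p" if "n \<noteq> -1" for n
    using Q0(1)[OF that] that by (simp add: Q_def)
  \<comment> \<open>The derived argument runs on left parts and returns a contraction in
    \<open>C\<close>, which is what exactness over the enveloping algebra of \<open>B\<close> asks
    for.\<close>
  have "\<exists>t. (\<forall>n. t n \<in> Hom C (fst (G.BB.Lp (Q n))) (fst (G.BB.Lp (Q (n + 1))))) \<and>
    (\<forall>n. ident C (fst (G.BB.Lp (Q n))) = dQ (n + 1) \<cdot> t n \<boxplus> t (n - 1) \<cdot> dQ n)" (is "\<exists>t. ?con t")
  proof (rule derived_contraction[OF A B iso G.AA.chain_complex_parts(1)[OF cR] G.BB.chain_complex_parts(1)[OF dQ(1)] Y1,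
        where v = v and k = k])
    show "\<exists>t. ?con t" if "\<And>n. t n \<in> Hom C (fst (G.BB.Lp (Q n))) (fst (G.BB.Lp (Q (n + 1))))"
      "\<And>n. ident C (fst (G.BB.Lp (Q n))) = dQ (n + 1) \<cdot> t n \<boxplus> t (n - 1) \<cdot> dQ n" for t
      using that by blast
    show "v (-1) = ident C (fst (G.BB.Lp (Q (-1))))" by (simp add: v_def Q_def fB)
    show "module_map C A (G.AA.Lp (R n)) (v n) (restrict_obj C f (G.BB.Lp (Q n)))" for n
    proof (cases "n = -1")
      case True
      have "left_module C A (restrict_obj C f (G.BB.Lp (Q (-1))))"
        by (rule restrictsD(6)[OF restricts_algebra_hom[OF f A B] G.BB.parts_module(1)[OF Q1]])
      from module_map_ident[OF E(1) this] show ?thesis unfolding True Y1 by (simp add: v_def Q_def fB)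
    next
      case False
      then show ?thesis using universal_map(1)[OF uL] by blast
    qed
    show "free_summand A (G.AA.Lp (R n))" if "n \<noteq> -1" for n
      using ret[OF that] G.AA.free_summand_parts(1) by blast
    show "free_summand B (G.BB.Lp (Q n))" for n
    proof (cases "n = -1")
      case True
      then show ?thesis using free_summand_regular[OF B] parts_regular(2)[OF B] by (simp add: Q_def)
    next
      case False
      then show ?thesis using retQ G.BB.free_summand_parts(1) by blast
    qed
  qed (use dQ(2) uL k G.AA.zero_object_parts(1)[OF zR1] G.BB.zero_object_parts(1)[OF zQ'] in simp_all)
  then obtain t where "?con t" ..
  then have "exact_complex C G.EB (module_cplx Q dQ)"
    by (intro exact_module_cplxI[OF dQ(1), of t]) simp_all
  then have "contractible C (map_cplx forget_obj forget_arr (module_cplx Q dQ))"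
    by (simp add: exact_complex_def)
  moreover have "projective_module C G.EB (Q n)" if "n \<noteq> -1" for n
    using retQ[OF that] G.BB.projective_bifree_summand by blast
  ultimately have "augmented_resolution B Q dQ"
    using dQ(1) zQ' unfolding augmented_resolution_def EB by (simp add: Q_def)
  then show ?thesis by (rule that) (use zQ in \<open>simp add: EB\<close>)
qed

end

theorem corollary2p7:
  fixes C :: "('o, 'm) moncat" and A B :: "('o, 'm) alg" and f :: 'm and k :: nat
  assumes "additive_category C"
    and "closed_symmetric_monoidal_category C"
    and "has_kernels C" and "has_cokernels C"
    and "unital_algebra C A" and "unital_algebra C B"
    and "isocohomological_embedding C A B f"
    and "has_projective_bimodule_resolution_of_length C A k"
  shows "has_projective_bimodule_resolution_of_length C B k"
proof -
  interpret additive_closed_monoidal C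
    using assms(1,2) by (rule additive_closed_monoidal.intro)
  obtain P \<epsilon> where P: "projective_bimodule_resolution C A P \<epsilon>"
    "\<And>n. n > int k \<Longrightarrow> zero_object (LMod C (env_alg C A)) (fst P n)"
    using assms(8) unfolding has_projective_bimodule_resolution_of_length_def by blast
  obtain d where X: "augmented_resolution A (\<lambda>n. if n = -1 then regular_bimodule C A else fst P n) d"
    using projective_resolution_augmented[OF P(1)] .
  obtain Q dQ where Q: "augmented_resolution B Q dQ"
    "\<forall>n. n \<noteq> -1 \<longrightarrow> zero_object (LMod C (env_alg C A)) (if n = -1 then regular_bimodule C A else fst P n) \<longrightarrow>
      zero_object (LMod C (env_alg C B)) (Q n)"
    by (rule induced_resolution[OF assms(5-7,3) X])
  \<comment> \<open>Degrees above \<open>k\<close> are positive, so neither truncation nor the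
    augmentation term at -1 interferes.\<close>
  have "zero_object (LMod C (env_alg C B)) (fst (module_cplx (trunc_obj Q) (trunc_diff Q dQ)) n)" if "n > int k" for n
    using Q(2)[rule_format, of n] P(2)[OF that] that by (simp add: trunc_obj_def)
  then show ?thesis
    using projective_resolution_trunc[OF assms(6) Q(1)]
    unfolding has_projective_bimodule_resolution_of_length_def by blast
qed

end
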